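(* Let $\underline{\lambda}$ be a bipartition (of $n=|\lambda^1|+|\lambda^2|$) and let $(e,\underline{s})\in \mathbb{Z}_{\geq 2}\times \mathbb{Z}^2$ be a parameter for the level 2 Fock space, with $\underline{s}=(s_1,s_2)$ and $s=s_2-s_1$. The irreducible representation $L(\underline{\lambda})\in\mathcal{O}_{e,\underline{s}}(n)$ is both unitary and finite-dimensional if and only if (i) $\underline{\lambda}=(\lambda,\emptyset)$ or $\underline{\lambda}=(\emptyset,\lambda)$ for some rectangle $\lambda$, and (ii) the parameter $(e,\underline{s})$ satisfies the following conditions depending on $\underline{\lambda}$, where $r$ is the number of rows and $q$ the number of columns of $\lambda$: (1) if $\underline{\lambda}=(\lambda,\emptyset)$ then $r-q=s-e$; (2) if $\underline{\lambda}=(\emptyset,\lambda)$ then $r-q=-s$.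
   Context: A partition is a finite non-increasing sequence $\lambda=(\lambda_1\ge\dots\ge\lambda_r>0)$ of positive integers, with $\emptyset$ denoting the empty sequence; it is identified with its Young diagram with $\lambda_i$ boxes in row $i$ (rows numbered from the top), and it is a rectangle if $\lambda_1=\dots=\lambda_r$. A bipartition of $n$ is a pair $\underline{\lambda}=(\lambda^1,\lambda^2)$ of partitions with $|\lambda^1|+|\lambda^2|=n$. A parameter for the level 2 Fock space is simply a pair $(e,\underline{s})$ with $e\ge 2$ an integer and $\underline{s}=(s_1,s_2)\in\mathbb{Z}^2$; it determines the parameters of the rational Cherednik algebra below. $B_n=(\mathbb{Z}/2\mathbb{Z})^n\rtimes S_n$ acts on its reflection representation $\mathfrak{h}=\mathbb{C}^n$ with basis $y_1,\dots,y_n$ and dual basis $x_1,\dots,x_n$; $s_{ij}$ is the transposition of coordinates $i,j$ and $\zeta_i$ the sign change of coordinate $i$. Irreducible complex representations of $B_n$ are labeled by bipartitions of $n$: $\underline{\lambda}$ labels the representation induced from $B_{|\lambda^1|}\times B_{|\lambda^2|}$ of $S^{\lambda^1}\boxtimes S^{\lambda^2}$, where $S^{\lambda^j}$ is the Specht module (with $S^{(m)}$ trivial), all $\zeta_i$ acting by $1$ on the first factor and by $-1$ on the second. The rational Cherednik algebra $H_{e,\underline{s}}(B_n)$ has parameters $c=\frac1e$, $d=-\frac12+\frac se$, $s=s_2-s_1$: it is generated by $\mathbb{C}[x_1,\dots,x_n]$, $\mathbb{C}[y_1,\dots,y_n]$ and $\mathbb{C}B_n$ with $wxw^{-1}=w(x)$,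 $wyw^{-1}=w(y)$ for $w\in B_n$, $[x_i,x_j]=[y_i,y_j]=0$, $$[y_i,x_i]=1-c\sum_{j\ne i}(s_{ij}+\zeta_is_{ij}\zeta_i)-2d\zeta_i,\qquad [y_i,x_j]=c(s_{ij}-\zeta_is_{ij}\zeta_i)\ (i\neq j).$$ $\mathcal{O}_{e,\underline{s}}(n)$ is the category of finitely generated $H_{e,\underline{s}}(B_n)$-modules on which the $y_i$ act locally nilpotently. The standard module $\Delta(\underline{\lambda})$ is induced from the $\mathbb{C}[y_1,\dots,y_n]\rtimes B_n$-module $\underline{\lambda}$ on which all $y_i$ act by $0$; $L(\underline{\lambda})$ is its unique irreducible quotient. $L(\underline{\lambda})$ carries a nondegenerate contravariant Hermitian form (that is, $B_n$-invariant, with $x_i$ adjoint to $y_i$, normalized to be positive definite on the lowest weight space $\underline{\lambda}$); $L(\underline{\lambda})$ is called unitary if this form is positive definite. *)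

theory Defs
  imports
    Complex_Main
    "HOL-Algebra.Algebra"
    "HOL-Algebra.Algebraic_Closure_Type"
    "HOL-Combinatorics.Permutations"
begin

section \<open>Left modules over a not necessarily commutative ring\<close>

text \<open>
  The locale \<open>module\<close> of HOL-Algebra is restricted to commutative rings. Its record type and its
  notion of \<^locale>\<open>submodule\<close> are not, and are used here for left modules over arbitrary rings.
  The fields \<open>mult\<close> and \<open>one\<close>, which a module record inherits from rings, carry no meaning for
  modules.
\<close>

definition gen_submodule ::
    "('a, 'c) ring_scheme \<Rightarrow> ('a, 'b, 'd) module_scheme \<Rightarrow> 'b set \<Rightarrow> 'b set" where
  "gen_submodule R M S = \<Inter>{N. submodule N R M \<and> S \<subseteq> N}"

definition quot_module ::
    "('a, 'b, 'd) module_scheme \<Rightarrow> 'b set \<Rightarrow> ('a, 'b set) module" where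
  "quot_module M N =
     \<lparr>carrier = a_rcosets\<^bsub>M\<^esub> N, monoid.mult = undefined, one = undefined,
      ring.zero = N, add = set_add M,
      module.smult = (\<lambda>r C. \<Union>u\<in>C. N +>\<^bsub>M\<^esub> (r \<odot>\<^bsub>M\<^esub> u))\<rparr>"

definition irreducible_module ::
    "('a, 'c) ring_scheme \<Rightarrow> ('a, 'b, 'd) module_scheme \<Rightarrow> bool" where
  "irreducible_module R M \<longleftrightarrow>
     carrier M \<noteq> {\<zero>\<^bsub>M\<^esub>} \<and> (\<forall>N. submodule N R M \<longrightarrow> N = {\<zero>\<^bsub>M\<^esub>} \<or> N = carrier M)"

definition restrict_scalars ::
    "('k \<Rightarrow> 'a) \<Rightarrow> ('a, 'b, 'd) module_scheme \<Rightarrow> ('k, 'b) module" where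
  "restrict_scalars h M =
     \<lparr>carrier = carrier M, monoid.mult = undefined, one = undefined,
      ring.zero = ring.zero M, add = add M,
      module.smult = (\<lambda>a u. h a \<odot>\<^bsub>M\<^esub> u)\<rparr>"

definition free_module :: "('a, 'c) ring_scheme \<Rightarrow> 'b set \<Rightarrow> ('a, 'b \<Rightarrow> 'a) module" where
  "free_module R S =
     \<lparr>carrier = {f. (\<forall>v\<in>S. f v \<in> carrier R) \<and> (\<forall>v. v \<notin> S \<longrightarrow> f v = \<zero>\<^bsub>R\<^esub>) \<and>
                   finite {v. f v \<noteq> \<zero>\<^bsub>R\<^esub>}},
      monoid.mult = undefined, one = undefined,
      ring.zero = (\<lambda>v. \<zero>\<^bsub>R\<^esub>), add = (\<lambda>f g v. f v \<oplus>\<^bsub>R\<^esub> g v),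
      module.smult = (\<lambda>r f v. r \<otimes>\<^bsub>R\<^esub> f v)\<rparr>"

definition free_basis :: "('a, 'c) ring_scheme \<Rightarrow> 'b \<Rightarrow> 'b \<Rightarrow> 'a" where
  "free_basis R v = (\<lambda>u. if u = v then \<one>\<^bsub>R\<^esub> else \<zero>\<^bsub>R\<^esub>)"

text \<open>
  For a ring homomorphism \<open>h: A \<rightarrow> R\<close> and a left \<open>A\<close>-module \<open>V\<close>, the induced module
  \<open>R \<otimes>\<^sub>A V\<close> is the quotient of the free left \<open>R\<close>-module on the set \<open>V\<close> by the relations
  \<open>[u + v] = [u] + [v]\<close> and \<open>[a v] = h(a) [v]\<close>; the class of \<open>r [v]\<close> is the tensor \<open>r \<otimes> v\<close>.
\<close>

definition tensor_relations ::
    "('a, 'c) ring_scheme \<Rightarrow> ('r, 'e) ring_scheme \<Rightarrow> ('a \<Rightarrow> 'r) \<Rightarrow> ('a, 'b, 'd) module_scheme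
      \<Rightarrow> ('b \<Rightarrow> 'r) set" where
  "tensor_relations A R h V = gen_submodule R (free_module R (carrier V))
     ({free_basis R (u \<oplus>\<^bsub>V\<^esub> v) \<ominus>\<^bsub>free_module R (carrier V)\<^esub>
         (free_basis R u \<oplus>\<^bsub>free_module R (carrier V)\<^esub> free_basis R v)
       | u v. u \<in> carrier V \<and> v \<in> carrier V} \<union>
      {free_basis R (a \<odot>\<^bsub>V\<^esub> v) \<ominus>\<^bsub>free_module R (carrier V)\<^esub>
         (h a \<odot>\<^bsub>free_module R (carrier V)\<^esub> free_basis R v)
       | a v. a \<in> carrier A \<and> v \<in> carrier V})"

definition induced_module ::
    "('a, 'c) ring_scheme \<Rightarrow> ('r, 'e) ring_scheme \<Rightarrow> ('a \<Rightarrow> 'r) \<Rightarrow> ('a, 'b, 'd) module_scheme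
      \<Rightarrow> ('r, ('b \<Rightarrow> 'r) set) module" where
  "induced_module A R h V = quot_module (free_module R (carrier V)) (tensor_relations A R h V)"

definition induced_unit ::
    "('a, 'c) ring_scheme \<Rightarrow> ('r, 'e) ring_scheme \<Rightarrow> ('a \<Rightarrow> 'r) \<Rightarrow> ('a, 'b, 'd) module_scheme
      \<Rightarrow> 'b \<Rightarrow> ('b \<Rightarrow> 'r) set" where
  "induced_unit A R h V v =
     tensor_relations A R h V +>\<^bsub>free_module R (carrier V)\<^esub> free_basis R v"

abbreviation complex_ring :: "complex ring" where
  "complex_ring \<equiv> ring_of_type_algebra"


section \<open>Complex associative algebras given by generators and relations\<close>

text \<open>
  An element of the free algebra on \<open>G\<close> is a finitely supported function giving the coefficient of
  each word in \<open>G\<close>.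
\<close>

definition free_algebra :: "'g set \<Rightarrow> (complex, 'g list \<Rightarrow> complex) module" where
  "free_algebra G =
     \<lparr>carrier = {f. finite {w. f w \<noteq> 0} \<and> {w. f w \<noteq> 0} \<subseteq> lists G},
      monoid.mult = (\<lambda>f g w. \<Sum>k\<le>length w. f (take k w) * g (drop k w)),
      one = (\<lambda>w. if w = [] then 1 else 0),
      ring.zero = (\<lambda>w. 0), add = (\<lambda>f g w. f w + g w), module.smult = (\<lambda>a f w. a * f w)\<rparr>"

definition gen :: "'g \<Rightarrow> 'g list \<Rightarrow> complex" where
  "gen a = (\<lambda>w. if w = [a] then 1 else 0)"

text \<open>A pair \<open>(a, b)\<close> in the set of relations stands for the relation \<open>a = b\<close>.\<close>

definition relation_ideal ::
    "'g set \<Rightarrow> (('g list \<Rightarrow> complex) \<times> ('g list \<Rightarrow> complex)) set \<Rightarrow> ('g list \<Rightarrow> complex) set" where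
  "relation_ideal G Rel = Idl\<^bsub>free_algebra G\<^esub> {a \<ominus>\<^bsub>free_algebra G\<^esub> b | a b. (a, b) \<in> Rel}"

definition presented_algebra ::
    "'g set \<Rightarrow> (('g list \<Rightarrow> complex) \<times> ('g list \<Rightarrow> complex)) set \<Rightarrow> ('g list \<Rightarrow> complex) set ring" where
  "presented_algebra G Rel = free_algebra G Quot relation_ideal G Rel"

text \<open>
  The map between presented algebras induced by an inclusion of generators and relations: the class
  of \<open>f\<close> goes to the class of \<open>f\<close>. The target is \<open>presented_algebra G Rel\<close>.
\<close>

definition presented_map ::
    "'g set \<Rightarrow> (('g list \<Rightarrow> complex) \<times> ('g list \<Rightarrow> complex)) set
      \<Rightarrow> ('g list \<Rightarrow> complex) set \<Rightarrow> ('g list \<Rightarrow> complex) set" where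
  "presented_map G Rel C = (\<Union>f\<in>C. relation_ideal G Rel +>\<^bsub>free_algebra G\<^esub> f)"

text \<open>
  The module over a presented algebra whose underlying complex vector space is \<open>V\<close> and on which the
  generator \<open>a\<close> acts by \<open>op a\<close>, for linear operators \<open>op a\<close> that satisfy the defining relations.
\<close>

definition free_algebra_act ::
    "(complex, 'v, 'd) module_scheme \<Rightarrow> ('g \<Rightarrow> 'v \<Rightarrow> 'v) \<Rightarrow> ('g list \<Rightarrow> complex) \<Rightarrow> 'v \<Rightarrow> 'v" where
  "free_algebra_act V op f v = (\<Oplus>\<^bsub>V\<^esub>w\<in>{w. f w \<noteq> 0}. f w \<odot>\<^bsub>V\<^esub> foldr op w v)"

definition module_of_operators ::
    "(complex, 'v, 'd) module_scheme \<Rightarrow> ('g \<Rightarrow> 'v \<Rightarrow> 'v) \<Rightarrow> (('g list \<Rightarrow> complex) set, 'v) module" where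
  "module_of_operators V op =
     \<lparr>carrier = carrier V, monoid.mult = undefined, one = undefined,
      ring.zero = ring.zero V, add = add V,
      module.smult = (\<lambda>C v. the_elem ((\<lambda>f. free_algebra_act V op f v) ` C))\<rparr>"


section \<open>The hyperoctahedral group\<close>

text \<open>
  A pair \<open>(\<epsilon>, \<sigma>)\<close> is the element \<open>\<epsilon>\<sigma>\<close> of \<open>(\<int>/2)\<^sup>n \<rtimes> S\<^sub>n\<close>, with signs \<open>\<epsilon> k = \<plusminus>1\<close>; it maps the
  basis vector \<open>y\<^sub>i\<close> to \<open>\<epsilon>(\<sigma> i) y\<^bsub>\<sigma> i\<^esub>\<close>.
\<close>

type_synonym signed_perm = "(nat \<Rightarrow> int) \<times> (nat \<Rightarrow> nat)"

definition hyperoctahedral :: "nat \<Rightarrow> signed_perm monoid" where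
  "hyperoctahedral n =
     \<lparr>carrier = {(\<epsilon>, \<sigma>). (\<forall>k\<in>{1..n}. \<epsilon> k \<in> {1, -1}) \<and> (\<forall>k. k \<notin> {1..n} \<longrightarrow> \<epsilon> k = 1) \<and>
                        \<sigma> permutes {1..n}},
      monoid.mult = (\<lambda>(\<epsilon>, \<sigma>) (\<epsilon>', \<sigma>'). (\<lambda>k. \<epsilon> k * \<epsilon>' (inv_into UNIV \<sigma> k), \<sigma> \<circ> \<sigma>')),
      one = (\<lambda>k. 1, id)\<rparr>"

definition perm_swap :: "nat \<Rightarrow> nat \<Rightarrow> signed_perm" where
  "perm_swap i j = (\<lambda>k. 1, Transposition.transpose i j)"

definition sign_change :: "nat \<Rightarrow> signed_perm" where
  "sign_change i = (\<lambda>k. if k = i then -1 else 1, id)"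


section \<open>Partitions and Specht modules\<close>

definition is_partition :: "nat list \<Rightarrow> bool" where
  "is_partition \<mu> \<longleftrightarrow> sorted_wrt (\<ge>) \<mu> \<and> (\<forall>p\<in>set \<mu>. p > 0)"

definition bipartition :: "nat \<Rightarrow> nat list \<times> nat list \<Rightarrow> bool" where
  "bipartition n \<Lambda> \<longleftrightarrow> is_partition (fst \<Lambda>) \<and> is_partition (snd \<Lambda>) \<and>
     sum_list (fst \<Lambda>) + sum_list (snd \<Lambda>) = n"

definition rectangle :: "nat list \<Rightarrow> bool" where
  "rectangle \<mu> \<longleftrightarrow> is_partition \<mu> \<and> (\<forall>p\<in>set \<mu>. \<forall>q\<in>set \<mu>. p = q)"

definition num_rows :: "nat list \<Rightarrow> nat" where
  "num_rows \<mu> = length \<mu>"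

definition num_cols :: "nat list \<Rightarrow> nat" where
  "num_cols \<mu> = (if \<mu> = [] then 0 else hd \<mu>)"

definition young_diagram :: "nat list \<Rightarrow> (nat \<times> nat) set" where
  "young_diagram \<mu> = {(i, j). 1 \<le> i \<and> i \<le> length \<mu> \<and> 1 \<le> j \<and> j \<le> \<mu> ! (i - 1)}"

text \<open>
  A tableau with entries in \<open>I\<close> is given by the map that sends an entry to its box, and a tabloid by
  the map that sends an entry to its row (and everything outside \<open>I\<close> to \<open>0\<close>). A permutation \<open>\<sigma>\<close> of
  \<open>I\<close> replaces each entry \<open>k\<close> by \<open>\<sigma> k\<close>, so it acts on both by precomposition with the inverse of
  \<open>\<sigma>\<close>. The permutation module on tabloids is realized by complex-valued functions of a tabloid.
\<close>

definition tableaux :: "nat list \<Rightarrow> nat set \<Rightarrow> (nat \<Rightarrow> nat \<times> nat) set" where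
  "tableaux \<mu> I = {t. bij_betw t I (young_diagram \<mu>)}"

definition tabloid :: "nat set \<Rightarrow> (nat \<Rightarrow> nat \<times> nat) \<Rightarrow> nat \<Rightarrow> nat" where
  "tabloid I t = (\<lambda>k. if k \<in> I then fst (t k) else 0)"

definition column_stabilizer :: "nat set \<Rightarrow> (nat \<Rightarrow> nat \<times> nat) \<Rightarrow> (nat \<Rightarrow> nat) set" where
  "column_stabilizer I t = {\<sigma>. \<sigma> permutes I \<and> (\<forall>k\<in>I. snd (t (\<sigma> k)) = snd (t k))}"

definition polytabloid :: "nat set \<Rightarrow> (nat \<Rightarrow> nat \<times> nat) \<Rightarrow> (nat \<Rightarrow> nat) \<Rightarrow> complex" where
  "polytabloid I t = (\<lambda>T. \<Sum>\<sigma>\<in>column_stabilizer I t.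
     if T = tabloid I (t \<circ> inv_into UNIV \<sigma>) then of_int (sign \<sigma>) else 0)"

definition function_space :: "(complex, 'x \<Rightarrow> complex) module" where
  "function_space =
     \<lparr>carrier = UNIV, monoid.mult = undefined, one = undefined,
      ring.zero = (\<lambda>x. 0), add = (\<lambda>f g x. f x + g x),
      module.smult = (\<lambda>a f x. a * f x)\<rparr>"

definition specht :: "nat list \<Rightarrow> nat set \<Rightarrow> ((nat \<Rightarrow> nat) \<Rightarrow> complex) set" where
  "specht \<mu> I = gen_submodule complex_ring function_space (polytabloid I ` tableaux \<mu> I)"


section \<open>Irreducible representations of the hyperoctahedral group\<close>

text \<open>
  For \<open>n = a + b\<close>, the subgroup \<open>B\<^sub>a \<times> B\<^sub>b\<close> acts on \<open>{1..a}\<close> and \<open>{a+1..a+b}\<close> separately. The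
  external tensor product of two Specht modules is the span of the products of a function of the
  first tabloid and a function of the second. A permutation preserving both blocks acts on each
  factor through its restriction to that block; a sign change at \<open>k\<close> acts by \<open>1\<close> for \<open>k\<close> in the first
  block and by \<open>-1\<close> for \<open>k\<close> in the second.
\<close>

definition block_subgroup :: "nat \<Rightarrow> nat \<Rightarrow> signed_perm set" where
  "block_subgroup a b = {w \<in> carrier (hyperoctahedral (a + b)). snd w ` {1..a} = {1..a}}"

definition outer_specht ::
    "nat list \<Rightarrow> nat list \<Rightarrow> (complex, (nat \<Rightarrow> nat) \<times> (nat \<Rightarrow> nat) \<Rightarrow> complex) module" where
  "outer_specht \<mu> \<nu> = (let a = sum_list \<mu>; b = sum_list \<nu> in
     function_space\<lparr>carrier := gen_submodule complex_ring function_space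
       {\<lambda>(T, U). f T * g U | f g. f \<in> specht \<mu> {1..a} \<and> g \<in> specht \<nu> {a+1..a+b}}\<rparr>)"

definition outer_act ::
    "nat \<Rightarrow> nat \<Rightarrow> signed_perm \<Rightarrow> ((nat \<Rightarrow> nat) \<times> (nat \<Rightarrow> nat) \<Rightarrow> complex)
      \<Rightarrow> (nat \<Rightarrow> nat) \<times> (nat \<Rightarrow> nat) \<Rightarrow> complex" where
  "outer_act a b w F =
     (\<lambda>(T, U). of_int (\<Prod>k\<in>{a+1..a+b}. fst w k) * F (T \<circ> snd w, U \<circ> snd w))"

text \<open>
  The representation induced from the action \<open>\<rho>\<close> of a subgroup \<open>K\<close> on \<open>V\<close>: the functions
  \<open>f: G \<rightarrow> V\<close> with \<open>f(g k) = \<rho>(k\<^sup>-\<^sup>1) f(g)\<close>, where \<open>G\<close> acts by left translation.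
\<close>

definition induced_rep_space ::
    "('g, 'e) monoid_scheme \<Rightarrow> 'g set \<Rightarrow> (complex, 'v, 'd) module_scheme \<Rightarrow> ('g \<Rightarrow> 'v \<Rightarrow> 'v)
      \<Rightarrow> (complex, 'g \<Rightarrow> 'v) module" where
  "induced_rep_space G K V \<rho> =
     \<lparr>carrier = {f \<in> carrier G \<rightarrow>\<^sub>E carrier V.
                  \<forall>g\<in>carrier G. \<forall>k\<in>K. f (g \<otimes>\<^bsub>G\<^esub> k) = \<rho> (inv\<^bsub>G\<^esub> k) (f g)},
      monoid.mult = undefined, one = undefined,
      ring.zero = (\<lambda>g\<in>carrier G. \<zero>\<^bsub>V\<^esub>),
      add = (\<lambda>f f'. \<lambda>g\<in>carrier G. f g \<oplus>\<^bsub>V\<^esub> f' g),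
      module.smult = (\<lambda>a f. \<lambda>g\<in>carrier G. a \<odot>\<^bsub>V\<^esub> f g)\<rparr>"

definition induced_rep_act :: "('g, 'e) monoid_scheme \<Rightarrow> 'g \<Rightarrow> ('g \<Rightarrow> 'v) \<Rightarrow> 'g \<Rightarrow> 'v" where
  "induced_rep_act G h f = (\<lambda>g\<in>carrier G. f (inv\<^bsub>G\<^esub> h \<otimes>\<^bsub>G\<^esub> g))"

type_synonym irrep_vec = "signed_perm \<Rightarrow> (nat \<Rightarrow> nat) \<times> (nat \<Rightarrow> nat) \<Rightarrow> complex"

definition irrep_space :: "nat list \<times> nat list \<Rightarrow> (complex, irrep_vec) module" where
  "irrep_space \<Lambda> = (let a = sum_list (fst \<Lambda>); b = sum_list (snd \<Lambda>) in
     induced_rep_space (hyperoctahedral (a + b)) (block_subgroup a b)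
       (outer_specht (fst \<Lambda>) (snd \<Lambda>)) (outer_act a b))"

definition irrep_act :: "nat list \<times> nat list \<Rightarrow> signed_perm \<Rightarrow> irrep_vec \<Rightarrow> irrep_vec" where
  "irrep_act \<Lambda> = induced_rep_act (hyperoctahedral (sum_list (fst \<Lambda>) + sum_list (snd \<Lambda>)))"


section \<open>The rational Cherednik algebra\<close>

datatype cgen = GenX nat | GenY nat | GenW signed_perm

definition smash_gens :: "nat \<Rightarrow> cgen set" where
  "smash_gens n = GenY ` {1..n} \<union> GenW ` carrier (hyperoctahedral n)"

definition cherednik_gens :: "nat \<Rightarrow> cgen set" where
  "cherednik_gens n = GenX ` {1..n} \<union> smash_gens n"

abbreviation (input) cherednik_free :: "nat \<Rightarrow> (complex, cgen list \<Rightarrow> complex) module" where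
  "cherednik_free n \<equiv> free_algebra (cherednik_gens n)"

text \<open>\<open>w(x\<^sub>i)\<close> for \<open>Z = GenX\<close> and \<open>w(y\<^sub>i)\<close> for \<open>Z = GenY\<close>\<close>

definition act_gen :: "(nat \<Rightarrow> cgen) \<Rightarrow> signed_perm \<Rightarrow> nat \<Rightarrow> cgen list \<Rightarrow> complex" where
  "act_gen Z w i = (\<lambda>u. of_int (fst w (snd w i)) * gen (Z (snd w i)) u)"

text \<open>
  The defining relations of \<open>\<complex>[y\<^sub>1,\<dots>,y\<^sub>n] \<rtimes> B\<^sub>n\<close>. The product and the unit of the free algebra do
  not depend on its set of generators, so these can also be used as relations among the generators
  of the Cherednik algebra.
\<close>

inductive_set smash_rels :: "nat \<Rightarrow> ((cgen list \<Rightarrow> complex) \<times> (cgen list \<Rightarrow> complex)) set"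
  for n :: nat where
  group_one: "(gen (GenW \<one>\<^bsub>hyperoctahedral n\<^esub>), \<one>\<^bsub>cherednik_free n\<^esub>) \<in> smash_rels n"
| group_mult: "\<lbrakk>v \<in> carrier (hyperoctahedral n); w \<in> carrier (hyperoctahedral n)\<rbrakk> \<Longrightarrow>
    (gen (GenW v) \<otimes>\<^bsub>cherednik_free n\<^esub> gen (GenW w), gen (GenW (v \<otimes>\<^bsub>hyperoctahedral n\<^esub> w)))
      \<in> smash_rels n"
| conj_y: "\<lbrakk>w \<in> carrier (hyperoctahedral n); i \<in> {1..n}\<rbrakk> \<Longrightarrow>
    (gen (GenW w) \<otimes>\<^bsub>cherednik_free n\<^esub> gen (GenY i)
       \<otimes>\<^bsub>cherednik_free n\<^esub> gen (GenW (inv\<^bsub>hyperoctahedral n\<^esub> w)),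
     act_gen GenY w i) \<in> smash_rels n"
| comm_y: "\<lbrakk>i \<in> {1..n}; j \<in> {1..n}\<rbrakk> \<Longrightarrow>
    (gen (GenY i) \<otimes>\<^bsub>cherednik_free n\<^esub> gen (GenY j),
     gen (GenY j) \<otimes>\<^bsub>cherednik_free n\<^esub> gen (GenY i)) \<in> smash_rels n"

definition commutator ::
    "nat \<Rightarrow> (cgen list \<Rightarrow> complex) \<Rightarrow> (cgen list \<Rightarrow> complex) \<Rightarrow> cgen list \<Rightarrow> complex" where
  "commutator n f g =
     (f \<otimes>\<^bsub>cherednik_free n\<^esub> g) \<ominus>\<^bsub>cherednik_free n\<^esub> (g \<otimes>\<^bsub>cherednik_free n\<^esub> f)"

text \<open>the element \<open>\<zeta>\<^sub>i s\<^sub>i\<^sub>j \<zeta>\<^sub>i\<close>\<close>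

definition twisted_swap :: "nat \<Rightarrow> nat \<Rightarrow> nat \<Rightarrow> signed_perm" where
  "twisted_swap n i j =
     sign_change i \<otimes>\<^bsub>hyperoctahedral n\<^esub> perm_swap i j \<otimes>\<^bsub>hyperoctahedral n\<^esub> sign_change i"

inductive_set cherednik_rels ::
    "nat \<Rightarrow> complex \<Rightarrow> complex \<Rightarrow> ((cgen list \<Rightarrow> complex) \<times> (cgen list \<Rightarrow> complex)) set"
  for n :: nat and c d :: complex where
  smash: "p \<in> smash_rels n \<Longrightarrow> p \<in> cherednik_rels n c d"
| conj_x: "\<lbrakk>w \<in> carrier (hyperoctahedral n); i \<in> {1..n}\<rbrakk> \<Longrightarrow>
    (gen (GenW w) \<otimes>\<^bsub>cherednik_free n\<^esub> gen (GenX i)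
       \<otimes>\<^bsub>cherednik_free n\<^esub> gen (GenW (inv\<^bsub>hyperoctahedral n\<^esub> w)),
     act_gen GenX w i) \<in> cherednik_rels n c d"
| comm_x: "\<lbrakk>i \<in> {1..n}; j \<in> {1..n}\<rbrakk> \<Longrightarrow>
    (gen (GenX i) \<otimes>\<^bsub>cherednik_free n\<^esub> gen (GenX j),
     gen (GenX j) \<otimes>\<^bsub>cherednik_free n\<^esub> gen (GenX i)) \<in> cherednik_rels n c d"
| comm_yx_same: "i \<in> {1..n} \<Longrightarrow>
    (commutator n (gen (GenY i)) (gen (GenX i)),
     \<one>\<^bsub>cherednik_free n\<^esub>
       \<ominus>\<^bsub>cherednik_free n\<^esub> c \<odot>\<^bsub>cherednik_free n\<^esub>
          (\<Oplus>\<^bsub>cherednik_free n\<^esub>j\<in>{1..n} - {i}.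
             gen (GenW (perm_swap i j)) \<oplus>\<^bsub>cherednik_free n\<^esub> gen (GenW (twisted_swap n i j)))
       \<ominus>\<^bsub>cherednik_free n\<^esub> (2 * d) \<odot>\<^bsub>cherednik_free n\<^esub> gen (GenW (sign_change i)))
    \<in> cherednik_rels n c d"
| comm_yx_diff: "\<lbrakk>i \<in> {1..n}; j \<in> {1..n}; i \<noteq> j\<rbrakk> \<Longrightarrow>
    (commutator n (gen (GenY i)) (gen (GenX j)),
     c \<odot>\<^bsub>cherednik_free n\<^esub>
       (gen (GenW (perm_swap i j)) \<ominus>\<^bsub>cherednik_free n\<^esub> gen (GenW (twisted_swap n i j))))
    \<in> cherednik_rels n c d"

type_synonym calg = "(cgen list \<Rightarrow> complex) set"

definition smash_algebra :: "nat \<Rightarrow> calg ring" where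
  "smash_algebra n = presented_algebra (smash_gens n) (smash_rels n)"

definition cherednik_algebra :: "nat \<Rightarrow> complex \<Rightarrow> complex \<Rightarrow> calg ring" where
  "cherednik_algebra n c d = presented_algebra (cherednik_gens n) (cherednik_rels n c d)"

definition cherednik_class ::
    "nat \<Rightarrow> complex \<Rightarrow> complex \<Rightarrow> (cgen list \<Rightarrow> complex) \<Rightarrow> calg" where
  "cherednik_class n c d f =
     relation_ideal (cherednik_gens n) (cherednik_rels n c d) +>\<^bsub>cherednik_free n\<^esub> f"

definition cherednik_scalar :: "nat \<Rightarrow> complex \<Rightarrow> complex \<Rightarrow> complex \<Rightarrow> calg" where
  "cherednik_scalar n c d a =
     cherednik_class n c d (a \<odot>\<^bsub>cherednik_free n\<^esub> \<one>\<^bsub>cherednik_free n\<^esub>)"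

definition smash_to_cherednik :: "nat \<Rightarrow> complex \<Rightarrow> complex \<Rightarrow> calg \<Rightarrow> calg" where
  "smash_to_cherednik n c d = presented_map (cherednik_gens n) (cherednik_rels n c d)"


section \<open>Standard modules and their irreducible quotients\<close>

text \<open>
  \<open>GenX i\<close> is not a generator of \<open>\<complex>[y\<^sub>1,\<dots>,y\<^sub>n] \<rtimes> B\<^sub>n\<close>; its value below is irrelevant.
\<close>

fun lowest_op :: "nat list \<times> nat list \<Rightarrow> cgen \<Rightarrow> irrep_vec \<Rightarrow> irrep_vec" where
  "lowest_op \<Lambda> (GenX i) v = \<zero>\<^bsub>irrep_space \<Lambda>\<^esub>"
| "lowest_op \<Lambda> (GenY i) v = \<zero>\<^bsub>irrep_space \<Lambda>\<^esub>"
| "lowest_op \<Lambda> (GenW w) v = irrep_act \<Lambda> w v"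

definition lowest_module :: "nat list \<times> nat list \<Rightarrow> (calg, irrep_vec) module" where
  "lowest_module \<Lambda> = module_of_operators (irrep_space \<Lambda>) (lowest_op \<Lambda>)"

type_synonym std_vec = "(irrep_vec \<Rightarrow> calg) set"

definition standard_module ::
    "nat \<Rightarrow> complex \<Rightarrow> complex \<Rightarrow> nat list \<times> nat list \<Rightarrow> (calg, std_vec) module" where
  "standard_module n c d \<Lambda> = induced_module (smash_algebra n) (cherednik_algebra n c d)
     (smash_to_cherednik n c d) (lowest_module \<Lambda>)"

definition std_radical ::
    "nat \<Rightarrow> complex \<Rightarrow> complex \<Rightarrow> nat list \<times> nat list \<Rightarrow> std_vec set" where
  "std_radical n c d \<Lambda> = (THE J. submodule J (cherednik_algebra n c d) (standard_module n c d \<Lambda>) \<and>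
     irreducible_module (cherednik_algebra n c d) (quot_module (standard_module n c d \<Lambda>) J))"

definition irred_module ::
    "nat \<Rightarrow> complex \<Rightarrow> complex \<Rightarrow> nat list \<times> nat list \<Rightarrow> (calg, std_vec set) module" where
  "irred_module n c d \<Lambda> = quot_module (standard_module n c d \<Lambda>) (std_radical n c d \<Lambda>)"

text \<open>The image of \<open>\<Lambda>\<close> in its irreducible quotient, under \<open>v \<mapsto> 1 \<otimes> v\<close>\<close>

definition lowest_weight_space ::
    "nat \<Rightarrow> complex \<Rightarrow> complex \<Rightarrow> nat list \<times> nat list \<Rightarrow> std_vec set set" where
  "lowest_weight_space n c d \<Lambda> =
     (\<lambda>v. std_radical n c d \<Lambda> +>\<^bsub>standard_module n c d \<Lambda>\<^esub>
        induced_unit (smash_algebra n) (cherednik_algebra n c d) (smash_to_cherednik n c d)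
          (lowest_module \<Lambda>) v) ` carrier (lowest_module \<Lambda>)"


section \<open>Unitarity and finite-dimensionality\<close>

text \<open>\<open>L\<close> is a module over \<open>cherednik_algebra n c d\<close>, and \<open>W\<close> its lowest weight space.\<close>

definition contravariant_form ::
    "nat \<Rightarrow> complex \<Rightarrow> complex \<Rightarrow> (calg, 'v, 'e) module_scheme \<Rightarrow> 'v set
      \<Rightarrow> ('v \<Rightarrow> 'v \<Rightarrow> complex) \<Rightarrow> bool" where
  "contravariant_form n c d L W B \<longleftrightarrow>
     (let cls = cherednik_class n c d; V = carrier L in
      (\<forall>u\<in>V. \<forall>v\<in>V. \<forall>w\<in>V. B (u \<oplus>\<^bsub>L\<^esub> v) w = B u w + B v w) \<and>
      (\<forall>a. \<forall>u\<in>V. \<forall>v\<in>V. B (cherednik_scalar n c d a \<odot>\<^bsub>L\<^esub> u) v = a * B u v) \<and>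
      (\<forall>u\<in>V. \<forall>v\<in>V. B v u = cnj (B u v)) \<and>
      (\<forall>g\<in>carrier (hyperoctahedral n). \<forall>u\<in>V. \<forall>v\<in>V.
         B (cls (gen (GenW g)) \<odot>\<^bsub>L\<^esub> u) (cls (gen (GenW g)) \<odot>\<^bsub>L\<^esub> v) = B u v) \<and>
      (\<forall>i\<in>{1..n}. \<forall>u\<in>V. \<forall>v\<in>V.
         B (cls (gen (GenX i)) \<odot>\<^bsub>L\<^esub> u) v = B u (cls (gen (GenY i)) \<odot>\<^bsub>L\<^esub> v)) \<and>
      (\<forall>u\<in>V. (\<forall>v\<in>V. B u v = 0) \<longrightarrow> u = \<zero>\<^bsub>L\<^esub>) \<and>
      (\<forall>u\<in>W. u \<noteq> \<zero>\<^bsub>L\<^esub> \<longrightarrow> Im (B u u) = 0 \<and> Re (B u u) > 0))"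

definition unitary_irred ::
    "nat \<Rightarrow> complex \<Rightarrow> complex \<Rightarrow> nat list \<times> nat list \<Rightarrow> bool" where
  "unitary_irred n c d \<Lambda> \<longleftrightarrow>
     (let L = irred_module n c d \<Lambda> in
      \<exists>B. contravariant_form n c d L (lowest_weight_space n c d \<Lambda>) B \<and>
          (\<forall>u\<in>carrier L. u \<noteq> \<zero>\<^bsub>L\<^esub> \<longrightarrow> Im (B u u) = 0 \<and> Re (B u u) > 0))"

definition finite_dim_irred ::
    "nat \<Rightarrow> complex \<Rightarrow> complex \<Rightarrow> nat list \<times> nat list \<Rightarrow> bool" where
  "finite_dim_irred n c d \<Lambda> \<longleftrightarrow>
     (let L = restrict_scalars (cherednik_scalar n c d) (irred_module n c d \<Lambda>) in
      \<exists>S. finite S \<and> S \<subseteq> carrier L \<and> gen_submodule complex_ring L S = carrier L)"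

definition fock_c :: "int \<Rightarrow> complex" where
  "fock_c e = 1 / of_int e"

definition fock_d :: "int \<Rightarrow> int \<times> int \<Rightarrow> complex" where
  "fock_d e ss = - 1 / 2 + of_int (snd ss - fst ss) / of_int e"

end

theory Submission imports Defs "HOL-Library.Poly_Mapping" begin

text \<open>
  Write \<open>V\<close> for the representation of \<open>B\<^sub>n\<close> labelled by the bipartition, \<open>\<Delta>\<close> for the standard module and
  \<open>L\<close> for its irreducible quotient. The theorem holds because \<open>L\<close> is unitary and finite-dimensional
  precisely if all commutators \<open>[y\<^sub>i, x\<^sub>j]\<close>, which are elements of the group algebra, act on \<open>V\<close> by \<open>0\<close>
  (\<open>unitary_finite_dim_iff_bracket_free\<close>); this condition is then read off from the Specht modules.

  Suppose that the form on \<open>L\<close> is positive definite and that \<open>L\<close> has finite dimension. The operators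
  \<open>A = \<Sum> x\<^sub>i\<^sup>2\<close> and \<open>A' = \<Sum> y\<^sub>i\<^sup>2\<close> are adjoint to each other, and \<open>[A', A] = 2 \<Sum> (x\<^sub>i y\<^sub>i + y\<^sub>i x\<^sub>i)\<close>
  (\<open>ysq_xsq\<close>): the group elements that enter \<open>[y\<^sub>i, x\<^sub>j]\<close> are reflections, each of which negates its root,
  and they cancel. A commutator has trace \<open>0\<close> (\<open>parseval_adjoint\<close>), while the trace of the right side is
  \<open>2 \<Sum> (|x\<^sub>i e|\<^sup>2 + |y\<^sub>i e|\<^sup>2)\<close> over an orthonormal basis. So every \<open>x\<^sub>i\<close> acts on \<open>L\<close> by \<open>0\<close>
  (\<open>unitary_finite_dim_imp_x_zero\<close>), and then so does every commutator on the image of \<open>V\<close> in \<open>L\<close>, which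
  is a copy of \<open>V\<close>. Conversely, if the commutators kill \<open>V\<close>, then \<open>L\<close> is \<open>V\<close> with the \<open>x\<^sub>i\<close> and \<open>y\<^sub>i\<close>
  acting by \<open>0\<close>, and a \<open>B\<^sub>n\<close>-invariant inner product on \<open>V\<close> is the required form.

  To say when an element of \<open>\<Delta>\<close> vanishes in \<open>L\<close>, the module \<open>\<Delta>\<close> is mapped to a coinduced module,
  whose elements record the degree \<open>0\<close> parts of all \<open>y\<^sub>i\<^sub>1 \<cdots> y\<^sub>i\<^sub>k u\<close>. The kernel of this map is the
  radical of \<open>\<Delta>\<close> (\<open>std_radical_eq\<close>). Irreducibility of \<open>V\<close> and the Euler element, whose
  eigenvalues separate the degrees, show that it contains every proper submodule
  (\<open>submodule_proper\<close>).

  It remains to evaluate the commutators on \<open>V\<close>. If both partitions are nonempty, then \<open>[y\<^sub>i, x\<^sub>j]\<close> with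
  \<open>i\<close> and \<open>j\<close> in different blocks does not vanish, because \<open>\<zeta>\<^sub>i \<zeta>\<^sub>j\<close> acts by \<open>-1\<close> there
  (\<open>bracket_free_imp_one_block\<close>). If one partition is empty, only the \<open>[y\<^sub>i, x\<^sub>i]\<close> matter, and they say that
  the sum of all transpositions \<open>(i j)\<close>, \<open>j \<noteq> i\<close>, acts on the Specht module by a scalar \<open>z\<close> determined by
  the parameters. The coefficient of the tabloid of \<open>t\<close> in this sum applied to the polytabloid of \<open>t\<close>
  is the length of the row of \<open>i\<close> minus the length of the column of \<open>i\<close>, so all rows have length
  \<open>z\<close> plus the number of rows, and the shape is a rectangle; a Garnir relation shows that for rectangles the sum is indeed
  a scalar (\<open>jucys_murphy_scalar_iff\<close>).
\<close>

section \<open>Left modules over a ring\<close>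

locale left_module = R?: ring R + M?: abelian_group M
  for R :: "('a, 'c) ring_scheme" (structure) and M :: "('a, 'b, 'd) module_scheme" (structure) +
  assumes smult_closed [simp, intro]:
      "\<lbrakk>a \<in> carrier R; x \<in> carrier M\<rbrakk> \<Longrightarrow> a \<odot>\<^bsub>M\<^esub> x \<in> carrier M"
    and smult_l_distr:
      "\<lbrakk>a \<in> carrier R; b \<in> carrier R; x \<in> carrier M\<rbrakk> \<Longrightarrow>
      (a \<oplus> b) \<odot>\<^bsub>M\<^esub> x = a \<odot>\<^bsub>M\<^esub> x \<oplus>\<^bsub>M\<^esub> b \<odot>\<^bsub>M\<^esub> x"
    and smult_r_distr:
      "\<lbrakk>a \<in> carrier R; x \<in> carrier M; y \<in> carrier M\<rbrakk> \<Longrightarrow>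
      a \<odot>\<^bsub>M\<^esub> (x \<oplus>\<^bsub>M\<^esub> y) = a \<odot>\<^bsub>M\<^esub> x \<oplus>\<^bsub>M\<^esub> a \<odot>\<^bsub>M\<^esub> y"
    and smult_assoc1:
      "\<lbrakk>a \<in> carrier R; b \<in> carrier R; x \<in> carrier M\<rbrakk> \<Longrightarrow>
      (a \<otimes> b) \<odot>\<^bsub>M\<^esub> x = a \<odot>\<^bsub>M\<^esub> (b \<odot>\<^bsub>M\<^esub> x)"
    and smult_one [simp]:
      "x \<in> carrier M \<Longrightarrow> \<one> \<odot>\<^bsub>M\<^esub> x = x"
begin

lemma smult_zero_right [simp]:
  assumes "a \<in> carrier R" shows "a \<odot>\<^bsub>M\<^esub> \<zero>\<^bsub>M\<^esub> = \<zero>\<^bsub>M\<^esub>"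
proof -
  have "a \<odot>\<^bsub>M\<^esub> \<zero>\<^bsub>M\<^esub> \<oplus>\<^bsub>M\<^esub> a \<odot>\<^bsub>M\<^esub> \<zero>\<^bsub>M\<^esub> = a \<odot>\<^bsub>M\<^esub> \<zero>\<^bsub>M\<^esub>"
    using assms by (simp flip: smult_r_distr)
  then show ?thesis using assms by (metis M.add.l_cancel_one' M.zero_closed smult_closed)
qed

lemma smult_zero_left [simp]:
  assumes "x \<in> carrier M" shows "\<zero> \<odot>\<^bsub>M\<^esub> x = \<zero>\<^bsub>M\<^esub>"
proof -
  have "\<zero> \<odot>\<^bsub>M\<^esub> x \<oplus>\<^bsub>M\<^esub> \<zero> \<odot>\<^bsub>M\<^esub> x = \<zero> \<odot>\<^bsub>M\<^esub> x"
    using assms by (simp flip: smult_l_distr)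
  then show ?thesis using assms by (metis M.add.l_cancel_one' R.zero_closed smult_closed)
qed

lemma smult_minus_right:
  assumes "a \<in> carrier R" "x \<in> carrier M"
  shows "a \<odot>\<^bsub>M\<^esub> (\<ominus>\<^bsub>M\<^esub> x) = \<ominus>\<^bsub>M\<^esub> (a \<odot>\<^bsub>M\<^esub> x)"
proof -
  have "a \<odot>\<^bsub>M\<^esub> (\<ominus>\<^bsub>M\<^esub> x) \<oplus>\<^bsub>M\<^esub> a \<odot>\<^bsub>M\<^esub> x = \<zero>\<^bsub>M\<^esub>"
    using assms by (simp add: M.l_neg flip: smult_r_distr)
  then show ?thesis using assms by (simp add: M.minus_equality)
qed

lemma smult_minus_one:
  assumes "x \<in> carrier M" shows "(\<ominus> \<one>) \<odot>\<^bsub>M\<^esub> x = \<ominus>\<^bsub>M\<^esub> x"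
proof -
  have "(\<ominus> \<one>) \<odot>\<^bsub>M\<^esub> x \<oplus>\<^bsub>M\<^esub> \<one> \<odot>\<^bsub>M\<^esub> x = \<zero>\<^bsub>M\<^esub>"
    using assms by (simp add: R.l_neg del: smult_one flip: smult_l_distr)
  then show ?thesis using assms by (simp add: M.minus_equality)
qed

lemma submoduleI:
  assumes "N \<subseteq> carrier M" "\<zero>\<^bsub>M\<^esub> \<in> N"
    and add: "\<And>u v. u \<in> N \<Longrightarrow> v \<in> N \<Longrightarrow> u \<oplus>\<^bsub>M\<^esub> v \<in> N"
    and smult: "\<And>a u. a \<in> carrier R \<Longrightarrow> u \<in> N \<Longrightarrow> a \<odot>\<^bsub>M\<^esub> u \<in> N"
  shows "submodule N R M"
proof (unfold_locales)
  show "inv\<^bsub>add_monoid M\<^esub> x \<in> N" if "x \<in> N" for x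
    using smult[of "\<ominus> \<one>" x] smult_minus_one[of x] that assms(1) unfolding a_inv_def by auto
qed (use assms in auto)

lemma submodule_carrier: "submodule (carrier M) R M"
  by (rule submoduleI) auto

end

lemma submoduleD:
  assumes "submodule N R M"
  shows "N \<subseteq> carrier M" "\<zero>\<^bsub>M\<^esub> \<in> N"
    "\<And>u v. u \<in> N \<Longrightarrow> v \<in> N \<Longrightarrow> u \<oplus>\<^bsub>M\<^esub> v \<in> N"
    "\<And>u. u \<in> N \<Longrightarrow> \<ominus>\<^bsub>M\<^esub> u \<in> N"
    "\<And>a u. a \<in> carrier R \<Longrightarrow> u \<in> N \<Longrightarrow> a \<odot>\<^bsub>M\<^esub> u \<in> N"
proof -
  interpret submodule N R M by fact
  show "N \<subseteq> carrier M" "\<zero>\<^bsub>M\<^esub> \<in> N"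
    "\<And>u v. u \<in> N \<Longrightarrow> v \<in> N \<Longrightarrow> u \<oplus>\<^bsub>M\<^esub> v \<in> N"
    "\<And>u. u \<in> N \<Longrightarrow> \<ominus>\<^bsub>M\<^esub> u \<in> N"
    "\<And>a u. a \<in> carrier R \<Longrightarrow> u \<in> N \<Longrightarrow> a \<odot>\<^bsub>M\<^esub> u \<in> N"
    using subset one_closed m_closed m_inv_closed by (auto simp: a_inv_def)
qed

lemma gen_submodule_least: "submodule N R M \<Longrightarrow> S \<subseteq> N \<Longrightarrow> gen_submodule R M S \<subseteq> N"
  unfolding gen_submodule_def by blast

lemma gen_submodule_incl: "S \<subseteq> gen_submodule R M S"
  unfolding gen_submodule_def by blast

lemma (in left_module) submodule_gen:
  assumes "S \<subseteq> carrier M" shows "submodule (gen_submodule R M S) R M"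
proof (rule submoduleI)
  show "gen_submodule R M S \<subseteq> carrier M"
    using assms submodule_carrier by (rule gen_submodule_least[rotated])
qed (unfold gen_submodule_def, auto dest: submoduleD)


subsection \<open>Quotients\<close>

locale quotient_by = left_module R M
  for R :: "('a, 'c) ring_scheme" (structure) and M :: "('a, 'b, 'd) module_scheme" (structure) +
  fixes N :: "'b set"
  assumes sub: "submodule N R M"
begin

lemma abelian_subgroup: "abelian_subgroup N M"
proof (rule abelian_subgroupI3)
  interpret submodule N R M by (rule sub)
  show "additive_subgroup N M" by (rule additive_subgroup.intro) (rule subgroup_axioms)
qed (rule M.abelian_group_axioms)

interpretation S: abelian_subgroup N M by (rule abelian_subgroup)

lemma coset_eq_iff:
  assumes "u \<in> carrier M" "v \<in> carrier M"
  shows "N +>\<^bsub>M\<^esub> u = N +>\<^bsub>M\<^esub> v \<longleftrightarrow> u \<ominus>\<^bsub>M\<^esub> v \<in> N"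
proof
  assume "N +>\<^bsub>M\<^esub> u = N +>\<^bsub>M\<^esub> v"
  then have "u \<in> N +>\<^bsub>M\<^esub> v" using S.a_rcos_self[OF assms(1)] by simp
  then show "u \<ominus>\<^bsub>M\<^esub> v \<in> N" using assms S.a_rcos_module[OF assms(2,1)] by (simp add: a_minus_def)
next
  assume "u \<ominus>\<^bsub>M\<^esub> v \<in> N"
  then have "u \<in> N +>\<^bsub>M\<^esub> v" using assms S.a_rcos_module[OF assms(2,1)] by (simp add: a_minus_def)
  then show "N +>\<^bsub>M\<^esub> u = N +>\<^bsub>M\<^esub> v" using M.a_repr_independence[OF _ assms(2) S.a_subgroup] by simp
qed

lemma coset_eq_zero_iff: "u \<in> carrier M \<Longrightarrow> N +>\<^bsub>M\<^esub> u = N \<longleftrightarrow> u \<in> N"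
  using coset_eq_iff[of u "\<zero>\<^bsub>M\<^esub>"] M.a_coset_add_zero[of N] submoduleD(1)[OF sub]
  by (simp add: a_minus_def a_inv_def)

lemma coset_repE:
  assumes "C \<in> carrier (quot_module M N)"
  obtains u where "u \<in> carrier M" "C = N +>\<^bsub>M\<^esub> u"
  using assms unfolding quot_module_def A_RCOSETS_def' by auto

lemma coset_closed [simp]: "u \<in> carrier M \<Longrightarrow> N +>\<^bsub>M\<^esub> u \<in> carrier (quot_module M N)"
  unfolding quot_module_def A_RCOSETS_def' by auto

lemma quot_zero [simp]: "\<zero>\<^bsub>quot_module M N\<^esub> = N"
  by (simp add: quot_module_def)

lemma quot_add [simp]:
  "u \<in> carrier M \<Longrightarrow> v \<in> carrier M \<Longrightarrow>
   (N +>\<^bsub>M\<^esub> u) \<oplus>\<^bsub>quot_module M N\<^esub> (N +>\<^bsub>M\<^esub> v) = N +>\<^bsub>M\<^esub> (u \<oplus>\<^bsub>M\<^esub> v)"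
  using S.a_rcos_sum by (simp add: quot_module_def)

lemma quot_smult [simp]:
  assumes "a \<in> carrier R" "u \<in> carrier M"
  shows "a \<odot>\<^bsub>quot_module M N\<^esub> (N +>\<^bsub>M\<^esub> u) = N +>\<^bsub>M\<^esub> (a \<odot>\<^bsub>M\<^esub> u)"
proof -
  have "N +>\<^bsub>M\<^esub> (a \<odot>\<^bsub>M\<^esub> v) = N +>\<^bsub>M\<^esub> (a \<odot>\<^bsub>M\<^esub> u)" if v: "v \<in> N +>\<^bsub>M\<^esub> u" for v
  proof -
    have vM: "v \<in> carrier M" using S.a_elemrcos_carrier[OF assms(2) v] .
    have "v \<ominus>\<^bsub>M\<^esub> u \<in> N" using v S.a_rcos_module[OF assms(2) vM] by (simp add: a_minus_def)
    then have "a \<odot>\<^bsub>M\<^esub> (v \<ominus>\<^bsub>M\<^esub> u) \<in> N" by (rule submoduleD(5)[OF sub assms(1)])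
    then have "a \<odot>\<^bsub>M\<^esub> v \<ominus>\<^bsub>M\<^esub> a \<odot>\<^bsub>M\<^esub> u \<in> N"
      using assms vM by (simp add: a_minus_def smult_r_distr smult_minus_right)
    then show ?thesis using coset_eq_iff assms vM by simp
  qed
  moreover have "u \<in> N +>\<^bsub>M\<^esub> u" using S.a_rcos_self assms by blast
  ultimately have "(\<Union>v\<in>N +>\<^bsub>M\<^esub> u. N +>\<^bsub>M\<^esub> (a \<odot>\<^bsub>M\<^esub> v)) = N +>\<^bsub>M\<^esub> (a \<odot>\<^bsub>M\<^esub> u)"
    by (metis (no_types, lifting) SUP_eq_const empty_iff)
  then show ?thesis by (simp add: quot_module_def)
qed

lemma left_module_quot: "left_module R (quot_module M N)"
proof -
  have N: "N = N +>\<^bsub>M\<^esub> \<zero>\<^bsub>M\<^esub>"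
    using submoduleD(2)[OF sub] coset_eq_zero_iff[of "\<zero>\<^bsub>M\<^esub>"] by simp
  interpret Q: abelian_group "quot_module M N"
  proof (rule abelian_groupI)
    show "\<zero>\<^bsub>quot_module M N\<^esub> \<in> carrier (quot_module M N)" using N coset_closed by (metis M.zero_closed quot_zero)
    fix x assume "x \<in> carrier (quot_module M N)"
    then obtain u where u: "u \<in> carrier M" "x = N +>\<^bsub>M\<^esub> u" by (rule coset_repE)
    show "\<zero>\<^bsub>quot_module M N\<^esub> \<oplus>\<^bsub>quot_module M N\<^esub> x = x"
      using u quot_add[OF M.zero_closed u(1)] N by simp
    have "(N +>\<^bsub>M\<^esub> (\<ominus>\<^bsub>M\<^esub> u)) \<oplus>\<^bsub>quot_module M N\<^esub> x = \<zero>\<^bsub>quot_module M N\<^esub>"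
      using u N by (simp add: M.l_neg)
    then show "\<exists>y\<in>carrier (quot_module M N). y \<oplus>\<^bsub>quot_module M N\<^esub> x = \<zero>\<^bsub>quot_module M N\<^esub>"
      using u coset_closed by blast
  qed (auto elim!: coset_repE simp: M.a_ac)
  show ?thesis
    by unfold_locales
       (auto elim!: coset_repE simp: smult_l_distr smult_r_distr smult_assoc1)
qed

lemma submodule_preimage:
  assumes "submodule K R (quot_module M N)"
  shows "submodule {u \<in> carrier M. N +>\<^bsub>M\<^esub> u \<in> K} R M"
proof (rule submoduleI)
  have "N +>\<^bsub>M\<^esub> \<zero>\<^bsub>M\<^esub> = N" using submoduleD(2)[OF sub] coset_eq_zero_iff by simp
  then show "\<zero>\<^bsub>M\<^esub> \<in> {u \<in> carrier M. N +>\<^bsub>M\<^esub> u \<in> K}"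
    using submoduleD(2)[OF assms] by simp
  fix u v assume uv: "u \<in> {u \<in> carrier M. N +>\<^bsub>M\<^esub> u \<in> K}" "v \<in> {u \<in> carrier M. N +>\<^bsub>M\<^esub> u \<in> K}"
  then show "u \<oplus>\<^bsub>M\<^esub> v \<in> {u \<in> carrier M. N +>\<^bsub>M\<^esub> u \<in> K}"
    using submoduleD(3)[OF assms, of "N +>\<^bsub>M\<^esub> u" "N +>\<^bsub>M\<^esub> v"] by simp
next
  fix a u assume "a \<in> carrier R" "u \<in> {u \<in> carrier M. N +>\<^bsub>M\<^esub> u \<in> K}"
  then show "a \<odot>\<^bsub>M\<^esub> u \<in> {u \<in> carrier M. N +>\<^bsub>M\<^esub> u \<in> K}"
    using submoduleD(5)[OF assms, of a "N +>\<^bsub>M\<^esub> u"] by simp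
qed auto

lemma submodule_image:
  assumes "submodule K R M"
  shows "submodule ((\<lambda>u. N +>\<^bsub>M\<^esub> u) ` K) R (quot_module M N)"
proof -
  interpret Q: left_module R "quot_module M N" by (rule left_module_quot)
  note K = submoduleD[OF assms]
  show ?thesis
  proof (rule Q.submoduleI)
    show "(\<lambda>u. N +>\<^bsub>M\<^esub> u) ` K \<subseteq> carrier (quot_module M N)" using K(1) by auto
    have "N +>\<^bsub>M\<^esub> \<zero>\<^bsub>M\<^esub> = N" using submoduleD(2)[OF sub] coset_eq_zero_iff by simp
    then show "\<zero>\<^bsub>quot_module M N\<^esub> \<in> (\<lambda>u. N +>\<^bsub>M\<^esub> u) ` K" using K(2) by force
    fix u v assume "u \<in> (\<lambda>u. N +>\<^bsub>M\<^esub> u) ` K" "v \<in> (\<lambda>u. N +>\<^bsub>M\<^esub> u) ` K"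
    then show "u \<oplus>\<^bsub>quot_module M N\<^esub> v \<in> (\<lambda>u. N +>\<^bsub>M\<^esub> u) ` K"
      using K(1) K(3) by (force simp: subset_iff)
  next
    fix a u assume "a \<in> carrier R" "u \<in> (\<lambda>u. N +>\<^bsub>M\<^esub> u) ` K"
    then show "a \<odot>\<^bsub>quot_module M N\<^esub> u \<in> (\<lambda>u. N +>\<^bsub>M\<^esub> u) ` K"
      using K(1) K(5) by (force simp: subset_iff)
  qed
qed

end

text \<open>
  If a proper submodule \<open>J\<close> contains every proper submodule, then it is the only submodule with
  irreducible quotient: any other one would be properly contained in \<open>J\<close>, and the image of \<open>J\<close> in
  its quotient would be neither zero nor everything.
\<close>

lemma (in left_module) irreducible_quotient_unique:
  assumes J: "submodule J R M" "J \<noteq> carrier M"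
    and max: "\<And>N. submodule N R M \<Longrightarrow> N \<noteq> carrier M \<Longrightarrow> N \<subseteq> J"
  shows "submodule K R M \<and> irreducible_module R (quot_module M K) \<longleftrightarrow> K = J"
proof
  interpret J: quotient_by R M J by (rule quotient_by.intro[OF left_module_axioms quotient_by_axioms.intro]) (rule J(1))
  assume "K = J"
  moreover have "irreducible_module R (quot_module M J)"
    unfolding irreducible_module_def
  proof (intro conjI allI impI)
    obtain u where "u \<in> carrier M" "u \<notin> J" using J submoduleD(1) by blast
    then have "J +>\<^bsub>M\<^esub> u \<in> carrier (quot_module M J)" "J +>\<^bsub>M\<^esub> u \<noteq> J"
      using J.coset_eq_zero_iff by auto
    then show "carrier (quot_module M J) \<noteq> {\<zero>\<^bsub>quot_module M J\<^esub>}" by auto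
  next
    fix N assume N: "submodule N R (quot_module M J)"
    let ?P = "{u \<in> carrier M. J +>\<^bsub>M\<^esub> u \<in> N}"
    have P: "submodule ?P R M" using N by (rule J.submodule_preimage)
    show "N = {\<zero>\<^bsub>quot_module M J\<^esub>} \<or> N = carrier (quot_module M J)"
    proof (cases "?P = carrier M")
      case True
      then have "C \<in> N" if "C \<in> carrier (quot_module M J)" for C
        using that by (auto elim!: J.coset_repE)
      then show ?thesis using submoduleD(1)[OF N] by blast
    next
      case False
      then have sub: "?P \<subseteq> J" using max[OF P] by blast
      have "C = J" if "C \<in> N" for C
      proof -
        have "C \<in> carrier (quot_module M J)" by (rule subsetD[OF submoduleD(1)[OF N] that])
        then obtain u where u: "u \<in> carrier M" "C = J +>\<^bsub>M\<^esub> u" by (rule J.coset_repE)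
        have "u \<in> J" by (rule subsetD[OF sub]) (use u that in simp)
        then show ?thesis using u J.coset_eq_zero_iff by simp
      qed
      then have "N = {J}" using submoduleD(2)[OF N] unfolding J.quot_zero by blast
      then show ?thesis by simp
    qed
  qed
  ultimately show "submodule K R M \<and> irreducible_module R (quot_module M K)" using J(1) by simp
next
  assume K: "submodule K R M \<and> irreducible_module R (quot_module M K)"
  then interpret K: quotient_by R M K by (intro quotient_by.intro[OF left_module_axioms quotient_by_axioms.intro]) blast
  have "K \<noteq> carrier M"
  proof
    assume "K = carrier M"
    then have "C = K" if "C \<in> carrier (quot_module M K)" for C
      using K.coset_repE[OF that] K.coset_eq_zero_iff by metis
    moreover have "K \<in> carrier (quot_module M K)"
      using K.coset_closed[of "\<zero>\<^bsub>M\<^esub>"] K.coset_eq_zero_iff[of "\<zero>\<^bsub>M\<^esub>"] submoduleD(2)[OF K.sub]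
      by (metis M.zero_closed)
    ultimately have "carrier (quot_module M K) = {\<zero>\<^bsub>quot_module M K\<^esub>}" by auto
    then show False using K unfolding irreducible_module_def by blast
  qed
  then have KJ: "K \<subseteq> J" using max K by blast
  have "(\<lambda>u. K +>\<^bsub>M\<^esub> u) ` J = {K} \<or> (\<lambda>u. K +>\<^bsub>M\<^esub> u) ` J = carrier (quot_module M K)"
    using K K.submodule_image[OF J(1)] unfolding irreducible_module_def by simp
  then show "K = J"
  proof
    assume "(\<lambda>u. K +>\<^bsub>M\<^esub> u) ` J = {K}"
    then have "u \<in> K" if "u \<in> J" for u
      using that K.coset_eq_zero_iff[of u] submoduleD(1)[OF J(1)] by blast
    then have "J \<subseteq> K" by blast
    then show ?thesis using KJ by blast
  next
    assume eq: "(\<lambda>u. K +>\<^bsub>M\<^esub> u) ` J = carrier (quot_module M K)"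
    have "u \<in> J" if u: "u \<in> carrier M" for u
    proof -
      obtain v where v: "v \<in> J" "K +>\<^bsub>M\<^esub> u = K +>\<^bsub>M\<^esub> v" using eq K.coset_closed[OF u] by (metis imageE)
      then have vM: "v \<in> carrier M" using submoduleD(1)[OF J(1)] by blast
      have "u \<ominus>\<^bsub>M\<^esub> v \<in> J" using v KJ K.coset_eq_iff[OF u vM] by blast
      then have "(u \<ominus>\<^bsub>M\<^esub> v) \<oplus>\<^bsub>M\<^esub> v \<in> J" using v submoduleD(3)[OF J(1)] by blast
      moreover have "(u \<ominus>\<^bsub>M\<^esub> v) \<oplus>\<^bsub>M\<^esub> v = u" using u vM by (simp add: a_minus_def M.a_assoc M.l_neg)
      ultimately show ?thesis by simp
    qed
    then show ?thesis using J submoduleD(1)[OF J(1)] by blast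
  qed
qed

text \<open>
  The sum runs over the support of \<open>f\<close>, so that it is a total operation on finitely supported
  coefficient functions on an infinite index set.
\<close>

definition (in left_module) lincomb :: "('i \<Rightarrow> 'a) \<Rightarrow> ('i \<Rightarrow> 'b) \<Rightarrow> 'b" where
  "lincomb f \<phi> = (\<Oplus>\<^bsub>M\<^esub>i\<in>{i. f i \<noteq> \<zero>}. f i \<odot>\<^bsub>M\<^esub> \<phi> i)"

context left_module begin

lemma lincomb_on:
  assumes "\<And>i. f i \<in> carrier R" "finite B" "{i. f i \<noteq> \<zero>} \<subseteq> B" "\<And>i. i \<in> B \<Longrightarrow> \<phi> i \<in> carrier M"
  shows "lincomb f \<phi> = (\<Oplus>\<^bsub>M\<^esub>i\<in>B. f i \<odot>\<^bsub>M\<^esub> \<phi> i)"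
  unfolding lincomb_def
  by (rule M.add.finprod_mono_neutral_cong_left[OF assms(2,3)]) (use assms in auto)

lemma lincomb_closed:
  assumes "\<And>i. f i \<in> carrier R" "\<And>i. f i \<noteq> \<zero> \<Longrightarrow> \<phi> i \<in> carrier M"
  shows "lincomb f \<phi> \<in> carrier M"
  unfolding lincomb_def by (rule M.finsum_closed) (use assms in auto)

lemma lincomb_add:
  assumes fin: "finite {i. f i \<noteq> \<zero>}" "finite {i. g i \<noteq> \<zero>}"
    and R: "\<And>i. f i \<in> carrier R" "\<And>i. g i \<in> carrier R"
    and \<phi>: "\<And>i. f i \<noteq> \<zero> \<Longrightarrow> \<phi> i \<in> carrier M" "\<And>i. g i \<noteq> \<zero> \<Longrightarrow> \<phi> i \<in> carrier M"
  shows "lincomb (\<lambda>i. f i \<oplus> g i) \<phi> = lincomb f \<phi> \<oplus>\<^bsub>M\<^esub> lincomb g \<phi>"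
proof -
  let ?B = "{i. f i \<noteq> \<zero>} \<union> {i. g i \<noteq> \<zero>}"
  have B: "finite ?B" "\<And>i. i \<in> ?B \<Longrightarrow> \<phi> i \<in> carrier M" using fin \<phi> by auto
  have "lincomb (\<lambda>i. f i \<oplus> g i) \<phi> = (\<Oplus>\<^bsub>M\<^esub>i\<in>?B. (f i \<oplus> g i) \<odot>\<^bsub>M\<^esub> \<phi> i)"
    by (rule lincomb_on) (use B R in auto)
  also have "\<dots> = (\<Oplus>\<^bsub>M\<^esub>i\<in>?B. f i \<odot>\<^bsub>M\<^esub> \<phi> i \<oplus>\<^bsub>M\<^esub> g i \<odot>\<^bsub>M\<^esub> \<phi> i)"
    by (rule M.finsum_cong') (use B R in \<open>auto simp: smult_l_distr\<close>)
  also have "\<dots> = (\<Oplus>\<^bsub>M\<^esub>i\<in>?B. f i \<odot>\<^bsub>M\<^esub> \<phi> i) \<oplus>\<^bsub>M\<^esub> (\<Oplus>\<^bsub>M\<^esub>i\<in>?B. g i \<odot>\<^bsub>M\<^esub> \<phi> i)"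
    by (rule M.finsum_addf) (use B R in auto)
  also have "\<dots> = lincomb f \<phi> \<oplus>\<^bsub>M\<^esub> lincomb g \<phi>"
    using lincomb_on[OF R(1) B(1) _ B(2)] lincomb_on[OF R(2) B(1) _ B(2)] by auto
  finally show ?thesis .
qed

lemma lincomb_smult:
  assumes a: "a \<in> carrier R" and fin: "finite {i. f i \<noteq> \<zero>}" and R: "\<And>i. f i \<in> carrier R"
    and \<phi>: "\<And>i. f i \<noteq> \<zero> \<Longrightarrow> \<phi> i \<in> carrier M"
  shows "lincomb (\<lambda>i. a \<otimes> f i) \<phi> = a \<odot>\<^bsub>M\<^esub> lincomb f \<phi>"
proof -
  let ?B = "{i. f i \<noteq> \<zero>}"
  have sm: "a \<odot>\<^bsub>M\<^esub> (\<Oplus>\<^bsub>M\<^esub>i\<in>B. g i) = (\<Oplus>\<^bsub>M\<^esub>i\<in>B. a \<odot>\<^bsub>M\<^esub> g i)"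
    if "finite B" "g \<in> B \<rightarrow> carrier M" for g :: "'z \<Rightarrow> _" and B
    using that
  proof (induction B)
    case (insert b B)
    then show ?case using a
      by (subst M.finsum_insert; (subst M.finsum_insert)?) (auto simp: smult_r_distr Pi_def)
  qed (use a in auto)
  have "lincomb (\<lambda>i. a \<otimes> f i) \<phi> = (\<Oplus>\<^bsub>M\<^esub>i\<in>?B. (a \<otimes> f i) \<odot>\<^bsub>M\<^esub> \<phi> i)"
    by (rule lincomb_on) (use a fin R \<phi> in auto)
  also have "\<dots> = (\<Oplus>\<^bsub>M\<^esub>i\<in>?B. a \<odot>\<^bsub>M\<^esub> (f i \<odot>\<^bsub>M\<^esub> \<phi> i))"
    by (rule M.finsum_cong') (use a R \<phi> in \<open>auto simp: smult_assoc1\<close>)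
  also have "\<dots> = a \<odot>\<^bsub>M\<^esub> lincomb f \<phi>"
    unfolding lincomb_def by (rule sm[symmetric, OF fin]) (use R \<phi> in auto)
  finally show ?thesis .
qed

end

section \<open>Free and induced modules\<close>

lemma (in ring) free_module_left_module: "left_module R (free_module R S)"
proof -
  have fin: "finite {v. f v \<oplus> g v \<noteq> \<zero>}"
    if "finite {v. f v \<noteq> \<zero>}" "finite {v. g v \<noteq> \<zero>}" for f g :: "'c \<Rightarrow> 'a"
    by (rule finite_subset[OF _ finite_UnI[OF that]]) auto
  have cl: "f v \<in> carrier R"
    if "\<forall>v\<in>S. f v \<in> carrier R" "\<forall>v. v \<notin> S \<longrightarrow> f v = \<zero>" for f :: "'c \<Rightarrow> 'a" and v
    using that by (cases "v \<in> S") auto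
  interpret F: abelian_group "free_module R S"
  proof (rule abelian_groupI)
    fix f assume f: "f \<in> carrier (free_module R S)"
    then have "(\<lambda>v. \<ominus> f v) \<in> carrier (free_module R S)"
      "(\<lambda>v. \<ominus> f v) \<oplus>\<^bsub>free_module R S\<^esub> f = \<zero>\<^bsub>free_module R S\<^esub>"
      using cl[of f] by (auto simp: free_module_def l_neg a_inv_def intro: rev_finite_subset)
    then show "\<exists>y\<in>carrier (free_module R S). y \<oplus>\<^bsub>free_module R S\<^esub> f = \<zero>\<^bsub>free_module R S\<^esub>"
      by blast
  qed (auto simp: free_module_def cl fin a_ac)
  show ?thesis
  proof (unfold_locales)
    fix a f assume a: "a \<in> carrier R" and f: "f \<in> carrier (free_module R S)"
    have "finite {v. a \<otimes> f v \<noteq> \<zero>}"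
      by (rule finite_subset[of _ "{v. f v \<noteq> \<zero>}"]) (use a f in \<open>auto simp: free_module_def\<close>)
    then show "a \<odot>\<^bsub>free_module R S\<^esub> f \<in> carrier (free_module R S)"
      using a f by (auto simp: free_module_def)
  qed (auto simp: free_module_def cl l_distr r_distr m_assoc)
qed

lemma (in ring) free_basis_closed: "v \<in> S \<Longrightarrow> free_basis R v \<in> carrier (free_module R S)"
  by (auto simp: free_basis_def free_module_def)

lemma (in ring) submodule_free_module_eq:
  assumes N: "submodule N R (free_module R S)" and basis: "\<And>v. v \<in> S \<Longrightarrow> free_basis R v \<in> N"
  shows "N = carrier (free_module R S)"
proof
  show "N \<subseteq> carrier (free_module R S)" using submoduleD(1)[OF N] .
  have "\<forall>f\<in>carrier (free_module R S). {v. f v \<noteq> \<zero>} = A \<longrightarrow> f \<in> N" if "finite A" for A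
    using that
  proof (induction A)
    case empty
    then show ?case using submoduleD(2)[OF N] by (auto simp: free_module_def fun_eq_iff)
  next
    case (insert a A)
    show ?case
    proof (intro ballI impI)
      fix f assume f: "f \<in> carrier (free_module R S)" and supp: "{v. f v \<noteq> \<zero>} = insert a A"
      then have aS: "a \<in> S" and fa: "f a \<in> carrier R" by (auto simp: free_module_def)
      let ?g = "f(a := \<zero>)"
      have "{v. ?g v \<noteq> \<zero>} = A" using supp insert.hyps by auto
      moreover have "?g \<in> carrier (free_module R S)"
        using f \<open>{v. ?g v \<noteq> \<zero>} = A\<close> insert.hyps aS by (auto simp: free_module_def)
      ultimately have g: "?g \<in> N" using insert.IH by blast
      have "f a \<odot>\<^bsub>free_module R S\<^esub> free_basis R a \<in> N"
        using submoduleD(5)[OF N fa basis[OF aS]] .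
      then have "?g \<oplus>\<^bsub>free_module R S\<^esub> (f a \<odot>\<^bsub>free_module R S\<^esub> free_basis R a) \<in> N"
        using submoduleD(3)[OF N g] by blast
      moreover have "?g \<oplus>\<^bsub>free_module R S\<^esub> (f a \<odot>\<^bsub>free_module R S\<^esub> free_basis R a) = f"
        using f fa by (auto simp: free_module_def free_basis_def fun_eq_iff)
          (metis r_zero zero_closed)+
      ultimately show "f \<in> N" by simp
    qed
  qed
  then show "carrier (free_module R S) \<subseteq> N" by (auto simp: free_module_def)
qed

locale induction_data = R?: ring R for R :: "('r, 'e) ring_scheme" (structure) +
  fixes A :: "('a, 'c) ring_scheme" and h :: "'a \<Rightarrow> 'r" and V :: "('a, 'b, 'd) module_scheme"
  assumes h_closed: "a \<in> carrier A \<Longrightarrow> h a \<in> carrier R"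
    and V_add: "u \<in> carrier V \<Longrightarrow> v \<in> carrier V \<Longrightarrow> u \<oplus>\<^bsub>V\<^esub> v \<in> carrier V"
    and V_smult: "a \<in> carrier A \<Longrightarrow> v \<in> carrier V \<Longrightarrow> a \<odot>\<^bsub>V\<^esub> v \<in> carrier V"
begin

abbreviation "F \<equiv> free_module R (carrier V)"

sublocale F: left_module R F by (rule free_module_left_module)

lemma tensor_relations_submodule: "submodule (tensor_relations A R h V) R F"
  unfolding tensor_relations_def
  by (rule F.submodule_gen)
     (auto intro!: F.minus_closed F.add.m_closed F.smult_closed free_basis_closed h_closed V_add V_smult)

sublocale Q: quotient_by R F "tensor_relations A R h V"
  by (intro quotient_by.intro[OF F.left_module_axioms] quotient_by_axioms.intro tensor_relations_submodule)

abbreviation "I \<equiv> induced_module A R h V"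
abbreviation "unit \<equiv> induced_unit A R h V"

sublocale I: left_module R I
  unfolding induced_module_def by (rule Q.left_module_quot)

lemma unit_closed: "v \<in> carrier V \<Longrightarrow> unit v \<in> carrier I"
  unfolding induced_unit_def induced_module_def by (rule Q.coset_closed) (rule free_basis_closed)

lemma unit_add:
  assumes "u \<in> carrier V" "v \<in> carrier V"
  shows "unit (u \<oplus>\<^bsub>V\<^esub> v) = unit u \<oplus>\<^bsub>I\<^esub> unit v"
proof -
  have "free_basis R (u \<oplus>\<^bsub>V\<^esub> v) \<ominus>\<^bsub>F\<^esub> (free_basis R u \<oplus>\<^bsub>F\<^esub> free_basis R v) \<in> tensor_relations A R h V"
    unfolding tensor_relations_def by (rule subsetD[OF gen_submodule_incl]) (use assms in blast)
  then show ?thesis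
    using assms by (simp add: induced_unit_def induced_module_def free_basis_closed V_add Q.coset_eq_iff)
qed

lemma unit_smult:
  assumes "a \<in> carrier A" "v \<in> carrier V"
  shows "unit (a \<odot>\<^bsub>V\<^esub> v) = h a \<odot>\<^bsub>I\<^esub> unit v"
proof -
  have "free_basis R (a \<odot>\<^bsub>V\<^esub> v) \<ominus>\<^bsub>F\<^esub> (h a \<odot>\<^bsub>F\<^esub> free_basis R v) \<in> tensor_relations A R h V"
    unfolding tensor_relations_def by (rule subsetD[OF gen_submodule_incl]) (use assms in blast)
  then show ?thesis
    using assms by (simp add: induced_unit_def induced_module_def free_basis_closed V_smult h_closed Q.coset_eq_iff)
qed

text \<open>
  The elements \<open>1 \<otimes> v\<close> generate the induced module, because the basis elements \<open>[v]\<close> generate the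
  free module.
\<close>

lemma submodule_induced_eq:
  assumes N: "submodule N R I" and "\<And>v. v \<in> carrier V \<Longrightarrow> unit v \<in> N"
  shows "N = carrier I"
proof
  show "N \<subseteq> carrier I" using submoduleD(1)[OF N] .
  have sub: "submodule {f \<in> carrier F. tensor_relations A R h V +>\<^bsub>F\<^esub> f \<in> N} R F"
    using N unfolding induced_module_def by (rule Q.submodule_preimage)
  have "{f \<in> carrier F. tensor_relations A R h V +>\<^bsub>F\<^esub> f \<in> N} = carrier F"
    by (rule submodule_free_module_eq[OF sub]) (use assms(2) free_basis_closed in \<open>auto simp: induced_unit_def\<close>)
  then show "carrier I \<subseteq> N"
    unfolding induced_module_def by (auto elim!: Q.coset_repE)
qed

end

text \<open>
  The value on \<open>f\<close> of the linear extension is a sum over the support of \<open>f\<close>; it kills the relations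
  of the tensor product, hence descends.
\<close>

lemma (in induction_data) induced_universal:
  assumes "left_module R N"
    and \<phi>: "\<And>v. v \<in> carrier V \<Longrightarrow> \<phi> v \<in> carrier N"
    and \<phi>_add: "\<And>u v. u \<in> carrier V \<Longrightarrow> v \<in> carrier V \<Longrightarrow> \<phi> (u \<oplus>\<^bsub>V\<^esub> v) = \<phi> u \<oplus>\<^bsub>N\<^esub> \<phi> v"
    and \<phi>_smult: "\<And>a v. a \<in> carrier A \<Longrightarrow> v \<in> carrier V \<Longrightarrow> \<phi> (a \<odot>\<^bsub>V\<^esub> v) = h a \<odot>\<^bsub>N\<^esub> \<phi> v"
  obtains \<Phi> where "\<And>x. x \<in> carrier I \<Longrightarrow> \<Phi> x \<in> carrier N"
    and "\<And>x y. x \<in> carrier I \<Longrightarrow> y \<in> carrier I \<Longrightarrow> \<Phi> (x \<oplus>\<^bsub>I\<^esub> y) = \<Phi> x \<oplus>\<^bsub>N\<^esub> \<Phi> y"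
    and "\<And>a x. a \<in> carrier R \<Longrightarrow> x \<in> carrier I \<Longrightarrow> \<Phi> (a \<odot>\<^bsub>I\<^esub> x) = a \<odot>\<^bsub>N\<^esub> \<Phi> x"
    and "\<And>v. v \<in> carrier V \<Longrightarrow> \<Phi> (unit v) = \<phi> v"
proof -
  interpret N: left_module R N by fact
  define L where "L = (\<lambda>f. N.lincomb f \<phi>)"
  have fR: "f v \<in> carrier R" if "f \<in> carrier F" for f v
    using that by (cases "v \<in> carrier V") (auto simp: free_module_def)
  have f\<phi>: "\<phi> v \<in> carrier N" if "f \<in> carrier F" "f v \<noteq> \<zero>\<^bsub>R\<^esub>" for f v
    using that \<phi> by (auto simp: free_module_def)
  have fin: "finite {v. f v \<noteq> \<zero>\<^bsub>R\<^esub>}" if "f \<in> carrier F" for f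
    using that by (auto simp: free_module_def)
  have L_closed: "L f \<in> carrier N" if "f \<in> carrier F" for f
    unfolding L_def by (rule N.lincomb_closed) (use fR[OF that] f\<phi>[OF that] in auto)
  have L_add: "L (f \<oplus>\<^bsub>F\<^esub> g) = L f \<oplus>\<^bsub>N\<^esub> L g" if f: "f \<in> carrier F" and g: "g \<in> carrier F" for f g
  proof -
    have "f \<oplus>\<^bsub>F\<^esub> g = (\<lambda>v. f v \<oplus>\<^bsub>R\<^esub> g v)" by (simp add: free_module_def)
    then show ?thesis
      unfolding L_def using N.lincomb_add[of f g \<phi>, OF fin[OF f] fin[OF g] fR[OF f] fR[OF g]] f\<phi> f g by simp
  qed
  have L_smult: "L (a \<odot>\<^bsub>F\<^esub> f) = a \<odot>\<^bsub>N\<^esub> L f" if a: "a \<in> carrier R" and f: "f \<in> carrier F" for a f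
  proof -
    have "a \<odot>\<^bsub>F\<^esub> f = (\<lambda>v. a \<otimes>\<^bsub>R\<^esub> f v)" by (simp add: free_module_def)
    then show ?thesis
      unfolding L_def using N.lincomb_smult[of a f \<phi>, OF a fin[OF f] fR[OF f]] f\<phi>[OF f] by simp
  qed
  have L_basis: "L (free_basis R v) = \<phi> v" if "v \<in> carrier V" for v
  proof (cases "\<one>\<^bsub>R\<^esub> = \<zero>\<^bsub>R\<^esub>")
    case True
    then have "\<phi> v = \<zero>\<^bsub>N\<^esub>" using N.smult_one[OF \<phi>[OF that]] N.smult_zero_left[OF \<phi>[OF that]] by simp
    then show ?thesis using True by (simp add: L_def N.lincomb_def free_basis_def)
  next
    case False
    then have "{u. free_basis R v u \<noteq> \<zero>\<^bsub>R\<^esub>} = {v}" by (auto simp: free_basis_def)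
    then show ?thesis using \<phi>[OF that] by (simp add: L_def N.lincomb_def free_basis_def)
  qed
  have L_minus: "L (f \<ominus>\<^bsub>F\<^esub> g) = L f \<ominus>\<^bsub>N\<^esub> L g" if "f \<in> carrier F" "g \<in> carrier F" for f g
    using that L_add L_smult[of "\<ominus>\<^bsub>R\<^esub> \<one>\<^bsub>R\<^esub>" g] L_closed[OF that(2)]
    by (simp add: a_minus_def F.smult_minus_one N.smult_minus_one)
  define K where "K = {f \<in> carrier F. L f = \<zero>\<^bsub>N\<^esub>}"
  have L0: "L \<zero>\<^bsub>F\<^esub> = \<zero>\<^bsub>N\<^esub>" by (simp add: L_def N.lincomb_def free_module_def)
  have "submodule K R F"
    by (rule F.submoduleI) (auto simp: K_def L_add L_smult L0)
  then have rel: "tensor_relations A R h V \<subseteq> K"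
    unfolding tensor_relations_def
  proof (rule gen_submodule_least, intro Un_least)
    show "{free_basis R (u \<oplus>\<^bsub>V\<^esub> v) \<ominus>\<^bsub>F\<^esub> (free_basis R u \<oplus>\<^bsub>F\<^esub> free_basis R v) | u v.
            u \<in> carrier V \<and> v \<in> carrier V} \<subseteq> K"
      by (auto simp: K_def L_minus L_add L_basis free_basis_closed V_add \<phi>_add \<phi> N.minus_eq N.r_neg)
    show "{free_basis R (a \<odot>\<^bsub>V\<^esub> v) \<ominus>\<^bsub>F\<^esub> (h a \<odot>\<^bsub>F\<^esub> free_basis R v) | a v.
            a \<in> carrier A \<and> v \<in> carrier V} \<subseteq> K"
      by (auto simp: K_def L_minus L_smult L_basis free_basis_closed V_smult h_closed \<phi>_smult \<phi> N.minus_eq N.r_neg)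
  qed
  define \<Phi> where "\<Phi> = (\<lambda>C. L (SOME f. f \<in> carrier F \<and> C = tensor_relations A R h V +>\<^bsub>F\<^esub> f))"
  have \<Phi>: "\<Phi> (tensor_relations A R h V +>\<^bsub>F\<^esub> f) = L f" if f: "f \<in> carrier F" for f
  proof -
    let ?P = "\<lambda>g. g \<in> carrier F \<and> tensor_relations A R h V +>\<^bsub>F\<^esub> f = tensor_relations A R h V +>\<^bsub>F\<^esub> g"
    have g: "?P (Eps ?P)" by (rule someI[of ?P f]) (use f in simp)
    then have "f \<ominus>\<^bsub>F\<^esub> Eps ?P \<in> K" using Q.coset_eq_iff[OF f] rel by blast
    then have "L f \<ominus>\<^bsub>N\<^esub> L (Eps ?P) = \<zero>\<^bsub>N\<^esub>" using L_minus[OF f] g by (simp add: K_def)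
    then show ?thesis unfolding \<Phi>_def using L_closed[OF f] L_closed[of "Eps ?P"] g
      by (metis (no_types, lifting) N.a_inv_closed N.minus_eq N.minus_equality N.minus_minus)
  qed
  show thesis
  proof
    show "\<Phi> x \<in> carrier N" if "x \<in> carrier I" for x
      using that unfolding induced_module_def by (auto elim!: Q.coset_repE simp: \<Phi> L_closed)
    show "\<Phi> (x \<oplus>\<^bsub>I\<^esub> y) = \<Phi> x \<oplus>\<^bsub>N\<^esub> \<Phi> y" if "x \<in> carrier I" "y \<in> carrier I" for x y
      using that unfolding induced_module_def by (auto elim!: Q.coset_repE simp: \<Phi> L_add)
    show "\<Phi> (a \<odot>\<^bsub>I\<^esub> x) = a \<odot>\<^bsub>N\<^esub> \<Phi> x" if "a \<in> carrier R" "x \<in> carrier I" for a x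
      using that unfolding induced_module_def by (auto elim!: Q.coset_repE simp: \<Phi> L_smult)
    show "\<Phi> (unit v) = \<phi> v" if "v \<in> carrier V" for v
      using that by (simp add: induced_unit_def \<Phi> free_basis_closed L_basis)
  qed
qed

section \<open>Presented algebras\<close>

text \<open>
  Words form a monoid under concatenation, so the convolution product of finitely supported functions
  on words is the product of noncommutative polynomials. This makes the ring \<open>'g ncpoly\<close>, in which
  all calculations with generators are done by simplification; \<open>lookup\<close> turns a polynomial into the
  coefficient function that represents it in \<open>free_algebra\<close>.
\<close>

instantiation list :: (type) monoid_add
begin
definition "0 = ([] :: 'a list)"
definition "u + v = (u @ v :: 'a list)"
instance by standard (simp_all add: zero_list_def plus_list_def)
end

type_synonym 'g ncpoly = "'g list \<Rightarrow>\<^sub>0 complex"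

abbreviation lookup :: "('a \<Rightarrow>\<^sub>0 'b::zero) \<Rightarrow> 'a \<Rightarrow> 'b" where
  "lookup \<equiv> Poly_Mapping.lookup"

definition genp :: "'g \<Rightarrow> 'g ncpoly" where "genp a = Poly_Mapping.single [a] 1"

definition constp :: "complex \<Rightarrow> 'g ncpoly" where "constp a = Poly_Mapping.single [] a"

definition ncpolys :: "'g set \<Rightarrow> 'g ncpoly set" where
  "ncpolys G = {p. Poly_Mapping.keys p \<subseteq> lists G}"

lemma lookup_mult_splits:
  "lookup (p * q) w = (\<Sum>k\<le>length w. lookup p (take k w) * lookup q (drop k w))"
  for p q :: "'g ncpoly"
proof -
  have inner: "Sum_any (\<lambda>v. lookup q v when w = u + v) =
      (if take (length u) w = u then lookup q (drop (length u) w) else 0)" for u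
  proof (cases "take (length u) w = u")
    case True
    then have "(w = u + v) \<longleftrightarrow> (v = drop (length u) w)" for v
      by (metis append_eq_conv_conj plus_list_def)
    then show ?thesis using True by simp
  next
    case False
    then have "w \<noteq> u + v" for v by (auto simp: plus_list_def)
    then show ?thesis using False by simp
  qed
  let ?f = "\<lambda>u. lookup p u * (if take (length u) w = u then lookup q (drop (length u) w) else 0)"
  have sub: "{u. ?f u \<noteq> 0} \<subseteq> (\<lambda>k. take k w) ` {..length w}"
  proof
    fix u assume "u \<in> {u. ?f u \<noteq> 0}"
    then have "take (length u) w = u" by (auto split: if_splits)
    then have "u = (\<lambda>k. take k w) (length u)" "length u \<in> {..length w}"
      by (auto, metis length_take min.cobounded1)
    then show "u \<in> (\<lambda>k. take k w) ` {..length w}" by blast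
  qed
  have "lookup (p * q) w = Sum_any ?f" by (simp add: lookup_mult inner)
  also have "\<dots> = (\<Sum>u\<in>(\<lambda>k. take k w) ` {..length w}. ?f u)"
    by (rule Sum_any.expand_superset) (use sub in auto)
  also have "\<dots> = (\<Sum>k\<le>length w. ?f (take k w))"
    by (rule sum.reindex_cong[of "\<lambda>k. take k w"])
       (auto simp: inj_on_def, metis length_take min.absorb2)
  also have "\<dots> = (\<Sum>k\<le>length w. lookup p (take k w) * lookup q (drop k w))"
    by (rule sum.cong) (auto simp: min_def)
  finally show ?thesis .
qed

lemma free_algebra_carrier: "carrier (free_algebra G) = lookup ` ncpolys G"
proof -
  have "f \<in> lookup ` ncpolys G" if "finite {w. f w \<noteq> 0}" "{w. f w \<noteq> 0} \<subseteq> lists G" for f :: "'a list \<Rightarrow> complex"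
  proof
    show "f = lookup (Abs_poly_mapping f)" using that by simp
    show "Abs_poly_mapping f \<in> ncpolys G" using that by (auto simp: ncpolys_def in_keys_iff)
  qed
  then show ?thesis
    by (auto simp: free_algebra_def ncpolys_def in_keys_iff subset_iff)
qed

lemma free_algebra_ops:
  "\<zero>\<^bsub>free_algebra G\<^esub> = lookup 0" "\<one>\<^bsub>free_algebra G\<^esub> = lookup 1"
  "lookup p \<oplus>\<^bsub>free_algebra G\<^esub> lookup q = lookup (p + q)"
  "lookup p \<otimes>\<^bsub>free_algebra G\<^esub> lookup q = lookup (p * q)"
  by (auto simp: free_algebra_def lookup_add fun_eq_iff lookup_mult_splits lookup_one when_def zero_list_def)

lemma lookup_genp: "lookup (genp a) = gen a"
  by (auto simp: genp_def gen_def lookup_single when_def fun_eq_iff)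

lemma lookup_constp_mult: "lookup (constp a * p) = (\<lambda>w. a * lookup p w)"
proof
  fix w
  have "lookup (constp a * p) w = (\<Sum>k\<le>length w. (if k = 0 then a * lookup p w else 0))"
    unfolding lookup_mult_splits constp_def
    by (rule sum.cong) (auto simp: lookup_single when_def)
  then show "lookup (constp a * p) w = a * lookup p w" by simp
qed

lemma free_algebra_smult: "a \<odot>\<^bsub>free_algebra G\<^esub> lookup p = lookup (constp a * p)"
  by (simp add: lookup_constp_mult free_algebra_def)

lemma ncpolys_0 [simp]: "0 \<in> ncpolys G" and ncpolys_1 [simp]: "1 \<in> ncpolys G"
  and ncpolys_const [simp]: "constp a \<in> ncpolys G"
  by (auto simp: ncpolys_def constp_def zero_list_def split: if_splits)

lemma ncpolys_gen [simp]: "a \<in> G \<Longrightarrow> genp a \<in> ncpolys G"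
  by (auto simp: ncpolys_def genp_def)

lemma ncpolys_add [simp]: "p \<in> ncpolys G \<Longrightarrow> q \<in> ncpolys G \<Longrightarrow> p + q \<in> ncpolys G"
  unfolding ncpolys_def using Poly_Mapping.keys_add[of p q] by blast

lemma ncpolys_uminus [simp]: "p \<in> ncpolys G \<Longrightarrow> - p \<in> ncpolys G"
  by (auto simp: ncpolys_def in_keys_iff subset_iff)

lemma ncpolys_diff [simp]: "p \<in> ncpolys G \<Longrightarrow> q \<in> ncpolys G \<Longrightarrow> p - q \<in> ncpolys G"
  using ncpolys_add[of p G "- q"] by simp

lemma ncpolys_mult [simp]: "p \<in> ncpolys G \<Longrightarrow> q \<in> ncpolys G \<Longrightarrow> p * q \<in> ncpolys G"
  unfolding ncpolys_def using keys_mult[of p q] by (fastforce simp: plus_list_def)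

lemma ncpolys_sum [simp]: "(\<And>i. i \<in> A \<Longrightarrow> f i \<in> ncpolys G) \<Longrightarrow> sum f A \<in> ncpolys G"
  by (induction A rule: infinite_finite_induct) auto

lemma ncpolys_mono: "G \<subseteq> G' \<Longrightarrow> ncpolys G \<subseteq> ncpolys G'"
  unfolding ncpolys_def using lists_mono by blast

lemma constp_simps [simp]: "constp 0 = 0" "constp 1 = 1"
  by (simp_all add: constp_def flip: zero_list_def)

lemma constp_add: "constp (a + b) = constp a + constp b"
  and constp_mult: "constp (a * b) = constp a * constp b"
  and constp_uminus: "constp (- a) = - constp a"
  and constp_diff: "constp (a - b) = constp a - constp b"
  by (simp_all add: constp_def single_add mult_single plus_list_def single_uminus single_diff)

lemma constp_comm: "constp a * p = p * constp a"
proof (rule poly_mapping_eqI)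
  fix w
  have "lookup (p * constp a) w = (\<Sum>k\<le>length w. (if k = length w then a * lookup p w else 0))"
    unfolding lookup_mult_splits constp_def
    by (rule sum.cong) (auto simp: lookup_single when_def)
  then show "lookup (constp a * p) w = lookup (p * constp a) w"
    by (simp add: lookup_constp_mult)
qed

lemma constp_pull:
  "NO_MATCH (constp b) p \<Longrightarrow> p * constp a = constp a * p"
  "NO_MATCH (constp b) p \<Longrightarrow> p * (constp a * q) = constp a * (p * q)"
  by (metis constp_comm) (metis constp_comm mult.assoc)

lemma constp_merge:
  "constp a * constp b = constp (a * b)" "constp a * (constp b * q) = constp (a * b) * q"
  by (simp_all add: constp_mult mult.assoc)

text \<open>
  Rewriting with these equations moves all constants to the left and merges them.
\<close>

lemmas constp_normalize = constp_pull constp_merge mult.assoc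

lemma single_Cons: "Poly_Mapping.single (g # w) a = genp g * Poly_Mapping.single w a"
  by (simp add: genp_def mult_single plus_list_def)

lemma ncpoly_induct [consumes 1, case_names const add gen]:
  assumes "p \<in> ncpolys G"
    and const: "\<And>a. P (constp a)"
    and add: "\<And>p q. p \<in> ncpolys G \<Longrightarrow> q \<in> ncpolys G \<Longrightarrow> P p \<Longrightarrow> P q \<Longrightarrow> P (p + q)"
    and gen: "\<And>g p. g \<in> G \<Longrightarrow> p \<in> ncpolys G \<Longrightarrow> P p \<Longrightarrow> P (genp g * p)"
  shows "P p"
proof -
  have single: "Poly_Mapping.single w a \<in> ncpolys G \<and> P (Poly_Mapping.single w a)" if "w \<in> lists G" for w a
    using that
  proof (induction w)
    case Nil
    then show ?case using const[of a] ncpolys_const[of a G] by (simp add: constp_def)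
  next
    case (Cons g w)
    then show ?case using gen[of g] by (simp add: single_Cons)
  qed
  have "\<forall>p. Poly_Mapping.keys p = A \<longrightarrow> p \<in> ncpolys G \<longrightarrow> P p" if "finite A" for A
    using that
  proof (induction A)
    case empty
    then show ?case using const[of 0] by simp
  next
    case (insert w A)
    show ?case
    proof (intro allI impI)
      fix p assume keys: "Poly_Mapping.keys p = insert w A" and p: "p \<in> ncpolys G"
      let ?s = "Poly_Mapping.single w (lookup p w)"
      have w: "w \<in> lists G" using keys p by (auto simp: ncpolys_def)
      have "Poly_Mapping.keys (p - ?s) = A"
        using keys insert.hyps(2)
        by (auto simp: in_keys_iff lookup_minus lookup_single when_def set_eq_iff split: if_splits)
      moreover have "p - ?s \<in> ncpolys G" using p single[OF w] by simp
      ultimately have "P (p - ?s)" using insert.IH by blast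
      then have "P ((p - ?s) + ?s)" using add[of "p - ?s" ?s] single[OF w] p by simp
      then show "P p" by simp
    qed
  qed
  then show ?thesis using assms(1) finite_keys[of p] by blast
qed

lemma free_algebra_ring: "ring (free_algebra G)"
proof (rule ringI)
  show "abelian_group (free_algebra G)"
  proof (rule abelian_groupI)
    fix x assume "x \<in> carrier (free_algebra G)"
    then obtain p where p: "x = lookup p" "p \<in> ncpolys G" unfolding free_algebra_carrier by blast
    then have "lookup (- p) \<oplus>\<^bsub>free_algebra G\<^esub> x = \<zero>\<^bsub>free_algebra G\<^esub>"
      by (simp add: free_algebra_ops)
    then show "\<exists>y\<in>carrier (free_algebra G). y \<oplus>\<^bsub>free_algebra G\<^esub> x = \<zero>\<^bsub>free_algebra G\<^esub>"
      using p unfolding free_algebra_carrier by (meson imageI ncpolys_uminus)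
  qed (auto simp: free_algebra_carrier free_algebra_ops ac_simps)
  show "Group.monoid (free_algebra G)"
    by (rule monoidI) (auto simp: free_algebra_carrier free_algebra_ops mult.assoc)
qed (auto simp: free_algebra_carrier free_algebra_ops distrib_left distrib_right)

lemma free_algebra_minus:
  assumes "p \<in> ncpolys G" "q \<in> ncpolys G"
  shows "lookup p \<ominus>\<^bsub>free_algebra G\<^esub> lookup q = lookup (p - q)"
proof -
  interpret ring "free_algebra G" by (rule free_algebra_ring)
  have "\<ominus>\<^bsub>free_algebra G\<^esub> lookup q = lookup (- q)"
    by (rule minus_equality) (use assms in \<open>auto simp: free_algebra_ops free_algebra_carrier\<close>)
  then show ?thesis by (simp add: a_minus_def free_algebra_ops)
qed

lemma free_algebra_finsum:
  assumes "finite A" "\<And>i. i \<in> A \<Longrightarrow> f i \<in> ncpolys G"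
  shows "(\<Oplus>\<^bsub>free_algebra G\<^esub>i\<in>A. lookup (f i)) = lookup (sum f A)"
proof -
  interpret ring "free_algebra G" by (rule free_algebra_ring)
  show ?thesis
    using assms
  proof (induction A)
    case (insert a A)
    then have "(\<lambda>i. lookup (f i)) \<in> A \<rightarrow> carrier (free_algebra G)" "lookup (f a) \<in> carrier (free_algebra G)"
      by (auto simp: free_algebra_carrier)
    then show ?case using insert by (simp add: free_algebra_ops)
  qed (simp add: free_algebra_ops)
qed

locale presentation =
  fixes G :: "'g set" and Rel :: "(('g list \<Rightarrow> complex) \<times> ('g list \<Rightarrow> complex)) set"
  assumes Rel: "Rel \<subseteq> carrier (free_algebra G) \<times> carrier (free_algebra G)"
begin

abbreviation "A \<equiv> presented_algebra G Rel"

definition cls :: "'g ncpoly \<Rightarrow> ('g list \<Rightarrow> complex) set" where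
  "cls p = relation_ideal G Rel +>\<^bsub>free_algebra G\<^esub> lookup p"

lemma relators_closed:
  "{a \<ominus>\<^bsub>free_algebra G\<^esub> b | a b. (a, b) \<in> Rel} \<subseteq> carrier (free_algebra G)"
proof -
  interpret ring "free_algebra G" by (rule free_algebra_ring)
  show ?thesis using Rel by auto
qed

lemma ideal: "ideal (relation_ideal G Rel) (free_algebra G)"
  unfolding relation_ideal_def by (rule ring.genideal_ideal[OF free_algebra_ring relators_closed])

interpretation I: ideal "relation_ideal G Rel" "free_algebra G" by (rule ideal)

sublocale A: ring A
  unfolding presented_algebra_def by (rule I.quotient_is_ring)

lemma cls_hom: "ring_hom_ring (free_algebra G) A (\<lambda>f. relation_ideal G Rel +>\<^bsub>free_algebra G\<^esub> f)"
  unfolding presented_algebra_def by (rule I.rcos_ring_hom_ring)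

interpretation cls: ring_hom_ring "free_algebra G" A "\<lambda>f. relation_ideal G Rel +>\<^bsub>free_algebra G\<^esub> f"
  by (rule cls_hom)

lemma cls_closed [simp]: "p \<in> ncpolys G \<Longrightarrow> cls p \<in> carrier A"
  unfolding cls_def by (rule cls.hom_closed) (simp add: free_algebra_carrier)

lemma cls_add: "p \<in> ncpolys G \<Longrightarrow> q \<in> ncpolys G \<Longrightarrow> cls (p + q) = cls p \<oplus>\<^bsub>A\<^esub> cls q"
  unfolding cls_def using cls.hom_add[of "lookup p" "lookup q"] by (simp add: free_algebra_carrier free_algebra_ops)

lemma cls_mult: "p \<in> ncpolys G \<Longrightarrow> q \<in> ncpolys G \<Longrightarrow> cls (p * q) = cls p \<otimes>\<^bsub>A\<^esub> cls q"
  unfolding cls_def using cls.hom_mult[of "lookup p" "lookup q"] by (simp add: free_algebra_carrier free_algebra_ops)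

lemma cls_one: "cls 1 = \<one>\<^bsub>A\<^esub>" and cls_zero: "cls 0 = \<zero>\<^bsub>A\<^esub>"
  unfolding cls_def using cls.hom_one cls.hom_zero by (simp_all add: free_algebra_ops)

lemma cls_surj:
  assumes "C \<in> carrier A" obtains p where "p \<in> ncpolys G" "C = cls p"
  using assms unfolding presented_algebra_def FactRing_def A_RCOSETS_def' cls_def
  by (auto simp: free_algebra_carrier)

text \<open>
  Equality of classes, as a relation on polynomials. In this form relations can be applied inside
  products and sums without conditions on the polynomials that stay unchanged.
\<close>

definition congr :: "'g ncpoly \<Rightarrow> 'g ncpoly \<Rightarrow> bool" (infix "\<doteq>" 50) where
  "p \<doteq> q \<longleftrightarrow> lookup (p - q) \<in> relation_ideal G Rel"

lemma cls_eq_iff: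
  assumes "p \<in> ncpolys G" "q \<in> ncpolys G" shows "cls p = cls q \<longleftrightarrow> p \<doteq> q"
proof -
  have "cls p = cls q \<longleftrightarrow> lookup p \<ominus>\<^bsub>free_algebra G\<^esub> lookup q \<in> relation_ideal G Rel"
    unfolding cls_def
    using I.quotient_eq_iff_same_a_r_cos[OF ideal, of "lookup p" "lookup q"] assms
    by (simp add: free_algebra_carrier)
  then show ?thesis using assms by (simp add: free_algebra_minus congr_def)
qed

lemma congr_rel: "(lookup p, lookup q) \<in> Rel \<Longrightarrow> p \<in> ncpolys G \<Longrightarrow> q \<in> ncpolys G \<Longrightarrow> p \<doteq> q"
  unfolding congr_def relation_ideal_def
  using ring.genideal_self[OF free_algebra_ring relators_closed] free_algebra_minus[of p G q]
  by (smt (verit, best) mem_Collect_eq subsetD)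

lemma congr_refl [simp]: "p \<doteq> p"
  using additive_subgroup.zero_closed[OF I.additive_subgroup_axioms] by (simp add: congr_def free_algebra_ops)

lemma congr_add: "p \<doteq> p' \<Longrightarrow> q \<doteq> q' \<Longrightarrow> p + q \<doteq> p' + q'"
  unfolding congr_def using additive_subgroup.a_closed[OF I.additive_subgroup_axioms, of "lookup (p - p')" "lookup (q - q')"]
  by (simp add: free_algebra_ops algebra_simps)

lemma congr_mult_left:
  assumes "p \<doteq> q" "r \<in> ncpolys G" shows "r * p \<doteq> r * q"
  using I.I_l_closed[of "lookup (p - q)" "lookup r"] assms
  by (simp add: congr_def free_algebra_ops free_algebra_carrier right_diff_distrib)

lemma congr_mult_right:
  assumes "p \<doteq> q" "r \<in> ncpolys G" shows "p * r \<doteq> q * r"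
  using I.I_r_closed[of "lookup (p - q)" "lookup r"] assms
  by (simp add: congr_def free_algebra_ops free_algebra_carrier left_diff_distrib)

lemma congr_uminus: "p \<doteq> q \<Longrightarrow> - p \<doteq> - q"
  using congr_mult_left[of p q "- 1"] by simp

lemma congr_diff: "p \<doteq> p' \<Longrightarrow> q \<doteq> q' \<Longrightarrow> p - q \<doteq> p' - q'"
  using congr_add[OF _ congr_uminus, of p p' q q'] by simp

lemma congr_sym: "p \<doteq> q \<Longrightarrow> q \<doteq> p"
  using congr_uminus[of p q] congr_add[of "- p" "- q" "p + q" "p + q"] by simp

lemma congr_trans [trans]: "p \<doteq> q \<Longrightarrow> q \<doteq> r \<Longrightarrow> p \<doteq> r"
  using congr_add[of p q q r] congr_diff[of "p + q" "q + r" q q] by simp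

lemma congr_eq_trans [trans]: "p \<doteq> q \<Longrightarrow> q = r \<Longrightarrow> p \<doteq> r"
  "p = q \<Longrightarrow> q \<doteq> r \<Longrightarrow> p \<doteq> r" by simp_all

lemma congr_sum: "(\<And>i. i \<in> S \<Longrightarrow> f i \<doteq> g i) \<Longrightarrow> sum f S \<doteq> sum g S"
  by (induction S rule: infinite_finite_induct) (auto intro: congr_add)

end

subsection \<open>Modules over a presented algebra\<close>

locale presented_module = presentation G Rel + M?: left_module "presented_algebra G Rel" M
  for G :: "'g set" and Rel and M :: "(('g list \<Rightarrow> complex) set, 'v, 'd) module_scheme"
begin

definition act :: "'g ncpoly \<Rightarrow> 'v \<Rightarrow> 'v" where
  "act p u = cls p \<odot>\<^bsub>M\<^esub> u"

lemma act_closed [simp]: "p \<in> ncpolys G \<Longrightarrow> u \<in> carrier M \<Longrightarrow> act p u \<in> carrier M"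
  by (simp add: act_def)

lemma act_add: "p \<in> ncpolys G \<Longrightarrow> q \<in> ncpolys G \<Longrightarrow> u \<in> carrier M \<Longrightarrow> act (p + q) u = act p u \<oplus>\<^bsub>M\<^esub> act q u"
  by (simp add: act_def cls_add smult_l_distr)

lemma act_mult: "p \<in> ncpolys G \<Longrightarrow> q \<in> ncpolys G \<Longrightarrow> u \<in> carrier M \<Longrightarrow> act (p * q) u = act p (act q u)"
  by (simp add: act_def cls_mult smult_assoc1)

lemma act_one [simp]: "u \<in> carrier M \<Longrightarrow> act 1 u = u" and act_zero [simp]: "u \<in> carrier M \<Longrightarrow> act 0 u = \<zero>\<^bsub>M\<^esub>"
  by (simp_all add: act_def cls_one cls_zero)

lemma act_vec_add: "p \<in> ncpolys G \<Longrightarrow> u \<in> carrier M \<Longrightarrow> v \<in> carrier M \<Longrightarrow> act p (u \<oplus>\<^bsub>M\<^esub> v) = act p u \<oplus>\<^bsub>M\<^esub> act p v"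
  by (simp add: act_def smult_r_distr)

lemma act_vec_zero [simp]: "p \<in> ncpolys G \<Longrightarrow> act p \<zero>\<^bsub>M\<^esub> = \<zero>\<^bsub>M\<^esub>"
  by (simp add: act_def)

lemma act_congr: "p \<doteq> q \<Longrightarrow> p \<in> ncpolys G \<Longrightarrow> q \<in> ncpolys G \<Longrightarrow> act p u = act q u"
  using cls_eq_iff[of p q] by (simp add: act_def)

lemma submodule_act: "submodule N A M \<Longrightarrow> p \<in> ncpolys G \<Longrightarrow> u \<in> N \<Longrightarrow> act p u \<in> N"
  using submoduleD(5)[of N A M "cls p" u] by (simp add: act_def)

lemma submodule_actI:
  assumes N: "N \<subseteq> carrier M" "\<zero>\<^bsub>M\<^esub> \<in> N"
    and add: "\<And>u v. u \<in> N \<Longrightarrow> v \<in> N \<Longrightarrow> u \<oplus>\<^bsub>M\<^esub> v \<in> N"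
    and const: "\<And>a u. u \<in> N \<Longrightarrow> act (constp a) u \<in> N"
    and gen: "\<And>g u. g \<in> G \<Longrightarrow> u \<in> N \<Longrightarrow> act (genp g) u \<in> N"
  shows "submodule N A M"
proof (rule submoduleI[OF N add])
  fix C u assume "C \<in> carrier A" and u: "u \<in> N"
  then obtain p where p: "p \<in> ncpolys G" "C = cls p" using cls_surj by blast
  have uM: "u \<in> carrier M" using u N by blast
  from p(1) have "act p u \<in> N"
    by (induction rule: ncpoly_induct) (auto simp: act_add act_mult uM intro: const u add gen)
  then show "C \<odot>\<^bsub>M\<^esub> u \<in> N" by (simp add: act_def p(2))
qed

end

lemma complex_ring_simps [simp]:
  "carrier complex_ring = UNIV" "\<one>\<^bsub>complex_ring\<^esub> = 1" "\<zero>\<^bsub>complex_ring\<^esub> = 0"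
  "a \<oplus>\<^bsub>complex_ring\<^esub> b = a + b" "a \<otimes>\<^bsub>complex_ring\<^esub> b = a * b"
  by (simp_all add: ring_of_type_algebra_def)

text \<open>
  A linear operator for each generator makes \<open>V\<close> a module over the free algebra. If the operators satisfy
  the relations, then the ideal acts by \<open>0\<close> and \<open>V\<close> is a module over the presented algebra.
\<close>

locale operator_module = presentation G Rel + V?: left_module complex_ring V
  for G :: "'g set" and Rel and V :: "(complex, 'v, 'd) module_scheme" +
  fixes op :: "'g \<Rightarrow> 'v \<Rightarrow> 'v"
  assumes op_closed: "g \<in> G \<Longrightarrow> v \<in> carrier V \<Longrightarrow> op g v \<in> carrier V"
    and op_add: "g \<in> G \<Longrightarrow> u \<in> carrier V \<Longrightarrow> v \<in> carrier V \<Longrightarrow> op g (u \<oplus>\<^bsub>V\<^esub> v) = op g u \<oplus>\<^bsub>V\<^esub> op g v"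
    and op_smult: "g \<in> G \<Longrightarrow> v \<in> carrier V \<Longrightarrow> op g (a \<odot>\<^bsub>V\<^esub> v) = a \<odot>\<^bsub>V\<^esub> op g v"
begin

definition opact :: "'g ncpoly \<Rightarrow> 'v \<Rightarrow> 'v" where
  "opact p v = free_algebra_act V op (lookup p) v"

lemma opact_lincomb: "opact p v = lincomb (lookup p) (\<lambda>w. foldr op w v)"
  by (simp add: opact_def free_algebra_act_def lincomb_def)

lemma V_simps [simp]:
  "v \<in> carrier V \<Longrightarrow> 0 \<odot>\<^bsub>V\<^esub> v = \<zero>\<^bsub>V\<^esub>" "v \<in> carrier V \<Longrightarrow> 1 \<odot>\<^bsub>V\<^esub> v = v"
  "v \<in> carrier V \<Longrightarrow> a \<odot>\<^bsub>V\<^esub> (b \<odot>\<^bsub>V\<^esub> v) = (a * b) \<odot>\<^bsub>V\<^esub> v"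
  using V.smult_zero_left[of v] V.smult_one[of v] V.smult_assoc1[of a b v] by simp_all

lemma foldr_op_closed: "w \<in> lists G \<Longrightarrow> v \<in> carrier V \<Longrightarrow> foldr op w v \<in> carrier V"
  by (induction w) (auto simp: op_closed)

lemma lookup_words: "p \<in> ncpolys G \<Longrightarrow> lookup p w \<noteq> 0 \<Longrightarrow> w \<in> lists G"
  by (auto simp: ncpolys_def in_keys_iff subset_iff)

lemma opact_closed: "p \<in> ncpolys G \<Longrightarrow> v \<in> carrier V \<Longrightarrow> opact p v \<in> carrier V"
  unfolding opact_lincomb by (rule lincomb_closed) (use lookup_words foldr_op_closed in auto)

lemma opact_add:
  assumes "p \<in> ncpolys G" "q \<in> ncpolys G" "v \<in> carrier V"
  shows "opact (p + q) v = opact p v \<oplus>\<^bsub>V\<^esub> opact q v"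
  using lincomb_add[of "lookup p" "lookup q" "\<lambda>w. foldr op w v"] assms lookup_words
  by (auto simp: opact_lincomb plus_poly_mapping.rep_eq foldr_op_closed)

lemma opact_const [simp]: "v \<in> carrier V \<Longrightarrow> opact (constp a) v = a \<odot>\<^bsub>V\<^esub> v"
proof (cases "a = 0")
  case True
  assume "v \<in> carrier V"
  then show ?thesis using True by (simp add: opact_lincomb lincomb_def)
next
  case False
  assume v: "v \<in> carrier V"
  have "{w. lookup (constp a :: 'g ncpoly) w \<noteq> 0} = {[]}" using False by (auto simp: constp_def lookup_single when_def)
  moreover have "lookup (constp a :: 'g ncpoly) [] = a" by (simp add: constp_def)
  ultimately show ?thesis using v by (simp add: opact_lincomb lincomb_def)
qed

lemma opact_gen_mult:
  assumes g: "g \<in> G" and p: "p \<in> ncpolys G" and v: "v \<in> carrier V"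
  shows "opact (genp g * p) v = op g (opact p v)"
proof -
  have shift: "opact (genp g * Poly_Mapping.single w a) v = op g (opact (Poly_Mapping.single w a) v)"
    if w: "w \<in> lists G" for w a
  proof (cases "a = 0")
    case True
    then show ?thesis using op_smult[OF g, of "\<zero>\<^bsub>V\<^esub>" 0] op_closed[OF g, of "\<zero>\<^bsub>V\<^esub>"] by (simp add: opact_lincomb lincomb_def)
  next
    case False
    have "{u. lookup (Poly_Mapping.single w a) u \<noteq> 0} = {w}" for w :: "'g list"
      using False by (auto simp: lookup_single when_def)
    then show ?thesis
      using foldr_op_closed[OF w v] w g
      by (simp add: opact_lincomb lincomb_def op_smult op_closed flip: single_Cons)
  qed
  have 0: "opact 0 v = \<zero>\<^bsub>V\<^esub>" by (simp add: opact_lincomb lincomb_def)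
  have op0: "op g \<zero>\<^bsub>V\<^esub> = \<zero>\<^bsub>V\<^esub>" using op_smult[OF g, of "\<zero>\<^bsub>V\<^esub>" 0] op_closed[OF g] by simp
  have "\<forall>p. Poly_Mapping.keys p = A \<longrightarrow> p \<in> ncpolys G \<longrightarrow> opact (genp g * p) v = op g (opact p v)"
    if "finite A" for A
    using that
  proof (induction A)
    case empty
    then show ?case by (simp add: 0 op0)
  next
    case (insert w A)
    show ?case
    proof (intro allI impI)
      fix p assume keys: "Poly_Mapping.keys p = insert w A" and p: "p \<in> ncpolys G"
      let ?s = "Poly_Mapping.single w (lookup p w)"
      have w: "w \<in> lists G" using keys p by (auto simp: ncpolys_def)
      have s: "?s \<in> ncpolys G" using w by (auto simp: ncpolys_def)
      have "Poly_Mapping.keys (p - ?s) = A"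
        using keys insert.hyps(2)
        by (auto simp: in_keys_iff lookup_minus lookup_single when_def set_eq_iff split: if_splits)
      moreover have ps: "p - ?s \<in> ncpolys G" using p s by simp
      ultimately have IH: "opact (genp g * (p - ?s)) v = op g (opact (p - ?s) v)" using insert.IH by blast
      have "opact (genp g * (p - ?s) + genp g * ?s) v = op g (opact ((p - ?s) + ?s) v)"
        using ps s g v by (simp only: opact_add ncpolys_mult ncpolys_gen IH shift[OF w] op_add opact_closed)
      then show "opact (genp g * p) v = op g (opact p v)" by (simp add: algebra_simps)
    qed
  qed
  then show ?thesis using p finite_keys[of p] by blast
qed

lemma opact_one: "v \<in> carrier V \<Longrightarrow> opact 1 v = v"
  using opact_const[of v 1] by simp

lemma opact_gen: "g \<in> G \<Longrightarrow> v \<in> carrier V \<Longrightarrow> opact (genp g) v = op g v"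
  using opact_gen_mult[of g 1 v] by (simp add: opact_one)

lemma opact_linear:
  assumes "p \<in> ncpolys G" "u \<in> carrier V" "v \<in> carrier V"
  shows "opact p (u \<oplus>\<^bsub>V\<^esub> v) = opact p u \<oplus>\<^bsub>V\<^esub> opact p v"
    and "opact p (a \<odot>\<^bsub>V\<^esub> v) = a \<odot>\<^bsub>V\<^esub> opact p v"
  using assms
  by (induction rule: ncpoly_induct)
     (auto simp: opact_add opact_gen_mult opact_closed op_add op_smult smult_r_distr V.M.a_ac mult.commute)

lemma opact_mult:
  assumes p: "p \<in> ncpolys G" and q: "q \<in> ncpolys G" and v: "v \<in> carrier V"
  shows "opact (p * q) v = opact p (opact q v)"
  using p
proof (induction rule: ncpoly_induct)
  case (const a)
  show ?case
    using q
  proof (induction rule: ncpoly_induct)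
    case (const b)
    then show ?case using v by (simp flip: constp_mult)
  next
    case (add p q)
    then show ?case using v by (simp add: distrib_left opact_add opact_closed smult_r_distr)
  next
    case (gen g p)
    have "constp a * (genp g * p) = genp g * (constp a * p)"
      by (metis constp_comm mult.assoc)
    then show ?case using gen v by (simp add: opact_gen_mult opact_closed op_smult op_closed)
  qed
next
  case (add p q')
  then show ?case using q v by (simp add: distrib_right opact_add opact_closed)
next
  case (gen g p)
  then show ?case using q v by (simp add: mult.assoc opact_gen_mult opact_closed)
qed

end

locale relation_module = operator_module +
  assumes relations: "p \<in> ncpolys G \<Longrightarrow> q \<in> ncpolys G \<Longrightarrow> (lookup p, lookup q) \<in> Rel \<Longrightarrow> v \<in> carrier V \<Longrightarrow>
    opact p v = opact q v"
begin

interpretation I: ideal "relation_ideal G Rel" "free_algebra G" by (rule ideal)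

lemma opact_uminus: "p \<in> ncpolys G \<Longrightarrow> v \<in> carrier V \<Longrightarrow> opact (- p) v = \<ominus>\<^bsub>V\<^esub> opact p v"
  using opact_add[of p "- p" v] opact_const[of v 0] V.M.minus_equality[of "opact (- p) v" "opact p v"]
  by (simp add: opact_closed V.M.a_comm)

text \<open>
  The polynomials that annihilate \<open>V\<close> form an ideal, and this ideal contains the relators.
\<close>

lemma opact_ideal:
  assumes p: "p \<in> ncpolys G" and I: "lookup p \<in> relation_ideal G Rel" and v: "v \<in> carrier V"
  shows "opact p v = \<zero>\<^bsub>V\<^esub>"
proof -
  let ?K = "lookup ` {p \<in> ncpolys G. \<forall>v\<in>carrier V. opact p v = \<zero>\<^bsub>V\<^esub>}"
  have z: "opact 0 v = \<zero>\<^bsub>V\<^esub>" if "v \<in> carrier V" for v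
    using opact_const[OF that, of 0] that by simp
  have op_z: "opact p \<zero>\<^bsub>V\<^esub> = \<zero>\<^bsub>V\<^esub>" if "p \<in> ncpolys G" for p
    using opact_linear(2)[OF that, of "\<zero>\<^bsub>V\<^esub>" "\<zero>\<^bsub>V\<^esub>" 0] opact_closed[OF that] by simp
  have "ideal ?K (free_algebra G)"
  proof (rule idealI[OF free_algebra_ring])
    show "subgroup ?K (add_monoid (free_algebra G))"
    proof
      fix x assume "x \<in> ?K"
      then obtain p where p: "x = lookup p" "p \<in> ncpolys G" "\<forall>v\<in>carrier V. opact p v = \<zero>\<^bsub>V\<^esub>" by blast
      have "\<ominus>\<^bsub>free_algebra G\<^esub> x = lookup (- p)"
        by (rule I.minus_equality) (use p in \<open>auto simp: free_algebra_ops free_algebra_carrier\<close>)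
      moreover have "lookup (- p) \<in> ?K" using p by (simp add: opact_uminus)
      ultimately show "inv\<^bsub>add_monoid (free_algebra G)\<^esub> x \<in> ?K" by (simp add: a_inv_def)
    qed (auto simp: free_algebra_carrier free_algebra_ops opact_add z)
  qed (auto simp: free_algebra_carrier free_algebra_ops opact_mult opact_closed op_z)
  moreover have "{a \<ominus>\<^bsub>free_algebra G\<^esub> b | a b. (a, b) \<in> Rel} \<subseteq> ?K"
  proof clarify
    fix a b assume ab: "(a, b) \<in> Rel"
    then obtain p q where pq: "a = lookup p" "b = lookup q" "p \<in> ncpolys G" "q \<in> ncpolys G"
      using Rel unfolding free_algebra_carrier by blast
    have "opact (p - q) v = \<zero>\<^bsub>V\<^esub>" if "v \<in> carrier V" for v
      using relations[OF pq(3,4) _ that] ab pq opact_add[of p "- q" v] that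
      by (simp add: opact_uminus opact_closed V.M.r_neg)
    then show "a \<ominus>\<^bsub>free_algebra G\<^esub> b \<in> ?K" using pq by (simp add: free_algebra_minus)
  qed
  ultimately have "relation_ideal G Rel \<subseteq> ?K"
    unfolding relation_ideal_def by (rule I.genideal_minimal)
  then show ?thesis using I v by (auto)
qed

abbreviation "OM \<equiv> module_of_operators V op"

lemma OM_smult:
  assumes p: "p \<in> ncpolys G" and v: "v \<in> carrier V"
  shows "cls p \<odot>\<^bsub>OM\<^esub> v = opact p v"
proof -
  have "free_algebra_act V op f v = opact p v" if f: "f \<in> cls p" for f
  proof -
    obtain i where i: "i \<in> relation_ideal G Rel" "f = i \<oplus>\<^bsub>free_algebra G\<^esub> lookup p"
      using f unfolding cls_def a_r_coset_def' by auto
    have "i \<in> lookup ` ncpolys G"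
      using subsetD[OF I.a_subset i(1)] unfolding free_algebra_carrier .
    then obtain q where q: "i = lookup q" "q \<in> ncpolys G" by auto
    then show ?thesis
      using i p v opact_ideal[of q v] opact_add[of q p v]
      by (simp add: free_algebra_ops opact_closed flip: opact_def)
  qed
  moreover have "lookup p \<in> cls p"
    unfolding cls_def using p I.a_rcos_self by (simp add: free_algebra_carrier)
  ultimately have "(\<lambda>f. free_algebra_act V op f v) ` cls p = {opact p v}" by force
  then show ?thesis by (simp add: module_of_operators_def)
qed

lemma OM_simps: "carrier OM = carrier V" "\<zero>\<^bsub>OM\<^esub> = \<zero>\<^bsub>V\<^esub>" "u \<oplus>\<^bsub>OM\<^esub> v = u \<oplus>\<^bsub>V\<^esub> v"
  by (simp_all add: module_of_operators_def)

sublocale OM: presented_module G Rel OM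
proof -
  interpret O: abelian_group OM
    by (rule abelian_groupI) (auto simp: OM_simps V.M.a_ac intro: V.M.l_neg)
  have "left_module A OM"
    by (unfold_locales)
       (auto elim!: cls_surj simp: OM_simps OM_smult opact_closed opact_add opact_mult opact_linear
         simp flip: cls_add cls_mult cls_one simp: opact_one)
  then show "presented_module G Rel OM"
    by (intro presented_module.intro presentation_axioms)
qed

end

section \<open>Reflections in the hyperoctahedral group\<close>

\<comment> \<open>The number \<open>1\<close> bounds index intervals and should not be rewritten to \<open>Suc 0\<close>.\<close>
declare One_nat_def [simp del]

text \<open>
  The multiplication, unit and inverse of \<open>hyperoctahedral n\<close> as functions that do not mention \<open>n\<close>.
\<close>

definition bmul :: "signed_perm \<Rightarrow> signed_perm \<Rightarrow> signed_perm" where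
  "bmul g h = (\<lambda>k. fst g k * fst h (inv_into UNIV (snd g) k), snd g \<circ> snd h)"

definition bone :: signed_perm where "bone = (\<lambda>k. 1, id)"

definition binv :: "signed_perm \<Rightarrow> signed_perm" where
  "binv g = (\<lambda>k. fst g (snd g k), inv_into UNIV (snd g))"

abbreviation "HO \<equiv> hyperoctahedral"

lemma HO_mult: "g \<otimes>\<^bsub>HO n\<^esub> h = bmul g h" and HO_one: "\<one>\<^bsub>HO n\<^esub> = bone"
  by (auto simp: hyperoctahedral_def bmul_def bone_def split: prod.splits)

lemma HO_carrier: "g \<in> carrier (HO n) \<longleftrightarrow>
    (\<forall>k\<in>{1..n}. fst g k \<in> {1, -1}) \<and> (\<forall>k. k \<notin> {1..n} \<longrightarrow> fst g k = 1) \<and> snd g permutes {1..n}"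
  by (cases g) (auto simp: hyperoctahedral_def)

lemma HO_sign: "g \<in> carrier (HO n) \<Longrightarrow> fst g k = 1 \<or> fst g k = -1"
  by (cases "k \<in> {1..n}") (auto simp: HO_carrier)

lemma HO_sign_square: "g \<in> carrier (HO n) \<Longrightarrow> fst g k * fst g k = 1"
  using HO_sign[of g n k] by auto

lemma HO_permutes: "g \<in> carrier (HO n) \<Longrightarrow> snd g permutes {1..n}"
  by (simp add: HO_carrier)

lemma HO_bij: "g \<in> carrier (HO n) \<Longrightarrow> bij (snd g)"
  using HO_permutes permutes_bij by blast

lemma HO_in [simp]: "g \<in> carrier (HO n) \<Longrightarrow> snd g k \<in> {1..n} \<longleftrightarrow> k \<in> {1..n}"
  using permutes_in_image[OF HO_permutes] by blast

lemma HO_inv_in [simp]: "g \<in> carrier (HO n) \<Longrightarrow> inv_into UNIV (snd g) k \<in> {1..n} \<longleftrightarrow> k \<in> {1..n}"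
  using permutes_in_image[OF permutes_inv[OF HO_permutes]] by blast

lemma HO_inv_simps:
  assumes "g \<in> carrier (HO n)"
  shows "snd g (inv_into UNIV (snd g) k) = k" "inv_into UNIV (snd g) (snd g k) = k"
  using HO_bij[OF assms] by (simp_all add: bij_is_surj surj_f_inv_f bij_is_inj inv_f_f)

lemma bmul_closed [simp]:
  assumes g: "g \<in> carrier (HO n)" and h: "h \<in> carrier (HO n)"
  shows "bmul g h \<in> carrier (HO n)"
  unfolding HO_carrier
proof (intro conjI ballI allI impI)
  fix k
  show "fst (bmul g h) k \<in> {1, -1}"
    using HO_sign[OF g, of k] HO_sign[OF h, of "inv_into UNIV (snd g) k"] by (auto simp: bmul_def)
next
  fix k assume k: "k \<notin> {1..n}"
  then have "inv_into UNIV (snd g) k \<notin> {1..n}" using HO_inv_in[OF g] by blast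
  then show "fst (bmul g h) k = 1"
    using g h k unfolding HO_carrier by (simp add: bmul_def)
next
  show "snd (bmul g h) permutes {1..n}"
    using permutes_compose[OF HO_permutes[OF h] HO_permutes[OF g]] by (simp add: bmul_def)
qed

lemma bone_closed [simp]: "bone \<in> carrier (HO n)"
  by (simp add: HO_carrier bone_def permutes_id)

lemma binv_closed [simp]:
  assumes g: "g \<in> carrier (HO n)" shows "binv g \<in> carrier (HO n)"
  unfolding HO_carrier
proof (intro conjI ballI allI impI)
  fix k
  show "fst (binv g) k \<in> {1, -1}" using HO_sign[OF g] by (auto simp: binv_def)
next
  fix k assume k: "k \<notin> {1..n}"
  then have "snd g k \<notin> {1..n}" using HO_in[OF g] by blast
  then show "fst (binv g) k = 1" using g unfolding HO_carrier by (simp add: binv_def)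
next
  show "snd (binv g) permutes {1..n}"
    using permutes_inv[OF HO_permutes[OF g]] by (simp add: binv_def)
qed

lemma binv_bone: "binv bone = bone"
  by (simp add: binv_def bone_def)

lemma bmul_assoc:
  assumes "g \<in> carrier (HO n)" "h \<in> carrier (HO n)"
  shows "bmul (bmul g h) k = bmul g (bmul h k)"
  using HO_bij[OF assms(1)] HO_bij[OF assms(2)]
  by (auto simp: bmul_def fun_eq_iff o_inv_distrib mult.assoc)

lemma bmul_bone [simp]: "bmul bone g = g" "bmul g bone = g"
  by (simp_all add: bmul_def bone_def prod_eq_iff flip: id_def)

lemma bmul_binv [simp]:
  assumes "g \<in> carrier (HO n)" shows "bmul g (binv g) = bone" "bmul (binv g) g = bone"
  using HO_inv_simps[OF assms] HO_sign_square[OF assms] HO_bij[OF assms]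
  by (auto simp: bmul_def binv_def bone_def fun_eq_iff inv_inv_eq)

lemma bmul_cancel [simp]:
  assumes "g \<in> carrier (HO n)" shows "bmul g (bmul (binv g) h) = h" "bmul (binv g) (bmul g h) = h"
  using assms by (simp_all flip: bmul_assoc[of _ n])

lemma HO_group: "group (HO n)"
proof (rule groupI)
  fix g assume "g \<in> carrier (HO n)"
  then show "\<exists>h\<in>carrier (HO n). h \<otimes>\<^bsub>HO n\<^esub> g = \<one>\<^bsub>HO n\<^esub>"
    by (intro bexI[of _ "binv g"]) (simp_all add: HO_mult HO_one)
qed (auto simp: HO_mult HO_one bmul_assoc)

lemma HO_inv: "g \<in> carrier (HO n) \<Longrightarrow> inv\<^bsub>HO n\<^esub> g = binv g"
  by (rule group.inv_equality[OF HO_group]) (auto simp: HO_mult HO_one)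

lemma binv_bmul: "g \<in> carrier (HO n) \<Longrightarrow> h \<in> carrier (HO n) \<Longrightarrow> binv (bmul g h) = bmul (binv h) (binv g)"
  using group.inv_mult_group[OF HO_group, of g n h] by (simp add: HO_inv HO_mult)

lemma binv_binv [simp]: "g \<in> carrier (HO n) \<Longrightarrow> binv (binv g) = g"
  using group.inv_inv[OF HO_group, of g n] by (simp add: HO_inv)

lemma HO_finite: "finite (carrier (HO n))"
proof -
  let ?S = "(\<lambda>f k. if k \<in> {1..n} then f k else (1::int)) ` ({1..n} \<rightarrow>\<^sub>E {1, -1})"
  have "carrier (HO n) \<subseteq> ?S \<times> {p. p permutes {1..n}}"
  proof
    fix g assume g: "g \<in> carrier (HO n)"
    have "fst g = (\<lambda>k. if k \<in> {1..n} then (restrict (fst g) {1..n}) k else 1)"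
      using g by (auto simp: HO_carrier fun_eq_iff)
    moreover have "restrict (fst g) {1..n} \<in> {1..n} \<rightarrow>\<^sub>E {1, -1}" using g by (auto simp: HO_carrier)
    ultimately have "fst g \<in> ?S" by blast
    then show "g \<in> ?S \<times> {p. p permutes {1..n}}" using g by (simp add: mem_Times_iff HO_carrier)
  qed
  then show ?thesis
    by (rule finite_subset) (auto intro!: finite_PiE finite_permutations)
qed

text \<open>
  The index \<open>(a, b, \<tau>)\<close> stands for the root \<open>x\<^sub>a - \<tau> x\<^sub>b\<close> if \<open>a \<noteq> b\<close> (so every reflection of this kind
  has two indices), and \<open>(a, a, -1)\<close> for the root \<open>2 x\<^sub>a\<close>. With these normalizations, one formula
  covers the three kinds of reflections \<open>s\<^sub>a\<^sub>b\<close>, \<open>\<zeta>\<^sub>a s\<^sub>a\<^sub>b \<zeta>\<^sub>a\<close> and \<open>\<zeta>\<^sub>a\<close>.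
\<close>

type_synonym root = "nat \<times> nat \<times> int"

definition roots :: "nat \<Rightarrow> root set" where
  "roots n = {(a, b, \<tau>). a \<in> {1..n} \<and> b \<in> {1..n} \<and> \<tau> \<in> {1, -1} \<and> (a = b \<longrightarrow> \<tau> = -1)}"

fun refln :: "root \<Rightarrow> signed_perm" where
  "refln (a, b, \<tau>) = (\<lambda>k. if k = a \<or> k = b then \<tau> else 1, Transposition.transpose a b)"

fun rt :: "root \<Rightarrow> nat \<Rightarrow> complex" where
  "rt (a, b, \<tau>) i = (if i = a then 1 else 0) - of_int \<tau> * (if i = b then 1 else 0)"

text \<open>
  The commutator of \<open>y\<^sub>i\<close> and \<open>x\<^sub>j\<close> is \<open>\<delta>\<^sub>i\<^sub>j - \<Sum> w\<^sub>s \<alpha>\<^sub>s(i) \<alpha>\<^sub>s(j) s\<close>, with these weights \<open>w\<^sub>s\<close>. The halves account for the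
  two indices of the reflections with \<open>a \<noteq> b\<close>, and for the factor \<open>2\<close> in the root \<open>2 x\<^sub>a\<close>.
\<close>

fun weight :: "complex \<Rightarrow> complex \<Rightarrow> root \<Rightarrow> complex" where
  "weight c d (a, b, \<tau>) = (if a = b then d / 2 else c / 2)"

text \<open>\<open>2 / |\<alpha>|\<^sup>2\<close> for the root \<open>\<alpha>\<close>\<close>

fun conorm :: "root \<Rightarrow> complex" where
  "conorm (a, b, \<tau>) = (if a = b then 1 / 2 else 1)"

lemma finite_roots [simp]: "finite (roots n)"
  by (rule finite_subset[of _ "{1..n} \<times> {1..n} \<times> {1, -1}"]) (auto simp: roots_def)

lemma perm_swap_refl: "perm_swap i j = refln (i, j, 1)"
  by (auto simp: perm_swap_def)

lemma sign_change_refl: "sign_change i = refln (i, i, -1)"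
  by (auto simp: sign_change_def id_def)

lemma refl_sym: "refln (i, j, \<tau>) = refln (j, i, \<tau>)"
  by (auto simp: transpose_commute)

lemma twisted_swap_refl: "i \<noteq> j \<Longrightarrow> twisted_swap n i j = refln (i, j, -1)"
  by (auto simp: twisted_swap_def HO_mult bmul_def sign_change_def perm_swap_def fun_eq_iff
      Transposition.transpose_def)

lemma refl_closed [simp]: "s \<in> roots n \<Longrightarrow> refln s \<in> carrier (HO n)"
  by (auto simp: roots_def HO_carrier intro!: permutes_swap_id)

lemma refl_square:
  assumes "s \<in> roots n" shows "bmul (refln s) (refln s) = bone" "binv (refln s) = refln s"
proof -
  show 1: "bmul (refln s) (refln s) = bone"
    using assms by (auto simp: roots_def bmul_def bone_def fun_eq_iff Transposition.transpose_def)
  then show "binv (refln s) = refln s"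
    using assms bmul_cancel(2)[OF refl_closed[OF assms], of "refln s"] by simp
qed

text \<open>
  The matrix entries of the reflection in the root \<open>\<alpha>\<close>, from \<open>s(x) = x - 2 \<langle>x, \<alpha>\<rangle> / |\<alpha>|\<^sup>2 \<alpha>\<close>.
\<close>

lemma reflection_formula:
  assumes "s \<in> roots n"
  shows "(if snd (refln s) k = l then of_int (fst (refln s) l) else 0) =
    (if k = l then 1 else 0) - conorm s * rt s k * rt s l"
proof -
  obtain a b \<tau> where s: "s = (a, b, \<tau>)" by (cases s)
  then have \<tau>: "\<tau> = 1 \<or> \<tau> = -1" "a = b \<Longrightarrow> \<tau> = -1" using assms by (auto simp: roots_def)
  consider "k = a" "a = b" | "k = a" "a \<noteq> b" | "k = b" "a \<noteq> b" | "k \<noteq> a" "k \<noteq> b" by blast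
  then show ?thesis
    using \<tau> by cases (auto simp: s)
qed

lemma root_norm:
  assumes "s \<in> roots n" shows "conorm s * (\<Sum>k\<in>{1..n}. rt s k * rt s k) = 2"
proof -
  obtain a b \<tau> where s: "s = (a, b, \<tau>)" by (cases s)
  have "(\<Sum>k\<in>{1..n}. rt s k * rt s k) = (\<Sum>k\<in>{a, b}. rt s k * rt s k)"
    by (rule sum.mono_neutral_right) (use assms in \<open>auto simp: s roots_def\<close>)
  then show ?thesis using assms by (cases "a = b") (auto simp: s roots_def)
qed

lemma root_outside: "s \<in> roots n \<Longrightarrow> i \<notin> {1..n} \<Longrightarrow> rt s i = 0"
  by (auto simp: roots_def)

text \<open>Conjugation permutes the roots up to sign.\<close>

fun conj_root :: "signed_perm \<Rightarrow> root \<Rightarrow> root" where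
  "conj_root g (a, b, \<tau>) = (snd g a, snd g b, \<tau> * fst g (snd g a) * fst g (snd g b))"

lemma conj_root_closed: "g \<in> carrier (HO n) \<Longrightarrow> s \<in> roots n \<Longrightarrow> conj_root g s \<in> roots n"
proof -
  assume g: "g \<in> carrier (HO n)" and s: "s \<in> roots n"
  obtain a b \<tau> where eq: "s = (a, b, \<tau>)" by (cases s)
  have inj: "snd g a = snd g b \<Longrightarrow> a = b" using HO_inv_simps(2)[OF g] by metis
  have "snd g a \<in> {1..n}" "snd g b \<in> {1..n}" using HO_in[OF g] s by (auto simp: roots_def eq)
  then show ?thesis
    using s inj HO_sign[OF g, of "snd g a"] HO_sign[OF g, of "snd g b"] by (auto simp: roots_def eq)
qed

lemma conj_root_conj:
  assumes g: "g \<in> carrier (HO n)" and h: "h \<in> carrier (HO n)"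
  shows "conj_root (bmul g h) s = conj_root g (conj_root h s)"
proof -
  obtain a b \<tau> where eq: "s = (a, b, \<tau>)" by (cases s)
  show ?thesis using HO_inv_simps[OF g] by (simp add: eq bmul_def)
qed

lemma conj_root_bij: 
  assumes g: "g \<in> carrier (HO n)" shows "bij_betw (conj_root g) (roots n) (roots n)"
proof (rule bij_betw_byWitness[where f' = "conj_root (binv g)"])
  have one: "conj_root bone s = s" for s by (cases s) (simp add: bone_def)
  show "\<forall>s\<in>roots n. conj_root (binv g) (conj_root g s) = s" "\<forall>s\<in>roots n. conj_root g (conj_root (binv g) s) = s"
    using g by (simp_all add: one flip: conj_root_conj[of _ n])
qed (use conj_root_closed[OF g] conj_root_closed[OF binv_closed[OF g]] in auto)

lemma conj_refl:
  assumes g: "g \<in> carrier (HO n)" and s: "s \<in> roots n"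
  shows "bmul g (refln s) = bmul (refln (conj_root g s)) g"
proof -
  obtain a b \<tau> where eq: "s = (a, b, \<tau>)" by (cases s)
  have inj: "snd g a = snd g b \<longleftrightarrow> a = b" for a b using HO_inv_simps(2)[OF g] by metis
  have "inv_into UNIV (snd g) k = a \<longleftrightarrow> k = snd g a" for k a using HO_inv_simps[OF g] by metis
  then show ?thesis
    using HO_sign[OF g, of "snd g a"] HO_sign[OF g, of "snd g b"] HO_sign_square[OF g]
    by (auto simp: eq bmul_def fun_eq_iff Transposition.transpose_def inj)
qed

lemma weight_conj: "g \<in> carrier (HO n) \<Longrightarrow> weight c d (conj_root g s) = weight c d s"
  and conorm_conj: "g \<in> carrier (HO n) \<Longrightarrow> conorm (conj_root g s) = conorm s"
proof -
  assume g: "g \<in> carrier (HO n)"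
  have inj: "snd g a = snd g b \<longleftrightarrow> a = b" for a b using HO_inv_simps(2)[OF g] by metis
  show "weight c d (conj_root g s) = weight c d s" "conorm (conj_root g s) = conorm s"
    by (cases s, simp add: inj)+
qed

lemma rt_conj:
  assumes g: "g \<in> carrier (HO n)"
  shows "rt (conj_root g s) (snd g i) * rt (conj_root g s) (snd g j) =
    of_int (fst g (snd g i)) * of_int (fst g (snd g j)) * (rt s i * rt s j)"
proof -
  obtain a b \<tau> where eq: "s = (a, b, \<tau>)" by (cases s)
  have inj: "snd g a = snd g b \<longleftrightarrow> a = b" for a b using HO_inv_simps(2)[OF g] by metis
  have "rt (conj_root g s) (snd g i) = of_int (fst g (snd g a)) * of_int (fst g (snd g i)) * rt s i" for i
    using HO_sign_square[OF g, of "snd g i"]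
    by (auto simp: eq inj simp flip: of_int_mult)
  then show ?thesis
    using HO_sign_square[OF g, of "snd g a"]
    by (simp add: mult_ac flip: of_int_mult)
qed

text \<open>
  The coefficients of the single reflections in the sum over all roots. The summand \<open>F\<close> is arbitrary, so
  the same computation serves for polynomials in the generators and for operators on functions.
\<close>

lemma sum_roots_diff:
  fixes F :: "complex \<Rightarrow> signed_perm \<Rightarrow> 'v::comm_monoid_add"
  assumes add: "\<And>a b g. F (a + b) g = F a g + F b g" and zero: "\<And>g. F 0 g = 0"
    and ij: "i \<in> {1..n}" "j \<in> {1..n}" "i \<noteq> j"
  shows "(\<Sum>s\<in>roots n. F (weight c d s * rt s i * rt s j) (refln s)) =
    F (- c) (refln (i, j, 1)) + F c (refln (i, j, -1))"
proof -
  let ?S = "{(i, j, 1), (j, i, 1), (i, j, -1), (j, i, -1)}"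
  have "(\<Sum>s\<in>roots n. F (weight c d s * rt s i * rt s j) (refln s)) =
      (\<Sum>s\<in>?S. F (weight c d s * rt s i * rt s j) (refln s))"
  proof (rule sum.mono_neutral_right)
    show "?S \<subseteq> roots n" using ij by (auto simp: roots_def)
    show "\<forall>s\<in>roots n - ?S. F (weight c d s * rt s i * rt s j) (refln s) = 0"
    proof
      fix s assume "s \<in> roots n - ?S"
      then have "rt s i * rt s j = 0"
        using ij by (cases s) (auto simp: roots_def split: if_splits)
      then show "F (weight c d s * rt s i * rt s j) (refln s) = 0"
        by (simp only: mult.assoc mult_zero_right zero)
    qed
  qed simp
  also have "\<dots> = (F (- c / 2) (refln (i, j, 1)) + F (- c / 2) (refln (i, j, 1))) +
      (F (c / 2) (refln (i, j, -1)) + F (c / 2) (refln (i, j, -1)))"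
    using ij refl_sym[of j i] by (simp del: refln.simps add: ac_simps)
  also have "\<dots> = F (- c) (refln (i, j, 1)) + F c (refln (i, j, -1))"
    by (simp del: refln.simps flip: add)
  finally show ?thesis .
qed

lemma sum_roots_same:
  fixes F :: "complex \<Rightarrow> signed_perm \<Rightarrow> 'v::comm_monoid_add"
  assumes add: "\<And>a b g. F (a + b) g = F a g + F b g" and zero: "\<And>g. F 0 g = 0"
    and i: "i \<in> {1..n}"
  shows "(\<Sum>s\<in>roots n. F (weight c d s * rt s i * rt s i) (refln s)) =
    (\<Sum>k\<in>{1..n} - {i}. F c (refln (i, k, 1)) + F c (refln (i, k, -1))) + F (2 * d) (refln (i, i, -1))"
proof -
  let ?K = "{1..n} - {i}"
  let ?T = "?K \<times> {1, -1}"
  let ?S1 = "(\<lambda>(k, \<tau>). (i, k, \<tau>)) ` ?T" and ?S2 = "(\<lambda>(k, \<tau>). (k, i, \<tau>)) ` ?T"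
  let ?f = "\<lambda>s. F (weight c d s * rt s i * rt s i) (refln s)"
  have "sum ?f (roots n) = sum ?f (insert (i, i, -1) (?S1 \<union> ?S2))"
  proof (rule sum.mono_neutral_right)
    show "insert (i, i, -1) (?S1 \<union> ?S2) \<subseteq> roots n" using i by (auto simp: roots_def)
    have "rt s i = 0" if "s \<in> roots n - insert (i, i, -1) (?S1 \<union> ?S2)" for s
    proof -
      obtain a b \<tau> where s: "s = (a, b, \<tau>)" by (cases s)
      have "a \<noteq> i" "b \<noteq> i" using that unfolding s roots_def by auto
      then show ?thesis by (simp add: s)
    qed
    then show "\<forall>s\<in>roots n - insert (i, i, -1) (?S1 \<union> ?S2). ?f s = 0" using zero by simp
  qed simp
  also have "\<dots> = ?f (i, i, -1) + (sum ?f ?S1 + sum ?f ?S2)"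
  proof -
    have split: "sum f (insert x (A \<union> B)) = f x + (sum f A + sum f B)"
      if "finite A" "finite B" "A \<inter> B = {}" "x \<notin> A \<union> B" for f :: "root \<Rightarrow> 'v" and x A B
      using that by (simp add: sum.union_disjoint)
    show ?thesis by (rule split) auto
  qed
  also have "sum ?f ?S1 = (\<Sum>(k, \<tau>)\<in>?T. F (c / 2) (refln (i, k, \<tau>)))"
  proof -
    have "?f (i, k, \<tau>) = F (c / 2) (refln (i, k, \<tau>))" if "k \<noteq> i" for k \<tau>
      using that by (simp del: refln.simps)
    then show ?thesis
      by (subst sum.reindex) (auto simp: inj_on_def simp del: refln.simps rt.simps weight.simps intro!: sum.cong)
  qed
  also have "sum ?f ?S2 = (\<Sum>(k, \<tau>)\<in>?T. F (c / 2) (refln (i, k, \<tau>)))"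
  proof -
    have "?f (k, i, \<tau>) = F (c / 2) (refln (i, k, \<tau>))" if "k \<noteq> i" "\<tau> = 1 \<or> \<tau> = -1" for k \<tau>
      using that refl_sym[of k i \<tau>] by (auto simp del: refln.simps)
    then show ?thesis
      by (subst sum.reindex) (auto simp: inj_on_def simp del: refln.simps rt.simps weight.simps intro!: sum.cong)
  qed
  also have "?f (i, i, -1) = F (2 * d) (refln (i, i, -1))" by (simp del: refln.simps add: mult.commute)
  also have "(\<Sum>(k, \<tau>)\<in>?T. F (c / 2) (refln (i, k, \<tau>))) + (\<Sum>(k, \<tau>)\<in>?T. F (c / 2) (refln (i, k, \<tau>))) =
      (\<Sum>k\<in>?K. F c (refln (i, k, 1)) + F c (refln (i, k, -1)))"
  proof -
    have "F (c / 2) g + F (c / 2) g = F c g" for g by (simp flip: add)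
    then have "(F (c / 2) g + F (c / 2) h) + (F (c / 2) g + F (c / 2) h) = F c g + F c h" for g h
      by (metis (no_types) add.assoc add.commute)
    then show ?thesis
      unfolding sum.cartesian_product[symmetric]
      by (simp del: refln.simps flip: sum.distrib)
  qed
  finally show ?thesis by (simp add: add.commute)
qed

section \<open>Identities in the rational Cherednik algebra\<close>

\<comment> \<open>Membership in \<open>{1..n}\<close> stays folded, to match the index conditions of the relations.\<close>
declare atLeastAtMost_iff [simp del]

abbreviation "xp i \<equiv> genp (GenX i)"
abbreviation "yp i \<equiv> genp (GenY i)"
abbreviation "wp g \<equiv> genp (GenW g)"

lemma act_gen_lookup: "act_gen Z w i = lookup (constp (of_int (fst w (snd w i))) * genp (Z (snd w i)))"
  by (simp add: act_gen_def lookup_constp_mult lookup_genp)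

lemma smash_gens_simps [simp]: "GenX i \<notin> smash_gens n" "GenY i \<in> smash_gens n \<longleftrightarrow> i \<in> {1..n}"
  "GenW g \<in> smash_gens n \<longleftrightarrow> g \<in> carrier (HO n)"
  by (auto simp: smash_gens_def)

lemma cherednik_gens_simps [simp]: "GenX i \<in> cherednik_gens n \<longleftrightarrow> i \<in> {1..n}"
  "GenY i \<in> cherednik_gens n \<longleftrightarrow> i \<in> {1..n}" "GenW g \<in> cherednik_gens n \<longleftrightarrow> g \<in> carrier (HO n)"
  by (auto simp: cherednik_gens_def)

lemma smash_gens_subset: "smash_gens n \<subseteq> cherednik_gens n"
  by (auto simp: cherednik_gens_def)

text \<open>The relations, read in the algebra of noncommutative polynomials\<close>

inductive_set smash_poly_rels :: "nat \<Rightarrow> (cgen ncpoly \<times> cgen ncpoly) set" for n where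
  "(wp bone, 1) \<in> smash_poly_rels n"
| "g \<in> carrier (HO n) \<Longrightarrow> h \<in> carrier (HO n) \<Longrightarrow> (wp g * wp h, wp (bmul g h)) \<in> smash_poly_rels n"
| "g \<in> carrier (HO n) \<Longrightarrow> i \<in> {1..n} \<Longrightarrow>
    (wp g * yp i * wp (binv g), constp (of_int (fst g (snd g i))) * yp (snd g i)) \<in> smash_poly_rels n"
| "i \<in> {1..n} \<Longrightarrow> j \<in> {1..n} \<Longrightarrow> (yp i * yp j, yp j * yp i) \<in> smash_poly_rels n"

lemma smash_rels_iff: "(lookup p, lookup q) \<in> smash_rels n \<longleftrightarrow> (p, q) \<in> smash_poly_rels n"
proof
  have "\<exists>p q. a = lookup p \<and> b = lookup q \<and> (p, q) \<in> smash_poly_rels n" if "(a, b) \<in> smash_rels n" for a b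
    using that
  proof cases
    case group_one
    then show ?thesis
      by (metis HO_one free_algebra_ops(2) lookup_genp smash_poly_rels.intros(1))
  next
    case (group_mult v w)
    then have "a = lookup (wp v * wp w)" "b = lookup (wp (bmul v w))"
      by (simp_all add: HO_mult free_algebra_ops flip: lookup_genp)
    then show ?thesis using group_mult smash_poly_rels.intros(2) by blast
  next
    case (conj_y w i)
    then have "a = lookup (wp w * yp i * wp (binv w))"
      by (simp add: HO_inv free_algebra_ops flip: lookup_genp)
    then show ?thesis using conj_y act_gen_lookup smash_poly_rels.intros(3) by blast
  next
    case (comm_y i j)
    then have "a = lookup (yp i * yp j)" "b = lookup (yp j * yp i)"
      by (simp_all add: free_algebra_ops flip: lookup_genp)
    then show ?thesis using comm_y smash_poly_rels.intros(4) by blast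
  qed
  then show "(lookup p, lookup q) \<in> smash_rels n \<Longrightarrow> (p, q) \<in> smash_poly_rels n"
    by (metis lookup_inject)
next
  assume "(p, q) \<in> smash_poly_rels n"
  then show "(lookup p, lookup q) \<in> smash_rels n"
  proof cases
    case 1
    then show ?thesis using smash_rels.group_one[of n] by (simp add: HO_one free_algebra_ops lookup_genp)
  next
    case (2 g h)
    then show ?thesis using smash_rels.group_mult[of g n h]
      by (simp add: HO_mult free_algebra_ops flip: lookup_genp)
  next
    case (3 g i)
    then show ?thesis using smash_rels.conj_y[of g n i]
      by (simp add: HO_inv free_algebra_ops act_gen_lookup flip: lookup_genp)
  next
    case (4 i j)
    then show ?thesis using smash_rels.comm_y[of i n j]
      by (simp add: free_algebra_ops flip: lookup_genp)
  qed
qed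

lemma smash_rels_lookup:
  assumes "(a, b) \<in> smash_rels n" obtains p q where "a = lookup p" "b = lookup q"
proof -
  have "a \<in> range lookup \<and> b \<in> range lookup"
    using assms
    by cases (auto simp: act_gen_lookup free_algebra_ops simp flip: lookup_genp)
  then show thesis using that by blast
qed

lemma smash_poly_rels_closed: "(p, q) \<in> smash_poly_rels n \<Longrightarrow> p \<in> ncpolys (smash_gens n) \<and> q \<in> ncpolys (smash_gens n)"
  by (erule smash_poly_rels.cases) simp_all

lemma smash_presentation: "presentation (smash_gens n) (smash_rels n)"
proof
  show "smash_rels n \<subseteq> carrier (free_algebra (smash_gens n)) \<times> carrier (free_algebra (smash_gens n))"
  proof clarify
    fix a b assume ab: "(a, b) \<in> smash_rels n"
    then obtain p q where pq: "a = lookup p" "b = lookup q" by (rule smash_rels_lookup)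
    then show "a \<in> carrier (free_algebra (smash_gens n)) \<and> b \<in> carrier (free_algebra (smash_gens n))"
      using ab smash_rels_iff smash_poly_rels_closed[of p q n] by (simp add: free_algebra_carrier)
  qed
qed

text \<open>
  The form as a sum over roots treats the two kinds of commutators alike; the relations that define the
  algebra are recovered from it by \<open>bracket_same\<close> and \<open>bracket_diff\<close>.
\<close>

definition bracket :: "nat \<Rightarrow> complex \<Rightarrow> complex \<Rightarrow> nat \<Rightarrow> nat \<Rightarrow> cgen ncpoly" where
  "bracket n c d i j = constp (if i = j then 1 else 0) -
     (\<Sum>s\<in>roots n. constp (weight c d s * rt s i * rt s j) * wp (refln s))"

lemma bracket_same:
  assumes "i \<in> {1..n}"
  shows "bracket n c d i i = 1 - constp c * (\<Sum>k\<in>{1..n} - {i}. wp (perm_swap i k) + wp (twisted_swap n i k))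
    - constp (2 * d) * wp (sign_change i)"
proof -
  have "(\<Sum>k\<in>{1..n} - {i}. constp c * wp (refln (i, k, 1)) + constp c * wp (refln (i, k, - 1))) =
      constp c * (\<Sum>k\<in>{1..n} - {i}. wp (perm_swap i k) + wp (twisted_swap n i k))"
    by (simp add: sum_distrib_left distrib_left perm_swap_refl twisted_swap_refl del: refln.simps)
  then show ?thesis
    using sum_roots_same[of "\<lambda>a g. constp a * wp g" i n c d] assms
    by (simp add: bracket_def constp_add distrib_right sign_change_refl del: refln.simps)
qed

lemma bracket_diff:
  assumes "i \<in> {1..n}" "j \<in> {1..n}" "i \<noteq> j"
  shows "bracket n c d i j = constp c * (wp (perm_swap i j) - wp (twisted_swap n i j))"
  using sum_roots_diff[of "\<lambda>a g. constp a * wp g" i n j c d] assms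
  by (simp add: bracket_def constp_add constp_uminus distrib_right right_diff_distrib
      perm_swap_refl twisted_swap_refl del: refln.simps)

lemma bracket_closed [simp]: "bracket n c d i j \<in> ncpolys (smash_gens n)"
  unfolding bracket_def by simp

lemma bracket_closed' [simp]: "bracket n c d i j \<in> ncpolys (cherednik_gens n)"
  using bracket_closed ncpolys_mono[OF smash_gens_subset] by blast

inductive_set cherednik_poly_rels ::
    "nat \<Rightarrow> complex \<Rightarrow> complex \<Rightarrow> (cgen ncpoly \<times> cgen ncpoly) set" for n c d where
  smash: "(p, q) \<in> smash_poly_rels n \<Longrightarrow> (p, q) \<in> cherednik_poly_rels n c d"
| conj_x: "g \<in> carrier (HO n) \<Longrightarrow> i \<in> {1..n} \<Longrightarrow>
    (wp g * xp i * wp (binv g), constp (of_int (fst g (snd g i))) * xp (snd g i)) \<in> cherednik_poly_rels n c d"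
| comm_x: "i \<in> {1..n} \<Longrightarrow> j \<in> {1..n} \<Longrightarrow> (xp i * xp j, xp j * xp i) \<in> cherednik_poly_rels n c d"
| comm_yx: "i \<in> {1..n} \<Longrightarrow> j \<in> {1..n} \<Longrightarrow>
    (yp i * xp j - xp j * yp i, bracket n c d i j) \<in> cherednik_poly_rels n c d"

lemma commutator_lookup:
  "p \<in> ncpolys (cherednik_gens n) \<Longrightarrow> q \<in> ncpolys (cherednik_gens n) \<Longrightarrow>
   commutator n (lookup p) (lookup q) = lookup (p * q - q * p)"
  by (simp add: commutator_def free_algebra_ops free_algebra_minus)

lemma reflection_gens:
  "i \<in> {1..n} \<Longrightarrow> k \<in> {1..n} \<Longrightarrow> i \<noteq> k \<Longrightarrow> perm_swap i k \<in> carrier (HO n)"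
  "i \<in> {1..n} \<Longrightarrow> k \<in> {1..n} \<Longrightarrow> i \<noteq> k \<Longrightarrow> twisted_swap n i k \<in> carrier (HO n)"
  "i \<in> {1..n} \<Longrightarrow> sign_change i \<in> carrier (HO n)"
  unfolding perm_swap_refl sign_change_refl
  by (simp_all add: twisted_swap_refl roots_def refl_closed del: refln.simps)

lemma same_bracket_lookup:
  assumes i: "i \<in> {1..n}"
  shows "\<one>\<^bsub>cherednik_free n\<^esub>
       \<ominus>\<^bsub>cherednik_free n\<^esub> c \<odot>\<^bsub>cherednik_free n\<^esub>
          (\<Oplus>\<^bsub>cherednik_free n\<^esub>j\<in>{1..n} - {i}.
             gen (GenW (perm_swap i j)) \<oplus>\<^bsub>cherednik_free n\<^esub> gen (GenW (twisted_swap n i j)))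
       \<ominus>\<^bsub>cherednik_free n\<^esub> (2 * d) \<odot>\<^bsub>cherednik_free n\<^esub> gen (GenW (sign_change i)) =
    lookup (bracket n c d i i)"
proof -
  let ?G = "cherednik_gens n"
  have cl: "wp (perm_swap i j) + wp (twisted_swap n i j) \<in> ncpolys ?G" if "j \<in> {1..n} - {i}" for j
    using that i by (intro ncpolys_add ncpolys_gen) (auto intro!: reflection_gens)
  have sum: "(\<Oplus>\<^bsub>free_algebra ?G\<^esub>j\<in>{1..n} - {i}.
             gen (GenW (perm_swap i j)) \<oplus>\<^bsub>free_algebra ?G\<^esub> gen (GenW (twisted_swap n i j))) =
      lookup (\<Sum>j\<in>{1..n} - {i}. wp (perm_swap i j) + wp (twisted_swap n i j))"
    by (subst free_algebra_finsum[symmetric, of _ _ ?G]) (use cl in \<open>auto simp: free_algebra_ops simp flip: lookup_genp\<close>)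
  have s: "wp (sign_change i) \<in> ncpolys ?G" using i by (intro ncpolys_gen) (auto intro!: reflection_gens)
  have S: "(\<Sum>j\<in>{1..n} - {i}. wp (perm_swap i j) + wp (twisted_swap n i j)) \<in> ncpolys ?G"
    using cl by (rule ncpolys_sum)
  show ?thesis
    unfolding sum using S s
    by (simp add: free_algebra_ops free_algebra_smult free_algebra_minus bracket_same[OF i] flip: lookup_genp)
qed

lemma diff_bracket_lookup:
  assumes ij: "i \<in> {1..n}" "j \<in> {1..n}" "i \<noteq> j"
  shows "c \<odot>\<^bsub>cherednik_free n\<^esub>
       (gen (GenW (perm_swap i j)) \<ominus>\<^bsub>cherednik_free n\<^esub> gen (GenW (twisted_swap n i j))) =
    lookup (bracket n c d i j)"
  using reflection_gens(1,2)[OF ij]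
  by (simp add: free_algebra_smult free_algebra_minus bracket_diff[OF ij] flip: lookup_genp)

lemma cherednik_rels_iff: "(lookup p, lookup q) \<in> cherednik_rels n c d \<longleftrightarrow> (p, q) \<in> cherednik_poly_rels n c d"
proof
  have "\<exists>p q. a = lookup p \<and> b = lookup q \<and> (p, q) \<in> cherednik_poly_rels n c d"
    if "(a, b) \<in> cherednik_rels n c d" for a b
    using that
  proof cases
    case smash
    then have "(a, b) \<in> smash_rels n" by simp
    then show ?thesis
      by (metis cherednik_poly_rels.smash smash_rels_iff smash_rels_lookup)
  next
    case (conj_x w i)
    then have "a = lookup (wp w * xp i * wp (binv w))"
      by (simp add: HO_inv free_algebra_ops flip: lookup_genp)
    then show ?thesis using conj_x act_gen_lookup cherednik_poly_rels.conj_x by blast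
  next
    case (comm_x i j)
    then have "a = lookup (xp i * xp j)" "b = lookup (xp j * xp i)"
      by (simp_all add: free_algebra_ops flip: lookup_genp)
    then show ?thesis using comm_x cherednik_poly_rels.comm_x by blast
  next
    case (comm_yx_same i)
    then have "a = lookup (yp i * xp i - xp i * yp i)" "b = lookup (bracket n c d i i)"
      using same_bracket_lookup by (simp_all add: commutator_lookup flip: lookup_genp)
    then show ?thesis using comm_yx_same cherednik_poly_rels.comm_yx by blast
  next
    case (comm_yx_diff i j)
    then have "a = lookup (yp i * xp j - xp j * yp i)" "b = lookup (bracket n c d i j)"
      using diff_bracket_lookup by (simp_all add: commutator_lookup flip: lookup_genp)
    then show ?thesis using comm_yx_diff cherednik_poly_rels.comm_yx by blast
  qed
  then show "(lookup p, lookup q) \<in> cherednik_rels n c d \<Longrightarrow> (p, q) \<in> cherednik_poly_rels n c d"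
    by (metis lookup_inject)
next
  assume "(p, q) \<in> cherednik_poly_rels n c d"
  then show "(lookup p, lookup q) \<in> cherednik_rels n c d"
  proof cases
    case smash
    then have "(lookup p, lookup q) \<in> smash_rels n" using smash_rels_iff by simp
    then show ?thesis by (intro cherednik_rels.smash) simp
  next
    case (conj_x g i)
    then show ?thesis using cherednik_rels.conj_x[of g n i]
      by (simp add: HO_inv free_algebra_ops act_gen_lookup flip: lookup_genp)
  next
    case (comm_x i j)
    then show ?thesis using cherednik_rels.comm_x[of i n j]
      by (simp add: free_algebra_ops flip: lookup_genp)
  next
    case (comm_yx i j)
    have comm: "lookup p = commutator n (gen (GenY i)) (gen (GenX j))"
      using comm_yx by (simp add: commutator_lookup flip: lookup_genp)
    show ?thesis
    proof (cases "i = j")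
      case True
      show ?thesis
        using cherednik_rels.comm_yx_same[OF comm_yx(3), of c d] True comm comm_yx(2)
        unfolding same_bracket_lookup[OF comm_yx(3)] by simp
    next
      case False
      show ?thesis
        using cherednik_rels.comm_yx_diff[OF comm_yx(3,4) False, of c d] comm comm_yx(2)
        unfolding diff_bracket_lookup[OF comm_yx(3,4) False, of c d] by simp
    qed
  qed
qed

lemma cherednik_rels_lookup:
  assumes "(a, b) \<in> cherednik_rels n c d" obtains p q where "a = lookup p" "b = lookup q"
  using assms
proof cases
  case smash
  then have "(a, b) \<in> smash_rels n" by simp
  then show ?thesis using that smash_rels_lookup by blast
next
  case (conj_x w i)
  then have "a = lookup (wp w * xp i * wp (binv w))"
    by (simp add: HO_inv free_algebra_ops flip: lookup_genp)
  then show ?thesis using conj_x act_gen_lookup that by blast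
next
  case (comm_x i j)
  then have "a = lookup (xp i * xp j)" "b = lookup (xp j * xp i)"
    by (simp_all add: free_algebra_ops flip: lookup_genp)
  then show ?thesis using that by blast
next
  case (comm_yx_same i)
  then show ?thesis using same_bracket_lookup[of i n c d] that
    by (simp add: commutator_lookup flip: lookup_genp)
next
  case (comm_yx_diff i j)
  then show ?thesis using diff_bracket_lookup[of i n j c d] that
    by (simp add: commutator_lookup flip: lookup_genp)
qed

lemma cherednik_poly_rels_closed:
  "(p, q) \<in> cherednik_poly_rels n c d \<Longrightarrow> p \<in> ncpolys (cherednik_gens n) \<and> q \<in> ncpolys (cherednik_gens n)"
proof (erule cherednik_poly_rels.cases)
  show "p \<in> ncpolys (cherednik_gens n) \<and> q \<in> ncpolys (cherednik_gens n)"
    if "p = p'" "q = q'" "(p', q') \<in> smash_poly_rels n" for p' q'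
    using that smash_poly_rels_closed[of p q n] ncpolys_mono[OF smash_gens_subset[of n]] by blast
qed simp_all

locale cherednik =
  fixes n :: nat and c d :: complex
begin

abbreviation "CG \<equiv> cherednik_gens n"

sublocale presentation CG "cherednik_rels n c d"
proof
  show "cherednik_rels n c d \<subseteq> carrier (free_algebra CG) \<times> carrier (free_algebra CG)"
  proof clarify
    fix a b assume ab: "(a, b) \<in> cherednik_rels n c d"
    then obtain p q where pq: "a = lookup p" "b = lookup q" by (rule cherednik_rels_lookup)
    then show "a \<in> carrier (free_algebra CG) \<and> b \<in> carrier (free_algebra CG)"
      using ab cherednik_rels_iff cherednik_poly_rels_closed[of p q n c d] by (simp add: free_algebra_carrier)
  qed
qed

notation congr (infix "\<doteq>" 50)

lemma poly_rel: "(p, q) \<in> cherednik_poly_rels n c d \<Longrightarrow> p \<doteq> q"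
  using cherednik_poly_rels_closed cherednik_rels_iff congr_rel by blast

abbreviation "br \<equiv> bracket n c d"

lemma x_comm: "i \<in> {1..n} \<Longrightarrow> j \<in> {1..n} \<Longrightarrow> xp i * xp j \<doteq> xp j * xp i"
  by (rule poly_rel) (rule cherednik_poly_rels.comm_x)

lemma w_mult: "g \<in> carrier (HO n) \<Longrightarrow> h \<in> carrier (HO n) \<Longrightarrow> wp g * wp h \<doteq> wp (bmul g h)"
  by (rule poly_rel) (intro cherednik_poly_rels.smash smash_poly_rels.intros)

lemma w_one: "wp bone \<doteq> 1"
  by (rule poly_rel) (intro cherednik_poly_rels.smash smash_poly_rels.intros)

lemma yx: "i \<in> {1..n} \<Longrightarrow> j \<in> {1..n} \<Longrightarrow> yp i * xp j \<doteq> xp j * yp i + br i j"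
  using congr_add[OF poly_rel[OF cherednik_poly_rels.comm_yx[of i n j c d]] congr_refl[of "xp j * yp i"]]
  by (simp add: add.commute)

text \<open>
  A relation \<open>w p w\<^sup>-\<^sup>1 = q\<close>, in the form that moves group elements to the right.
\<close>

lemma w_conj_imp:
  assumes g: "g \<in> carrier (HO n)" and p: "p \<in> ncpolys CG" and q: "q \<in> ncpolys CG"
    and conj: "wp g * p * wp (binv g) \<doteq> q"
  shows "wp g * p \<doteq> q * wp g"
proof -
  have "wp g * p = wp g * p * 1" by simp
  also have "\<dots> \<doteq> wp g * p * wp bone"
    by (rule congr_mult_left[OF congr_sym[OF w_one]]) (use g p in simp)
  also have "wp bone = wp (bmul (binv g) g)" using g by simp
  also have "wp g * p * wp (bmul (binv g) g) \<doteq> wp g * p * (wp (binv g) * wp g)"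
    by (rule congr_mult_left[OF congr_sym[OF w_mult]]) (use g p in auto)
  also have "\<dots> = (wp g * p * wp (binv g)) * wp g" by (simp add: mult.assoc)
  also have "\<dots> \<doteq> q * wp g" by (rule congr_mult_right[OF conj]) (use g in simp)
  finally show ?thesis .
qed

lemma w_x: "g \<in> carrier (HO n) \<Longrightarrow> i \<in> {1..n} \<Longrightarrow>
    wp g * xp i \<doteq> constp (of_int (fst g (snd g i))) * xp (snd g i) * wp g"
  by (rule w_conj_imp) (simp_all add: poly_rel cherednik_poly_rels.conj_x)

definition root_form :: "root \<Rightarrow> cgen ncpoly" where
  "root_form s = (\<Sum>l\<in>{1..n}. constp (rt s l) * xp l)"

lemma refl_x:
  assumes s: "s \<in> roots n" and k: "k \<in> {1..n}"
  shows "wp (refln s) * xp k \<doteq> (xp k - constp (conorm s * rt s k) * root_form s) * wp (refln s)"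
proof -
  let ?g = "refln s"
  have g: "?g \<in> carrier (HO n)" using s by simp
  have "constp (of_int (fst ?g (snd ?g k))) * xp (snd ?g k) =
      (\<Sum>l\<in>{1..n}. constp (if snd ?g k = l then of_int (fst ?g l) else 0) * xp l)"
    using HO_in[OF g, of k] k by (subst sum.remove[of _ "snd ?g k"]) (auto intro!: sum.neutral)
  also have "\<dots> = (\<Sum>l\<in>{1..n}. (if k = l then xp l else 0) - constp (conorm s * rt s k) * (constp (rt s l) * xp l))"
    unfolding reflection_formula[OF s]
    by (rule sum.cong) (auto simp: constp_diff constp_mult left_diff_distrib mult.assoc)
  also have "\<dots> = xp k - constp (conorm s * rt s k) * root_form s"
    using k by (simp add: sum_subtractf root_form_def sum_distrib_left)
  finally show ?thesis using w_x[OF g k] by simp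
qed

text \<open>
  A reflection negates its root: the coefficient \<open>1 - 2\<close> comes from \<open>root_norm\<close>.
\<close>

lemma refl_root_form:
  assumes s: "s \<in> roots n"
  shows "wp (refln s) * root_form s \<doteq> - (root_form s * wp (refln s))"
proof -
  have "wp (refln s) * root_form s = (\<Sum>k\<in>{1..n}. constp (rt s k) * (wp (refln s) * xp k))"
    unfolding root_form_def sum_distrib_left
    by (rule sum.cong) (simp_all add: constp_normalize)
  also have "\<dots> \<doteq> (\<Sum>k\<in>{1..n}. constp (rt s k) * ((xp k - constp (conorm s * rt s k) * root_form s) * wp (refln s)))"
    by (rule congr_sum, rule congr_mult_left[OF refl_x[OF s]]) auto
  also have "\<dots> = root_form s * wp (refln s) -
      constp (conorm s * (\<Sum>k\<in>{1..n}. rt s k * rt s k)) * (root_form s * wp (refln s))"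
  proof -
    have constp_sum: "constp (sum f A) = (\<Sum>k\<in>A. constp (f k))" for f :: "nat \<Rightarrow> complex" and A
      by (induction A rule: infinite_finite_induct) (auto simp: constp_add)
    have "constp (rt s k) * ((xp k - constp (conorm s * rt s k) * root_form s) * wp (refln s)) =
        constp (rt s k) * xp k * wp (refln s) -
        constp (conorm s * (rt s k * rt s k)) * (root_form s * wp (refln s))" for k
      by (simp add: left_diff_distrib right_diff_distrib constp_normalize mult.left_commute[where 'a=complex])
    then show ?thesis
      by (simp add: sum_subtractf sum_distrib_left constp_sum sum_distrib_right)
         (simp add: root_form_def sum_distrib_right)
  qed
  also have "\<dots> = - (root_form s * wp (refln s))"
  proof -
    have "(constp 2 :: cgen ncpoly) = 2" using constp_add[of 1 1] by simp
    then show ?thesis unfolding root_norm[OF s] by (simp add: mult_2)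
  qed
  finally show ?thesis .
qed

text \<open>
  The Euler element. Its commutator with \<open>x\<^sub>j\<close> is \<open>x\<^sub>j\<close>, because the group part \<open>group_euler\<close> contributes
  the negative of what the reflections in \<open>[y\<^sub>i, x\<^sub>j]\<close> contribute. So it grades standard modules by the
  polynomial degree.
\<close>

definition group_euler :: "cgen ncpoly" where
  "group_euler = (\<Sum>s\<in>roots n. constp (weight c d s / conorm s) * wp (refln s))"

definition euler :: "cgen ncpoly" where
  "euler = (\<Sum>i\<in>{1..n}. xp i * yp i) - group_euler"

lemma group_euler_closed [simp]: "group_euler \<in> ncpolys CG"
  and euler_closed [simp]: "euler \<in> ncpolys CG"
  unfolding euler_def group_euler_def by (auto intro!: ncpolys_sum ncpolys_diff)

lemma conorm_nz [simp]: "conorm s \<noteq> 0" by (cases s) simp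

lemma euler_x:
  assumes j: "j \<in> {1..n}" shows "euler * xp j \<doteq> xp j * (euler + 1)"
proof -
  have 1: "(\<Sum>i\<in>{1..n}. xp i * yp i) * xp j \<doteq>
      xp j * (\<Sum>i\<in>{1..n}. xp i * yp i) + (\<Sum>i\<in>{1..n}. xp i * br i j)"
  proof -
    have "xp i * yp i * xp j \<doteq> xp j * (xp i * yp i) + xp i * br i j" if i: "i \<in> {1..n}" for i
    proof -
      have "xp i * yp i * xp j = xp i * (yp i * xp j)" by (simp add: mult.assoc)
      also have "\<dots> \<doteq> xp i * (xp j * yp i + br i j)"
        by (rule congr_mult_left[OF yx[OF i j]]) (use i in simp)
      also have "\<dots> = xp i * xp j * yp i + xp i * br i j" by (simp add: algebra_simps)
      also have "\<dots> \<doteq> xp j * xp i * yp i + xp i * br i j"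
        by (rule congr_add[OF congr_mult_right[OF x_comm[OF i j]] congr_refl]) (use i in simp)
      finally show ?thesis by (simp add: mult.assoc)
    qed
    then show ?thesis unfolding sum_distrib_right sum_distrib_left sum.distrib[symmetric] by (rule congr_sum)
  qed
  have 2: "(\<Sum>i\<in>{1..n}. xp i * br i j) =
      xp j - (\<Sum>s\<in>roots n. constp (weight c d s * rt s j) * (root_form s * wp (refln s)))"
  proof -
    have "xp i * br i j = (if i = j then xp j else 0) -
        (\<Sum>s\<in>roots n. constp (weight c d s * rt s j) * (constp (rt s i) * xp i * wp (refln s)))" for i
    proof -
      have "xp i * (constp (weight c d s * rt s i * rt s j) * wp (refln s)) =
          constp (weight c d s * rt s j) * (constp (rt s i) * xp i * wp (refln s))" for s
        by (simp add: constp_normalize mult_ac[where 'a=complex])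
      then show ?thesis by (simp add: bracket_def right_diff_distrib sum_distrib_left)
    qed
    then have "(\<Sum>i\<in>{1..n}. xp i * br i j) = xp j -
        (\<Sum>i\<in>{1..n}. \<Sum>s\<in>roots n. constp (weight c d s * rt s j) * (constp (rt s i) * xp i * wp (refln s)))"
      using j by (simp add: sum_subtractf)
    also have "\<dots> = xp j - (\<Sum>s\<in>roots n. constp (weight c d s * rt s j) * (root_form s * wp (refln s)))"
      by (subst sum.swap) (simp add: root_form_def sum_distrib_left sum_distrib_right)
    finally show ?thesis .
  qed
  have 3: "group_euler * xp j \<doteq> xp j * group_euler -
      (\<Sum>s\<in>roots n. constp (weight c d s * rt s j) * (root_form s * wp (refln s)))"
  proof -
    have "constp (weight c d s / conorm s) * wp (refln s) * xp j \<doteq>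
        xp j * (constp (weight c d s / conorm s) * wp (refln s)) -
        constp (weight c d s * rt s j) * (root_form s * wp (refln s))" if s: "s \<in> roots n" for s
    proof -
      have "constp (weight c d s / conorm s) * wp (refln s) * xp j =
          constp (weight c d s / conorm s) * (wp (refln s) * xp j)" by (simp add: mult.assoc)
      also have "\<dots> \<doteq> constp (weight c d s / conorm s) *
          ((xp j - constp (conorm s * rt s j) * root_form s) * wp (refln s))"
        by (rule congr_mult_left[OF refl_x[OF s j]]) simp
      also have "\<dots> = xp j * (constp (weight c d s / conorm s) * wp (refln s)) -
        constp (weight c d s * rt s j) * (root_form s * wp (refln s))"
        by (simp add: left_diff_distrib right_diff_distrib constp_normalize)
      finally show ?thesis .
    qed
    then show ?thesis
      unfolding group_euler_def sum_distrib_right sum_distrib_left sum_subtractf[symmetric] by (rule congr_sum)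
  qed
  show ?thesis
    using congr_diff[OF 1 3] unfolding 2 by (simp add: euler_def algebra_simps)
qed

text \<open>
  The operators \<open>\<Sum> x\<^sub>i\<^sup>2\<close> and \<open>\<Sum> y\<^sub>i\<^sup>2\<close> span, with their commutator, a copy of \<open>sl\<^sub>2\<close>. The terms that
  come from reflections cancel because every reflection negates its root.
\<close>

definition xsq :: "cgen ncpoly" where "xsq = (\<Sum>i\<in>{1..n}. xp i * xp i)"
definition ysq :: "cgen ncpoly" where "ysq = (\<Sum>i\<in>{1..n}. yp i * yp i)"

lemma xsq_closed [simp]: "xsq \<in> ncpolys CG" and ysq_closed [simp]: "ysq \<in> ncpolys CG"
  unfolding xsq_def ysq_def by (auto intro!: ncpolys_sum)

lemma y_xsq:
  assumes j: "j \<in> {1..n}" shows "yp j * xsq \<doteq> xsq * yp j + (xp j + xp j)"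
proof -
  have "yp j * (xp i * xp i) \<doteq> xp i * xp i * yp j + (xp i * br j i + br j i * xp i)" if i: "i \<in> {1..n}" for i
  proof -
    have "yp j * (xp i * xp i) = yp j * xp i * xp i" by (simp add: mult.assoc)
    also have "\<dots> \<doteq> (xp i * yp j + br j i) * xp i" by (rule congr_mult_right[OF yx[OF j i]]) (use i in simp)
    also have "\<dots> = xp i * (yp j * xp i) + br j i * xp i" by (simp add: algebra_simps)
    also have "\<dots> \<doteq> xp i * (xp i * yp j + br j i) + br j i * xp i"
      by (rule congr_add[OF congr_mult_left[OF yx[OF j i]] congr_refl]) (use i in simp)
    finally show ?thesis by (simp add: algebra_simps)
  qed
  then have "yp j * xsq \<doteq> (\<Sum>i\<in>{1..n}. xp i * xp i * yp j + (xp i * br j i + br j i * xp i))"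
    unfolding xsq_def sum_distrib_left by (rule congr_sum)
  also have "\<dots> = xsq * yp j + (\<Sum>i\<in>{1..n}. xp i * br j i + br j i * xp i)"
    by (simp add: xsq_def sum.distrib sum_distrib_right)
  \<comment> \<open>Collecting the terms of each reflection \<open>s\<close> gives \<open>\<alpha>\<^sub>s s + s \<alpha>\<^sub>s\<close>, where \<open>\<alpha>\<^sub>s\<close> is \<open>root_form s\<close>.\<close>
  also have "(\<Sum>i\<in>{1..n}. xp i * br j i + br j i * xp i) = xp j + xp j -
      (\<Sum>s\<in>roots n. constp (weight c d s * rt s j) * (root_form s * wp (refln s) + wp (refln s) * root_form s))"
  proof -
    have "xp i * br j i + br j i * xp i = (if i = j then xp j + xp j else 0) -
        (\<Sum>s\<in>roots n. constp (weight c d s * rt s j) *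
          (constp (rt s i) * xp i * wp (refln s) + wp (refln s) * (constp (rt s i) * xp i)))" for i
    proof -
      have "xp i * (constp (weight c d s * rt s j * rt s i) * wp (refln s)) +
          constp (weight c d s * rt s j * rt s i) * wp (refln s) * xp i =
          constp (weight c d s * rt s j) *
          (constp (rt s i) * xp i * wp (refln s) + wp (refln s) * (constp (rt s i) * xp i))" for s
        by (simp add: distrib_left constp_normalize)
      then have "(\<Sum>s\<in>roots n. xp i * (constp (weight c d s * rt s j * rt s i) * wp (refln s))) +
          (\<Sum>s\<in>roots n. constp (weight c d s * rt s j * rt s i) * wp (refln s) * xp i) =
          (\<Sum>s\<in>roots n. constp (weight c d s * rt s j) *
          (constp (rt s i) * xp i * wp (refln s) + wp (refln s) * (constp (rt s i) * xp i)))" (is "?S1 + ?S2 = ?S3")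
        by (simp only: sum.distrib[symmetric])
      moreover have "xp i * br j i = (if i = j then xp j else 0) - ?S1"
        by (simp add: bracket_def right_diff_distrib sum_distrib_left)
      moreover have "br j i * xp i = (if i = j then xp j else 0) - ?S2"
        by (simp add: bracket_def left_diff_distrib sum_distrib_right)
      ultimately have "xp i * br j i + br j i * xp i =
          ((if i = j then xp j else 0) + (if i = j then xp j else 0)) - ?S3"
        by (simp only: add_diff_add[symmetric])
      then show ?thesis by simp
    qed
    then have "(\<Sum>i\<in>{1..n}. xp i * br j i + br j i * xp i) = xp j + xp j -
        (\<Sum>i\<in>{1..n}. \<Sum>s\<in>roots n. constp (weight c d s * rt s j) *
          (constp (rt s i) * xp i * wp (refln s) + wp (refln s) * (constp (rt s i) * xp i)))"
      using j by (simp add: sum_subtractf)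
    also have "\<dots> = xp j + xp j -
      (\<Sum>s\<in>roots n. constp (weight c d s * rt s j) * (root_form s * wp (refln s) + wp (refln s) * root_form s))"
      by (subst sum.swap) (simp add: root_form_def sum_distrib_left sum_distrib_right distrib_left sum.distrib)
    finally show ?thesis .
  qed
  also have "xsq * yp j + \<dots> \<doteq> xsq * yp j + (xp j + xp j - (\<Sum>s\<in>roots n. 0))"
  proof (intro congr_add congr_diff congr_sum congr_refl)
    fix s assume s: "s \<in> roots n"
    have "root_form s * wp (refln s) + wp (refln s) * root_form s \<doteq>
        root_form s * wp (refln s) + - (root_form s * wp (refln s))"
      by (rule congr_add[OF congr_refl refl_root_form[OF s]])
    then show "constp (weight c d s * rt s j) * (root_form s * wp (refln s) + wp (refln s) * root_form s) \<doteq> 0"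
      using congr_mult_left[of _ 0 "constp (weight c d s * rt s j)"] by simp
  qed
  finally show ?thesis by simp
qed

lemma ysq_xsq:
  "ysq * xsq \<doteq> xsq * ysq + (\<Sum>j\<in>{1..n}. (xp j * yp j + xp j * yp j) + (yp j * xp j + yp j * xp j))"
proof -
  have "yp j * yp j * xsq \<doteq> xsq * (yp j * yp j) + ((xp j * yp j + xp j * yp j) + (yp j * xp j + yp j * xp j))"
    if j: "j \<in> {1..n}" for j
  proof -
    have "yp j * yp j * xsq = yp j * (yp j * xsq)" by (simp add: mult.assoc)
    also have "\<dots> \<doteq> yp j * (xsq * yp j + (xp j + xp j))"
      by (rule congr_mult_left[OF y_xsq[OF j]]) (use j in simp)
    also have "\<dots> = yp j * xsq * yp j + (yp j * xp j + yp j * xp j)" by (simp add: algebra_simps)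
    also have "\<dots> \<doteq> (xsq * yp j + (xp j + xp j)) * yp j + (yp j * xp j + yp j * xp j)"
      by (rule congr_add[OF congr_mult_right[OF y_xsq[OF j]] congr_refl]) (use j in simp)
    finally show ?thesis by (simp add: algebra_simps)
  qed
  then show ?thesis
    unfolding ysq_def sum_distrib_right sum_distrib_left sum.distrib[symmetric] by (rule congr_sum)
qed

end

section \<open>The coinduced module\<close>

text \<open>
  The dual construction to the standard module: the space of functions on words in the \<open>y\<^sub>i\<close>, to be
  thought of as \<open>w \<mapsto> (degree \<open>0\<close> part of \<open>y\<^sub>w u\<close>)\<close>, where a vector in degree \<open>0\<close> is a function of a group
  element \<open>h\<close> and a further argument \<open>t\<close> on which nothing acts. Since the \<open>y\<^sub>i\<close> commute, only the functions
  that are invariant under swaps of adjacent letters are relevant. The module is far larger than \<open>\<Delta>\<close>, but it has a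
  simple description and receives a map from \<open>\<Delta>\<close>.
\<close>

type_synonym 'a coind_vec = "nat list \<Rightarrow> signed_perm \<times> 'a \<Rightarrow> complex"

fun wact :: "signed_perm \<Rightarrow> 'a coind_vec \<Rightarrow> 'a coind_vec" where
  "wact g \<Phi> w (h, t) = of_int (prod_list (map (fst g) w)) *
     \<Phi> (map (inv_into UNIV (snd g)) w) (bmul (binv g) h, t)"

definition yop :: "nat \<Rightarrow> 'a coind_vec \<Rightarrow> 'a coind_vec" where
  "yop i \<Phi> = (\<lambda>w. \<Phi> (i # w))"

definition swap_invariant :: "'a coind_vec set" where
  "swap_invariant = {\<Phi>. \<forall>u i k w. \<Phi> (u @ i # k # w) = \<Phi> (u @ k # i # w)}"

lemma wact_bmul:
  assumes g: "g \<in> carrier (HO n)" and h: "h \<in> carrier (HO n)"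
  shows "wact g (wact h \<Phi>) = wact (bmul g h) (\<Phi> :: 'a coind_vec)"
proof (intro ext)
  fix w :: "nat list" and p :: "signed_perm \<times> 'a"
  obtain u t where p: "p = (u, t)" by (cases p)
  have "prod_list (map (fst g) w) * prod_list (map (fst h \<circ> inv_into UNIV (snd g)) w) =
      prod_list (map (fst (bmul g h)) w)"
    by (induction w) (simp_all add: bmul_def mult_ac)
  moreover have "inv_into UNIV (snd (bmul g h)) = inv_into UNIV (snd h) \<circ> inv_into UNIV (snd g)"
    by (simp add: bmul_def o_inv_distrib[OF HO_bij[OF g] HO_bij[OF h]])
  moreover have "bmul (binv h) (bmul (binv g) u) = bmul (binv (bmul g h)) u"
    using g h by (simp add: binv_bmul[OF g h] bmul_assoc[of _ n])
  ultimately show "wact g (wact h \<Phi>) w p = wact (bmul g h) \<Phi> w p"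
    by (simp add: p mult.assoc[symmetric] flip: of_int_mult)
qed

lemma wact_bone: "wact bone (\<Phi> :: 'a coind_vec) = \<Phi>"
proof (intro ext)
  fix w :: "nat list" and p :: "signed_perm \<times> 'a"
  have 1: "prod_list (map (fst bone) w) = 1" by (induction w) (auto simp: bone_def)
  have 3: "map (inv_into UNIV (snd bone)) w = w" by (simp add: bone_def)
  show "wact bone \<Phi> w p = \<Phi> w p" by (cases p) (simp only: wact.simps 1 binv_bone 3, simp)
qed

lemma yop_wact: "yop i (wact g \<Phi>) w p = of_int (fst g i) * wact g (yop (inv_into UNIV (snd g) i) \<Phi>) w p"
  by (cases p) (simp add: yop_def)

lemma wact_linear:
  "wact g (\<lambda>w p. \<Phi> w p + \<Psi> w p) w p = wact g \<Phi> w p + wact g \<Psi> w p"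
  "wact g (\<lambda>w p. a * \<Phi> w p) w p = a * wact g \<Phi> w p"
  by (cases p; simp add: algebra_simps)+

lemma wact_sum: "wact g (\<lambda>w p. \<Sum>s\<in>S. a s * F s w p) w p = (\<Sum>s\<in>S. a s * wact g (F s) w p)"
  by (cases p) (simp add: sum_distrib_left mult_ac)

lemma swap_invariantD: "\<Phi> \<in> swap_invariant \<Longrightarrow> \<Phi> (u @ i # k # w) = \<Phi> (u @ k # i # w)"
  by (simp add: swap_invariant_def)

lemma swap_invariant_yop: "\<Phi> \<in> swap_invariant \<Longrightarrow> yop i \<Phi> \<in> swap_invariant"
  using swap_invariantD[of \<Phi> "i # u" for u] by (simp add: swap_invariant_def yop_def)

lemma swap_invariant_wact: "\<Phi> \<in> swap_invariant \<Longrightarrow> wact g \<Phi> \<in> swap_invariant"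
  unfolding swap_invariant_def
proof clarify
  fix u w :: "nat list" and i k
  assume "\<forall>u i k w. \<Phi> (u @ i # k # w) = \<Phi> (u @ k # i # w)"
  then have "\<Phi> (map f (u @ i # k # w)) = \<Phi> (map f (u @ k # i # w))" for f by simp
  moreover have "prod_list (map (fst g) (u @ i # k # w)) = prod_list (map (fst g) (u @ k # i # w))" by simp
  ultimately show "wact g \<Phi> (u @ i # k # w) = wact g \<Phi> (u @ k # i # w)"
    by (intro ext) (metis surj_pair wact.simps)
qed

lemma swap_invariant_linear:
  "\<Phi> \<in> swap_invariant \<Longrightarrow> \<Psi> \<in> swap_invariant \<Longrightarrow> (\<lambda>w p. \<Phi> w p + \<Psi> w p) \<in> swap_invariant"
  "\<Phi> \<in> swap_invariant \<Longrightarrow> (\<lambda>w p. a * \<Phi> w p) \<in> swap_invariant"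
  by (auto simp: swap_invariant_def fun_eq_iff)

text \<open>The effect of a reflection on a coordinate function and on its inverse image\<close>

lemma reflection_apply:
  assumes s: "s \<in> roots n" and k: "k \<in> {1..n}"
  shows "of_int (fst (refln s) (snd (refln s) k)) * f (snd (refln s) k) =
    f k - conorm s * rt s k * (\<Sum>l\<in>{1..n}. rt s l * f l :: complex)"
proof -
  have "of_int (fst (refln s) (snd (refln s) k)) * f (snd (refln s) k) =
      (\<Sum>l\<in>{1..n}. (if snd (refln s) k = l then of_int (fst (refln s) l) else 0) * f l)"
    using HO_in[OF refl_closed[OF s], of k] k
    by (subst sum.remove[of _ "snd (refln s) k"]) (auto intro!: sum.neutral simp del: refln.simps)
  also have "\<dots> = (\<Sum>l\<in>{1..n}. (if k = l then f l else 0) - conorm s * rt s k * (rt s l * f l))"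
    unfolding reflection_formula[OF s] by (rule sum.cong) (auto simp: algebra_simps)
  finally show ?thesis using k by (simp add: sum_subtractf sum_distrib_left)
qed

lemma reflection_apply_inv:
  assumes s: "s \<in> roots n"
  shows "of_int (fst (refln s) k) * f (inv_into UNIV (snd (refln s)) k) =
    f k - conorm s * rt s k * (\<Sum>l\<in>{1..n}. rt s l * f l :: complex)"
proof -
  obtain a b \<tau> where eq: "s = (a, b, \<tau>)" by (cases s)
  have inv: "inv_into UNIV (snd (refln s)) = snd (refln s)" by (simp add: eq)
  have sgn: "fst (refln s) (snd (refln s) k) = fst (refln s) k" by (simp add: eq)
  show ?thesis
  proof (cases "k \<in> {1..n}")
    case True
    then show ?thesis using reflection_apply[OF s True, of f] by (simp only: inv sgn)
  next
    case False
    then have "snd (refln s) k = k" "fst (refln s) k = 1"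
      using refl_closed[OF s] unfolding HO_carrier by (auto simp: permutes_def)
    then show ?thesis using root_outside[OF s False] inv by (simp del: refln.simps)
  qed
qed

context cherednik
begin

text \<open>
  The operator by which the commutator of \<open>y\<^sub>i\<close> and \<open>x\<^sub>k\<close> acts (\<open>coind_opact_br\<close>).
\<close>

definition brop :: "nat \<Rightarrow> nat \<Rightarrow> 'a coind_vec \<Rightarrow> 'a coind_vec" where
  "brop i k \<Phi> = (\<lambda>w p. (if i = k then 1 else 0) * \<Phi> w p -
     (\<Sum>s\<in>roots n. weight c d s * rt s i * rt s k * wact (refln s) \<Phi> w p))"

text \<open>
  The recursion for \<open>x\<^sub>k\<close> is forced by the commutation relation with the \<open>y\<^sub>i\<close> and the requirement
  that the value at the empty word, the projection to degree \<open>0\<close>, is \<open>0\<close>.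
\<close>

primrec xval :: "nat list \<Rightarrow> nat \<Rightarrow> 'a coind_vec \<Rightarrow> signed_perm \<times> 'a \<Rightarrow> complex" where
  "xval [] k \<Phi> p = 0"
| "xval (i # w) k \<Phi> p = xval w k (yop i \<Phi>) p + brop i k \<Phi> w p"

definition xop :: "nat \<Rightarrow> 'a coind_vec \<Rightarrow> 'a coind_vec" where
  "xop k \<Phi> = (\<lambda>w. xval w k \<Phi>)"

lemma xop_Nil [simp]: "xop k \<Phi> [] p = 0"
  and xop_Cons: "xop k \<Phi> (i # w) p = xop k (yop i \<Phi>) w p + brop i k \<Phi> w p"
  by (simp_all add: xop_def)

lemma yop_xop: "yop i (xop k \<Phi>) = (\<lambda>w p. xop k (yop i \<Phi>) w p + brop i k \<Phi> w p)"
  by (simp add: fun_eq_iff xop_Cons yop_def)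

lemma brop_linear:
  "brop i k (\<lambda>w p. \<Phi> w p + \<Psi> w p) w p = brop i k \<Phi> w p + brop i k \<Psi> w p"
  "brop i k (\<lambda>w p. a * \<Phi> w p) w p = a * brop i k \<Phi> w p"
  by (simp_all add: brop_def wact_linear algebra_simps sum.distrib sum_distrib_left)

lemma yop_linear:
  "yop i (\<lambda>w p. \<Phi> w p + \<Psi> w p) = (\<lambda>w p. yop i \<Phi> w p + yop i \<Psi> w p)"
  "yop i (\<lambda>w p. a * \<Phi> w p) = (\<lambda>w p. a * yop i \<Phi> w p)"
  by (simp_all add: yop_def)

lemma xop_linear:
  "xop k (\<lambda>w p. \<Phi> w p + \<Psi> w p) w p = xop k \<Phi> w p + xop k \<Psi> w p"
  "xop k (\<lambda>w p. a * \<Phi> w p) w p = a * xop k \<Phi> w p"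
  by (induction w arbitrary: \<Phi> \<Psi>) (simp_all add: xop_Cons yop_linear brop_linear algebra_simps)

lemma xop_zero: "xop k (\<lambda>w p. 0) w p = 0"
  using xop_linear(2)[of k 0 "\<lambda>w p. 0"] by simp

lemma xop_sum: "xop k (\<lambda>w p. \<Sum>s\<in>S. a s * F s w p) w p = (\<Sum>s\<in>S. a s * xop k (F s) w p)"
  by (induction S rule: infinite_finite_induct)
     (simp_all add: xop_zero xop_linear(1)[of k "\<lambda>w p. a x * F x w p" for x] xop_linear(2))

lemma brop_conj:
  assumes g: "g \<in> carrier (HO n)"
  shows "wact g (brop i k \<Phi>) w p =
    of_int (fst g (snd g i)) * of_int (fst g (snd g k)) * brop (snd g i) (snd g k) (wact g \<Phi>) w p"
proof -
  let ?e = "of_int (fst g (snd g i)) * of_int (fst g (snd g k)) :: complex"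
  have inj: "snd g i = snd g k \<longleftrightarrow> i = k" using HO_inv_simps(2)[OF g] by metis
  have sq: "?e * ?e = 1" and same: "i = k \<Longrightarrow> ?e = 1"
    using HO_sign_square[OF g, of "snd g i"] HO_sign_square[OF g, of "snd g k"]
    by (simp_all add: mult_ac flip: of_int_mult)
  have "wact g (brop i k \<Phi>) w p = wact g (\<lambda>w p. (if i = k then 1 else 0) * \<Phi> w p +
      (\<Sum>s\<in>roots n. - (weight c d s * rt s i * rt s k) * wact (refln s) \<Phi> w p)) w p"
    by (simp add: brop_def sum_negf)
  also have "\<dots> = (if i = k then 1 else 0) * wact g \<Phi> w p +
      (\<Sum>s\<in>roots n. - (weight c d s * rt s i * rt s k) * wact g (wact (refln s) \<Phi>) w p)"
    by (simp only: wact_linear wact_sum)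
  also have "(\<Sum>s\<in>roots n. - (weight c d s * rt s i * rt s k) * wact g (wact (refln s) \<Phi>) w p) =
      (\<Sum>s\<in>roots n. - ?e * (weight c d (conj_root g s) * rt (conj_root g s) (snd g i) *
          rt (conj_root g s) (snd g k)) * wact (refln (conj_root g s)) (wact g \<Phi>) w p)"
  proof (rule sum.cong)
    fix s assume s: "s \<in> roots n"
    have "wact g (wact (refln s) \<Phi>) = wact (refln (conj_root g s)) (wact g \<Phi>)"
      using wact_bmul[OF g refl_closed[OF s]] wact_bmul[OF refl_closed[OF conj_root_closed[OF g s]] g]
        conj_refl[OF g s] by metis
    moreover have "rt s i * rt s k = ?e * (rt (conj_root g s) (snd g i) * rt (conj_root g s) (snd g k))"
      unfolding rt_conj[OF g] using sq by (simp add: mult.assoc[symmetric])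
    ultimately show "- (weight c d s * rt s i * rt s k) * wact g (wact (refln s) \<Phi>) w p =
        - ?e * (weight c d (conj_root g s) * rt (conj_root g s) (snd g i) *
          rt (conj_root g s) (snd g k)) * wact (refln (conj_root g s)) (wact g \<Phi>) w p"
      by (simp add: weight_conj[OF g] mult_ac)
  qed simp
  also have "\<dots> = (\<Sum>s\<in>roots n. - ?e * (weight c d s * rt s (snd g i) *
          rt s (snd g k)) * wact (refln s) (wact g \<Phi>) w p)"
    by (rule sum.reindex_bij_betw[OF conj_root_bij[OF g]])
  finally show ?thesis
    using same by (auto simp: brop_def inj sum_negf sum_distrib_left right_diff_distrib mult.assoc)
qed

lemma xop_conj:
  assumes g: "g \<in> carrier (HO n)"
  shows "wact g (xop k \<Phi>) w p = of_int (fst g (snd g k)) * xop (snd g k) (wact g \<Phi>) w p"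
proof (induction w arbitrary: \<Phi> p)
  case Nil
  then show ?case by (cases p) simp
next
  case (Cons i w)
  let ?i = "inv_into UNIV (snd g) i"
  have sq: "of_int (fst g i) * of_int (fst g i) = (1::complex)"
    using HO_sign_square[OF g, of i] by (simp flip: of_int_mult)
  have y: "yop i (wact g \<Phi>) = (\<lambda>w p. of_int (fst g i) * wact g (yop ?i \<Phi>) w p)"
    by (intro ext) (rule yop_wact)
  have "wact g (xop k \<Phi>) (i # w) p = of_int (fst g i) * wact g (yop ?i (xop k \<Phi>)) w p"
    using yop_wact[of i g "xop k \<Phi>" w p] by (simp add: yop_def)
  also have "\<dots> = of_int (fst g i) * (wact g (xop k (yop ?i \<Phi>)) w p + wact g (brop ?i k \<Phi>) w p)"
    by (simp add: yop_xop wact_linear)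
  also have "\<dots> = of_int (fst g (snd g k)) * (of_int (fst g i) * xop (snd g k) (wact g (yop ?i \<Phi>)) w p +
      brop i (snd g k) (wact g \<Phi>) w p)"
  proof -
    have "a * (b * x + a * b * y) = b * (a * x + y)" if "a * a = 1" for a b x y :: complex
      using that by (metis (no_types, lifting) distrib_left mult.assoc mult.left_commute mult_1)
    from this[OF sq] show ?thesis by (simp add: Cons brop_conj[OF g] HO_inv_simps[OF g])
  qed
  also have "\<dots> = of_int (fst g (snd g k)) * xop (snd g k) (wact g \<Phi>) (i # w) p"
    by (simp add: xop_Cons y xop_linear(2))
  finally show ?case .
qed

lemma wact_refl_xop:
  assumes s: "s \<in> roots n" and k: "k \<in> {1..n}"
  shows "wact (refln s) (xop k \<Phi>) w p = xop k (wact (refln s) \<Phi>) w p -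
    conorm s * rt s k * (\<Sum>l\<in>{1..n}. rt s l * xop l (wact (refln s) \<Phi>) w p)"
  unfolding xop_conj[OF refl_closed[OF s]] by (rule reflection_apply[OF s k])

lemma yop_wact_refl:
  assumes s: "s \<in> roots n"
  shows "yop k (wact (refln s) \<Phi>) w p = wact (refln s) (yop k \<Phi>) w p -
    conorm s * rt s k * (\<Sum>l\<in>{1..n}. rt s l * wact (refln s) (yop l \<Phi>) w p)"
  unfolding yop_wact by (rule reflection_apply_inv[OF s])

text \<open>
  Both commutators below are sums over the roots of terms that are symmetric in all three indices.
  This is what makes the \<open>x\<^sub>k\<close> commute, and lets them preserve the functions invariant under swaps.
\<close>

lemma brop_xop:
  assumes k: "k \<in> {1..n}"
  shows "brop i j (xop k \<Phi>) w p - xop k (brop i j \<Phi>) w p =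
    (\<Sum>s\<in>roots n. weight c d s * conorm s * (rt s i * rt s j * rt s k) *
       (\<Sum>l\<in>{1..n}. rt s l * xop l (wact (refln s) \<Phi>) w p))"
proof -
  have "xop k (brop i j \<Phi>) w p = xop k (\<lambda>w p. (if i = j then 1 else 0) * \<Phi> w p +
      (\<Sum>s\<in>roots n. - (weight c d s * rt s i * rt s j) * wact (refln s) \<Phi> w p)) w p"
    by (simp add: brop_def sum_negf)
  also have "\<dots> = (if i = j then 1 else 0) * xop k \<Phi> w p +
      (\<Sum>s\<in>roots n. - (weight c d s * rt s i * rt s j) * xop k (wact (refln s) \<Phi>) w p)"
    by (simp only: xop_linear xop_sum)
  finally have "brop i j (xop k \<Phi>) w p - xop k (brop i j \<Phi>) w p =
      (\<Sum>s\<in>roots n. weight c d s * rt s i * rt s j *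
        (xop k (wact (refln s) \<Phi>) w p - wact (refln s) (xop k \<Phi>) w p))"
    by (simp add: brop_def[of i j "xop k \<Phi>"] sum_negf right_diff_distrib sum_subtractf)
  also have "\<dots> = (\<Sum>s\<in>roots n. weight c d s * conorm s * (rt s i * rt s j * rt s k) *
       (\<Sum>l\<in>{1..n}. rt s l * xop l (wact (refln s) \<Phi>) w p))"
    by (rule sum.cong) (simp_all add: wact_refl_xop[OF _ k] mult_ac)
  finally show ?thesis .
qed

lemma yop_brop:
  "yop k (brop i j \<Phi>) w p - brop i j (yop k \<Phi>) w p =
    (\<Sum>s\<in>roots n. weight c d s * conorm s * (rt s i * rt s j * rt s k) *
       (\<Sum>l\<in>{1..n}. rt s l * wact (refln s) (yop l \<Phi>) w p))"
proof -
  have "yop k (brop i j \<Phi>) w p - brop i j (yop k \<Phi>) w p =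
      (\<Sum>s\<in>roots n. weight c d s * rt s i * rt s j *
        (wact (refln s) (yop k \<Phi>) w p - yop k (wact (refln s) \<Phi>) w p))"
    by (simp add: brop_def yop_def right_diff_distrib sum_subtractf)
  also have "\<dots> = (\<Sum>s\<in>roots n. weight c d s * conorm s * (rt s i * rt s j * rt s k) *
       (\<Sum>l\<in>{1..n}. rt s l * wact (refln s) (yop l \<Phi>) w p))"
    by (rule sum.cong) (simp_all add: yop_wact_refl mult_ac)
  finally show ?thesis .
qed

text \<open>
  Applying \<open>y\<^sub>i\<close> reduces the claim to shorter words and to the symmetry of \<open>brop_xop\<close> in \<open>j\<close> and \<open>k\<close>.
\<close>

lemma xop_commute:
  assumes j: "j \<in> {1..n}" and k: "k \<in> {1..n}"
  shows "xop j (xop k \<Phi>) w p = xop k (xop j \<Phi>) w p"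
proof (induction w arbitrary: \<Phi>)
  case (Cons i w)
  have "brop i j (xop k \<Phi>) w p - xop k (brop i j \<Phi>) w p = brop i k (xop j \<Phi>) w p - xop j (brop i k \<Phi>) w p"
    unfolding brop_xop[OF k] brop_xop[OF j] by (simp add: mult_ac)
  then show ?case using Cons by (simp add: xop_Cons yop_xop xop_linear algebra_simps)
qed simp

lemma swap_invariant_brop: "\<Phi> \<in> swap_invariant \<Longrightarrow> brop i k \<Phi> \<in> swap_invariant"
  using swap_invariant_wact[of \<Phi>] by (simp add: brop_def swap_invariant_def)

lemma swap_invariant_xop:
  assumes \<Phi>: "\<Phi> \<in> swap_invariant" shows "xop j \<Phi> \<in> swap_invariant"
proof -
  have "xop j \<Phi> (u @ i # k # w) p = xop j \<Phi> (u @ k # i # w) p" for u i k w p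
    using \<Phi>
  proof (induction u arbitrary: \<Phi>)
    case Nil
    have "yop k (yop i \<Phi>) = yop i (yop k \<Phi>)"
      using swap_invariantD[OF Nil, of "[]"] by (simp add: yop_def fun_eq_iff)
    moreover have "yop k (brop i j \<Phi>) w p - brop i j (yop k \<Phi>) w p = yop i (brop k j \<Phi>) w p - brop k j (yop i \<Phi>) w p"
      unfolding yop_brop by (simp add: mult_ac)
    ultimately show ?case by (simp add: xop_Cons algebra_simps) (simp add: yop_def add.commute)
  next
    case (Cons a u)
    then show ?case
      using swap_invariantD[OF swap_invariant_brop[OF Cons.prems]] by (simp add: xop_Cons swap_invariant_yop)
  qed
  then show ?thesis by (auto simp: swap_invariant_def fun_eq_iff)
qed

definition coind :: "(complex, 'a coind_vec) module" where
  "coind = \<lparr>carrier = swap_invariant, monoid.mult = undefined, one = undefined,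
     ring.zero = (\<lambda>w p. 0), add = (\<lambda>\<Phi> \<Psi> w p. \<Phi> w p + \<Psi> w p), module.smult = (\<lambda>a \<Phi> w p. a * \<Phi> w p)\<rparr>"

lemma coind_simps [simp]: "carrier coind = swap_invariant" "\<zero>\<^bsub>coind\<^esub> = (\<lambda>w p. 0)"
  "\<Phi> \<oplus>\<^bsub>coind\<^esub> \<Psi> = (\<lambda>w p. \<Phi> w p + \<Psi> w p)" "a \<odot>\<^bsub>coind\<^esub> \<Phi> = (\<lambda>w p. a * \<Phi> w p)"
  by (simp_all add: coind_def)

fun cop :: "cgen \<Rightarrow> 'a coind_vec \<Rightarrow> 'a coind_vec" where
  "cop (GenX i) \<Phi> = xop i \<Phi>"
| "cop (GenY i) \<Phi> = yop i \<Phi>"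
| "cop (GenW g) \<Phi> = wact g \<Phi>"

lemma coind_left_module: "left_module complex_ring (coind :: (complex, 'a coind_vec) module)"
proof -
  interpret R: ring complex_ring by (rule ring_from_type_algebra)
  interpret V: abelian_group "coind :: (complex, 'a coind_vec) module"
  proof (rule abelian_groupI)
    fix x :: "'a coind_vec" assume "x \<in> carrier coind"
    then have "(\<lambda>w p. (-1) * x w p) \<in> carrier coind" using swap_invariant_linear(2)[of x "-1"] by simp
    then show "\<exists>y\<in>carrier coind. y \<oplus>\<^bsub>coind\<^esub> x = \<zero>\<^bsub>coind\<^esub>" by (rule bexI[rotated]) simp
  qed (auto simp: swap_invariant_linear algebra_simps, simp add: swap_invariant_def)
  show ?thesis
    by unfold_locales (auto simp: swap_invariant_linear algebra_simps)
qed

sublocale coind: operator_module CG "cherednik_rels n c d" "coind :: (complex, 'a coind_vec) module" cop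
proof (intro operator_module.intro presentation_axioms coind_left_module operator_module_axioms.intro)
  fix g :: cgen and u v :: "'a coind_vec" and a :: complex
  assume v: "v \<in> carrier coind"
  show "cop g v \<in> carrier coind"
    using v by (cases g) (auto simp: swap_invariant_xop swap_invariant_yop swap_invariant_wact)
  show "cop g (u \<oplus>\<^bsub>coind\<^esub> v) = cop g u \<oplus>\<^bsub>coind\<^esub> cop g v"
    by (cases g) (simp_all add: fun_eq_iff xop_linear yop_linear wact_linear del: wact.simps)
  show "cop g (a \<odot>\<^bsub>coind\<^esub> v) = a \<odot>\<^bsub>coind\<^esub> cop g v"
    by (cases g) (simp_all add: fun_eq_iff xop_linear yop_linear wact_linear del: wact.simps)
qed

lemma coind_opact_simps:
  assumes "\<Phi> \<in> swap_invariant"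
  shows "p \<in> ncpolys CG \<Longrightarrow> q \<in> ncpolys CG \<Longrightarrow> coind.opact (p + q) \<Phi> w z = coind.opact p \<Phi> w z + coind.opact q \<Phi> w z"
    and "p \<in> ncpolys CG \<Longrightarrow> q \<in> ncpolys CG \<Longrightarrow> coind.opact (p - q) \<Phi> w z = coind.opact p \<Phi> w z - coind.opact q \<Phi> w z"
    and "coind.opact (constp a) \<Phi> w z = a * \<Phi> w z"
    and "p \<in> ncpolys CG \<Longrightarrow> coind.opact (constp a * p) \<Phi> w z = a * coind.opact p \<Phi> w z"
    and "i \<in> {1..n} \<Longrightarrow> coind.opact (xp i) \<Phi> = xop i \<Phi>"
    and "i \<in> {1..n} \<Longrightarrow> coind.opact (yp i) \<Phi> = yop i \<Phi>"
    and "g \<in> carrier (HO n) \<Longrightarrow> coind.opact (wp g) \<Phi> = wact g \<Phi>"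
  using assms coind.opact_add[of p q \<Phi>] coind.opact_add[of "p - q" q \<Phi>] coind.opact_const[of \<Phi> a]
    coind.opact_mult[of "constp a" p \<Phi>] coind.opact_const[of "coind.opact p \<Phi>" a] coind.opact_closed[of p \<Phi>]
  by (simp_all add: coind.opact_gen)

lemma coind_opact_br:
  assumes \<Phi>: "\<Phi> \<in> swap_invariant"
  shows "coind.opact (br i k) \<Phi> = brop i k \<Phi>"
proof (intro ext)
  fix w p
  have "coind.opact (\<Sum>s\<in>S. constp (a s) * wp (refln s)) \<Phi> w p = (\<Sum>s\<in>S. a s * wact (refln s) \<Phi> w p)"
    if "S \<subseteq> roots n" for S :: "root set" and a
    using finite_subset[OF that finite_roots] that
  proof (induction S)
    case empty
    then show ?case using coind_opact_simps(3)[OF \<Phi>, of 0] by simp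
  next
    case (insert s S)
    have "(\<Sum>s\<in>S. constp (a s) * wp (refln s)) \<in> ncpolys CG" by (rule ncpolys_sum) (use insert.prems in \<open>auto simp del: refln.simps\<close>)
    then show ?case using insert by (simp add: coind_opact_simps[OF \<Phi>])
  qed
  from this[OF subset_refl] show "coind.opact (br i k) \<Phi> w p = brop i k \<Phi> w p"
    unfolding bracket_def brop_def by (simp add: coind_opact_simps[OF \<Phi>])
qed

sublocale coind: relation_module CG "cherednik_rels n c d" "coind :: (complex, 'a coind_vec) module" cop
proof (intro relation_module.intro coind.operator_module_axioms relation_module_axioms.intro)
  fix p q and v :: "'a coind_vec"
  assume "(lookup p, lookup q) \<in> cherednik_rels n c d" "v \<in> carrier coind"
  then have rel: "(p, q) \<in> cherednik_poly_rels n c d" and v: "v \<in> swap_invariant"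
    by (simp_all add: cherednik_rels_iff)
  note cl = swap_invariant_xop[OF v] swap_invariant_yop[OF v] swap_invariant_wact[OF v]
  note simps = coind_opact_simps coind.opact_mult v cl
  from rel show "coind.opact p v = coind.opact q v"
  proof cases
    case smash
    from smash(1) show ?thesis
    proof cases
      case 1
      then show ?thesis using coind_opact_simps(3)[OF v, of 1] by (simp add: simps wact_bone fun_eq_iff)
    next
      case (2 g h)
      then show ?thesis by (simp add: simps wact_bmul)
    next
      case (3 g i)
      have "wact g (yop i (wact (binv g) v)) w z = of_int (fst g (snd g i)) * yop (snd g i) v w z" for w z
      proof -
        have "yop (snd g i) v w z = yop (snd g i) (wact g (wact (binv g) v)) w z"
          using 3 by (simp add: wact_bmul[of _ n] wact_bone)
        also have "\<dots> = of_int (fst g (snd g i)) * wact g (yop i (wact (binv g) v)) w z"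
          unfolding yop_wact using HO_inv_simps[OF 3(3)] by simp
        finally show ?thesis
          using HO_sign_square[OF 3(3), of "snd g i"] by (simp add: mult.assoc[symmetric] flip: of_int_mult)
      qed
      then show ?thesis using 3
        by (simp add: simps fun_eq_iff swap_invariant_yop swap_invariant_wact)
    next
      case (4 i j)
      then show ?thesis using swap_invariantD[OF v, of "[]"]
        by (simp add: simps swap_invariant_yop) (simp add: yop_def fun_eq_iff)
    qed
  next
    case (conj_x g i)
    have "wact g (xop i (wact (binv g) v)) w z = of_int (fst g (snd g i)) * xop (snd g i) v w z" for w z
      unfolding xop_conj[OF conj_x(3)] using conj_x by (simp add: wact_bmul[of _ n] wact_bone)
    then show ?thesis using conj_x
      by (simp add: simps fun_eq_iff swap_invariant_xop swap_invariant_wact)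
  next
    case (comm_x i j)
    then show ?thesis by (simp add: simps swap_invariant_xop xop_commute fun_eq_iff)
  next
    case (comm_yx i j)
    then show ?thesis
      by (simp add: simps coind_opact_br fun_eq_iff swap_invariant_xop swap_invariant_yop)
         (simp add: yop_xop)
  qed
qed

end

section \<open>Tabloids and Specht modules\<close>

declare atLeastAtMost_iff [simp]
\<comment> \<open>From here on, reflections are used through the lemmas about them.\<close>
declare refln.simps [simp del] wact.simps [simp del]

lemma young_diagram_down:
  assumes "is_partition \<mu>" "(a, b) \<in> young_diagram \<mu>" "1 \<le> a'" "a' \<le> a"
  shows "(a', b) \<in> young_diagram \<mu>"
proof -
  have "\<mu> ! (a - 1) \<le> \<mu> ! (a' - 1)" if "a' < a"
    using assms that sorted_wrt_nth_less[of "(\<ge>)" \<mu> "a' - 1" "a - 1"]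
    by (auto simp: is_partition_def young_diagram_def)
  then show ?thesis using assms by (cases "a' = a") (auto simp: young_diagram_def)
qed

lemma young_diagram_Sigma: "young_diagram \<mu> = Sigma {1..length \<mu>} (\<lambda>i. {1..\<mu> ! (i - 1)})"
  by (auto simp: young_diagram_def)

lemma finite_young_diagram [simp]: "finite (young_diagram \<mu>)"
  by (simp add: young_diagram_Sigma)

lemma card_young_diagram: "card (young_diagram \<mu>) = sum_list \<mu>"
proof -
  have "card (young_diagram \<mu>) = (\<Sum>i\<in>{1..length \<mu>}. \<mu> ! (i - 1))"
    by (simp add: young_diagram_Sigma)
  also have "\<dots> = (\<Sum>i<length \<mu>. \<mu> ! i)"
    by (rule sum.reindex_bij_witness[of _ Suc "\<lambda>i. i - 1"]) auto
  finally show ?thesis by (simp add: sum_list_sum_nth atLeast0LessThan)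
qed

lemma tableaux_exist:
  assumes "finite I" "card I = sum_list \<mu>" obtains t where "t \<in> tableaux \<mu> I"
  using finite_same_card_bij[of I "young_diagram \<mu>"] assms card_young_diagram
  by (auto simp: tableaux_def)

definition tabloids :: "nat list \<Rightarrow> nat set \<Rightarrow> (nat \<Rightarrow> nat) set" where
  "tabloids \<mu> I = tabloid I ` tableaux \<mu> I"

lemma permutes_comp_bij: "\<sigma> permutes I \<Longrightarrow> bij_betw t I B \<Longrightarrow> bij_betw (t \<circ> \<sigma>) I B"
  using bij_betw_trans[OF permutes_imp_bij] by blast

lemma tableaux_comp: "\<sigma> permutes I \<Longrightarrow> t \<in> tableaux \<mu> I \<Longrightarrow> t \<circ> \<sigma> \<in> tableaux \<mu> I"
  by (simp add: tableaux_def permutes_comp_bij)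

lemma tabloid_comp: "\<sigma> permutes I \<Longrightarrow> tabloid I (t \<circ> \<sigma>) = tabloid I t \<circ> \<sigma>"
  by (auto simp: tabloid_def fun_eq_iff permutes_in_image permutes_not_in)

lemma tabloids_comp: "\<sigma> permutes I \<Longrightarrow> T \<in> tabloids \<mu> I \<Longrightarrow> T \<circ> \<sigma> \<in> tabloids \<mu> I"
  unfolding tabloids_def by (auto simp flip: tabloid_comp intro!: imageI tableaux_comp)

lemma tabloids_comp_iff: "\<sigma> permutes I \<Longrightarrow> T \<circ> \<sigma> \<in> tabloids \<mu> I \<longleftrightarrow> T \<in> tabloids \<mu> I"
  using tabloids_comp[of \<sigma> I T \<mu>] tabloids_comp[of "inv_into UNIV \<sigma>" I "T \<circ> \<sigma>" \<mu>]
  by (auto simp: permutes_inv comp_assoc permutes_inv_o)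

lemma tabloids_outside: "T \<in> tabloids \<mu> I \<Longrightarrow> k \<notin> I \<Longrightarrow> T k = 0"
  by (auto simp: tabloids_def tabloid_def)

lemma tabloids_row:
  assumes "T \<in> tabloids \<mu> I" "k \<in> I" shows "T k \<in> {1..length \<mu>}"
proof -
  obtain s where s: "T = tabloid I s" "bij_betw s I (young_diagram \<mu>)"
    using assms(1) by (auto simp: tabloids_def tableaux_def)
  then have "s k \<in> young_diagram \<mu>" using assms(2) by (auto simp: bij_betw_def)
  then show ?thesis using assms(2) s by (auto simp: young_diagram_def tabloid_def)
qed

lemma finite_tabloids:
  assumes "finite I" shows "finite (tabloids \<mu> I)"
proof (rule finite_subset)
  show "tabloids \<mu> I \<subseteq> (\<lambda>f k. if k \<in> I then f k else 0) ` (I \<rightarrow>\<^sub>E {1..length \<mu>})"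
  proof
    fix T assume T: "T \<in> tabloids \<mu> I"
    have "T = (\<lambda>k. if k \<in> I then restrict T I k else 0)" using tabloids_outside[OF T] by auto
    moreover have "restrict T I \<in> I \<rightarrow>\<^sub>E {1..length \<mu>}" using tabloids_row[OF T] by auto
    ultimately show "T \<in> (\<lambda>f k. if k \<in> I then f k else 0) ` (I \<rightarrow>\<^sub>E {1..length \<mu>})" by blast
  qed
qed (use assms in \<open>auto intro!: finite_PiE\<close>)

lemma finite_column_stabilizer: "finite I \<Longrightarrow> finite (column_stabilizer I t)"
  by (rule finite_subset[OF _ finite_permutations[of I]]) (auto simp: column_stabilizer_def)

lemma column_stabilizer_comp:
  assumes "\<sigma> \<in> column_stabilizer I t" "\<tau> \<in> column_stabilizer I t"
  shows "\<sigma> \<circ> \<tau> \<in> column_stabilizer I t"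
  using assms by (auto simp: column_stabilizer_def permutes_compose permutes_in_image)

lemma column_stabilizer_inv:
  assumes "\<sigma> \<in> column_stabilizer I t" shows "inv_into UNIV \<sigma> \<in> column_stabilizer I t"
proof -
  have p: "\<sigma> permutes I" using assms by (simp add: column_stabilizer_def)
  have "snd (t (inv_into UNIV \<sigma> k)) = snd (t k)" if "k \<in> I" for k
    using assms that permutes_in_image[OF permutes_inv[OF p], of k] permutes_inverses(1)[OF p, of k]
    by (simp add: column_stabilizer_def) metis
  then show ?thesis using permutes_inv[OF p] by (simp add: column_stabilizer_def)
qed

lemma column_stabilizer_transpose:
  "i \<in> I \<Longrightarrow> j \<in> I \<Longrightarrow> snd (t i) = snd (t j) \<Longrightarrow> Transposition.transpose i j \<in> column_stabilizer I t"
  by (auto simp: column_stabilizer_def permutes_swap_id Transposition.transpose_def)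

lemma sign_comp:
  "finite I \<Longrightarrow> \<sigma> permutes I \<Longrightarrow> \<tau> permutes I \<Longrightarrow> sign (\<sigma> \<circ> \<tau>) = sign \<sigma> * sign \<tau>"
  by (intro sign_compose permutation_permutes[THEN iffD2]) blast+

lemma sign_inv: "finite I \<Longrightarrow> \<sigma> permutes I \<Longrightarrow> sign (inv_into UNIV \<sigma>) = sign \<sigma>"
  by (intro sign_inverse permutation_permutes[THEN iffD2]) blast

lemma polytabloid_outside:
  assumes "t \<in> tableaux \<mu> I" "T \<notin> tabloids \<mu> I" shows "polytabloid I t T = 0"
  unfolding polytabloid_def
proof (rule sum.neutral, rule ballI)
  fix \<sigma> assume "\<sigma> \<in> column_stabilizer I t"
  then have "t \<circ> inv_into UNIV \<sigma> \<in> tableaux \<mu> I"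
    by (intro tableaux_comp permutes_inv assms) (simp add: column_stabilizer_def)
  then show "(if T = tabloid I (t \<circ> inv_into UNIV \<sigma>) then of_int (sign \<sigma>) else 0) = (0 :: complex)"
    using assms(2) by (auto simp: tabloids_def)
qed

lemma polytabloid_permute:
  assumes "finite I" and \<pi>: "\<pi> permutes I"
  shows "polytabloid I (t \<circ> inv_into UNIV \<pi>) T = polytabloid I t (T \<circ> \<pi>)"
proof -
  have \<pi>': "inv_into UNIV \<pi> permutes I" by (rule permutes_inv[OF \<pi>])
  have inv\<pi>: "inv_into UNIV \<pi> \<circ> \<pi> = id" "\<pi> \<circ> inv_into UNIV \<pi> = id" using permutes_inv_o[OF \<pi>] by auto
  show ?thesis
    unfolding polytabloid_def
  proof (rule sum.reindex_bij_witness[of _ "\<lambda>\<sigma>. \<pi> \<circ> \<sigma> \<circ> inv_into UNIV \<pi>" "\<lambda>\<sigma>. inv_into UNIV \<pi> \<circ> \<sigma> \<circ> \<pi>"])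
    fix \<sigma> assume \<sigma>: "\<sigma> \<in> column_stabilizer I t"
    then have p: "\<sigma> permutes I" by (simp add: column_stabilizer_def)
    show "inv_into UNIV \<pi> \<circ> (\<pi> \<circ> \<sigma> \<circ> inv_into UNIV \<pi>) \<circ> \<pi> = \<sigma>"
      by (metis comp_assoc comp_id id_comp inv\<pi>(1))
    show "\<pi> \<circ> \<sigma> \<circ> inv_into UNIV \<pi> \<in> column_stabilizer I (t \<circ> inv_into UNIV \<pi>)"
      using \<sigma> permutes_compose[OF \<pi>' permutes_compose[OF p \<pi>]] permutes_in_image[OF \<pi>'] permutes_inverses[OF \<pi>]
      by (auto simp: column_stabilizer_def comp_assoc)
  next
    fix \<sigma> assume \<sigma>: "\<sigma> \<in> column_stabilizer I (t \<circ> inv_into UNIV \<pi>)"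
    then have p: "\<sigma> permutes I" by (simp add: column_stabilizer_def)
    show "\<pi> \<circ> (inv_into UNIV \<pi> \<circ> \<sigma> \<circ> \<pi>) \<circ> inv_into UNIV \<pi> = \<sigma>"
      by (metis comp_assoc comp_id id_comp inv\<pi>(2))
    have "snd (t (inv_into UNIV \<pi> (\<sigma> (\<pi> k)))) = snd (t k)" if "k \<in> I" for k
      using \<sigma> permutes_in_image[OF \<pi>] permutes_inverses[OF \<pi>] that by (auto simp: column_stabilizer_def)
    then show "inv_into UNIV \<pi> \<circ> \<sigma> \<circ> \<pi> \<in> column_stabilizer I t"
      using permutes_compose[OF \<pi> permutes_compose[OF p \<pi>']] by (auto simp: column_stabilizer_def comp_assoc)
    have "sign (inv_into UNIV \<pi> \<circ> \<sigma> \<circ> \<pi>) = sign \<sigma>"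
      using sign_comp[OF assms(1) permutes_compose[OF p \<pi>'] \<pi>] sign_comp[OF assms(1) \<pi>' p] sign_inv[OF assms(1) \<pi>]
      by (simp add: mult_ac comp_assoc)
    moreover have "inv_into UNIV (inv_into UNIV \<pi> \<circ> \<sigma> \<circ> \<pi>) = inv_into UNIV \<pi> \<circ> inv_into UNIV \<sigma> \<circ> \<pi>"
      using \<pi> \<pi>' p by (simp add: o_inv_distrib permutes_bij bij_comp inv_inv_eq comp_assoc)
    moreover have "(T = Z \<circ> inv_into UNIV \<pi>) \<longleftrightarrow> (T \<circ> \<pi> = Z)" for Z :: "nat \<Rightarrow> nat"
      by (metis comp_assoc comp_id inv\<pi>)
    moreover have "tabloid I (t \<circ> inv_into UNIV \<pi> \<circ> inv_into UNIV \<sigma>) =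
        tabloid I (t \<circ> (inv_into UNIV \<pi> \<circ> inv_into UNIV \<sigma> \<circ> \<pi>)) \<circ> inv_into UNIV \<pi>"
      using tabloid_comp[OF \<pi>', of "t \<circ> (inv_into UNIV \<pi> \<circ> inv_into UNIV \<sigma> \<circ> \<pi>)"] inv\<pi>(2)
      by (simp add: comp_assoc)
    ultimately show "(if T \<circ> \<pi> = tabloid I (t \<circ> inv_into UNIV (inv_into UNIV \<pi> \<circ> \<sigma> \<circ> \<pi>))
        then of_int (sign (inv_into UNIV \<pi> \<circ> \<sigma> \<circ> \<pi>)) else 0) =
      (if T = tabloid I (t \<circ> inv_into UNIV \<pi> \<circ> inv_into UNIV \<sigma>) then of_int (sign \<sigma>) else (0 :: complex))"
      by simp
  qed
qed

lemma polytabloid_antisym: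
  assumes fin: "finite I" and \<sigma>: "\<sigma> \<in> column_stabilizer I t"
  shows "polytabloid I t (T \<circ> \<sigma>) = of_int (sign \<sigma>) * polytabloid I t T"
proof -
  have p: "\<sigma> permutes I" using \<sigma> by (simp add: column_stabilizer_def)
  have inv\<sigma>: "inv_into UNIV \<sigma> \<circ> \<sigma> = id" "\<sigma> \<circ> inv_into UNIV \<sigma> = id" using permutes_inv_o[OF p] by auto
  have "polytabloid I t (T \<circ> \<sigma>) = (\<Sum>\<tau>\<in>column_stabilizer I t. of_int (sign \<sigma>) *
      (if T = tabloid I (t \<circ> inv_into UNIV \<tau>) then of_int (sign \<tau>) else 0))"
    unfolding polytabloid_def
  proof (rule sum.reindex_bij_witness[of _ "\<lambda>\<tau>. inv_into UNIV \<sigma> \<circ> \<tau>" "\<lambda>\<tau>. \<sigma> \<circ> \<tau>"])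
    fix \<tau> assume \<tau>: "\<tau> \<in> column_stabilizer I t"
    then have q: "\<tau> permutes I" by (simp add: column_stabilizer_def)
    show "inv_into UNIV \<sigma> \<circ> (\<sigma> \<circ> \<tau>) = \<tau>" "\<sigma> \<circ> (inv_into UNIV \<sigma> \<circ> \<tau>) = \<tau>"
      using inv\<sigma> by (simp_all flip: comp_assoc)
    show "\<sigma> \<circ> \<tau> \<in> column_stabilizer I t" "inv_into UNIV \<sigma> \<circ> \<tau> \<in> column_stabilizer I t"
      using column_stabilizer_comp column_stabilizer_inv \<sigma> \<tau> by blast+
    have "of_int (sign (\<sigma> \<circ> \<tau>)) * of_int (sign \<sigma>) = (of_int (sign \<tau>) :: complex)"
      using sign_comp[OF fin p q] by (simp add: mult_ac flip: of_int_mult)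
    moreover have "tabloid I (t \<circ> inv_into UNIV (\<sigma> \<circ> \<tau>)) = tabloid I (t \<circ> inv_into UNIV \<tau>) \<circ> inv_into UNIV \<sigma>"
      using tabloid_comp[OF permutes_inv[OF p], of "t \<circ> inv_into UNIV \<tau>"] p q
      by (simp add: o_inv_distrib permutes_bij comp_assoc)
    moreover have "(T = Z \<circ> inv_into UNIV \<sigma>) \<longleftrightarrow> (T \<circ> \<sigma> = Z)" for Z :: "nat \<Rightarrow> nat"
      by (metis comp_assoc comp_id inv\<sigma>)
    ultimately show "of_int (sign \<sigma>) * (if T = tabloid I (t \<circ> inv_into UNIV (\<sigma> \<circ> \<tau>)) then of_int (sign (\<sigma> \<circ> \<tau>)) else 0) =
        (if T \<circ> \<sigma> = tabloid I (t \<circ> inv_into UNIV \<tau>) then of_int (sign \<tau>) else (0 :: complex))"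
      by (simp add: mult.commute)
  qed
  then show ?thesis by (simp add: polytabloid_def sum_distrib_left)
qed

text \<open>
  An entry of a tableau is determined by its row and its column.
\<close>

lemma row_column_stabilizer:
  assumes t: "t \<in> tableaux \<mu> I" and \<sigma>: "\<sigma> \<in> column_stabilizer I t" and eq: "tabloid I t \<circ> \<sigma> = tabloid I t"
  shows "\<sigma> = id"
proof -
  have p: "\<sigma> permutes I" using \<sigma> by (simp add: column_stabilizer_def)
  have "\<sigma> k = k" if k: "k \<in> I" for k
  proof -
    have \<sigma>k: "\<sigma> k \<in> I" using k p by (simp add: permutes_in_image)
    have "fst (t (\<sigma> k)) = fst (t k)" using fun_cong[OF eq, of k] k \<sigma>k by (simp add: tabloid_def)
    moreover have "snd (t (\<sigma> k)) = snd (t k)" using \<sigma> k by (simp add: column_stabilizer_def)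
    ultimately have "t (\<sigma> k) = t k" by (simp add: prod_eq_iff)
    then show ?thesis using t k \<sigma>k by (auto simp: tableaux_def bij_betw_def inj_on_def)
  qed
  then show ?thesis using permutes_not_in[OF p] by (auto simp: fun_eq_iff)
qed

lemma polytabloid_self:
  assumes fin: "finite I" and t: "t \<in> tableaux \<mu> I"
  shows "polytabloid I t (tabloid I t) = 1"
proof -
  have "\<sigma> = id" if \<sigma>: "\<sigma> \<in> column_stabilizer I t" and eq: "tabloid I t = tabloid I (t \<circ> inv_into UNIV \<sigma>)" for \<sigma>
  proof -
    have p: "\<sigma> permutes I" using \<sigma> by (simp add: column_stabilizer_def)
    have "tabloid I t \<circ> \<sigma> = tabloid I t"
      using eq tabloid_comp[OF permutes_inv[OF p], of t] permutes_inv_o(2)[OF p] by (metis comp_assoc comp_id)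
    then show ?thesis using row_column_stabilizer[OF t \<sigma>] by blast
  qed
  moreover have "id \<in> column_stabilizer I t" by (simp add: column_stabilizer_def permutes_id)
  ultimately have "polytabloid I t (tabloid I t) =
      (\<Sum>\<sigma>\<in>column_stabilizer I t. if \<sigma> = id then 1 else 0)"
    unfolding polytabloid_def by (intro sum.cong) auto
  then show ?thesis
    using finite_column_stabilizer[OF fin] \<open>id \<in> column_stabilizer I t\<close> by simp
qed

text \<open>
  The combinatorial core of James' submodule theorem. Among the entries in the first \<open>m\<close> rows of \<open>T\<close>,
  column \<open>b\<close> of \<open>t\<close> contributes at most \<open>min(m, c\<^sub>b)\<close>, where \<open>c\<^sub>b\<close> is its length. Their number
  is the sum of these bounds, as \<open>T\<close> has the shape of \<open>t\<close>, so each bound is attained; for \<open>m = c\<^sub>b\<close>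
  this says that the entries of column \<open>b\<close> lie in rows \<open>1, \<dots>, c\<^sub>b\<close> of \<open>T\<close>.
\<close>

lemma column_injective_tabloid:
  assumes part: "is_partition \<mu>" and fin: "finite I" and t: "t \<in> tableaux \<mu> I" and T: "T \<in> tabloids \<mu> I"
    and inj: "\<And>i j. i \<in> I \<Longrightarrow> j \<in> I \<Longrightarrow> i \<noteq> j \<Longrightarrow> snd (t i) = snd (t j) \<Longrightarrow> T i \<noteq> T j"
  obtains \<rho> where "\<rho> \<in> column_stabilizer I t" "T = tabloid I t \<circ> \<rho>"
proof -
  have tbij: "bij_betw t I (young_diagram \<mu>)" using t by (simp add: tableaux_def)
  obtain s where s: "T = tabloid I s" "bij_betw s I (young_diagram \<mu>)"
    using T by (auto simp: tabloids_def tableaux_def)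
  define C where "C b = {k \<in> I. snd (t k) = b}" for b
  define D where "D b = {a. (a, b) \<in> young_diagram \<mu>}" for b
  let ?B = "snd ` young_diagram \<mu>"
  have Bfin: "finite ?B" by simp
  have D_int: "D b = {1..card (D b)}" for b
  proof -
    have finD: "finite (D b)"
      by (rule finite_subset[of _ "fst ` young_diagram \<mu>"]) (force simp: D_def)+
    show ?thesis
    proof (cases "D b = {}")
      case False
      have "D b = {1..Max (D b)}"
      proof (rule Set.set_eqI)
        fix a
        have "1 \<le> a" if "a \<in> D b" using that by (simp add: D_def young_diagram_def)
        moreover have "a \<in> D b" if "1 \<le> a" "a \<le> Max (D b)"
          using young_diagram_down[OF part _ that] Max_in[OF finD False] by (simp add: D_def)
        ultimately show "a \<in> D b \<longleftrightarrow> a \<in> {1..Max (D b)}" using Max_ge[OF finD] by auto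
      qed
      moreover from this have "card (D b) = Max (D b)" by (metis card_atLeastAtMost add_diff_cancel_right' Suc_eq_plus1)
      ultimately show ?thesis by simp
    qed simp
  qed
  have D_mem: "x \<in> D b \<longleftrightarrow> 1 \<le> x \<and> x \<le> card (D b)" for x b
    using D_int[of b] by (metis atLeastAtMost_iff)
  have Ccard: "card (C b) = card (D b)" for b
  proof (rule bij_betw_same_card[of "\<lambda>k. fst (t k)"])
    show "bij_betw (\<lambda>k. fst (t k)) (C b) (D b)"
      unfolding bij_betw_def
    proof
      show "inj_on (\<lambda>k. fst (t k)) (C b)"
        using tbij by (auto simp: C_def bij_betw_def inj_on_def prod_eq_iff)
      show "(\<lambda>k. fst (t k)) ` C b = D b"
      proof
        show "(\<lambda>k. fst (t k)) ` C b \<subseteq> D b" using tbij by (auto simp: C_def D_def bij_betw_def)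
        show "D b \<subseteq> (\<lambda>k. fst (t k)) ` C b"
        proof
          fix a assume "a \<in> D b"
          then have "(a, b) \<in> t ` I" using tbij by (simp add: D_def bij_betw_def)
          then obtain k where "k \<in> I" "t k = (a, b)" by (metis imageE)
          then show "a \<in> (\<lambda>k. fst (t k)) ` C b" by (force simp: C_def)
        qed
      qed
    qed
  qed
  have row: "(T k, snd (t k)) \<in> young_diagram \<mu>" if k: "k \<in> I" for k
  proof -
    define b where "b = snd (t k)"
    define m where "m = card (D b)"
    have bB: "b \<in> ?B" using tbij k by (auto simp: b_def bij_betw_def)
    \<comment> \<open>The bound for one column: its entries have distinct rows in \<open>T\<close>.\<close>
    have le: "card {k \<in> C b'. T k \<le> m} \<le> min (card (D b')) m" for b'
    proof -
      have "card {k \<in> C b'. T k \<le> m} \<le> card (C b')"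
        by (rule card_mono) (use fin in \<open>auto simp: C_def\<close>)
      moreover have "card {k \<in> C b'. T k \<le> m} \<le> card {1..m}"
      proof (rule card_inj_on_le[of T])
        show "inj_on T {k \<in> C b'. T k \<le> m}"
        proof (rule inj_onI)
          fix x y assume "x \<in> {k \<in> C b'. T k \<le> m}" "y \<in> {k \<in> C b'. T k \<le> m}" "T x = T y"
          then show "x = y" using inj[of x y] by (auto simp: C_def)
        qed
        show "T ` {k \<in> C b'. T k \<le> m} \<subseteq> {1..m}" using tabloids_row[OF T] by (auto simp: C_def)
      qed simp
      ultimately show ?thesis by (simp add: Ccard)
    qed
    \<comment> \<open>The bounds add up to the number of boxes in the first \<open>m\<close> rows, as \<open>T\<close> comes from a tableau \<open>s\<close>.\<close>
    have "(\<Sum>b'\<in>?B. card {k \<in> C b'. T k \<le> m}) = card (\<Union>b'\<in>?B. {k \<in> C b'. T k \<le> m})"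
    proof (rule card_UN_disjoint[symmetric])
      show "\<forall>b'\<in>?B. finite {k \<in> C b'. T k \<le> m}" using fin by (simp add: C_def)
      show "\<forall>b'\<in>?B. \<forall>b''\<in>?B. b' \<noteq> b'' \<longrightarrow> {k \<in> C b'. T k \<le> m} \<inter> {k \<in> C b''. T k \<le> m} = {}"
        by (simp add: C_def disjoint_iff)
    qed (rule Bfin)
    also have "(\<Union>b'\<in>?B. {k \<in> C b'. T k \<le> m}) = {k \<in> I. fst (s k) \<le> m}"
      using tbij by (auto simp: C_def s tabloid_def bij_betw_def)
    also have "card \<dots> = card {p \<in> young_diagram \<mu>. fst p \<le> m}"
    proof (rule bij_betw_same_card[of s])
      show "bij_betw s {k \<in> I. fst (s k) \<le> m} {p \<in> young_diagram \<mu>. fst p \<le> m}"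
      proof -
        have inj: "inj_on s I" and im: "young_diagram \<mu> = s ` I" using s(2) by (auto simp: bij_betw_def)
        show ?thesis unfolding bij_betw_def im by (auto intro: inj_on_subset[OF inj])
      qed
    qed
    also have "{p \<in> young_diagram \<mu>. fst p \<le> m} = (\<Union>b'\<in>?B. (\<lambda>a. (a, b')) ` {a \<in> D b'. a \<le> m})"
      by (force simp: D_def)
    also have "card \<dots> = (\<Sum>b'\<in>?B. card ((\<lambda>a. (a, b')) ` {a \<in> D b'. a \<le> m}))"
    proof (rule card_UN_disjoint)
      show "\<forall>b'\<in>?B. finite ((\<lambda>a. (a, b')) ` {a \<in> D b'. a \<le> m})"
        by (simp add: finite_subset[of _ "{..m}"])
      show "\<forall>b'\<in>?B. \<forall>b''\<in>?B. b' \<noteq> b'' \<longrightarrow>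
          (\<lambda>a. (a, b')) ` {a \<in> D b'. a \<le> m} \<inter> (\<lambda>a. (a, b'')) ` {a \<in> D b''. a \<le> m} = {}"
        by blast
    qed (rule Bfin)
    also have "\<dots> = (\<Sum>b'\<in>?B. min (card (D b')) m)"
    proof (rule sum.cong)
      fix b'
      have "{a \<in> D b'. a \<le> m} = {1..min (card (D b')) m}" by (auto simp: D_mem)
      then show "card ((\<lambda>a. (a, b')) ` {a \<in> D b'. a \<le> m}) = min (card (D b')) m"
        by (simp add: card_image inj_on_def)
    qed simp
    finally have "card {k \<in> C b. T k \<le> m} = min (card (D b)) m"
      by (rule sum_mono_inv[OF _ le bB Bfin])
    then have "card {k \<in> C b. T k \<le> m} = card (C b)" by (simp add: m_def Ccard)
    moreover have "finite (C b)" using fin by (simp add: C_def)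
    ultimately have "{k \<in> C b. T k \<le> m} = C b" by (metis (no_types, lifting) card_subset_eq mem_Collect_eq subsetI)
    then have "T k \<le> m" using k by (auto simp: C_def b_def)
    then have "T k \<in> D b" using D_mem tabloids_row[OF T k] by (simp add: m_def)
    then show ?thesis by (simp add: D_def b_def)
  qed
  define \<rho> where "\<rho> k = (if k \<in> I then inv_into I t (T k, snd (t k)) else k)" for k
  have t\<rho>: "t (\<rho> k) = (T k, snd (t k))" and \<rho>I: "\<rho> k \<in> I" if "k \<in> I" for k
    using that row[OF that] tbij by (auto simp: \<rho>_def bij_betw_def f_inv_into_f inv_into_into)
  have "\<rho> permutes I"
  proof (rule bij_imp_permutes)
    have "inj_on \<rho> I"
    proof (rule inj_onI)
      fix i j assume ij: "i \<in> I" "j \<in> I" "\<rho> i = \<rho> j"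
      then have "T i = T j" "snd (t i) = snd (t j)" using t\<rho>[of i] t\<rho>[of j] by auto
      then show "i = j" using inj ij by blast
    qed
    moreover have "\<rho> ` I \<subseteq> I" using \<rho>I by auto
    ultimately show "bij_betw \<rho> I I"
      using fin by (simp add: bij_betw_def endo_inj_surj)
  qed (simp add: \<rho>_def)
  then have "\<rho> \<in> column_stabilizer I t" using t\<rho> by (simp add: column_stabilizer_def)
  moreover have "T = tabloid I t \<circ> \<rho>"
  proof
    fix k show "T k = (tabloid I t \<circ> \<rho>) k"
      using t\<rho>[of k] \<rho>I[of k] tabloids_outside[OF T, of k] by (cases "k \<in> I") (auto simp: tabloid_def \<rho>_def)
  qed
  ultimately show thesis by (rule that)
qed

text \<open>
  A function on tabloids that transforms under the column stabilizer of \<open>t\<close> by the sign vanishes on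
  every tabloid with two entries of a column of \<open>t\<close> in one row. By \<open>column_injective_tabloid\<close>, the other
  tabloids form one orbit of the column stabilizer.
\<close>

lemma polytabloid_unique:
  assumes part: "is_partition \<mu>" and fin: "finite I" and t: "t \<in> tableaux \<mu> I"
    and supp: "\<And>T. T \<notin> tabloids \<mu> I \<Longrightarrow> F T = 0"
    and anti: "\<And>T \<sigma>. \<sigma> \<in> column_stabilizer I t \<Longrightarrow> F (T \<circ> \<sigma>) = of_int (sign \<sigma>) * (F T :: complex)"
  shows "F T = F (tabloid I t) * polytabloid I t T"
proof (cases "T \<in> tabloids \<mu> I")
  case False
  then show ?thesis using supp polytabloid_outside[OF t] by simp
next
  case T: True
  show ?thesis
  proof (cases "\<exists>i\<in>I. \<exists>j\<in>I. i \<noteq> j \<and> snd (t i) = snd (t j) \<and> T i = T j")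
    case True
    then obtain i j where ij: "i \<in> I" "j \<in> I" "i \<noteq> j" "snd (t i) = snd (t j)" "T i = T j" by blast
    let ?s = "Transposition.transpose i j"
    have s: "?s \<in> column_stabilizer I t" using ij by (intro column_stabilizer_transpose)
    have "T \<circ> ?s = T" using ij by (auto simp: fun_eq_iff Transposition.transpose_def)
    then have "F T = - F T" "polytabloid I t T = - polytabloid I t T"
      using anti[OF s, of T] polytabloid_antisym[OF fin s, of T] ij by (simp_all add: sign_swap_id)
    then show ?thesis by simp
  next
    case False
    then obtain \<rho> where \<rho>: "\<rho> \<in> column_stabilizer I t" "T = tabloid I t \<circ> \<rho>"
      using column_injective_tabloid[OF part fin t T] by metis
    then show ?thesis
      using anti[OF \<rho>(1)] polytabloid_antisym[OF fin \<rho>(1)] polytabloid_self[OF fin t] by simp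
  qed
qed

text \<open>
  The coefficient of the tabloid of \<open>t\<close> in a Jucys--Murphy sum applied to the polytabloid of \<open>t\<close>. An
  entry outside the row and the column of \<open>i\<close> does not contribute, because swapping it with \<open>i\<close> changes
  the sum of the row numbers over the column of \<open>i\<close>.
\<close>

lemma jucys_murphy_coefficient:
  assumes fin: "finite I" and t: "t \<in> tableaux \<mu> I" and i: "i \<in> I"
  shows "(\<Sum>j\<in>I - {i}. polytabloid I t (tabloid I t \<circ> Transposition.transpose i j)) =
    of_nat (card {j \<in> I. fst (t j) = fst (t i)}) - of_nat (card {j \<in> I. snd (t j) = snd (t i)})"
proof -
  let ?R = "{j \<in> I. fst (t j) = fst (t i)}" and ?C = "{j \<in> I. snd (t j) = snd (t i)}"
  have inj: "j = k" if "j \<in> I" "k \<in> I" "t j = t k" for j k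
    using t that by (auto simp: tableaux_def bij_betw_def inj_on_def)
  have val: "polytabloid I t (tabloid I t \<circ> Transposition.transpose i j) =
      (if j \<in> ?R then 1 else 0) - (if j \<in> ?C then 1 else 0)" if j: "j \<in> I - {i}" for j
  proof -
    let ?s = "Transposition.transpose i j" and ?T = "tabloid I t"
    have notboth: "\<not> (j \<in> ?R \<and> j \<in> ?C)" using inj[of i j] i j by (auto simp: prod_eq_iff)
    consider "j \<in> ?R" | "j \<in> ?C" | "j \<notin> ?R" "j \<notin> ?C" by blast
    then show ?thesis
    proof cases
      case 1
      then have "?T \<circ> ?s = ?T" using i by (auto simp: fun_eq_iff tabloid_def Transposition.transpose_def)
      then show ?thesis using 1 notboth polytabloid_self[OF fin t] by simp
    next
      case 2
      then have "?s \<in> column_stabilizer I t" using i by (intro column_stabilizer_transpose) auto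
      then show ?thesis
        using 2 notboth j polytabloid_antisym[OF fin, of ?s t ?T] polytabloid_self[OF fin t]
        by (auto simp: sign_swap_id)
    next
      case 3
      have "?T \<circ> ?s \<noteq> tabloid I (t \<circ> inv_into UNIV \<sigma>)" if \<sigma>: "\<sigma> \<in> column_stabilizer I t" for \<sigma>
      proof
        assume eq: "?T \<circ> ?s = tabloid I (t \<circ> inv_into UNIV \<sigma>)"
        have p: "\<sigma> permutes I" using \<sigma> by (simp add: column_stabilizer_def)
        have bij: "bij_betw \<sigma> ?C ?C"
        proof (rule bij_betw_byWitness[where f' = "inv_into UNIV \<sigma>"])
          show "\<sigma> ` ?C \<subseteq> ?C" "inv_into UNIV \<sigma> ` ?C \<subseteq> ?C"
            using \<sigma> column_stabilizer_inv[OF \<sigma>] by (auto simp: column_stabilizer_def permutes_in_image)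
        qed (use permutes_inverses[OF p] in auto)
        have \<sigma>T: "(?T \<circ> ?s) (\<sigma> k) = ?T k" if "k \<in> ?C" for k
        proof -
          have "(?T \<circ> ?s) (\<sigma> k) = fst (t (inv_into UNIV \<sigma> (\<sigma> k)))"
            unfolding eq using that p by (simp add: tabloid_def permutes_in_image)
          then show ?thesis using that permutes_inverses(2)[OF p, of k] by (simp add: tabloid_def)
        qed
        have "(\<Sum>k\<in>?C. (?T \<circ> ?s) k) = (\<Sum>k\<in>?C. ?T k)"
          using sum.reindex_bij_betw[OF bij, of "?T \<circ> ?s"] \<sigma>T by simp
        moreover have "(\<Sum>k\<in>?C. (?T \<circ> ?s) k) = ?T j + (\<Sum>k\<in>?C - {i}. ?T k)"
        proof -
          have "(?T \<circ> ?s) k = ?T k" if "k \<in> ?C - {i}" for k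
          proof -
            have "k \<noteq> j" "k \<noteq> i" using that 3 j by auto
            then show ?thesis by simp
          qed
          then show ?thesis using fin i by (subst sum.remove[of _ i]) auto
        qed
        moreover have "(\<Sum>k\<in>?C. ?T k) = ?T i + (\<Sum>k\<in>?C - {i}. ?T k)"
          using fin i by (subst sum.remove[of _ i]) auto
        ultimately have "?T i = ?T j" by simp
        then show False using 3 i j by (simp add: tabloid_def)
      qed
      then have "polytabloid I t (?T \<circ> ?s) = 0" unfolding polytabloid_def by (intro sum.neutral) auto
      then show ?thesis using 3 by auto
    qed
  qed
  have count: "(\<Sum>j\<in>I - {i}. if j \<in> S then 1 else 0) = (of_nat (card S) - 1 :: complex)"
    if "S \<subseteq> I" "i \<in> S" for S
  proof -
    have "(I - {i}) \<inter> S = S - {i}" using that by blast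
    then have "(\<Sum>j\<in>I - {i}. if j \<in> S then 1 else 0) = (of_nat (card (S - {i})) :: complex)"
      using fin by (simp add: sum.If_cases)
    moreover have "card S = Suc (card (S - {i}))" using that fin by (metis card_Suc_Diff1 finite_subset)
    ultimately show ?thesis by simp
  qed
  show ?thesis
    using val count[of ?R] count[of ?C] i by (simp add: sum_subtractf)
qed

text \<open>
  A Garnir relation. If \<open>f\<close> is antisymmetric in the entries of \<open>S\<close>, then \<open>f - \<Sum> (i j) f\<close>, with \<open>j\<close>
  running through \<open>S\<close>, is antisymmetric in the entries of \<open>S \<union> {i}\<close>. It vanishes at \<open>T\<close> if two of
  these entries lie in one row.
\<close>

lemma garnir:
  fixes f :: "(nat \<Rightarrow> nat) \<Rightarrow> complex"
  assumes fin: "finite S" and i: "i \<notin> S"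
    and anti: "\<And>T x y. x \<in> S \<Longrightarrow> y \<in> S \<Longrightarrow> x \<noteq> y \<Longrightarrow> f (T \<circ> Transposition.transpose x y) = - f T"
    and xy: "x \<in> insert i S" "y \<in> insert i S" "x \<noteq> y" "T x = T y"
  shows "(\<Sum>j\<in>S. f (T \<circ> Transposition.transpose i j)) = f T"
proof -
  \<comment> \<open>\<open>g\<close> is antisymmetric under swaps within \<open>S\<close> and under swaps of \<open>i\<close> with an element of \<open>S\<close>.\<close>
  define g where "g T = f T - (\<Sum>j\<in>S. f (T \<circ> Transposition.transpose i j))" for T
  have g_inner: "g (T \<circ> Transposition.transpose x y) = - g T" if xy: "x \<in> S" "y \<in> S" "x \<noteq> y" for x y T
  proof -
    let ?s = "Transposition.transpose x y"
    have bij: "bij_betw ?s S S" using xy by (intro permutes_imp_bij permutes_swap_id)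
    have "f (T \<circ> ?s \<circ> Transposition.transpose i j) = - f (T \<circ> Transposition.transpose i (?s j))" if "j \<in> S" for j
    proof -
      have "?s \<circ> Transposition.transpose i j = Transposition.transpose i (?s j) \<circ> ?s"
        using i xy that by (auto simp: fun_eq_iff Transposition.transpose_def)
      then show ?thesis using anti[OF xy, of "T \<circ> Transposition.transpose i (?s j)"] by (simp add: comp_assoc)
    qed
    then have "(\<Sum>j\<in>S. f (T \<circ> ?s \<circ> Transposition.transpose i j)) = (\<Sum>j\<in>S. - f (T \<circ> Transposition.transpose i (?s j)))"
      by simp
    also have "\<dots> = (\<Sum>j\<in>S. - f (T \<circ> Transposition.transpose i j))"
      by (rule sum.reindex_bij_betw[OF bij])
    finally show ?thesis using anti[OF xy, of T] by (simp add: g_def sum_negf)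
  qed
  have g_outer: "g (T \<circ> Transposition.transpose i y) = - g T" if y: "y \<in> S" for y T
  proof -
    let ?s = "Transposition.transpose i y"
    have "f (T \<circ> ?s \<circ> Transposition.transpose i j) = - f (T \<circ> Transposition.transpose i j)" if j: "j \<in> S - {y}" for j
    proof -
      have "?s \<circ> Transposition.transpose i j = Transposition.transpose i j \<circ> Transposition.transpose j y"
        using i y j by (auto simp: fun_eq_iff Transposition.transpose_def)
      then show ?thesis using anti[of j y "T \<circ> Transposition.transpose i j"] y j by (simp add: comp_assoc)
    qed
    then have 1: "(\<Sum>j\<in>S - {y}. f (T \<circ> ?s \<circ> Transposition.transpose i j)) = - (\<Sum>j\<in>S - {y}. f (T \<circ> Transposition.transpose i j))"
      by (simp add: sum_negf)
    have 2: "T \<circ> ?s \<circ> ?s = T" by (simp add: comp_assoc)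
    show ?thesis
      unfolding g_def sum.remove[OF fin y] 1 2 by simp
  qed
  have "g (T \<circ> Transposition.transpose x y) = - g T"
    using xy g_inner[of x y T] g_outer[of y T] g_outer[of x T] by (auto simp: transpose_commute)
  moreover have "T \<circ> Transposition.transpose x y = T"
    using xy by (auto simp: fun_eq_iff Transposition.transpose_def)
  ultimately have "g T = 0" by simp
  then show ?thesis by (simp add: g_def)
qed

text \<open>
  The column of \<open>i\<close> contributes \<open>-1\<close> for each of its other \<open>r - 1\<close> entries. Each of the other \<open>q - 1\<close> columns
  contributes \<open>1\<close> by the Garnir relation: such a column has \<open>r\<close> entries, which together with \<open>i\<close> are too many to lie in different
  rows.
\<close>

lemma jucys_murphy_rectangle:
  assumes fin: "finite I" and t: "t \<in> tableaux \<mu> I" and i: "i \<in> I"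
    and rect: "young_diagram \<mu> = {1..r} \<times> {1..q}"
  shows "(\<Sum>j\<in>I - {i}. polytabloid I t (T \<circ> Transposition.transpose i j)) =
    (of_nat q - of_nat r) * polytabloid I t T"
proof (cases "T \<in> tabloids \<mu> I")
  case False
  then show ?thesis
    using polytabloid_outside[OF t] tabloids_comp_iff[of "Transposition.transpose i j" I T \<mu> for j] i
    by (simp add: permutes_swap_id)
next
  case T: True
  have tbij: "bij_betw t I ({1..r} \<times> {1..q})" using t rect by (simp add: tableaux_def)
  define C where "C b = {k \<in> I. snd (t k) = b}" for b
  have finC: "finite (C b)" for b using fin by (simp add: C_def)
  have colC: "card (C b) = r" if "b \<in> {1..q}" for b
  proof -
    have "bij_betw t (C b) ({1..r} \<times> {b})"
      unfolding C_def using tbij that by (auto simp: bij_betw_def inj_on_def image_iff) (metis (no_types, lifting) SigmaE2 atLeastAtMost_iff mem_Sigma_iff imageE snd_conv)+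
    then show ?thesis using bij_betw_same_card by fastforce
  qed
  have Trow: "T k \<in> {1..r}" if k: "k \<in> I" for k
  proof -
    obtain s where s: "T = tabloid I s" "bij_betw s I ({1..r} \<times> {1..q})"
      using T rect by (auto simp: tabloids_def tableaux_def)
    then have "s k \<in> {1..r} \<times> {1..q}" using k by (auto simp: bij_betw_def)
    then show ?thesis using k s by (auto simp: tabloid_def)
  qed
  have anti: "polytabloid I t (T \<circ> Transposition.transpose x y) = - polytabloid I t T"
    if "x \<in> C b" "y \<in> C b" "x \<noteq> y" for x y b T
    using that polytabloid_antisym[OF fin column_stabilizer_transpose[of x I y t], of T]
    by (simp add: C_def sign_swap_id)
  define b where "b = snd (t i)"
  have iC: "i \<in> C b" using i by (simp add: C_def b_def)
  have "t i \<in> {1..r} \<times> {1..q}" using tbij i by (auto simp: bij_betw_def)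
  then have bq: "b \<in> {1..q}" by (auto simp: b_def)
  have part: "I - {i} = (C b - {i}) \<union> (\<Union>b'\<in>{1..q} - {b}. C b')"
    using tbij by (auto simp: C_def b_def bij_betw_def) (metis SigmaE atLeastAtMost_iff imageI snd_conv)+
  have "(\<Sum>j\<in>I - {i}. polytabloid I t (T \<circ> Transposition.transpose i j)) =
      (\<Sum>j\<in>C b - {i}. polytabloid I t (T \<circ> Transposition.transpose i j)) +
      (\<Sum>b'\<in>{1..q} - {b}. \<Sum>j\<in>C b'. polytabloid I t (T \<circ> Transposition.transpose i j))"
    unfolding part
    by (subst sum.union_disjoint, use finC in \<open>auto simp: C_def\<close>)
       (subst sum.UNION_disjoint, use finC in \<open>auto simp: C_def\<close>)
  also have "(\<Sum>j\<in>C b - {i}. polytabloid I t (T \<circ> Transposition.transpose i j)) = (\<Sum>j\<in>C b - {i}. - polytabloid I t T)"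
    by (rule sum.cong) (use anti[OF iC] in auto)
  also have "\<dots> = (1 - of_nat r) * polytabloid I t T"
  proof -
    have "r = Suc (card (C b - {i}))" using colC[OF bq] iC finC by (metis card_Suc_Diff1)
    then show ?thesis by simp
  qed
  also have "(\<Sum>b'\<in>{1..q} - {b}. \<Sum>j\<in>C b'. polytabloid I t (T \<circ> Transposition.transpose i j)) =
      (\<Sum>b'\<in>{1..q} - {b}. polytabloid I t T)"
  proof (rule sum.cong)
    fix b' assume b': "b' \<in> {1..q} - {b}"
    have iC': "i \<notin> C b'" using b' by (auto simp: C_def b_def)
    have "\<not> inj_on T (insert i (C b'))"
    proof
      assume inj: "inj_on T (insert i (C b'))"
      have "card (insert i (C b')) \<le> card {1..r}"
        by (rule card_inj_on_le[OF inj]) (use Trow i in \<open>auto simp: C_def\<close>)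
      then show False using iC' finC colC b' by simp
    qed
    then obtain x y where "x \<in> insert i (C b')" "y \<in> insert i (C b')" "x \<noteq> y" "T x = T y"
      unfolding inj_on_def by blast
    then show "(\<Sum>j\<in>C b'. polytabloid I t (T \<circ> Transposition.transpose i j)) = polytabloid I t T"
      using garnir[OF finC iC', of "polytabloid I t"] anti by blast
  qed simp
  also have "\<dots> = (of_nat q - 1) * polytabloid I t T"
  proof -
    have "card ({1..q} - {b}) = q - 1" "1 \<le> q" using bq by auto
    then show ?thesis by (simp add: of_nat_diff)
  qed
  finally show ?thesis by (simp add: algebra_simps comp_def)
qed

section \<open>Irreducible representations of the hyperoctahedral group\<close>

lemma function_space_simps [simp]: "carrier function_space = UNIV" "\<zero>\<^bsub>function_space\<^esub> = (\<lambda>x. 0)"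
  "f \<oplus>\<^bsub>function_space\<^esub> g = (\<lambda>x. f x + g x)" "a \<odot>\<^bsub>function_space\<^esub> f = (\<lambda>x. a * f x)"
  by (simp_all add: function_space_def)

lemma function_space_left_module: "left_module complex_ring (function_space :: (complex, 'x \<Rightarrow> complex) module)"
proof -
  interpret R: ring complex_ring by (rule ring_from_type_algebra)
  interpret V: abelian_group "function_space :: (complex, 'x \<Rightarrow> complex) module"
    by (rule abelian_groupI) (auto simp: algebra_simps fun_eq_iff intro: exI[of _ "\<lambda>z. - x z" for x])
  show ?thesis
    by unfold_locales (auto simp: algebra_simps)
qed

interpretation FS: left_module complex_ring "function_space :: (complex, 'x \<Rightarrow> complex) module"
  by (rule function_space_left_module)

lemma polytabloid_cong:
  assumes "\<And>k. k \<in> I \<Longrightarrow> t k = t' k" shows "polytabloid I t = polytabloid I t'"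
proof -
  have "column_stabilizer I t = column_stabilizer I t'"
    using assms by (auto simp: column_stabilizer_def permutes_in_image)
  moreover have "tabloid I (t \<circ> inv_into UNIV \<sigma>) = tabloid I (t' \<circ> inv_into UNIV \<sigma>)"
    if "\<sigma> \<in> column_stabilizer I t'" for \<sigma>
    using assms that permutes_in_image[OF permutes_inv, of \<sigma> I]
    by (auto simp: tabloid_def fun_eq_iff column_stabilizer_def)
  ultimately show ?thesis by (simp add: polytabloid_def fun_eq_iff)
qed

lemma polytabloid_real: "cnj (polytabloid I t T) = polytabloid I t T"
  unfolding polytabloid_def cnj_sum by (rule sum.cong) auto

definition tensor :: "('x \<Rightarrow> complex) \<Rightarrow> ('y \<Rightarrow> complex) \<Rightarrow> 'x \<times> 'y \<Rightarrow> complex" where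
  "tensor f g = (\<lambda>(T, U). f T * g U)"

lemma tensor_linear:
  "tensor (\<lambda>x. f x + f' x) g = (\<lambda>x. tensor f g x + tensor f' g x)"
  "tensor f (\<lambda>x. g x + g' x) = (\<lambda>x. tensor f g x + tensor f g' x)"
  "tensor (\<lambda>x. c * f x) g = (\<lambda>x. c * tensor f g x)" "tensor f (\<lambda>x. c * g x) = (\<lambda>x. c * tensor f g x)"
  "tensor (\<lambda>x. 0) g = (\<lambda>x. 0)" "tensor f (\<lambda>x. 0) = (\<lambda>x. 0)"
  by (auto simp: tensor_def fun_eq_iff algebra_simps)

text \<open>
  Throughout, \<open>Out\<close> is the external tensor product of the Specht modules, \<open>\<rho>\<close> the action of the block
  subgroup \<open>K\<close> on it, and \<open>V\<close> the induced representation of \<open>G\<close>. The elements \<open>E t u\<close> are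
  products of polytabloids, which span \<open>Out\<close>.
\<close>

locale bipartition_rep =
  fixes \<Lambda> :: "nat list \<times> nat list" and n :: nat
  assumes bipart: "bipartition n \<Lambda>"
begin

definition a where "a = sum_list (fst \<Lambda>)"
definition b where "b = sum_list (snd \<Lambda>)"

lemma n_eq: "n = a + b"
  using bipart by (simp add: bipartition_def a_def b_def)

definition I1 where "I1 = {1..a}"
definition I2 where "I2 = {a+1..a+b}"

lemma fin [simp]: "finite I1" "finite I2" by (simp_all add: I1_def I2_def)

lemma I12: "I1 \<inter> I2 = {}" "I1 \<union> I2 = {1..n}" by (auto simp: I1_def I2_def n_eq)

abbreviation "V \<equiv> irrep_space \<Lambda>"
abbreviation "act \<equiv> irrep_act \<Lambda>"
abbreviation "G \<equiv> carrier (HO n)"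

lemmas HO_simps [simp] = bmul_binv[of _ n] bmul_cancel[of _ n] binv_binv[of _ n]

definition Out :: "((nat \<Rightarrow> nat) \<times> (nat \<Rightarrow> nat) \<Rightarrow> complex) set" where
  "Out = carrier (outer_specht (fst \<Lambda>) (snd \<Lambda>))"

definition \<rho> where "\<rho> = outer_act a b"
definition K where "K = block_subgroup a b"

abbreviation "TB1 \<equiv> tabloids (fst \<Lambda>) I1"
abbreviation "TB2 \<equiv> tabloids (snd \<Lambda>) I2"

definition E :: "(nat \<Rightarrow> nat \<times> nat) \<Rightarrow> (nat \<Rightarrow> nat \<times> nat) \<Rightarrow> (nat \<Rightarrow> nat) \<times> (nat \<Rightarrow> nat) \<Rightarrow> complex" where
  "E t u = tensor (polytabloid I1 t) (polytabloid I2 u)"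

lemma Out_alt: "Out = gen_submodule complex_ring function_space
    {tensor f g | f g. f \<in> specht (fst \<Lambda>) I1 \<and> g \<in> specht (snd \<Lambda>) I2}"
  by (simp add: Out_def outer_specht_def Let_def tensor_def I1_def I2_def a_def b_def)

lemma Out_submodule: "submodule Out complex_ring function_space"
  unfolding Out_alt by (rule FS.submodule_gen) simp

lemma Out_simps [simp]: "(\<lambda>x. 0) \<in> Out" "F \<in> Out \<Longrightarrow> F' \<in> Out \<Longrightarrow> (\<lambda>x. F x + F' x) \<in> Out"
  "F \<in> Out \<Longrightarrow> (\<lambda>x. c * F x) \<in> Out"
  using submoduleD[OF Out_submodule] by simp_all

text \<open>
  A subspace that contains the products of polytabloids contains all products, by linearity in each
  factor.
\<close>

lemma Out_least:
  assumes N: "submodule N complex_ring function_space"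
    and E: "\<And>t u. t \<in> tableaux (fst \<Lambda>) I1 \<Longrightarrow> u \<in> tableaux (snd \<Lambda>) I2 \<Longrightarrow> E t u \<in> N"
  shows "Out \<subseteq> N"
proof -
  note N' = submoduleD[OF N, simplified]
  have 1: "tensor f (polytabloid I2 u) \<in> N" if "f \<in> specht (fst \<Lambda>) I1" "u \<in> tableaux (snd \<Lambda>) I2" for f u
  proof -
    have "submodule {f. tensor f (polytabloid I2 u) \<in> N} complex_ring function_space"
      by (rule FS.submoduleI) (simp_all add: tensor_linear N')
    then have "specht (fst \<Lambda>) I1 \<subseteq> {f. tensor f (polytabloid I2 u) \<in> N}"
      unfolding specht_def by (rule gen_submodule_least) (use E that(2) in \<open>auto simp: E_def\<close>)
    then show ?thesis using that by blast
  qed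
  have 2: "tensor f g \<in> N" if "f \<in> specht (fst \<Lambda>) I1" "g \<in> specht (snd \<Lambda>) I2" for f g
  proof -
    have "submodule {g. tensor f g \<in> N} complex_ring function_space"
      by (rule FS.submoduleI) (simp_all add: tensor_linear N')
    then have "specht (snd \<Lambda>) I2 \<subseteq> {g. tensor f g \<in> N}"
      unfolding specht_def by (rule gen_submodule_least) (use 1 that(1) in auto)
    then show ?thesis using that by blast
  qed
  show ?thesis unfolding Out_alt by (rule gen_submodule_least[OF N]) (use 2 in auto)
qed

lemma E_Out: "t \<in> tableaux (fst \<Lambda>) I1 \<Longrightarrow> u \<in> tableaux (snd \<Lambda>) I2 \<Longrightarrow> E t u \<in> Out"
  unfolding Out_alt E_def
  by (rule subsetD[OF gen_submodule_incl])
     (use subsetD[OF gen_submodule_incl[of "polytabloid I1 ` tableaux (fst \<Lambda>) I1" complex_ring function_space]]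
       subsetD[OF gen_submodule_incl[of "polytabloid I2 ` tableaux (snd \<Lambda>) I2" complex_ring function_space]]
       in \<open>unfold specht_def, blast\<close>)

lemma Out_support: "F \<in> Out \<Longrightarrow> T \<notin> TB1 \<or> U \<notin> TB2 \<Longrightarrow> F (T, U) = 0"
proof -
  let ?N = "{F. \<forall>T U. T \<notin> TB1 \<or> U \<notin> TB2 \<longrightarrow> F (T, U) = (0::complex)}"
  have "submodule ?N complex_ring function_space" by (rule FS.submoduleI) auto
  then have "Out \<subseteq> ?N" by (rule Out_least) (auto simp: E_def tensor_def polytabloid_outside)
  then show "F \<in> Out \<Longrightarrow> T \<notin> TB1 \<or> U \<notin> TB2 \<Longrightarrow> F (T, U) = 0" by blast
qed


subsection \<open>The block subgroup\<close>

lemma K_iff: "g \<in> K \<longleftrightarrow> g \<in> G \<and> snd g ` I1 = I1"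
  by (simp add: K_def block_subgroup_def n_eq I1_def)

lemma K_G [simp]: "g \<in> K \<Longrightarrow> g \<in> G" by (simp add: K_iff)

lemma K_image2: "g \<in> K \<Longrightarrow> snd g ` I2 = I2"
proof -
  assume g: "g \<in> K"
  then have p: "snd g permutes {1..n}" using HO_permutes K_iff by blast
  have "I2 = {1..n} - I1" using I12 by blast
  then show ?thesis
    using permutes_image[OF p] permutes_inj[OF p] g K_iff by (simp add: image_set_diff)
qed

lemma K_in1: "g \<in> K \<Longrightarrow> snd g k \<in> I1 \<longleftrightarrow> k \<in> I1"
proof -
  assume g: "g \<in> K"
  then have "inj (snd g)" using HO_bij K_G bij_is_inj by blast
  moreover have "snd g ` I1 = I1" using g K_iff by blast
  ultimately show ?thesis by (metis image_eqI inj_image_mem_iff)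
qed

lemma K_in2: "g \<in> K \<Longrightarrow> snd g k \<in> I2 \<longleftrightarrow> k \<in> I2"
proof -
  assume g: "g \<in> K"
  then have "inj (snd g)" using HO_bij K_G bij_is_inj by blast
  then show ?thesis using K_image2[OF g] by (metis inj_image_mem_iff)
qed

lemma bone_K [simp]: "bone \<in> K" by (simp add: K_iff) (simp add: bone_def)

lemma bmul_K [simp]:
  assumes "g \<in> K" "h \<in> K" shows "bmul g h \<in> K"
proof -
  have "snd (bmul g h) ` I1 = snd g ` (snd h ` I1)" by (simp add: bmul_def image_comp)
  then show ?thesis using assms by (simp add: K_iff)
qed

lemma binv_K [simp]: "g \<in> K \<Longrightarrow> binv g \<in> K"
proof -
  assume g: "g \<in> K"
  then have "inv_into UNIV (snd g) ` (snd g ` I1) = I1"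
    using HO_inv_simps(2)[OF K_G[OF g]] by (simp add: image_comp)
  then show ?thesis using g by (simp add: K_iff) (simp add: binv_def)
qed

lemma bmul_K_iff: "g \<in> G \<Longrightarrow> k \<in> K \<Longrightarrow> bmul g k \<in> K \<longleftrightarrow> g \<in> K"
proof
  assume g: "g \<in> G" "k \<in> K" "bmul g k \<in> K"
  have "g = bmul (bmul g k) (binv k)" using g by (simp add: bmul_assoc[of _ n] bmul_binv(1)[OF K_G[OF g(2)]])
  then show "g \<in> K" using g by (metis bmul_K binv_K)
qed simp

text \<open>
  The restrictions of a permutation to the two blocks, extended by the identity
\<close>

definition r1 :: "(nat \<Rightarrow> nat) \<Rightarrow> nat \<Rightarrow> nat" where "r1 \<sigma> k = (if k \<in> I1 then \<sigma> k else k)"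
definition r2 :: "(nat \<Rightarrow> nat) \<Rightarrow> nat \<Rightarrow> nat" where "r2 \<sigma> k = (if k \<in> I2 then \<sigma> k else k)"

lemma r_permutes: assumes "g \<in> K" shows "r1 (snd g) permutes I1" "r2 (snd g) permutes I2"
proof -
  have inj: "inj (snd g)" using HO_bij K_G bij_is_inj assms by blast
  show "r1 (snd g) permutes I1"
    by (rule bij_imp_permutes)
       (use assms inj in \<open>auto simp: r1_def bij_betw_def K_iff inj_on_def intro: injD\<close>)
  show "r2 (snd g) permutes I2"
    by (rule bij_imp_permutes)
       (use K_image2[OF assms] inj in \<open>auto simp: r2_def bij_betw_def inj_on_def intro: injD\<close>)
qed

lemma comp_r:
  assumes "g \<in> K"
  shows "(\<And>k. k \<notin> I1 \<Longrightarrow> T k = (0::nat)) \<Longrightarrow> T \<circ> snd g = T \<circ> r1 (snd g)"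
    and "(\<And>k. k \<notin> I2 \<Longrightarrow> U k = (0::nat)) \<Longrightarrow> U \<circ> snd g = U \<circ> r2 (snd g)"
  using K_in1[OF assms] K_in2[OF assms] by (auto simp: fun_eq_iff r1_def r2_def)

lemma TB_comp:
  assumes "g \<in> K"
  shows "T \<in> TB1 \<Longrightarrow> T \<circ> snd g = T \<circ> r1 (snd g)" "U \<in> TB2 \<Longrightarrow> U \<circ> snd g = U \<circ> r2 (snd g)"
    "T \<circ> snd g \<in> TB1 \<longleftrightarrow> T \<in> TB1" "U \<circ> snd g \<in> TB2 \<longleftrightarrow> U \<in> TB2"
proof -
  have 1: "T \<in> TB1 \<Longrightarrow> T \<circ> snd g = T \<circ> r1 (snd g)" "U \<in> TB2 \<Longrightarrow> U \<circ> snd g = U \<circ> r2 (snd g)"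
    if "g \<in> K" for T U g
    using comp_r[OF that] tabloids_outside by blast+
  have 2: "T \<in> TB1 \<Longrightarrow> T \<circ> snd g \<in> TB1" "U \<in> TB2 \<Longrightarrow> U \<circ> snd g \<in> TB2" if "g \<in> K" for T U g
    using 1[OF that] tabloids_comp r_permutes[OF that] by simp_all
  have inv: "Z \<circ> snd g \<circ> snd (binv g) = Z" for Z :: "nat \<Rightarrow> nat"
    using HO_inv_simps(1)[OF K_G[OF assms]] by (auto simp: binv_def)
  show "T \<circ> snd g \<in> TB1 \<longleftrightarrow> T \<in> TB1" "U \<circ> snd g \<in> TB2 \<longleftrightarrow> U \<in> TB2"
    using 2[OF assms] 2(1)[OF binv_K[OF assms], of "T \<circ> snd g"] 2(2)[OF binv_K[OF assms], of "U \<circ> snd g"] inv by auto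
  show "T \<in> TB1 \<Longrightarrow> T \<circ> snd g = T \<circ> r1 (snd g)" "U \<in> TB2 \<Longrightarrow> U \<circ> snd g = U \<circ> r2 (snd g)"
    using 1[OF assms] by blast+
qed

text \<open>
  The scalar by which the sign changes of a group element act: those in the first block act trivially.
\<close>

definition sgn2 :: "signed_perm \<Rightarrow> complex" where "sgn2 g = of_int (\<Prod>k\<in>I2. fst g k)"

lemma \<rho>_eq: "\<rho> g F = (\<lambda>(T, U). sgn2 g * F (T \<circ> snd g, U \<circ> snd g))"
  by (simp add: \<rho>_def outer_act_def sgn2_def I2_def)

lemma \<rho>_linear: "\<rho> g (\<lambda>x. F x + F' x) = (\<lambda>x. \<rho> g F x + \<rho> g F' x)" "\<rho> g (\<lambda>x. c * F x) = (\<lambda>x. c * \<rho> g F x)"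
  "\<rho> g (\<lambda>x. 0) = (\<lambda>x. 0)"
  by (auto simp: \<rho>_eq fun_eq_iff algebra_simps)

lemma sgn2_mult: "g \<in> K \<Longrightarrow> h \<in> K \<Longrightarrow> sgn2 (bmul g h) = sgn2 g * sgn2 h"
proof -
  assume g: "g \<in> K" and h: "h \<in> K"
  have "inj (inv_into UNIV (snd g))" using HO_bij[OF K_G[OF g]] by (simp add: bij_imp_bij_inv bij_is_inj)
  then have bij: "bij_betw (inv_into UNIV (snd g)) I2 I2"
    using K_image2[OF binv_K[OF g]] by (auto simp: binv_def bij_betw_def intro: inj_on_subset)
  have "(\<Prod>k\<in>I2. fst h (inv_into UNIV (snd g) k)) = (\<Prod>k\<in>I2. fst h k)"
    by (rule prod.reindex_bij_betw[OF bij])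
  then show ?thesis by (simp add: sgn2_def bmul_def prod.distrib)
qed

lemma \<rho>_bmul: "g \<in> K \<Longrightarrow> h \<in> K \<Longrightarrow> \<rho> (bmul g h) F = \<rho> g (\<rho> h F)"
  by (auto simp: \<rho>_eq sgn2_mult fun_eq_iff) (simp add: bmul_def comp_assoc)

lemma \<rho>_bone [simp]: "\<rho> bone F = F"
  by (auto simp: \<rho>_eq sgn2_def bone_def fun_eq_iff)

lemma polytabloid_comp:
  assumes "g \<in> K"
  shows "t \<in> tableaux (fst \<Lambda>) I1 \<Longrightarrow>
      polytabloid I1 t (T \<circ> snd g) = polytabloid I1 (t \<circ> inv_into UNIV (r1 (snd g))) T"
    and "u \<in> tableaux (snd \<Lambda>) I2 \<Longrightarrow>
      polytabloid I2 u (T \<circ> snd g) = polytabloid I2 (u \<circ> inv_into UNIV (r2 (snd g))) T"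
proof -
  note p = r_permutes[OF assms]
  show "polytabloid I1 t (T \<circ> snd g) = polytabloid I1 (t \<circ> inv_into UNIV (r1 (snd g))) T"
    if t: "t \<in> tableaux (fst \<Lambda>) I1"
  proof (cases "T \<in> TB1")
    case True
    then show ?thesis using polytabloid_permute[OF fin(1) p(1)] TB_comp(1)[OF assms True] by simp
  next
    case False
    then show ?thesis
      using polytabloid_outside[OF t] TB_comp(3)[OF assms, of T]
        polytabloid_outside[OF tableaux_comp[OF permutes_inv[OF p(1)] t]] by simp
  qed
  show "polytabloid I2 u (T \<circ> snd g) = polytabloid I2 (u \<circ> inv_into UNIV (r2 (snd g))) T"
    if u: "u \<in> tableaux (snd \<Lambda>) I2"
  proof (cases "T \<in> TB2")
    case True
    then show ?thesis using polytabloid_permute[OF fin(2) p(2)] TB_comp(2)[OF assms True] by simp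
  next
    case False
    then show ?thesis
      using polytabloid_outside[OF u] TB_comp(4)[OF assms, of T]
        polytabloid_outside[OF tableaux_comp[OF permutes_inv[OF p(2)] u]] by simp
  qed
qed

lemma \<rho>_E:
  assumes "g \<in> K" "t \<in> tableaux (fst \<Lambda>) I1" "u \<in> tableaux (snd \<Lambda>) I2"
  shows "\<rho> g (E t u) = (\<lambda>x. sgn2 g * E (t \<circ> inv_into UNIV (r1 (snd g))) (u \<circ> inv_into UNIV (r2 (snd g))) x)"
  using polytabloid_comp(1)[OF assms(1,2)] polytabloid_comp(2)[OF assms(1,3)]
  by (auto simp: \<rho>_eq E_def tensor_def fun_eq_iff)

lemma \<rho>_Out: assumes "g \<in> K" "F \<in> Out" shows "\<rho> g F \<in> Out"
proof -
  have "submodule {F. \<rho> g F \<in> Out} complex_ring function_space"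
    by (rule FS.submoduleI) (auto simp: \<rho>_linear)
  then have "Out \<subseteq> {F. \<rho> g F \<in> Out}"
    by (rule Out_least)
       (simp add: \<rho>_E assms E_Out tableaux_comp permutes_inv r_permutes)
  then show ?thesis using assms by blast
qed


subsection \<open>The induced representation\<close>

lemma V_iff: "v \<in> carrier V \<longleftrightarrow> (\<forall>g\<in>G. v g \<in> Out) \<and> (\<forall>g. g \<notin> G \<longrightarrow> v g = undefined) \<and>
    (\<forall>g\<in>G. \<forall>k\<in>K. v (bmul g k) = \<rho> (binv k) (v g))"
  unfolding irrep_space_def induced_rep_space_def Let_def
  using n_eq K_G
  by (auto simp: HO_mult HO_inv PiE_iff extensional_def Out_def K_def \<rho>_def a_def b_def)

lemma V_zero: "\<zero>\<^bsub>V\<^esub> = (\<lambda>g\<in>G. \<lambda>x. 0)"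
  and V_add: "v \<oplus>\<^bsub>V\<^esub> w = (\<lambda>g\<in>G. \<lambda>x. v g x + w g x)"
  and V_smult: "c \<odot>\<^bsub>V\<^esub> v = (\<lambda>g\<in>G. \<lambda>x. c * v g x)"
  using n_eq
  by (simp_all add: irrep_space_def induced_rep_space_def Let_def outer_specht_def a_def b_def
      function_space_def)

lemma act_eq: "h \<in> G \<Longrightarrow> act h v = (\<lambda>g\<in>G. v (bmul (binv h) g))"
  using n_eq by (simp add: irrep_act_def induced_rep_act_def HO_inv HO_mult a_def b_def)

lemma V_ext: "v \<in> carrier V \<Longrightarrow> w \<in> carrier V \<Longrightarrow> (\<And>g x. g \<in> G \<Longrightarrow> v g x = w g x) \<Longrightarrow> v = w"
  unfolding V_iff by (metis ext)

lemma V_closed: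
  assumes "v \<in> carrier V" "w \<in> carrier V"
  shows "v \<oplus>\<^bsub>V\<^esub> w \<in> carrier V" "c \<odot>\<^bsub>V\<^esub> v \<in> carrier V" "h \<in> G \<Longrightarrow> act h v \<in> carrier V"
  using assms unfolding V_iff
  by (simp_all add: V_add V_smult act_eq \<rho>_linear bmul_assoc[of _ n, symmetric])

lemma V_left_module: "left_module complex_ring V"
proof -
  interpret R: ring complex_ring by (rule ring_from_type_algebra)
  have z: "\<zero>\<^bsub>V\<^esub> \<in> carrier V" unfolding V_iff V_zero by (simp add: \<rho>_linear)
  interpret V: abelian_group V
  proof (rule abelian_groupI)
    fix x assume x: "x \<in> carrier V"
    have "((-1) \<odot>\<^bsub>V\<^esub> x) \<oplus>\<^bsub>V\<^esub> x = \<zero>\<^bsub>V\<^esub>" by (simp add: V_add V_smult V_zero fun_eq_iff)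
    then show "\<exists>y\<in>carrier V. y \<oplus>\<^bsub>V\<^esub> x = \<zero>\<^bsub>V\<^esub>" using V_closed(2)[OF x x] by blast
    show "\<zero>\<^bsub>V\<^esub> \<oplus>\<^bsub>V\<^esub> x = x" using x by (auto simp: V_iff V_add V_zero fun_eq_iff)
  qed (auto simp: V_closed z, auto simp: V_add algebra_simps fun_eq_iff)
  show ?thesis
  proof unfold_locales
    fix x assume "x \<in> carrier V"
    then show "\<one>\<^bsub>complex_ring\<^esub> \<odot>\<^bsub>V\<^esub> x = x" by (auto simp: V_iff V_smult fun_eq_iff)
  qed (auto simp: V_closed, auto simp: V_add V_smult algebra_simps fun_eq_iff)
qed

sublocale V: left_module complex_ring V by (rule V_left_module)

lemma act_linear:
  assumes "h \<in> G"
  shows "act h (v \<oplus>\<^bsub>V\<^esub> w) = act h v \<oplus>\<^bsub>V\<^esub> act h w" "act h (c \<odot>\<^bsub>V\<^esub> v) = c \<odot>\<^bsub>V\<^esub> act h v"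
  using assms by (auto simp: act_eq V_add V_smult fun_eq_iff)

lemma act_bmul:
  assumes "g \<in> G" "h \<in> G" shows "act (bmul g h) v = act g (act h v)"
  using assms by (auto simp: act_eq fun_eq_iff binv_bmul bmul_assoc[of _ n])

lemma act_bone: "v \<in> carrier V \<Longrightarrow> act bone v = v"
  by (auto simp: act_eq V_iff fun_eq_iff binv_bone)

definition subrep :: "irrep_vec set \<Rightarrow> bool" where
  "subrep U \<longleftrightarrow> submodule U complex_ring V \<and> (\<forall>g\<in>G. \<forall>v\<in>U. act g v \<in> U)"

lemma subrepI:
  assumes "U \<subseteq> carrier V" "\<zero>\<^bsub>V\<^esub> \<in> U" "\<And>v w. v \<in> U \<Longrightarrow> w \<in> U \<Longrightarrow> v \<oplus>\<^bsub>V\<^esub> w \<in> U"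
    "\<And>c v. v \<in> U \<Longrightarrow> c \<odot>\<^bsub>V\<^esub> v \<in> U" "\<And>g v. g \<in> G \<Longrightarrow> v \<in> U \<Longrightarrow> act g v \<in> U"
  shows "subrep U"
  using assms unfolding subrep_def by (auto intro!: V.submoduleI)

lemma subrepD:
  assumes "subrep U"
  shows "U \<subseteq> carrier V" "\<zero>\<^bsub>V\<^esub> \<in> U" "\<And>v w. v \<in> U \<Longrightarrow> w \<in> U \<Longrightarrow> v \<oplus>\<^bsub>V\<^esub> w \<in> U"
    "\<And>c v. v \<in> U \<Longrightarrow> c \<odot>\<^bsub>V\<^esub> v \<in> U" "\<And>g v. g \<in> G \<Longrightarrow> v \<in> U \<Longrightarrow> act g v \<in> U"
  using assms submoduleD[of U complex_ring V] unfolding subrep_def by auto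

lemma subrep_V: "subrep (carrier V)"
  by (rule subrepI) (auto simp: V_closed)

text \<open>The action of the element \<open>\<Sum> c\<^sub>s \<gamma>\<^sub>s\<^sup>-\<^sup>1\<close> of the group algebra\<close>

definition group_comb :: "'s set \<Rightarrow> ('s \<Rightarrow> complex) \<Rightarrow> ('s \<Rightarrow> signed_perm) \<Rightarrow> irrep_vec \<Rightarrow> irrep_vec" where
  "group_comb S c \<gamma> v = (\<lambda>g\<in>G. \<lambda>x. \<Sum>s\<in>S. c s * v (bmul (\<gamma> s) g) x)"

lemma group_comb_empty: "group_comb {} c \<gamma> v = \<zero>\<^bsub>V\<^esub>"
  by (simp only: group_comb_def V_zero sum.empty)

lemma group_comb_insert:
  assumes "finite S" "s \<notin> S" "\<gamma> s \<in> G"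
  shows "group_comb (insert s S) c \<gamma> v = (c s \<odot>\<^bsub>V\<^esub> act (binv (\<gamma> s)) v) \<oplus>\<^bsub>V\<^esub> group_comb S c \<gamma> v"
  using assms by (auto simp: group_comb_def V_add V_smult act_eq fun_eq_iff)

lemma group_comb_gsub:
  assumes U: "subrep U" and "finite S" "\<And>s. s \<in> S \<Longrightarrow> \<gamma> s \<in> G" "v \<in> U"
  shows "group_comb S c \<gamma> v \<in> U"
  using assms(2-4)
proof (induction S)
  case empty
  then show ?case using subrepD(2)[OF U] by (simp add: group_comb_empty)
next
  case (insert s S)
  then show ?case using subrepD[OF U] by (simp add: group_comb_insert)
qed

text \<open>
  The copy of \<open>Out\<close> in the induced representation: functions supported on the identity coset.
\<close>

definition coset_vec :: "((nat \<Rightarrow> nat) \<times> (nat \<Rightarrow> nat) \<Rightarrow> complex) \<Rightarrow> irrep_vec" where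
  "coset_vec F = (\<lambda>g\<in>G. if g \<in> K then \<rho> (binv g) F else (\<lambda>x. 0))"

lemma coset_vec_V: "F \<in> Out \<Longrightarrow> coset_vec F \<in> carrier V"
proof -
  assume F: "F \<in> Out"
  have "coset_vec F (bmul g k) = \<rho> (binv k) (coset_vec F g)" if "g \<in> G" "k \<in> K" for g k
    using that by (auto simp: coset_vec_def bmul_K_iff binv_bmul[of _ n] \<rho>_bmul \<rho>_linear)
  then show ?thesis unfolding V_iff using F by (auto simp: coset_vec_def \<rho>_Out)
qed

lemma coset_vec_linear: "coset_vec (\<lambda>x. F x + F' x) = coset_vec F \<oplus>\<^bsub>V\<^esub> coset_vec F'"
  "coset_vec (\<lambda>x. c * F x) = c \<odot>\<^bsub>V\<^esub> coset_vec F" "coset_vec (\<lambda>x. 0) = \<zero>\<^bsub>V\<^esub>"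
  by (auto simp: coset_vec_def V_add V_smult V_zero \<rho>_linear fun_eq_iff)

lemma act_coset_vec:
  assumes k: "k \<in> K" shows "act k (coset_vec F) = coset_vec (\<rho> k F)"
proof (rule ext)
  fix g
  have "bmul (binv k) g \<in> K \<longleftrightarrow> g \<in> K" if "g \<in> G"
  proof
    assume "bmul (binv k) g \<in> K"
    then have "bmul k (bmul (binv k) g) \<in> K" using k bmul_K by blast
    then show "g \<in> K" by (simp only: bmul_cancel(1)[OF K_G[OF k]])
  qed (use k in simp)
  then show "act k (coset_vec F) g = coset_vec (\<rho> k F) g"
    using k by (auto simp: act_eq coset_vec_def binv_bmul[of _ n] \<rho>_bmul)
qed


text \<open>The character \<open>sign\<close> of the subgroup that fixes the columns of \<open>t\<close> and \<open>u\<close>, with sign changes in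
  the first block only\<close>

definition Q :: "(nat \<Rightarrow> nat \<times> nat) \<Rightarrow> (nat \<Rightarrow> nat \<times> nat) \<Rightarrow> signed_perm set" where
  "Q t u = {q \<in> K. (\<forall>k\<in>I2. fst q k = 1) \<and> r1 (snd q) \<in> column_stabilizer I1 t \<and>
     r2 (snd q) \<in> column_stabilizer I2 u}"

definition \<chi> :: "signed_perm \<Rightarrow> complex" where "\<chi> q = of_int (sign (snd q))"

lemma Q_K: "q \<in> Q t u \<Longrightarrow> q \<in> K" by (simp add: Q_def)

lemma finite_Q [simp]: "finite (Q t u)"
  by (rule finite_subset[OF _ HO_finite[of n]]) (auto simp: Q_def)

lemma r_comp:
  assumes "g \<in> K" "h \<in> K"
  shows "r1 (snd (bmul g h)) = r1 (snd g) \<circ> r1 (snd h)" "r2 (snd (bmul g h)) = r2 (snd g) \<circ> r2 (snd h)"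
  using K_in1[OF assms(2)] K_in2[OF assms(2)] by (auto simp: r1_def r2_def bmul_def fun_eq_iff)

lemma Q_bmul: "p \<in> Q t u \<Longrightarrow> q \<in> Q t u \<Longrightarrow> bmul p q \<in> Q t u"
proof -
  assume p: "p \<in> Q t u" and q: "q \<in> Q t u"
  have "inv_into UNIV (snd p) k \<in> I2" if "k \<in> I2" for k
    using that K_in2[OF binv_K[OF Q_K[OF p]], of k] by (simp add: binv_def)
  then have "\<forall>k\<in>I2. fst (bmul p q) k = 1" using p q by (simp add: Q_def bmul_def)
  then show ?thesis
    using p q r_comp[OF Q_K[OF p] Q_K[OF q]] by (auto simp: Q_def intro: column_stabilizer_comp)
qed

lemma r_inv:
  assumes "g \<in> K"
  shows "r1 (snd (binv g)) = inv_into UNIV (r1 (snd g))" "r2 (snd (binv g)) = inv_into UNIV (r2 (snd g))"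
proof -
  have "r1 id = id" "r2 id = id" by (auto simp: r1_def r2_def)
  then have "r1 (snd (binv g)) \<circ> r1 (snd g) = id" "r2 (snd (binv g)) \<circ> r2 (snd g) = id"
    using r_comp[OF binv_K[OF assms] assms] assms by (simp_all add: bone_def)
  then show "r1 (snd (binv g)) = inv_into UNIV (r1 (snd g))" "r2 (snd (binv g)) = inv_into UNIV (r2 (snd g))"
    using r_permutes[OF assms] by (metis comp_assoc comp_id id_comp permutes_inv_o(1))+
qed

lemma Q_binv: "q \<in> Q t u \<Longrightarrow> binv q \<in> Q t u"
proof -
  assume q: "q \<in> Q t u"
  have "\<forall>k\<in>I2. fst (binv q) k = 1"
    using q K_in2[OF Q_K[OF q]] by (simp add: Q_def binv_def)
  then show ?thesis
    using q r_inv[OF Q_K[OF q]] by (simp add: Q_def column_stabilizer_inv)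
qed

lemma bone_Q [simp]: "bone \<in> Q t u"
proof -
  have "r1 id = id" "r2 id = id" by (auto simp: r1_def r2_def)
  then show ?thesis by (simp add: Q_def) (simp add: bone_def column_stabilizer_def permutes_id)
qed

lemma \<chi>_bmul: "p \<in> G \<Longrightarrow> q \<in> G \<Longrightarrow> \<chi> (bmul p q) = \<chi> p * \<chi> q"
  using sign_comp[OF finite_atLeastAtMost HO_permutes[of p n] HO_permutes[of q n]] by (simp add: \<chi>_def bmul_def)

lemma \<chi>_binv: "q \<in> G \<Longrightarrow> \<chi> (binv q) = \<chi> q"
  using sign_inv[OF finite_atLeastAtMost HO_permutes[of q n]] by (simp add: \<chi>_def binv_def)

lemma \<chi>_sq: "\<chi> q * \<chi> q = 1"
  by (simp add: \<chi>_def flip: of_int_mult)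

lemma perm_Q:
  "\<sigma> \<in> column_stabilizer I1 t \<Longrightarrow> (\<lambda>k. 1, \<sigma>) \<in> Q t u"
  "\<sigma> \<in> column_stabilizer I2 u \<Longrightarrow> (\<lambda>k. 1, \<sigma>) \<in> Q t u"
proof -
  have G: "(\<lambda>k. 1, \<sigma>) \<in> G" if "\<sigma> permutes I1 \<or> \<sigma> permutes I2" for \<sigma> :: "nat \<Rightarrow> nat"
    using that permutes_subset[of \<sigma> _ "{1..n}"] I12 unfolding HO_carrier by (metis Un_upper1 Un_upper2 fst_conv insertI1 snd_conv)
  have id: "id \<in> column_stabilizer I1 t" "id \<in> column_stabilizer I2 u"
    by (simp_all add: column_stabilizer_def permutes_id)
  show "(\<lambda>k. 1, \<sigma>) \<in> Q t u" if \<sigma>: "\<sigma> \<in> column_stabilizer I1 t"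
  proof -
    have p: "\<sigma> permutes I1" using \<sigma> by (simp add: column_stabilizer_def)
    have "r1 \<sigma> = \<sigma>" "r2 \<sigma> = id"
      using I12 permutes_not_in[OF p] by (auto simp: r1_def r2_def fun_eq_iff)
    then show ?thesis using \<sigma> id G p by (simp add: Q_def K_iff permutes_image)
  qed
  show "(\<lambda>k. 1, \<sigma>) \<in> Q t u" if \<sigma>: "\<sigma> \<in> column_stabilizer I2 u"
  proof -
    have p: "\<sigma> permutes I2" using \<sigma> by (simp add: column_stabilizer_def)
    have r: "r1 \<sigma> = id" "r2 \<sigma> = \<sigma>"
      using I12 permutes_not_in[OF p] by (auto simp: r1_def r2_def fun_eq_iff)
    have "\<sigma> k = k" if "k \<in> I1" for k using that I12 permutes_not_in[OF p] by blast
    then have "\<sigma> ` I1 = I1" by force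
    then show ?thesis using \<sigma> id G p r by (simp add: Q_def K_iff)
  qed
qed

lemma sgn2_Q: "q \<in> Q t u \<Longrightarrow> sgn2 q = 1"
  by (simp add: sgn2_def Q_def)

lemma \<chi>_split: "q \<in> K \<Longrightarrow> \<chi> q = of_int (sign (r1 (snd q))) * of_int (sign (r2 (snd q)))"
proof -
  assume q: "q \<in> K"
  have "snd q = r1 (snd q) \<circ> r2 (snd q)"
  proof
    fix k
    have "k \<notin> {1..n} \<Longrightarrow> snd q k = k" using permutes_not_in[OF HO_permutes[OF K_G[OF q]]] by blast
    then show "snd q k = (r1 (snd q) \<circ> r2 (snd q)) k"
      using I12 K_in2[OF q, of k] by (auto simp: r1_def r2_def)
  qed
  moreover have "r1 (snd q) permutes {1..n}" "r2 (snd q) permutes {1..n}"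
    using r_permutes[OF q] I12 by (auto intro: permutes_subset)
  ultimately show ?thesis
    using sign_comp[of "{1..n}" "r1 (snd q)" "r2 (snd q)"] by (simp add: \<chi>_def flip: of_int_mult)
qed

lemma E_unique:
  assumes t: "t \<in> tableaux (fst \<Lambda>) I1" and u: "u \<in> tableaux (snd \<Lambda>) I2"
    and supp: "\<And>T U. T \<notin> TB1 \<or> U \<notin> TB2 \<Longrightarrow> F (T, U) = 0"
    and anti: "\<And>q T U. q \<in> Q t u \<Longrightarrow> F (T \<circ> snd q, U \<circ> snd q) = \<chi> q * F (T, U)"
  shows "F = (\<lambda>x. F (tabloid I1 t, tabloid I2 u) * E t u x)"
proof -
  have part: "is_partition (fst \<Lambda>)" "is_partition (snd \<Lambda>)" using bipart by (simp_all add: bipartition_def)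
  have out: "U \<circ> \<sigma> = U" if "\<sigma> permutes A" "\<And>k. k \<in> A \<Longrightarrow> U k = 0" for \<sigma> A and U :: "nat \<Rightarrow> nat"
  proof
    fix k show "(U \<circ> \<sigma>) k = U k"
      using that permutes_not_in[OF that(1), of k] permutes_in_image[OF that(1), of k] by (cases "k \<in> A") auto
  qed
  have 1: "F (T, U) = F (tabloid I1 t, U) * polytabloid I1 t T" for T U
  proof (cases "U \<in> TB2")
    case U: True
    show ?thesis
    proof (rule polytabloid_unique[OF part(1) fin(1) t, of "\<lambda>T. F (T, U)"])
      fix T \<sigma> assume \<sigma>: "\<sigma> \<in> column_stabilizer I1 t"
      have "U \<circ> \<sigma> = U"
        by (rule out[of _ I1]) (use \<sigma> I12 tabloids_outside[OF U] in \<open>auto simp: column_stabilizer_def\<close>)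
      then show "F (T \<circ> \<sigma>, U) = of_int (sign \<sigma>) * F (T, U)"
        using anti[OF perm_Q(1)[OF \<sigma>], of T U] by (simp add: \<chi>_def)
    qed (use supp in auto)
  qed (use supp in simp)
  have 2: "F (T, U) = F (T, tabloid I2 u) * polytabloid I2 u U" for T U
  proof (cases "T \<in> TB1")
    case T: True
    show ?thesis
    proof (rule polytabloid_unique[OF part(2) fin(2) u, of "\<lambda>U. F (T, U)"])
      fix U \<sigma> assume \<sigma>: "\<sigma> \<in> column_stabilizer I2 u"
      have "T \<circ> \<sigma> = T"
        by (rule out[of _ I2]) (use \<sigma> I12 tabloids_outside[OF T] in \<open>auto simp: column_stabilizer_def\<close>)
      then show "F (T, U \<circ> \<sigma>) = of_int (sign \<sigma>) * F (T, U)"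
        using anti[OF perm_Q(2)[OF \<sigma>], of T U] by (simp add: \<chi>_def)
    qed (use supp in auto)
  qed (use supp in simp)
  show ?thesis
  proof
    fix x :: "(nat \<Rightarrow> nat) \<times> (nat \<Rightarrow> nat)"
    obtain T U where x: "x = (T, U)" by (cases x)
    show "F x = F (tabloid I1 t, tabloid I2 u) * E t u x"
      using 1[of T U] 2[of "tabloid I1 t" U] by (simp add: x E_def tensor_def)
  qed
qed

lemma E_antisym:
  assumes q: "q \<in> Q t u" and t: "t \<in> tableaux (fst \<Lambda>) I1" and u: "u \<in> tableaux (snd \<Lambda>) I2"
  shows "E t u (T \<circ> snd q, U \<circ> snd q) = \<chi> q * E t u (T, U)"
proof -
  have st: "r1 (snd q) \<in> column_stabilizer I1 t" "r2 (snd q) \<in> column_stabilizer I2 u" using q by (simp_all add: Q_def)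
  show ?thesis
  proof (cases "T \<in> TB1 \<and> U \<in> TB2")
    case True
    then show ?thesis
      using TB_comp(1,2)[OF Q_K[OF q]] polytabloid_antisym[OF fin(1) st(1), of T] polytabloid_antisym[OF fin(2) st(2), of U]
      by (simp add: E_def tensor_def \<chi>_split[OF Q_K[OF q]])
  next
    case False
    then show ?thesis
      using TB_comp(3,4)[OF Q_K[OF q]] polytabloid_outside[OF t] polytabloid_outside[OF u]
      by (auto simp: E_def tensor_def)
  qed
qed

lemma E_self: "t \<in> tableaux (fst \<Lambda>) I1 \<Longrightarrow> u \<in> tableaux (snd \<Lambda>) I2 \<Longrightarrow> E t u (tabloid I1 t, tabloid I2 u) = 1"
  by (simp add: E_def tensor_def polytabloid_self)

text \<open>
  The line on which \<open>Q t u\<close> acts by the character. A vector in it vanishes on every other coset \<open>g K\<close>: there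
  is an \<open>i\<close> in the first block such that \<open>g\<^sup>-\<^sup>1 \<zeta>\<^sub>i g\<close> is a sign change in the second block, so that
  \<open>\<zeta>\<^sub>i\<close> acts on the value at \<open>g\<close> by \<open>-1\<close>, whereas the character has the value \<open>1\<close> at \<open>\<zeta>\<^sub>i\<close>.
  On the identity coset the claim is \<open>E_unique\<close>.
\<close>

lemma coset_line:
  assumes t: "t \<in> tableaux (fst \<Lambda>) I1" and u: "u \<in> tableaux (snd \<Lambda>) I2" and v: "v \<in> carrier V"
    and eig: "\<And>q. q \<in> Q t u \<Longrightarrow> act q v = \<chi> q \<odot>\<^bsub>V\<^esub> v"
  shows "v = v bone (tabloid I1 t, tabloid I2 u) \<odot>\<^bsub>V\<^esub> coset_vec (E t u)"
proof -
  note V = v[unfolded V_iff]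
  have off: "v g = (\<lambda>x. 0)" if g: "g \<in> G" "g \<notin> K" for g
  proof -
    have gi: "binv g \<in> G" "binv g \<notin> K" using g binv_K[of "binv g"] by auto
    have "\<exists>i\<in>I1. snd (binv g) i \<notin> I1"
    proof (rule ccontr)
      assume "\<not> ?thesis"
      then have "snd (binv g) ` I1 \<subseteq> I1" by blast
      moreover have "inj_on (snd (binv g)) I1" using HO_bij[OF gi(1)] bij_is_inj inj_on_subset by blast
      ultimately have "snd (binv g) ` I1 = I1" by (simp add: endo_inj_surj)
      then show False using gi by (simp add: K_iff)
    qed
    then obtain i where i: "i \<in> I1" "snd (binv g) i \<notin> I1" by blast
    define i' where "i' = snd (binv g) i"
    have gi': "snd g i' = i" using HO_inv_simps(1)[OF g(1)] by (simp add: i'_def binv_def)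
    have "i \<in> {1..n}" using i I12 by blast
    then have i'n: "i' \<in> {1..n}" using HO_in[OF gi(1), of i] by (simp add: i'_def)
    then have i'2: "i' \<in> I2" using i I12 by (auto simp: i'_def)
    have r: "(i, i, -1) \<in> roots n" "(i', i', -1) \<in> roots n" using \<open>i \<in> {1..n}\<close> i'n by (auto simp: roots_def)
    have z: "refln (i, i, -1) = (\<lambda>k. if k = i then -1 else 1, id)" "refln (i', i', -1) = (\<lambda>k. if k = i' then -1 else 1, id)"
      by (auto simp: refln.simps id_def)
    have r12: "r1 id = id" "r2 id = id" by (auto simp: r1_def r2_def)
    have Kz: "refln (i, i, -1) \<in> K" "refln (i', i', -1) \<in> K"
      using refl_closed[OF r(1)] refl_closed[OF r(2)] by (simp_all add: K_iff z)
    have Qz: "refln (i, i, -1) \<in> Q t u"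
      using Kz(1) i I12 by (auto simp: Q_def z r12 column_stabilizer_def permutes_id)
    have \<chi>z: "\<chi> (refln (i, i, -1)) = 1" by (simp add: \<chi>_def z)
    have "bmul g (refln (i', i', -1)) = bmul (refln (i, i, -1)) g"
      using conj_refl[OF g(1) r(2)] gi' HO_sign_square[OF g(1), of i] by simp
    then have "v (bmul (refln (i, i, -1)) g) = \<rho> (refln (i', i', -1)) (v g)"
      using V g Kz(2) refl_square(2)[OF r(2)] by metis
    moreover have "v (bmul (refln (i, i, -1)) g) = v g"
    proof -
      have "act (refln (i, i, -1)) v g = (\<chi> (refln (i, i, -1)) \<odot>\<^bsub>V\<^esub> v) g" using eig[OF Qz] by simp
      then show ?thesis
        using g Kz(1) refl_square(2)[OF r(1)] by (simp add: act_eq V_smult \<chi>z)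
    qed
    moreover have "\<rho> (refln (i', i', -1)) (v g) x = - v g x" for x
    proof -
      have "(\<Prod>k\<in>I2. if k = i' then -1 else 1) = (-1 :: int)" using i'2 by simp
      then show ?thesis by (cases x) (simp add: \<rho>_eq sgn2_def z)
    qed
    ultimately have "v g x = - v g x" for x by metis
    then show ?thesis by (auto simp: fun_eq_iff)
  qed
  define F where "F = v bone"
  have F: "F \<in> Out" using V by (simp add: F_def)
  have K: "v k = \<rho> (binv k) F" if "k \<in> K" for k
    using V that bone_closed[of n] by (metis F_def bmul_bone(1))
  have "F = (\<lambda>x. F (tabloid I1 t, tabloid I2 u) * E t u x)"
  proof (rule E_unique[OF t u])
    show "F (T, U) = 0" if "T \<notin> TB1 \<or> U \<notin> TB2" for T U using Out_support[OF F that] .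
    fix q T U assume q: "q \<in> Q t u"
    have "act q v bone = (\<chi> q \<odot>\<^bsub>V\<^esub> v) bone" using eig[OF q] by simp
    then have "v (binv q) = (\<lambda>x. \<chi> q * F x)" using Q_K[OF q] by (simp add: act_eq V_smult F_def)
    then have "\<rho> q F = (\<lambda>x. \<chi> q * F x)" using K[OF binv_K[OF Q_K[OF q]]] Q_K[OF q] by simp
    then have "\<rho> q F (T, U) = \<chi> q * F (T, U)" by simp
    then show "F (T \<circ> snd q, U \<circ> snd q) = \<chi> q * F (T, U)" by (simp add: \<rho>_eq sgn2_Q[OF q])
  qed
  then have FE: "F = (\<lambda>x. v bone (tabloid I1 t, tabloid I2 u) * E t u x)" by (simp add: F_def)
  show ?thesis
  proof
    fix g
    have "v g = \<rho> (binv g) (\<lambda>x. v bone (tabloid I1 t, tabloid I2 u) * E t u x)" if "g \<in> K"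
      using K[OF that] FE by metis
    moreover have "v g = undefined" if "g \<notin> G" using V that by blast
    ultimately show "v g = (v bone (tabloid I1 t, tabloid I2 u) \<odot>\<^bsub>V\<^esub> coset_vec (E t u)) g"
      using off[of g] by (auto simp: V_smult coset_vec_def \<rho>_linear)
  qed
qed

lemma coset_vec_eigen:
  assumes q: "q \<in> Q t u" and t: "t \<in> tableaux (fst \<Lambda>) I1" and u: "u \<in> tableaux (snd \<Lambda>) I2"
  shows "act q (coset_vec (E t u)) = \<chi> q \<odot>\<^bsub>V\<^esub> coset_vec (E t u)"
proof -
  have "\<rho> q (E t u) = (\<lambda>x. \<chi> q * E t u x)"
    using E_antisym[OF q t u] by (auto simp: \<rho>_eq sgn2_Q[OF q] fun_eq_iff)
  then show ?thesis by (simp add: act_coset_vec[OF Q_K[OF q]] coset_vec_linear)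
qed

text \<open>
  The permutation that carries one tableau to the other acts on the polytabloids in the same way.
\<close>

lemma K_transitive:
  assumes t: "t \<in> tableaux (fst \<Lambda>) I1" "t' \<in> tableaux (fst \<Lambda>) I1"
    and u: "u \<in> tableaux (snd \<Lambda>) I2" "u' \<in> tableaux (snd \<Lambda>) I2"
  obtains k where "k \<in> K" "\<rho> k (E t u) = E t' u'"
proof -
  have ex: "\<exists>\<pi>. \<pi> permutes A \<and> (\<forall>k\<in>A. t' (\<pi> k) = t k)"
    if "t \<in> tableaux \<mu> A" "t' \<in> tableaux \<mu> A" for t t' \<mu> and A :: "nat set"
  proof -
    have b: "bij_betw t A (young_diagram \<mu>)" "bij_betw t' A (young_diagram \<mu>)"
      using that by (simp_all add: tableaux_def)
    let ?\<pi> = "\<lambda>k. if k \<in> A then inv_into A t' (t k) else k"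
    have "bij_betw (\<lambda>k. inv_into A t' (t k)) A A"
      using bij_betw_trans[OF b(1) bij_betw_inv_into[OF b(2)]] by (simp add: comp_def)
    then have "bij_betw ?\<pi> A A" by (rule bij_betw_cong[THEN iffD1, rotated]) simp
    then have "?\<pi> permutes A" by (rule bij_imp_permutes) simp
    moreover have "t' (?\<pi> k) = t k" if "k \<in> A" for k
    proof -
      have "t k \<in> t' ` A" using that b by (auto simp: bij_betw_def)
      then show ?thesis using that by (simp add: f_inv_into_f)
    qed
    ultimately show ?thesis by blast
  qed
  obtain \<pi>1 where p1: "\<pi>1 permutes I1" "\<forall>k\<in>I1. t' (\<pi>1 k) = t k" using ex[OF t] by blast
  obtain \<pi>2 where p2: "\<pi>2 permutes I2" "\<forall>k\<in>I2. u' (\<pi>2 k) = u k" using ex[OF u] by blast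
  let ?k = "(\<lambda>k. 1, \<pi>1 \<circ> \<pi>2) :: signed_perm"
  have "\<pi>1 permutes {1..n}" "\<pi>2 permutes {1..n}"
    using p1(1) p2(1) I12 by (auto intro: permutes_subset)
  then have "?k \<in> G" by (simp add: HO_carrier permutes_compose)
  moreover have on1: "\<pi>2 k = k" if "k \<in> I1" for k using that I12 permutes_not_in[OF p2(1)] by blast
  moreover have on2: "\<pi>1 k = k" if "k \<in> I2" for k using that I12 permutes_not_in[OF p1(1)] by blast
  ultimately have k: "?k \<in> K" using permutes_image[OF p1(1)] by (simp add: K_iff image_comp[symmetric])
  have "r1 (\<pi>1 \<circ> \<pi>2) = \<pi>1" "r2 (\<pi>1 \<circ> \<pi>2) = \<pi>2"
    using on1 on2 permutes_in_image[OF p2(1)] permutes_not_in[OF p1(1)] permutes_not_in[OF p2(1)]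
    by (auto simp: r1_def r2_def fun_eq_iff)
  moreover have "polytabloid I1 (t \<circ> inv_into UNIV \<pi>1) = polytabloid I1 t'"
    by (rule polytabloid_cong)
       (use p1 permutes_in_image[OF permutes_inv[OF p1(1)]] permutes_inverses(1)[OF p1(1)] in \<open>metis comp_apply\<close>)
  moreover have "polytabloid I2 (u \<circ> inv_into UNIV \<pi>2) = polytabloid I2 u'"
    by (rule polytabloid_cong)
       (use p2 permutes_in_image[OF permutes_inv[OF p2(1)]] permutes_inverses(1)[OF p2(1)] in \<open>metis comp_apply\<close>)
  moreover have "sgn2 ?k = 1" by (simp add: sgn2_def)
  ultimately have "\<rho> ?k (E t u) = E t' u'"
    using \<rho>_E[OF k t(1) u(1)] by (simp add: E_def)
  then show thesis using that k by blast
qed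

end

subsection \<open>Irreducibility\<close>

context bipartition_rep
begin

lemma HO_left_bij: assumes "g \<in> G" shows "bij_betw (bmul g) G G"
  by (rule bij_betw_byWitness[where f' = "bmul (binv g)"]) (use assms in auto)

text \<open>Every vector is the average of translates of vectors supported on the identity coset.\<close>

lemma subrep_generate:
  assumes U: "subrep U" and t: "t \<in> tableaux (fst \<Lambda>) I1" and u: "u \<in> tableaux (snd \<Lambda>) I2"
    and e: "coset_vec (E t u) \<in> U"
  shows "U = carrier V"
proof
  note U' = subrepD[OF U]
  show "U \<subseteq> carrier V" by (rule U'(1))
  have "submodule {F. coset_vec F \<in> U} complex_ring function_space"
    by (rule FS.submoduleI) (simp_all add: coset_vec_linear U')
  then have Out: "Out \<subseteq> {F. coset_vec F \<in> U}"
  proof (rule Out_least)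
    fix t' u' assume "t' \<in> tableaux (fst \<Lambda>) I1" "u' \<in> tableaux (snd \<Lambda>) I2"
    then obtain k where k: "k \<in> K" "\<rho> k (E t u) = E t' u'" using K_transitive[OF t _ u] by metis
    then show "E t' u' \<in> {F. coset_vec F \<in> U}" using U'(5)[OF K_G[OF k(1)] e] by (simp add: act_coset_vec)
  qed
  show "carrier V \<subseteq> U"
  proof
    fix v assume v: "v \<in> carrier V"
    note V = v[unfolded V_iff]
    have finG: "finite G" by (rule HO_finite)
    have sum_U: "(\<lambda>h\<in>G. \<lambda>x. \<Sum>g\<in>S. coset_vec (v g) (bmul (binv g) h) x) \<in> U" if "S \<subseteq> G" for S
      using finite_subset[OF that finG] that
    proof (induction S)
      case empty
      then show ?case using U'(2) by (simp only: V_zero sum.empty)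
    next
      case (insert g S)
      have "(\<lambda>h\<in>G. \<lambda>x. \<Sum>g\<in>insert g S. coset_vec (v g) (bmul (binv g) h) x) =
          act g (coset_vec (v g)) \<oplus>\<^bsub>V\<^esub> (\<lambda>h\<in>G. \<lambda>x. \<Sum>g\<in>S. coset_vec (v g) (bmul (binv g) h) x)"
        using insert by (auto simp: V_add act_eq fun_eq_iff)
      moreover have "coset_vec (v g) \<in> U" using Out V insert.prems by blast
      then have "act g (coset_vec (v g)) \<in> U" using U'(5) insert.prems by blast
      moreover have "(\<lambda>h\<in>G. \<lambda>x. \<Sum>g\<in>S. coset_vec (v g) (bmul (binv g) h) x) \<in> U"
        using insert.IH insert.prems by blast
      ultimately show ?case by (simp only: U'(3))
    qed
    have "finite K" by (rule finite_subset[OF _ finG]) auto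
    then have K0: "card K \<noteq> 0" using bone_K card_eq_0_iff[of K] by blast
    \<comment> \<open>The translate by \<open>g\<close> of the vector with value \<open>v g\<close> at the identity agrees with \<open>v\<close> on \<open>g K\<close>.\<close>
    have "(\<Sum>g\<in>G. coset_vec (v g) (bmul (binv g) h) x) = of_nat (card K) * v h x" if h: "h \<in> G" for h x
    proof -
      have "coset_vec (v g) (bmul (binv g) h) x = (if bmul (binv g) h \<in> K then v h x else 0)" if g: "g \<in> G" for g
      proof (cases "bmul (binv g) h \<in> K")
        case True
        have "v (bmul g (bmul (binv g) h)) = \<rho> (binv (bmul (binv g) h)) (v g)" using V g True by blast
        then show ?thesis using True g h by (simp add: coset_vec_def)
      qed (use g h in \<open>simp add: coset_vec_def\<close>)
      then have "(\<Sum>g\<in>G. coset_vec (v g) (bmul (binv g) h) x) = (\<Sum>g\<in>G. if bmul (binv g) h \<in> K then v h x else 0)"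
        by simp
      also have "\<dots> = (\<Sum>g\<in>{g \<in> G. bmul (binv g) h \<in> K}. v h x)"
        by (rule sum.inter_filter[symmetric, OF finG])
      also have "\<dots> = (\<Sum>k\<in>K. v h x)"
        by (rule sum.reindex_bij_witness[of _ "\<lambda>k. bmul h (binv k)" "\<lambda>g. bmul (binv g) h"])
           (use h in \<open>auto simp: binv_bmul[of _ n] bmul_assoc[of _ n]\<close>)
      finally show ?thesis by simp
    qed
    then have "v = (1 / of_nat (card K)) \<odot>\<^bsub>V\<^esub> (\<lambda>h\<in>G. \<lambda>x. \<Sum>g\<in>G. coset_vec (v g) (bmul (binv g) h) x)"
      using V K0 by (auto simp: V_smult fun_eq_iff)
    then show "v \<in> U"
      by (rule ssubst[where P = "\<lambda>w. w \<in> U"]) (rule U'(4)[OF sum_U[OF subset_refl]])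
  qed
qed

text \<open>
  Averaging a translate of a nonzero vector over \<open>Q t u\<close> with the character gives a multiple of the
  vector \<open>coset_vec (E t u)\<close>, by \<open>coset_line\<close>. If this vector is not in \<open>U\<close>, then all the multiples are \<open>0\<close>. They are, up
  to a common factor, the pairings of the values of \<open>f\<close> with \<open>E t u\<close>. Moving by \<open>K\<close>, the values of \<open>f\<close> pair to
  \<open>0\<close> with every product of polytabloids, hence with themselves.
\<close>

lemma subrep_contains:
  assumes U: "subrep U" and f: "f \<in> U" "f \<noteq> \<zero>\<^bsub>V\<^esub>"
    and t: "t \<in> tableaux (fst \<Lambda>) I1" and u: "u \<in> tableaux (snd \<Lambda>) I2"
  shows "coset_vec (E t u) \<in> U"
proof (rule ccontr)
  assume notin: "coset_vec (E t u) \<notin> U"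
  note U' = subrepD[OF U]
  let ?t = "tabloid I1 t" and ?u = "tabloid I2 u"
  have tu: "?t \<in> TB1" "?u \<in> TB2" using t u by (simp_all add: tabloids_def)
  have fV: "f \<in> carrier V" using f U' by blast
  note V = fV[unfolded V_iff]
  \<comment> \<open>\<open>l\<close> sends a value \<open>f g\<close> to the multiple that the average gives.\<close>
  define l where "l F = (\<Sum>q\<in>Q t u. \<chi> q * F (?t \<circ> snd q, ?u \<circ> snd q))" for F :: "(nat \<Rightarrow> nat) \<times> (nat \<Rightarrow> nat) \<Rightarrow> complex"
  have l0: "l (f g) = 0" if g: "g \<in> G" for g
  proof -
    define v where "v = act (binv g) f"
    have v: "v \<in> U" using U'(5)[OF _ f(1)] g by (simp add: v_def)
    have vV: "v \<in> carrier V" using v U' by blast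
    have vb: "v bone = f g" using g by (simp add: v_def act_eq)
    define w where "w = group_comb (Q t u) \<chi> binv v"
    have w: "w \<in> U" unfolding w_def by (rule group_comb_gsub[OF U]) (use v Q_K in auto)
    have "act q w = \<chi> q \<odot>\<^bsub>V\<^esub> w" if q: "q \<in> Q t u" for q
    proof (rule V_ext)
      show "act q w \<in> carrier V" "\<chi> q \<odot>\<^bsub>V\<^esub> w \<in> carrier V"
        using w U' Q_K[OF q] by (auto intro!: V_closed)
      fix h x assume h: "h \<in> G"
      have "act q w h x = (\<Sum>p\<in>Q t u. \<chi> p * v (bmul (binv p) (bmul (binv q) h)) x)"
        using h Q_K[OF q] by (simp add: act_eq w_def group_comb_def)
      also have "\<dots> = (\<Sum>p\<in>Q t u. \<chi> q * (\<chi> p * v (bmul (binv p) h) x))"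
      proof (rule sum.reindex_bij_witness[of _ "\<lambda>p. bmul (binv q) p" "\<lambda>p. bmul q p"])
        fix p assume p: "p \<in> Q t u"
        have pG: "p \<in> G" "q \<in> G" using Q_K p q by auto
        show "bmul (binv q) (bmul q p) = p" "bmul q (bmul (binv q) p) = p" using pG by simp_all
        show "bmul q p \<in> Q t u" "bmul (binv q) p \<in> Q t u" using p q Q_bmul Q_binv by blast+
        show "\<chi> q * (\<chi> (bmul q p) * v (bmul (binv (bmul q p)) h) x) = \<chi> p * v (bmul (binv p) (bmul (binv q) h)) x"
          using pG \<chi>_sq[of q] by (simp add: \<chi>_bmul binv_bmul[of _ n] bmul_assoc[of _ n] mult.assoc[symmetric])
      qed
      also have "\<dots> = (\<chi> q \<odot>\<^bsub>V\<^esub> w) h x" using h by (simp add: V_smult w_def group_comb_def sum_distrib_left)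
      finally show "act q w h x = (\<chi> q \<odot>\<^bsub>V\<^esub> w) h x" .
    qed
    then have we: "w = w bone (?t, ?u) \<odot>\<^bsub>V\<^esub> coset_vec (E t u)"
      using w U' by (intro coset_line[OF t u]) auto
    have "w bone (?t, ?u) = l (f g)"
    proof -
      have "v (binv q) (?t, ?u) = f g (?t \<circ> snd q, ?u \<circ> snd q)" if q: "q \<in> Q t u" for q
      proof -
        have "v (bmul bone (binv q)) = \<rho> (binv (binv q)) (v bone)"
          using vV[unfolded V_iff] binv_K[OF Q_K[OF q]] bone_closed by blast
        then show ?thesis using Q_K[OF q] by (simp add: vb \<rho>_eq sgn2_Q[OF q])
      qed
      then show ?thesis by (simp add: w_def group_comb_def l_def)
    qed
    moreover have "w bone (?t, ?u) = 0"
    proof (rule ccontr)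
      assume nz: "w bone (?t, ?u) \<noteq> 0"
      have "(1 / w bone (?t, ?u)) \<odot>\<^bsub>V\<^esub> w \<in> U" using U'(4) w by blast
      moreover have "(1 / w bone (?t, ?u)) \<odot>\<^bsub>V\<^esub> w = coset_vec (E t u)"
      proof -
        have "c \<odot>\<^bsub>V\<^esub> (d \<odot>\<^bsub>V\<^esub> coset_vec (E t u)) = (c * d) \<odot>\<^bsub>V\<^esub> coset_vec (E t u)" for c d
          by (auto simp: V_smult fun_eq_iff)
        moreover have "1 \<odot>\<^bsub>V\<^esub> coset_vec (E t u) = coset_vec (E t u)"
          by (auto simp: V_smult fun_eq_iff coset_vec_def)
        ultimately show ?thesis using we nz by (metis nonzero_eq_divide_eq)
      qed
      ultimately show False using notin by simp
    qed
    ultimately show ?thesis by simp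
  qed
  \<comment> \<open>\<open>l\<close> is the pairing with a function \<open>E'\<close> on tabloids, which is proportional to \<open>E t u\<close>.\<close>
  define E' where "E' x = (\<Sum>q\<in>Q t u. \<chi> q * (if x = (?t \<circ> snd q, ?u \<circ> snd q) then 1 else 0))" for x
  let ?B = "TB1 \<times> TB2"
  have finB: "finite ?B" by (simp add: finite_tabloids)
  have tq: "(?t \<circ> snd q, ?u \<circ> snd q) \<in> ?B" if "q \<in> Q t u" for q
    using that tu TB_comp(3,4)[OF Q_K] by auto
  have lE': "l F = (\<Sum>x\<in>?B. F x * E' x)" for F
  proof -
    have "(\<Sum>x\<in>?B. F x * E' x) = (\<Sum>q\<in>Q t u. \<Sum>x\<in>?B. \<chi> q * (if x = (?t \<circ> snd q, ?u \<circ> snd q) then F x else 0))"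
      unfolding E'_def sum_distrib_left by (subst sum.swap) (auto intro!: sum.cong)
    also have "\<dots> = l F"
      unfolding l_def sum_distrib_left[symmetric] using tq by (intro sum.cong) (simp_all add: finB)
    finally show ?thesis by simp
  qed
  have E'E: "E' = (\<lambda>x. E' (?t, ?u) * E t u x)"
  proof (rule E_unique[OF t u])
    fix T U assume "T \<notin> TB1 \<or> U \<notin> TB2"
    then have "(T, U) \<noteq> (?t \<circ> snd q, ?u \<circ> snd q)" if "q \<in> Q t u" for q using tq[OF that] by auto
    then show "E' (T, U) = 0" unfolding E'_def by (intro sum.neutral) auto
  next
    fix q T U assume q: "q \<in> Q t u"
    have qG: "q \<in> G" using Q_K[OF q] by simp
    show "E' (T \<circ> snd q, U \<circ> snd q) = \<chi> q * E' (T, U)"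
      unfolding E'_def sum_distrib_left
    proof (rule sum.reindex_bij_witness[of _ "\<lambda>p. bmul p q" "\<lambda>p. bmul p (binv q)"])
      fix p assume p: "p \<in> Q t u"
      have pG: "p \<in> G" using Q_K[OF p] by simp
      show "bmul (bmul p (binv q)) q = p" "bmul (bmul p q) (binv q) = p" using pG qG by (simp_all add: bmul_assoc[of _ n])
      show "bmul p (binv q) \<in> Q t u" "bmul p q \<in> Q t u" using p q Q_bmul Q_binv by blast+
      have iff: "(A \<circ> snd q = B) \<longleftrightarrow> (A = B \<circ> snd (binv q))" for A B :: "nat \<Rightarrow> nat"
      proof -
        have "snd q \<circ> snd (binv q) = id" "snd (binv q) \<circ> snd q = id"
          using HO_inv_simps[OF qG] by (auto simp: binv_def)
        then show ?thesis by (metis comp_assoc comp_id)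
      qed
      have "\<chi> q * (\<chi> p * \<chi> q) = \<chi> p" using \<chi>_sq[of q] by (simp add: mult.left_commute)
      then show "\<chi> q * (\<chi> (bmul p (binv q)) * (if (T, U) = (?t \<circ> snd (bmul p (binv q)), ?u \<circ> snd (bmul p (binv q))) then 1 else 0)) =
          \<chi> p * (if (T \<circ> snd q, U \<circ> snd q) = (?t \<circ> snd p, ?u \<circ> snd p) then 1 else 0)"
        using pG qG by (simp add: \<chi>_bmul \<chi>_binv iff) (simp add: bmul_def comp_assoc)
    qed
  qed
  have "E' (?t, ?u) \<noteq> 0"
  proof -
    have "\<chi> q = 1" if q: "q \<in> Q t u" and eq: "(?t, ?u) = (?t \<circ> snd q, ?u \<circ> snd q)" for q
    proof -
      have "?t \<circ> r1 (snd q) = ?t" "?u \<circ> r2 (snd q) = ?u" using eq TB_comp(1,2)[OF Q_K[OF q]] tu by auto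
      then have "r1 (snd q) = id" "r2 (snd q) = id"
        using row_column_stabilizer[OF t] row_column_stabilizer[OF u] q by (auto simp: Q_def)
      then show ?thesis using \<chi>_split[OF Q_K[OF q]] by simp
    qed
    then have "E' (?t, ?u) = (\<Sum>q\<in>Q t u. if (?t, ?u) = (?t \<circ> snd q, ?u \<circ> snd q) then 1 else 0)"
      unfolding E'_def by (intro sum.cong) auto
    also have "\<dots> = of_nat (card {q \<in> Q t u. (?t, ?u) = (?t \<circ> snd q, ?u \<circ> snd q)})"
      by (simp add: sum.inter_filter[symmetric])
    also have "\<dots> \<noteq> 0"
    proof -
      let ?S = "{q \<in> Q t u. (?t, ?u) = (?t \<circ> snd q, ?u \<circ> snd q)}"
      have "bone \<in> ?S" by simp (simp add: bone_def)
      moreover have "finite ?S" by simp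
      ultimately have "card ?S \<noteq> 0" using card_eq_0_iff[of ?S] by blast
      then show ?thesis by (simp only: of_nat_eq_0_iff simp_thms)
    qed
    finally show ?thesis .
  qed
  then have pair0: "(\<Sum>x\<in>?B. f g x * E t u x) = 0" if "g \<in> G" for g
  proof -
    have "E' (?t, ?u) * (\<Sum>x\<in>?B. f g x * E t u x) = (\<Sum>x\<in>?B. f g x * E' x)"
      unfolding sum_distrib_left by (subst (2) E'E) (simp add: mult_ac)
    also have "\<dots> = 0" using l0[OF that] lE' by simp
    finally show ?thesis using \<open>E' (?t, ?u) \<noteq> 0\<close> by simp
  qed
  have pair: "(\<Sum>x\<in>?B. f g x * E t' u' x) = 0"
    if g: "g \<in> G" and t': "t' \<in> tableaux (fst \<Lambda>) I1" and u': "u' \<in> tableaux (snd \<Lambda>) I2" for g t' u'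
  proof -
    obtain k where k: "k \<in> K" "\<rho> k (E t u) = E t' u'" using K_transitive[OF t t' u u'] by metis
    have kG: "k \<in> G" using k by simp
    have sq: "sgn2 k * sgn2 k = 1"
      using sgn2_mult[OF binv_K[OF k(1)] k(1)] kG
      by (simp add: sgn2_def) (metis (no_types, lifting) HO_sign_square of_int_1 of_int_mult prod.distrib prod.neutral_const prod.cong)
    have inv: "snd k \<circ> snd (binv k) = id" "snd (binv k) \<circ> snd k = id"
      using HO_inv_simps[OF kG] by (auto simp: binv_def)
    have "(\<Sum>x\<in>?B. f g x * E t' u' x) = (\<Sum>x\<in>?B. sgn2 k * (\<rho> (binv k) (f g) x * E t u x) * sgn2 (binv k) )"
    proof (rule sum.reindex_bij_witness[of _ "\<lambda>(T, U). (T \<circ> snd (binv k), U \<circ> snd (binv k))" "\<lambda>(T, U). (T \<circ> snd k, U \<circ> snd k)"])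
      fix x assume x: "x \<in> ?B"
      obtain T U where xTU: "x = (T, U)" by (cases x)
      show "(case case x of (T, U) \<Rightarrow> (T \<circ> snd k, U \<circ> snd k) of (T, U) \<Rightarrow> (T \<circ> snd (binv k), U \<circ> snd (binv k))) = x"
        "(case case x of (T, U) \<Rightarrow> (T \<circ> snd (binv k), U \<circ> snd (binv k)) of (T, U) \<Rightarrow> (T \<circ> snd k, U \<circ> snd k)) = x"
        by (simp_all add: xTU comp_assoc inv)
      show "(case x of (T, U) \<Rightarrow> (T \<circ> snd k, U \<circ> snd k)) \<in> ?B" "(case x of (T, U) \<Rightarrow> (T \<circ> snd (binv k), U \<circ> snd (binv k))) \<in> ?B"
        using x TB_comp(3,4)[OF k(1)] TB_comp(3,4)[OF binv_K[OF k(1)]] by (simp_all add: xTU)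
      have "sgn2 (binv k) * sgn2 (binv k) = 1"
        using sgn2_mult[OF binv_K[OF k(1)] k(1)] sq kG
        by simp (metis mult.left_commute mult_1_right \<rho>_bone sgn2_mult bone_K k(1) binv_K bmul_bone(1) mult.commute)
      then show "sgn2 k * (\<rho> (binv k) (f g) (case x of (T, U) \<Rightarrow> (T \<circ> snd k, U \<circ> snd k)) *
          E t u (case x of (T, U) \<Rightarrow> (T \<circ> snd k, U \<circ> snd k))) * sgn2 (binv k) = f g x * E t' u' x"
        unfolding k(2)[symmetric] by (simp add: xTU \<rho>_eq comp_assoc inv mult_ac)
    qed
    also have "\<dots> = sgn2 k * sgn2 (binv k) * (\<Sum>x\<in>?B. f (bmul g k) x * E t u x)"
      using V g k(1) by (simp add: sum_distrib_left mult_ac)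
    also have "\<dots> = 0" using pair0[of "bmul g k"] g kG by simp
    finally show ?thesis .
  qed
  have "f g = (\<lambda>x. 0)" if g: "g \<in> G" for g
  proof -
    let ?N = "{H. (\<Sum>x\<in>?B. f g x * cnj (H x)) = 0}"
    have "submodule ?N complex_ring function_space"
      by (rule FS.submoduleI)
         (auto simp: distrib_left sum.distrib mult.left_commute simp flip: sum_distrib_left)
    moreover have "cnj (E t' u' x) = E t' u' x" for t' u' x
      by (cases x) (simp add: E_def tensor_def polytabloid_real)
    ultimately have "Out \<subseteq> ?N" using pair[OF g] by (intro Out_least) auto
    then have "(\<Sum>x\<in>?B. f g x * cnj (f g x)) = 0" using V g by blast
    then have "of_real (\<Sum>x\<in>?B. (cmod (f g x))\<^sup>2) = (0 :: complex)"
      by (simp only: of_real_sum complex_norm_square)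
    then have "(\<Sum>x\<in>?B. (cmod (f g x))\<^sup>2) = 0" by (simp only: of_real_eq_0_iff)
    then have "\<forall>x\<in>?B. (cmod (f g x))\<^sup>2 = 0" by (subst (asm) sum_nonneg_eq_0_iff) (auto simp: finB)
    then have "f g (T, U) = 0" for T U
      using Out_support[of "f g" T U] V g by (cases "T \<in> TB1 \<and> U \<in> TB2") auto
    then show ?thesis by auto
  qed
  then have "f = \<zero>\<^bsub>V\<^esub>" using V by (auto simp: V_zero fun_eq_iff)
  then show False using f by simp
qed

lemma tableaux_ex: "\<exists>t u. t \<in> tableaux (fst \<Lambda>) I1 \<and> u \<in> tableaux (snd \<Lambda>) I2"
  using tableaux_exist[OF fin(1), of "fst \<Lambda>"] tableaux_exist[OF fin(2), of "snd \<Lambda>"]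
  by (auto simp: I1_def I2_def a_def b_def)

theorem irrep_irreducible:
  assumes "subrep U" "U \<noteq> {\<zero>\<^bsub>V\<^esub>}" shows "U = carrier V"
proof -
  obtain t u where tu: "t \<in> tableaux (fst \<Lambda>) I1" "u \<in> tableaux (snd \<Lambda>) I2" using tableaux_ex by blast
  obtain f where "f \<in> U" "f \<noteq> \<zero>\<^bsub>V\<^esub>" using assms subrepD(2) by blast
  then show ?thesis using subrep_generate[OF assms(1) tu subrep_contains[OF assms(1) _ _ tu]] by blast
qed

lemma coset_vec_nonzero:
  assumes t: "t \<in> tableaux (fst \<Lambda>) I1" and u: "u \<in> tableaux (snd \<Lambda>) I2"
  shows "coset_vec (E t u) \<noteq> \<zero>\<^bsub>V\<^esub>" "coset_vec (E t u) \<in> carrier V"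
proof -
  have "coset_vec (E t u) bone (tabloid I1 t, tabloid I2 u) = 1"
    using E_self[OF t u] by (simp add: coset_vec_def binv_bone)
  then show "coset_vec (E t u) \<noteq> \<zero>\<^bsub>V\<^esub>" by (auto simp: V_zero)
  show "coset_vec (E t u) \<in> carrier V" by (rule coset_vec_V[OF E_Out[OF t u]])
qed

text \<open>
  A conjugation invariant combination of reflections commutes with the group, so it preserves the line of
  \<open>coset_line\<close>. It acts on this line by a scalar, and the line generates \<open>V\<close>.
\<close>

lemma central_scalar:
  assumes \<kappa>: "\<And>g s. g \<in> G \<Longrightarrow> s \<in> roots n \<Longrightarrow> \<kappa> (conj_root g s) = \<kappa> s"
  obtains z where "\<And>v. v \<in> carrier V \<Longrightarrow> group_comb (roots n) \<kappa> refln v = z \<odot>\<^bsub>V\<^esub> v"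
proof -
  let ?Z = "group_comb (roots n) \<kappa> refln"
  have closed: "?Z v \<in> carrier V" if "v \<in> carrier V" for v
    by (rule group_comb_gsub[OF subrep_V]) (use that in auto)
  have comm: "act g (?Z v) = ?Z (act g v)" if g: "g \<in> G" and v: "v \<in> carrier V" for g v
  proof (rule V_ext)
    show "act g (?Z v) \<in> carrier V" "?Z (act g v) \<in> carrier V"
      using V_closed(3)[OF closed[OF v] closed[OF v] g] closed[OF V_closed(3)[OF v v g]] by blast+
    fix h x assume h: "h \<in> G"
    have gi: "binv g \<in> G" using g by simp
    have "?Z (act g v) h x = (\<Sum>s\<in>roots n. \<kappa> s * v (bmul (binv g) (bmul (refln s) h)) x)"
      using h g by (simp add: group_comb_def act_eq)
    also have "\<dots> = (\<Sum>s\<in>roots n. \<kappa> (conj_root (binv g) s) * v (bmul (refln (conj_root (binv g) s)) (bmul (binv g) h)) x)"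
    proof (rule sum.cong)
      fix s assume s: "s \<in> roots n"
      have "bmul (binv g) (bmul (refln s) h) = bmul (refln (conj_root (binv g) s)) (bmul (binv g) h)"
        using conj_refl[OF gi s] bmul_assoc[OF gi refl_closed[OF s], of h]
          bmul_assoc[OF refl_closed[OF conj_root_closed[OF gi s]] gi, of h] by simp
      then show "\<kappa> s * v (bmul (binv g) (bmul (refln s) h)) x =
          \<kappa> (conj_root (binv g) s) * v (bmul (refln (conj_root (binv g) s)) (bmul (binv g) h)) x"
        by (simp add: \<kappa>[OF gi s])
    qed simp
    also have "\<dots> = (\<Sum>s\<in>roots n. \<kappa> s * v (bmul (refln s) (bmul (binv g) h)) x)"
      by (rule sum.reindex_bij_betw[OF conj_root_bij[OF gi]])
    also have "\<dots> = act g (?Z v) h x" using h g by (simp add: group_comb_def act_eq)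
    finally show "act g (?Z v) h x = ?Z (act g v) h x" by simp
  qed
  have lin: "?Z (v \<oplus>\<^bsub>V\<^esub> w) = ?Z v \<oplus>\<^bsub>V\<^esub> ?Z w" "?Z (c \<odot>\<^bsub>V\<^esub> v) = c \<odot>\<^bsub>V\<^esub> ?Z v" "?Z \<zero>\<^bsub>V\<^esub> = \<zero>\<^bsub>V\<^esub>" for v w c
    by (auto simp: group_comb_def V_add V_smult V_zero fun_eq_iff algebra_simps sum.distrib sum_distrib_left)
  have sm: "c \<odot>\<^bsub>V\<^esub> (d \<odot>\<^bsub>V\<^esub> v) = d \<odot>\<^bsub>V\<^esub> (c \<odot>\<^bsub>V\<^esub> v)" "c \<odot>\<^bsub>V\<^esub> (v \<oplus>\<^bsub>V\<^esub> w) = c \<odot>\<^bsub>V\<^esub> v \<oplus>\<^bsub>V\<^esub> c \<odot>\<^bsub>V\<^esub> w" for c d v w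
    by (auto simp: V_smult V_add fun_eq_iff algebra_simps)
  obtain t u where tu: "t \<in> tableaux (fst \<Lambda>) I1" "u \<in> tableaux (snd \<Lambda>) I2" using tableaux_ex by blast
  let ?e = "coset_vec (E t u)"
  note e = coset_vec_nonzero[OF tu]
  define z where "z = ?Z ?e bone (tabloid I1 t, tabloid I2 u)"
  have Ze: "?Z ?e = z \<odot>\<^bsub>V\<^esub> ?e"
    unfolding z_def
  proof (rule coset_line[OF tu closed[OF e(2)]])
    fix q assume q: "q \<in> Q t u"
    show "act q (?Z ?e) = \<chi> q \<odot>\<^bsub>V\<^esub> ?Z ?e"
      using comm[OF K_G[OF Q_K[OF q]] e(2)] coset_vec_eigen[OF q tu] lin(2) by simp
  qed
  have "{v \<in> carrier V. ?Z v = z \<odot>\<^bsub>V\<^esub> v} = carrier V"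
  proof (rule subrep_generate[OF _ tu])
    show "subrep {v \<in> carrier V. ?Z v = z \<odot>\<^bsub>V\<^esub> v}"
    proof (rule subrepI)
      show "\<zero>\<^bsub>V\<^esub> \<in> {v \<in> carrier V. ?Z v = z \<odot>\<^bsub>V\<^esub> v}" by (simp add: lin)
      fix g v assume "g \<in> G" "v \<in> {v \<in> carrier V. ?Z v = z \<odot>\<^bsub>V\<^esub> v}"
      then show "act g v \<in> {v \<in> carrier V. ?Z v = z \<odot>\<^bsub>V\<^esub> v}"
        using comm[of g v] act_linear(2)[of g z v] V_closed(3)[of v v g] by auto
    qed (auto simp: lin sm V_closed)
    show "?e \<in> {v \<in> carrier V. ?Z v = z \<odot>\<^bsub>V\<^esub> v}" using e Ze by simp
  qed
  then show thesis using that by blast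
qed

end

section \<open>The radical of the standard module\<close>

text \<open>
  The ideal of the larger presentation intersects the smaller free algebra in an ideal that contains the smaller
  relators.
\<close>

lemma relation_ideal_mono:
  assumes "presentation G Rel" "presentation G' Rel'" "G \<subseteq> G'" "Rel \<subseteq> Rel'"
  shows "relation_ideal G Rel \<subseteq> relation_ideal G' Rel'"
proof -
  interpret P: presentation G Rel by fact
  interpret P': presentation G' Rel' by fact
  interpret I': ideal "relation_ideal G' Rel'" "free_algebra G'" by (rule P'.ideal)
  note sub = additive_subgroup.zero_closed[OF I'.additive_subgroup_axioms]
    additive_subgroup.a_closed[OF I'.additive_subgroup_axioms]
    additive_subgroup.a_inv_closed[OF I'.additive_subgroup_axioms]
  have sum: "lookup p \<in> relation_ideal G' Rel' \<Longrightarrow> lookup q \<in> relation_ideal G' Rel' \<Longrightarrow>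
      lookup (p + q) \<in> relation_ideal G' Rel'" for p q
    using sub(2)[of "lookup p" "lookup q"] by (simp add: free_algebra_ops)
  have mono: "ncpolys G \<subseteq> ncpolys G'" using assms(3) by (rule ncpolys_mono)
  have minus: "\<ominus>\<^bsub>free_algebra H\<^esub> lookup p = lookup (- p)" if "p \<in> ncpolys H" for H :: "'a set" and p
  proof -
    interpret ring "free_algebra H" by (rule free_algebra_ring)
    show ?thesis
      by (rule minus_equality) (use that in \<open>auto simp: free_algebra_ops free_algebra_carrier\<close>)
  qed
  let ?K = "carrier (free_algebra G) \<inter> relation_ideal G' Rel'"
  have "ideal ?K (free_algebra G)"
  proof (rule idealI[OF free_algebra_ring])
    show "subgroup ?K (add_monoid (free_algebra G))"
    proof
      fix x assume x: "x \<in> ?K"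
      then obtain p where p: "p \<in> ncpolys G" "x = lookup p" by (auto simp: free_algebra_carrier)
      have "lookup (- p) \<in> relation_ideal G' Rel'" using sub(3)[of x] x p minus[OF subsetD[OF mono p(1)]] by auto
      then show "inv\<^bsub>add_monoid (free_algebra G)\<^esub> x \<in> ?K"
        using minus[OF p(1)] p by (auto simp: a_inv_def free_algebra_carrier)
    qed (use sub(1) sum in \<open>auto simp: free_algebra_carrier free_algebra_ops\<close>)
  next
    fix x f assume "x \<in> ?K" "f \<in> carrier (free_algebra G)"
    then obtain p q where pq: "p \<in> ncpolys G" "x = lookup p" "q \<in> ncpolys G" "f = lookup q" "x \<in> relation_ideal G' Rel'"
      by (auto simp: free_algebra_carrier)
    then have "lookup (q * p) \<in> relation_ideal G' Rel'" "lookup (p * q) \<in> relation_ideal G' Rel'"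
      using I'.I_l_closed[of x f] I'.I_r_closed[of x f] mono by (auto simp: free_algebra_carrier free_algebra_ops)
    then show "f \<otimes>\<^bsub>free_algebra G\<^esub> x \<in> ?K" "x \<otimes>\<^bsub>free_algebra G\<^esub> f \<in> ?K"
      using pq by (auto simp: free_algebra_carrier free_algebra_ops)
  qed
  moreover have "{a \<ominus>\<^bsub>free_algebra G\<^esub> b | a b. (a, b) \<in> Rel} \<subseteq> ?K"
  proof clarify
    fix a b assume ab: "(a, b) \<in> Rel"
    then obtain p q where pq: "a = lookup p" "b = lookup q" "p \<in> ncpolys G" "q \<in> ncpolys G"
      using P.Rel unfolding free_algebra_carrier by blast
    have "a \<ominus>\<^bsub>free_algebra G'\<^esub> b \<in> relation_ideal G' Rel'"
      unfolding relation_ideal_def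
      using ring.genideal_self[OF free_algebra_ring P'.relators_closed] ab assms(4) by blast
    then show "a \<ominus>\<^bsub>free_algebra G\<^esub> b \<in> ?K"
      using pq mono by (auto simp: free_algebra_minus free_algebra_carrier subset_iff)
  qed
  ultimately have "relation_ideal G Rel \<subseteq> ?K"
    unfolding relation_ideal_def[of G] by (rule ring.genideal_minimal[OF free_algebra_ring])
  then show ?thesis by blast
qed

locale cherednik_irrep = cherednik n c d + bipartition_rep \<Lambda> n
  for n :: nat and c d :: complex and \<Lambda> :: "nat list \<times> nat list"
begin

abbreviation "SG \<equiv> smash_gens n"

lemma V_scale: "v \<in> carrier V \<Longrightarrow> 1 \<odot>\<^bsub>V\<^esub> v = v"
  "v \<in> carrier V \<Longrightarrow> x \<odot>\<^bsub>V\<^esub> (y \<odot>\<^bsub>V\<^esub> v) = (x * y) \<odot>\<^bsub>V\<^esub> v"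
  using V.smult_zero_left[of v] V.smult_one[of v] V.smult_assoc1[of x y v] by simp_all

lemma act_V_zero: "g \<in> G \<Longrightarrow> act g \<zero>\<^bsub>V\<^esub> = \<zero>\<^bsub>V\<^esub>"
  by (auto simp: act_eq V_zero fun_eq_iff)

sublocale low: operator_module SG "smash_rels n" V "lowest_op \<Lambda>"
proof (intro operator_module.intro smash_presentation V_left_module operator_module_axioms.intro)
  fix g and u v assume g: "g \<in> SG" and v: "v \<in> carrier V"
  have z: "\<zero>\<^bsub>V\<^esub> \<in> carrier V" by simp
  show "lowest_op \<Lambda> g v \<in> carrier V"
    using g v V_closed(3)[OF v v] by (cases g) (auto simp del: atLeastAtMost_iff)
  show "lowest_op \<Lambda> g (u \<oplus>\<^bsub>V\<^esub> v) = lowest_op \<Lambda> g u \<oplus>\<^bsub>V\<^esub> lowest_op \<Lambda> g v"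
    using g by (cases g) (auto simp: act_linear)
  show "lowest_op \<Lambda> g (x \<odot>\<^bsub>V\<^esub> v) = x \<odot>\<^bsub>V\<^esub> lowest_op \<Lambda> g v" for x
    using g by (cases g) (auto simp: act_linear V.smult_zero_right)
qed

sublocale low: relation_module SG "smash_rels n" V "lowest_op \<Lambda>"
proof (intro relation_module.intro low.operator_module_axioms relation_module_axioms.intro)
  fix p q v assume "(lookup p, lookup q) \<in> smash_rels n" and v: "v \<in> carrier V"
  then have "(p, q) \<in> smash_poly_rels n" by (simp add: smash_rels_iff)
  moreover have V: "act g w \<in> carrier V" if "g \<in> G" "w \<in> carrier V" for g w using V_closed(3)[OF that(2,2,1)] .
  ultimately show "low.opact p v = low.opact q v"
    by cases (simp_all add: low.opact_mult low.opact_gen low.opact_one act_bone act_bmul v V act_V_zero V.smult_zero_right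
      del: atLeastAtMost_iff)
qed

lemma lowest_module_eq: "lowest_module \<Lambda> = low.OM"
  by (simp add: lowest_module_def)

lemma smash_to_cherednik_cls:
  assumes p: "p \<in> ncpolys SG" shows "smash_to_cherednik n c d (low.cls p) = cls p"
proof -
  have sub: "smash_rels n \<subseteq> cherednik_rels n c d" by (auto intro: cherednik_rels.smash)
  have mono: "ncpolys SG \<subseteq> ncpolys CG" by (rule ncpolys_mono[OF smash_gens_subset])
  have "relation_ideal CG (cherednik_rels n c d) +>\<^bsub>free_algebra CG\<^esub> f = cls p" if f: "f \<in> low.cls p" for f
  proof -
    obtain i where i: "i \<in> relation_ideal SG (smash_rels n)" "f = i \<oplus>\<^bsub>free_algebra SG\<^esub> lookup p"
      using f unfolding low.cls_def a_r_coset_def' by auto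
    have "i \<in> carrier (free_algebra SG)"
      using i(1) ideal.Icarr[OF low.ideal] by blast
    then obtain q where q: "i = lookup q" "q \<in> ncpolys SG" unfolding free_algebra_carrier by blast
    have "q + p \<doteq> p"
      using relation_ideal_mono[OF smash_presentation presentation_axioms smash_gens_subset sub] i q
      by (auto simp: congr_def)
    then have "cls (q + p) = cls p" using cls_eq_iff[of "q + p" p] subsetD[OF mono p] subsetD[OF mono q(2)] by simp
    then show ?thesis unfolding i(2) q(1) free_algebra_ops by (simp add: cls_def)
  qed
  moreover interpret I: ideal "relation_ideal SG (smash_rels n)" "free_algebra SG" by (rule low.ideal)
  have "lookup p \<in> low.cls p"
    unfolding low.cls_def using p by (intro I.a_rcos_self) (simp add: free_algebra_carrier)
  ultimately show ?thesis unfolding smash_to_cherednik_def presented_map_def by blast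
qed

sublocale ind: induction_data A "smash_algebra n" "smash_to_cherednik n c d" "lowest_module \<Lambda>"
proof (intro induction_data.intro A.ring_axioms induction_data_axioms.intro)
  fix x v assume x: "x \<in> carrier (smash_algebra n)"
  then obtain p where p: "p \<in> ncpolys SG" "x = low.cls p"
    unfolding smash_algebra_def by (rule low.cls_surj)
  then show "smash_to_cherednik n c d x \<in> carrier A"
    using smash_to_cherednik_cls[OF p(1)] subsetD[OF ncpolys_mono[OF smash_gens_subset] p(1)] by simp
  show "v \<in> carrier (lowest_module \<Lambda>) \<Longrightarrow> x \<odot>\<^bsub>lowest_module \<Lambda>\<^esub> v \<in> carrier (lowest_module \<Lambda>)"
    using p by (simp add: lowest_module_eq low.OM_smult low.OM_simps low.opact_closed)
qed (simp add: lowest_module_eq low.OM_simps)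

abbreviation "\<Delta> \<equiv> standard_module n c d \<Lambda>"

definition \<iota> :: "irrep_vec \<Rightarrow> std_vec" where
  "\<iota> v = induced_unit (smash_algebra n) A (smash_to_cherednik n c d) (lowest_module \<Lambda>) v"

lemma \<Delta>_ind: "\<Delta> = ind.I"
  by (simp add: standard_module_def cherednik_algebra_def)

sublocale D: presented_module CG "cherednik_rels n c d" \<Delta>
  unfolding \<Delta>_ind by (intro presented_module.intro presentation_axioms ind.I.left_module_axioms)

lemma \<iota>_closed [simp]: "v \<in> carrier V \<Longrightarrow> \<iota> v \<in> carrier \<Delta>"
  unfolding \<Delta>_ind \<iota>_def by (rule ind.unit_closed) (simp add: lowest_module_eq low.OM_simps)

lemma \<iota>_add: "v \<in> carrier V \<Longrightarrow> w \<in> carrier V \<Longrightarrow> \<iota> (v \<oplus>\<^bsub>V\<^esub> w) = \<iota> v \<oplus>\<^bsub>\<Delta>\<^esub> \<iota> w"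
  unfolding \<Delta>_ind \<iota>_def using ind.unit_add[of v w] by (simp add: lowest_module_eq low.OM_simps)

lemma \<iota>_act: "p \<in> ncpolys SG \<Longrightarrow> v \<in> carrier V \<Longrightarrow> D.act p (\<iota> v) = \<iota> (low.opact p v)"
  unfolding D.act_def unfolding \<Delta>_ind \<iota>_def
  using ind.unit_smult[of "low.cls p" v] smash_to_cherednik_cls[of p] low.cls_closed[of p]
  by (simp add: lowest_module_eq low.OM_simps low.OM_smult smash_algebra_def)

lemma \<iota>_simps:
  assumes v: "v \<in> carrier V"
  shows "D.act (constp x) (\<iota> v) = \<iota> (x \<odot>\<^bsub>V\<^esub> v)"
    and "g \<in> G \<Longrightarrow> D.act (wp g) (\<iota> v) = \<iota> (act g v)"
    and "i \<in> {1..n} \<Longrightarrow> D.act (yp i) (\<iota> v) = \<zero>\<^bsub>\<Delta>\<^esub>"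
    and "\<iota> \<zero>\<^bsub>V\<^esub> = \<zero>\<^bsub>\<Delta>\<^esub>"
proof -
  show 1: "D.act (constp x) (\<iota> v) = \<iota> (x \<odot>\<^bsub>V\<^esub> v)" for x using \<iota>_act[of "constp x" v] v by simp
  show 0: "\<iota> \<zero>\<^bsub>V\<^esub> = \<zero>\<^bsub>\<Delta>\<^esub>" using 1[of 0] v by (simp add: V_scale)
  show "g \<in> G \<Longrightarrow> D.act (wp g) (\<iota> v) = \<iota> (act g v)" using \<iota>_act[of "wp g" v] v by (simp add: low.opact_gen)
  show "i \<in> {1..n} \<Longrightarrow> D.act (yp i) (\<iota> v) = \<zero>\<^bsub>\<Delta>\<^esub>" using \<iota>_act[of "yp i" v] v 0 by (simp add: low.opact_gen)
qed

lemma submodule_\<Delta>_eq: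
  "submodule N A \<Delta> \<Longrightarrow> (\<And>v. v \<in> carrier V \<Longrightarrow> \<iota> v \<in> N) \<Longrightarrow> N = carrier \<Delta>"
  unfolding \<Delta>_ind \<iota>_def using ind.submodule_induced_eq[of N] by (simp add: lowest_module_eq low.OM_simps)

text \<open>
  The part of the Poincare--Birkhoff--Witt theorem that is needed: the standard module is spanned by words in the
  \<open>x\<^sub>i\<close> applied to the lowest weight space. The relations move group elements and the \<open>y\<^sub>i\<close> past the \<open>x\<^sub>i\<close>, so this
  span is a submodule.
\<close>

inductive_set xspan :: "std_vec set" where
  unit: "v \<in> carrier V \<Longrightarrow> \<iota> v \<in> xspan"
| add: "u \<in> xspan \<Longrightarrow> u' \<in> xspan \<Longrightarrow> u \<oplus>\<^bsub>\<Delta>\<^esub> u' \<in> xspan"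
| mult_x: "u \<in> xspan \<Longrightarrow> i \<in> {1..n} \<Longrightarrow> D.act (xp i) u \<in> xspan"

lemma xspan_closed: "u \<in> xspan \<Longrightarrow> u \<in> carrier \<Delta>"
  by (induction rule: xspan.induct) auto

lemma xspan_const: "u \<in> xspan \<Longrightarrow> D.act (constp x) u \<in> xspan"
proof (induction rule: xspan.induct)
  case (unit v)
  then show ?case using V_closed(2)[OF unit unit] by (simp add: \<iota>_simps xspan.unit)
next
  case (add u u')
  then show ?case by (simp add: D.act_vec_add xspan_closed xspan.add)
next
  case (mult_x u i)
  have "D.act (constp x) (D.act (xp i) u) = D.act (xp i) (D.act (constp x) u)"
    using mult_x by (simp add: xspan_closed constp_comm flip: D.act_mult)
  then show ?case using mult_x by (simp add: xspan.mult_x)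
qed

lemma xspan_w: "u \<in> xspan \<Longrightarrow> g \<in> G \<Longrightarrow> D.act (wp g) u \<in> xspan"
proof (induction rule: xspan.induct)
  case (unit v)
  then show ?case using V_closed(3)[OF unit(1) unit(1)] by (simp add: \<iota>_simps xspan.unit)
next
  case (add u u')
  then show ?case by (simp add: D.act_vec_add xspan_closed xspan.add)
next
  case (mult_x u i)
  have "D.act (wp g) (D.act (xp i) u) = D.act (wp g * xp i) u"
    using mult_x by (simp add: xspan_closed D.act_mult)
  also have "\<dots> = D.act (constp (of_int (fst g (snd g i))) * xp (snd g i) * wp g) u"
    by (rule D.act_congr[OF w_x])
      (use mult_x in \<open>simp_all add: xspan_closed del: atLeastAtMost_iff\<close>)
  also have "\<dots> = D.act (constp (of_int (fst g (snd g i)))) (D.act (xp (snd g i)) (D.act (wp g) u))"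
    using mult_x by (simp add: D.act_mult xspan_closed del: atLeastAtMost_iff)
  finally show ?case
    using mult_x by (simp add: xspan_const xspan.mult_x del: atLeastAtMost_iff)
qed

lemma xspan_br: "u \<in> xspan \<Longrightarrow> D.act (br i j) u \<in> xspan"
proof -
  assume u: "u \<in> xspan"
  have "br i j \<in> ncpolys (GenW ` G)" unfolding bracket_def by (intro ncpolys_diff ncpolys_sum) auto
  then show ?thesis
  proof (induction rule: ncpoly_induct)
    case (const x)
    then show ?case by (rule xspan_const[OF u])
  next
    case (add p q)
    have "ncpolys (GenW ` G) \<subseteq> ncpolys CG" by (rule ncpolys_mono) auto
    then have "p \<in> ncpolys CG" "q \<in> ncpolys CG" using add by blast+
    then show ?case using add u by (simp add: D.act_add xspan_closed xspan.add)
  next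
    case (gen g p)
    have "ncpolys (GenW ` G) \<subseteq> ncpolys CG" by (rule ncpolys_mono) auto
    then have "p \<in> ncpolys CG" using gen by blast
    then show ?case using gen u by (auto simp: D.act_mult xspan_closed intro!: xspan_w)
  qed
qed

lemma xspan_y: "u \<in> xspan \<Longrightarrow> j \<in> {1..n} \<Longrightarrow> D.act (yp j) u \<in> xspan"
proof (induction rule: xspan.induct)
  case (unit v)
  then show ?case using xspan.unit[of "\<zero>\<^bsub>V\<^esub>"] by (simp add: \<iota>_simps del: atLeastAtMost_iff)
next
  case (add u u')
  then show ?case by (simp add: D.act_vec_add xspan_closed xspan.add)
next
  case (mult_x u i)
  have "D.act (yp j) (D.act (xp i) u) = D.act (yp j * xp i) u"
    using mult_x by (simp add: xspan_closed D.act_mult)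
  also have "\<dots> = D.act (xp i * yp j + br j i) u"
    by (rule D.act_congr[OF yx]) (use mult_x in auto)
  also have "\<dots> = D.act (xp i) (D.act (yp j) u) \<oplus>\<^bsub>\<Delta>\<^esub> D.act (br j i) u"
    using mult_x by (simp add: D.act_mult D.act_add xspan_closed)
  finally show ?case using mult_x by (simp add: xspan_br xspan.intros)
qed

lemma xspan_eq: "xspan = carrier \<Delta>"
proof (rule submodule_\<Delta>_eq)
  show "submodule xspan A \<Delta>"
  proof (rule D.submodule_actI)
    show "\<zero>\<^bsub>\<Delta>\<^esub> \<in> xspan" using xspan.unit[of "\<zero>\<^bsub>V\<^esub>"] \<iota>_simps(4)[of "\<zero>\<^bsub>V\<^esub>"] by simp
    fix g u assume "g \<in> CG" "u \<in> xspan"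
    then show "D.act (genp g) u \<in> xspan"
      by (cases g) (simp_all add: xspan.mult_x xspan_w xspan_y del: atLeastAtMost_iff)
  qed (auto simp: xspan_closed xspan_const intro: xspan.add)
qed (rule xspan.unit)

lemma \<Delta>_induct [consumes 1, case_names unit add mult_x]:
  assumes "u \<in> carrier \<Delta>"
    and "\<And>v. v \<in> carrier V \<Longrightarrow> P (\<iota> v)"
    and "\<And>u u'. u \<in> carrier \<Delta> \<Longrightarrow> u' \<in> carrier \<Delta> \<Longrightarrow> P u \<Longrightarrow> P u' \<Longrightarrow> P (u \<oplus>\<^bsub>\<Delta>\<^esub> u')"
    and "\<And>u i. u \<in> carrier \<Delta> \<Longrightarrow> P u \<Longrightarrow> i \<in> {1..n} \<Longrightarrow> P (D.act (xp i) u)"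
  shows "P u"
  using assms(1) unfolding xspan_eq[symmetric]
  by (induction rule: xspan.induct) (use assms xspan_eq in auto)


subsection \<open>The map to the coinduced module\<close>

text \<open>
  A lowest weight vector as an element of the coinduced module: it has degree \<open>0\<close>, so its value at every
  nonempty word is \<open>0\<close>.
\<close>

definition emb :: "irrep_vec \<Rightarrow> ((nat \<Rightarrow> nat) \<times> (nat \<Rightarrow> nat)) coind_vec" where
  "emb v = (\<lambda>w (h, x). if w = [] \<and> h \<in> G then v h x else 0)"

lemma emb_closed: "emb v \<in> swap_invariant"
  by (simp add: emb_def swap_invariant_def)

lemma emb_linear: "emb (v \<oplus>\<^bsub>V\<^esub> w) = (\<lambda>z p. emb v z p + emb w z p)" "emb (x \<odot>\<^bsub>V\<^esub> v) = (\<lambda>z p. x * emb v z p)"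
  "emb \<zero>\<^bsub>V\<^esub> = (\<lambda>z p. 0)"
  by (auto simp: emb_def V_add V_smult V_zero fun_eq_iff)

lemma yop_emb: "yop i (emb v) = (\<lambda>w p. 0)"
  by (auto simp: yop_def emb_def fun_eq_iff)

lemma wact_emb:
  assumes g: "g \<in> G" shows "wact g (emb v) = emb (act g v)"
proof (intro ext)
  fix w :: "nat list" and p :: "signed_perm \<times> (nat \<Rightarrow> nat) \<times> (nat \<Rightarrow> nat)"
  obtain h x where p: "p = (h, x)" by (cases p)
  have "bmul (binv g) h \<in> G \<longleftrightarrow> h \<in> G" using g by (metis HO_simps(3) binv_closed bmul_closed)
  then show "wact g (emb v) w p = emb (act g v) w p"
    using g by (auto simp: p emb_def wact.simps act_eq)
qed

lemma emb_inj: "v \<in> carrier V \<Longrightarrow> w \<in> carrier V \<Longrightarrow> emb v [] = emb w [] \<Longrightarrow> v = w"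
proof (rule V_ext)
  fix g x assume eq: "emb v [] = emb w []" and g: "g \<in> G"
  show "v g x = w g x" using fun_cong[OF eq, of "(g, x)"] g by (simp add: emb_def)
qed

lemma emb_opact:
  assumes p: "p \<in> ncpolys SG" and v: "v \<in> carrier V"
  shows "coind.opact p (emb v) = emb (low.opact p v)"
  using p
proof (induction rule: ncpoly_induct)
  case (const x)
  then show ?case using v emb_closed by (simp add: emb_linear)
next
  case (add p q)
  then show ?case
    using coind.opact_add[of p q "emb v"] ncpolys_mono[OF smash_gens_subset] v emb_closed
    by (auto simp: low.opact_add emb_linear)
next
  case (gen g p)
  then have "g \<in> CG" "p \<in> ncpolys CG" using ncpolys_mono[OF smash_gens_subset] smash_gens_subset by auto
  then have "coind.opact (genp g * p) (emb v) = cop g (emb (low.opact p v))"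
    using coind.opact_gen_mult[of g p "emb v"] gen emb_closed by simp
  also have "\<dots> = emb (lowest_op \<Lambda> g (low.opact p v))"
    using gen(1) by (cases g) (auto simp: yop_emb wact_emb emb_linear)
  finally show ?case using gen v by (simp add: low.opact_gen_mult)
qed

text \<open>
  The universal property of the induced module, applied to \<open>emb\<close>.
\<close>

lemma coinduced_map_exists: "\<exists>\<Phi>. (\<forall>u\<in>carrier \<Delta>. \<Phi> u \<in> carrier coind.OM) \<and>
    (\<forall>u\<in>carrier \<Delta>. \<forall>u'\<in>carrier \<Delta>. \<Phi> (u \<oplus>\<^bsub>\<Delta>\<^esub> u') = \<Phi> u \<oplus>\<^bsub>coind.OM\<^esub> \<Phi> u') \<and>
    (\<forall>x\<in>carrier A. \<forall>u\<in>carrier \<Delta>. \<Phi> (x \<odot>\<^bsub>\<Delta>\<^esub> u) = x \<odot>\<^bsub>coind.OM\<^esub> \<Phi> u) \<and>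
    (\<forall>v\<in>carrier V. \<Phi> (\<iota> v) = emb v)"
proof (rule ind.induced_universal[OF coind.OM.left_module_axioms, of emb])
  fix u v assume "u \<in> carrier (lowest_module \<Lambda>)" "v \<in> carrier (lowest_module \<Lambda>)"
  then show "emb (u \<oplus>\<^bsub>lowest_module \<Lambda>\<^esub> v) = emb u \<oplus>\<^bsub>coind.OM\<^esub> emb v"
    by (simp add: lowest_module_eq low.OM_simps coind.OM_simps emb_linear)
next
  fix x v assume x: "x \<in> carrier (smash_algebra n)" and v: "v \<in> carrier (lowest_module \<Lambda>)"
  then obtain p where p: "p \<in> ncpolys SG" "x = low.cls p"
    unfolding smash_algebra_def using low.cls_surj by blast
  then show "emb (x \<odot>\<^bsub>lowest_module \<Lambda>\<^esub> v) = smash_to_cherednik n c d x \<odot>\<^bsub>coind.OM\<^esub> emb v"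
    using v smash_to_cherednik_cls coind.OM_smult[of p "emb v"] emb_opact[of p v] emb_closed
      ncpolys_mono[OF smash_gens_subset[of n]]
    by (auto simp: lowest_module_eq low.OM_simps low.OM_smult)
next
  fix \<Phi>
  assume "\<And>x. x \<in> carrier ind.I \<Longrightarrow> \<Phi> x \<in> carrier coind.OM"
    "\<And>x y. x \<in> carrier ind.I \<Longrightarrow> y \<in> carrier ind.I \<Longrightarrow> \<Phi> (x \<oplus>\<^bsub>ind.I\<^esub> y) = \<Phi> x \<oplus>\<^bsub>coind.OM\<^esub> \<Phi> y"
    "\<And>a x. a \<in> carrier A \<Longrightarrow> x \<in> carrier ind.I \<Longrightarrow> \<Phi> (a \<odot>\<^bsub>ind.I\<^esub> x) = a \<odot>\<^bsub>coind.OM\<^esub> \<Phi> x"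
    "\<And>v. v \<in> carrier (lowest_module \<Lambda>) \<Longrightarrow> \<Phi> (ind.unit v) = emb v"
  then show ?thesis
    unfolding \<Delta>_ind \<iota>_def by (intro exI[of _ \<Phi>]) (simp add: lowest_module_eq low.OM_simps)
qed (simp add: coind.OM_simps emb_closed)

definition \<Phi> :: "std_vec \<Rightarrow> ((nat \<Rightarrow> nat) \<times> (nat \<Rightarrow> nat)) coind_vec" where
  "\<Phi> = (SOME \<Phi>. (\<forall>u\<in>carrier \<Delta>. \<Phi> u \<in> carrier coind.OM) \<and>
    (\<forall>u\<in>carrier \<Delta>. \<forall>u'\<in>carrier \<Delta>. \<Phi> (u \<oplus>\<^bsub>\<Delta>\<^esub> u') = \<Phi> u \<oplus>\<^bsub>coind.OM\<^esub> \<Phi> u') \<and>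
    (\<forall>x\<in>carrier A. \<forall>u\<in>carrier \<Delta>. \<Phi> (x \<odot>\<^bsub>\<Delta>\<^esub> u) = x \<odot>\<^bsub>coind.OM\<^esub> \<Phi> u) \<and>
    (\<forall>v\<in>carrier V. \<Phi> (\<iota> v) = emb v))"

lemma \<Phi>_closed: "u \<in> carrier \<Delta> \<Longrightarrow> \<Phi> u \<in> swap_invariant"
  and \<Phi>_add: "u \<in> carrier \<Delta> \<Longrightarrow> u' \<in> carrier \<Delta> \<Longrightarrow> \<Phi> (u \<oplus>\<^bsub>\<Delta>\<^esub> u') = (\<lambda>w p. \<Phi> u w p + \<Phi> u' w p)"
  and \<Phi>_act: "p \<in> ncpolys CG \<Longrightarrow> u \<in> carrier \<Delta> \<Longrightarrow> \<Phi> (D.act p u) = coind.opact p (\<Phi> u)"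
  and \<Phi>_unit: "v \<in> carrier V \<Longrightarrow> \<Phi> (\<iota> v) = emb v"
proof -
  note P = someI_ex[OF coinduced_map_exists, folded \<Phi>_def]
  show cl: "u \<in> carrier \<Delta> \<Longrightarrow> \<Phi> u \<in> swap_invariant" for u using P by (simp add: coind.OM_simps)
  show "u \<in> carrier \<Delta> \<Longrightarrow> u' \<in> carrier \<Delta> \<Longrightarrow> \<Phi> (u \<oplus>\<^bsub>\<Delta>\<^esub> u') = (\<lambda>w p. \<Phi> u w p + \<Phi> u' w p)"
    using P by (simp add: coind.OM_simps)
  show "p \<in> ncpolys CG \<Longrightarrow> u \<in> carrier \<Delta> \<Longrightarrow> \<Phi> (D.act p u) = coind.opact p (\<Phi> u)"
    using P cl coind.OM_smult[of p "\<Phi> u"] by (simp add: D.act_def)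
  show "v \<in> carrier V \<Longrightarrow> \<Phi> (\<iota> v) = emb v" using P by simp
qed

lemma \<Phi>_gen:
  assumes "u \<in> carrier \<Delta>"
  shows "i \<in> {1..n} \<Longrightarrow> \<Phi> (D.act (xp i) u) = xop i (\<Phi> u)"
    "i \<in> {1..n} \<Longrightarrow> \<Phi> (D.act (yp i) u) = yop i (\<Phi> u)"
    "g \<in> G \<Longrightarrow> \<Phi> (D.act (wp g) u) = wact g (\<Phi> u)"
    "\<Phi> (D.act (constp x) u) = (\<lambda>w p. x * \<Phi> u w p)"
    "\<Phi> \<zero>\<^bsub>\<Delta>\<^esub> = (\<lambda>w p. 0)"
proof -
  note cl = \<Phi>_closed[OF assms]
  show "i \<in> {1..n} \<Longrightarrow> \<Phi> (D.act (xp i) u) = xop i (\<Phi> u)"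
    "i \<in> {1..n} \<Longrightarrow> \<Phi> (D.act (yp i) u) = yop i (\<Phi> u)"
    "g \<in> G \<Longrightarrow> \<Phi> (D.act (wp g) u) = wact g (\<Phi> u)"
    using \<Phi>_act[OF _ assms] coind_opact_simps(5-7)[OF cl] by simp_all
  show c: "\<Phi> (D.act (constp x) u) = (\<lambda>w p. x * \<Phi> u w p)" for x
    using \<Phi>_act[of "constp x", OF _ assms] cl by simp
  show "\<Phi> \<zero>\<^bsub>\<Delta>\<^esub> = (\<lambda>w p. 0)" using c[of 0] assms by simp
qed

lemma xop_range:
  assumes k: "k \<in> {1..n}"
  shows "(\<And>w p. w \<notin> lists {1..n} \<Longrightarrow> F w p = 0) \<Longrightarrow> w \<notin> lists {1..n} \<Longrightarrow> xop k F w p = 0"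
proof (induction w arbitrary: F)
  case (Cons i w)
  have w: "wact g F w p = 0" if "g \<in> G" "w \<notin> lists {1..n}" for g w p
  proof -
    have "map (inv_into UNIV (snd g)) w \<notin> lists {1..n}"
      using that(2) HO_inv_in[OF that(1)] by (auto simp: in_lists_conv_set)
    from Cons.prems(1)[OF this] show ?thesis by (cases p) (simp add: wact.simps)
  qed
  show ?case
  proof (cases "i \<in> {1..n}")
    case True
    then have "w \<notin> lists {1..n}" using Cons.prems(2) by auto
    moreover have "yop i F w' p = 0" if "w' \<notin> lists {1..n}" for w' p
      using Cons.prems(1)[of "i # w'"] that by (auto simp: yop_def)
    moreover have "brop i k F w p = 0"
      unfolding brop_def using Cons.prems(1) w calculation(1) by simp
    ultimately show ?thesis using Cons.IH by (simp add: xop_Cons)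
  next
    case False
    then have "yop i F = (\<lambda>w p. 0)" using Cons.prems(1) by (auto simp: yop_def fun_eq_iff)
    moreover have "i \<noteq> k" using k False by blast
    ultimately show ?thesis using root_outside[OF _ False] by (simp add: xop_Cons xop_zero brop_def)
  qed
qed simp

lemma \<Phi>_range: "u \<in> carrier \<Delta> \<Longrightarrow> w \<notin> lists {1..n} \<Longrightarrow> \<Phi> u w p = 0"
proof (induction u arbitrary: w p rule: \<Delta>_induct)
  case (unit v)
  then show ?case by (cases p) (auto simp: \<Phi>_unit emb_def)
next
  case (mult_x u i)
  have "xop i (\<Phi> u) w p = 0" by (rule xop_range) (fact mult_x)+
  then show ?case using mult_x by (simp only: \<Phi>_gen(1))
qed (simp add: \<Phi>_add)

text \<open>
  Application of the \<open>y\<^sub>i\<close> of a word turns the value of \<open>\<Phi> u\<close> at this word into a value at the empty word.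
\<close>

primrec act_word :: "nat list \<Rightarrow> std_vec \<Rightarrow> std_vec" where
  "act_word [] u = u"
| "act_word (i # w) u = act_word w (D.act (yp i) u)"

lemma act_word: "w \<in> lists {1..n} \<Longrightarrow> u \<in> carrier \<Delta> \<Longrightarrow>
    act_word w u \<in> carrier \<Delta> \<and> \<Phi> (act_word w u) [] = \<Phi> u w"
  by (induction w arbitrary: u) (simp_all add: \<Phi>_gen yop_def)


subsection \<open>Projection to the lowest weight space\<close>

lemma group_euler_scalar:
  obtains z where "\<And>v. v \<in> carrier V \<Longrightarrow> D.act group_euler (\<iota> v) = \<iota> (z \<odot>\<^bsub>V\<^esub> v)"
proof -
  let ?\<kappa> = "\<lambda>s. weight c d s / conorm s"
  obtain z where z: "\<And>v. v \<in> carrier V \<Longrightarrow> group_comb (roots n) ?\<kappa> refln v = z \<odot>\<^bsub>V\<^esub> v"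
    by (rule central_scalar[of ?\<kappa>]) (simp add: weight_conj conorm_conj, blast)
  have "D.act (\<Sum>s\<in>S. constp (?\<kappa> s) * wp (refln s)) (\<iota> v) = \<iota> (group_comb S ?\<kappa> refln v)"
    if v: "v \<in> carrier V" and S: "S \<subseteq> roots n" for v S
    using finite_subset[OF S finite_roots] S
  proof (induction S)
    case empty
    then show ?case using \<iota>_simps(4)[OF v] v by (simp add: group_comb_empty)
  next
    case (insert s S)
    have s: "s \<in> roots n" using insert.prems by simp
    have cl: "group_comb S ?\<kappa> refln v \<in> carrier V"
      by (rule group_comb_gsub[OF subrep_V]) (use insert v in auto)
    have sum: "(\<Sum>s\<in>S. constp (?\<kappa> s) * wp (refln s)) \<in> ncpolys CG" by (rule ncpolys_sum) (use insert.prems in auto)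
    have a: "act (refln s) v \<in> carrier V" by (rule V_closed(3)[OF v v refl_closed[OF s]])
    have "D.act (constp (?\<kappa> s) * wp (refln s)) (\<iota> v) = \<iota> (?\<kappa> s \<odot>\<^bsub>V\<^esub> act (refln s) v)"
      using s v a by (simp add: D.act_mult \<iota>_simps)
    then show ?case
      using insert sum s v a cl V_closed(2)[OF a a]
      by (simp add: D.act_add group_comb_insert refl_square(2) \<iota>_add)
  qed
  from this[OF _ subset_refl] have "D.act group_euler (\<iota> v) = \<iota> (z \<odot>\<^bsub>V\<^esub> v)" if "v \<in> carrier V" for v
    unfolding group_euler_def using that z by simp
  then show thesis by (rule that)
qed

lemma euler_lowest:
  obtains h where "\<And>v. v \<in> carrier V \<Longrightarrow> D.act (euler - constp h) (\<iota> v) = \<zero>\<^bsub>\<Delta>\<^esub>"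
proof -
  obtain z where z: "\<And>v. v \<in> carrier V \<Longrightarrow> D.act group_euler (\<iota> v) = \<iota> (z \<odot>\<^bsub>V\<^esub> v)"
    by (rule group_euler_scalar) blast
  have sub: "D.act (p - q) u \<oplus>\<^bsub>\<Delta>\<^esub> D.act q u = D.act p u" if "p \<in> ncpolys CG" "q \<in> ncpolys CG" "u \<in> carrier \<Delta>" for p q u
    using that D.act_add[of "p - q" q u] by simp
  have "D.act (euler - constp (- z)) (\<iota> v) = \<zero>\<^bsub>\<Delta>\<^esub>" if v: "v \<in> carrier V" for v
  proof -
    have "D.act (\<Sum>i\<in>S. xp i * yp i) (\<iota> v) = \<zero>\<^bsub>\<Delta>\<^esub>" if "S \<subseteq> {1..n}" for S
      using finite_subset[OF that finite_atLeastAtMost] that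
    proof (induction S)
      case (insert i S)
      have "(\<Sum>i\<in>S. xp i * yp i) \<in> ncpolys CG" by (rule ncpolys_sum) (use insert.prems in auto)
      then show ?case using insert v by (simp add: D.act_add D.act_mult \<iota>_simps del: atLeastAtMost_iff)
    qed (use v in simp)
    from this[OF subset_refl] have 0: "D.act (\<Sum>i\<in>{1..n}. xp i * yp i) (\<iota> v) = \<zero>\<^bsub>\<Delta>\<^esub>" .
    have p: "(\<Sum>i\<in>{1..n}. xp i * yp i) \<in> ncpolys CG" by (rule ncpolys_sum) auto
    have "D.act (euler - constp (- z)) (\<iota> v) \<oplus>\<^bsub>\<Delta>\<^esub> D.act (group_euler - constp z) (\<iota> v) = \<zero>\<^bsub>\<Delta>\<^esub>"
      using 0 v p D.act_add[of "euler - constp (- z)" "group_euler - constp z" "\<iota> v"]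
      by (simp add: euler_def constp_uminus)
    moreover have "D.act (group_euler - constp z) (\<iota> v) = \<zero>\<^bsub>\<Delta>\<^esub>"
      using sub[of group_euler "constp z" "\<iota> v"] z[OF v] v V_closed(2)[OF v v]
      by (simp add: \<iota>_simps)
    ultimately show ?thesis using v by simp
  qed
  then show thesis by (rule that)
qed

text \<open>
  If the Euler element acts on the lowest weight space by \<open>h\<close>, then this polynomial in it kills the degrees \<open>1, \<dots>, m\<close> and
  acts on degree \<open>0\<close> by a nonzero scalar.
\<close>

primrec deg_poly :: "complex \<Rightarrow> nat \<Rightarrow> cgen ncpoly" where
  "deg_poly h 0 = 1"
| "deg_poly h (Suc m) = (euler - constp (h + of_nat (Suc m))) * deg_poly h m"

lemma deg_poly_closed [simp]: "deg_poly h m \<in> ncpolys CG"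
  by (induction m) auto

lemma deg_poly_comm: "deg_poly h m * (euler - constp x) = (euler - constp x) * deg_poly h m"
proof (induction m)
  case (Suc m)
  let ?y = "h + of_nat (Suc m)"
  have e: "euler * (euler - constp x) = (euler - constp x) * euler"
    by (simp only: left_diff_distrib right_diff_distrib constp_comm[of x euler])
  have "(euler - constp ?y) * (euler - constp x) = (euler - constp x) * (euler - constp ?y)"
    by (simp only: left_diff_distrib[of euler "constp ?y"] right_diff_distrib[of _ euler "constp ?y"]
        constp_comm[of ?y] e)
  then show ?case unfolding deg_poly.simps mult.assoc Suc by (simp only: mult.assoc[symmetric])
qed simp

lemma deg_poly_add: "\<exists>q\<in>ncpolys CG. deg_poly h (m + k) = q * deg_poly h m"
proof (induction k)
  case 0
  show ?case by (rule bexI[of _ 1]) simp_all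
next
  case (Suc k)
  then obtain q where "q \<in> ncpolys CG" "deg_poly h (m + k) = q * deg_poly h m" by blast
  then show ?case by (intro bexI[of _ "(euler - constp (h + of_nat (Suc (m + k)))) * q"]) (simp_all add: mult.assoc)
qed

lemma euler_const_x:
  assumes i: "i \<in> {1..n}"
  shows "(euler - constp (h + 1)) * xp i \<doteq> xp i * (euler - constp h)"
  using congr_diff[OF euler_x[OF i] congr_refl[of "constp (h + 1) * xp i"]]
  by (simp add: algebra_simps constp_add constp_comm[of h])

text \<open>
  Moving \<open>x\<^sub>i\<close> to the left lowers all roots of the polynomial by \<open>1\<close>.
\<close>

lemma deg_poly_x:
  assumes i: "i \<in> {1..n}"
  shows "deg_poly h (Suc m) * xp i \<doteq> xp i * (deg_poly h m * (euler - constp h))"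
proof (induction m)
  case 0
  then show ?case using euler_const_x[OF i, of h] by simp
next
  case (Suc m)
  let ?e = "\<lambda>k. euler - constp (h + of_nat k)"
  have "deg_poly h (Suc (Suc m)) * xp i = ?e (Suc (Suc m)) * (deg_poly h (Suc m) * xp i)" by (simp add: mult.assoc)
  also have "\<dots> \<doteq> ?e (Suc (Suc m)) * (xp i * (deg_poly h m * (euler - constp h)))"
    by (rule congr_mult_left[OF Suc]) simp
  also have "\<dots> = ?e (Suc (Suc m)) * xp i * (deg_poly h m * (euler - constp h))" by (simp add: mult.assoc)
  also have "\<dots> \<doteq> xp i * ?e (Suc m) * (deg_poly h m * (euler - constp h))"
    by (rule congr_mult_right)
       (use euler_const_x[OF i, of "h + of_nat (Suc m)"] in \<open>simp_all add: add_ac\<close>)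
  finally show ?case by (simp add: mult.assoc)
qed

text \<open>
  Every element of the standard module has a component \<open>v\<close> of degree \<open>0\<close>, and a polynomial in the Euler
  element of sufficiently high degree does not see the rest. The component is also the value of \<open>\<Phi>\<close> at the empty
  word.
\<close>

lemma lowest_part:
  assumes h: "\<And>v. v \<in> carrier V \<Longrightarrow> D.act (euler - constp h) (\<iota> v) = \<zero>\<^bsub>\<Delta>\<^esub>" and u: "u \<in> carrier \<Delta>"
  shows "\<exists>m. \<exists>v\<in>carrier V. \<Phi> u [] = emb v [] \<and> D.act (deg_poly h m) u = D.act (deg_poly h m) (\<iota> v)"
  using u
proof (induction u rule: \<Delta>_induct)
  case (unit v)
  then show ?case by (intro exI[of _ 0] bexI[of _ v]) (simp_all add: \<Phi>_unit)
next
  case (add u u')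
  then obtain m v m' v' where m: "v \<in> carrier V" "\<Phi> u [] = emb v []" "D.act (deg_poly h m) u = D.act (deg_poly h m) (\<iota> v)"
    "v' \<in> carrier V" "\<Phi> u' [] = emb v' []" "D.act (deg_poly h m') u' = D.act (deg_poly h m') (\<iota> v')" by blast
  obtain q where q: "q \<in> ncpolys CG" "deg_poly h (m + m') = q * deg_poly h m" using deg_poly_add by blast
  obtain q' where q': "q' \<in> ncpolys CG" "deg_poly h (m + m') = q' * deg_poly h m'"
    using deg_poly_add[of h m' m] by (auto simp: add.commute)
  have "D.act (deg_poly h (m + m')) u = D.act (deg_poly h (m + m')) (\<iota> v)"
    unfolding q(2) using add m q by (simp add: D.act_mult)
  moreover have "D.act (deg_poly h (m + m')) u' = D.act (deg_poly h (m + m')) (\<iota> v')"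
    unfolding q'(2) using add m q' by (simp add: D.act_mult)
  ultimately have "D.act (deg_poly h (m + m')) (u \<oplus>\<^bsub>\<Delta>\<^esub> u') = D.act (deg_poly h (m + m')) (\<iota> (v \<oplus>\<^bsub>V\<^esub> v'))"
    using add m by (simp add: D.act_vec_add \<iota>_add)
  moreover have "\<Phi> (u \<oplus>\<^bsub>\<Delta>\<^esub> u') [] = emb (v \<oplus>\<^bsub>V\<^esub> v') []" using add m by (simp add: \<Phi>_add emb_linear)
  ultimately show ?case using m by blast
next
  case (mult_x u i)
  then obtain m v where m: "v \<in> carrier V" "D.act (deg_poly h m) u = D.act (deg_poly h m) (\<iota> v)" by blast
  have "D.act (deg_poly h (Suc m)) (D.act (xp i) u) = D.act (deg_poly h (Suc m) * xp i) u"
    using mult_x by (simp add: D.act_mult del: deg_poly.simps)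
  also have "\<dots> = D.act (xp i * (deg_poly h m * (euler - constp h))) u"
    by (rule D.act_congr[OF deg_poly_x]) (use mult_x in \<open>auto simp del: deg_poly.simps\<close>)
  also have "\<dots> = D.act (xp i) (D.act (euler - constp h) (D.act (deg_poly h m) u))"
    using mult_x unfolding deg_poly_comm by (simp add: D.act_mult)
  also have "\<dots> = D.act (xp i) (D.act (deg_poly h m) (D.act (euler - constp h) (\<iota> v)))"
    unfolding m(2) using m(1) deg_poly_comm[of h m h] by (simp flip: D.act_mult)
  also have "\<dots> = D.act (deg_poly h (Suc m)) (\<iota> \<zero>\<^bsub>V\<^esub>)"
    using h[OF m(1)] mult_x \<iota>_simps(4)[of "\<zero>\<^bsub>V\<^esub>"] by (simp del: deg_poly.simps)
  finally have "D.act (deg_poly h (Suc m)) (D.act (xp i) u) = D.act (deg_poly h (Suc m)) (\<iota> \<zero>\<^bsub>V\<^esub>)" .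
  moreover have "\<Phi> (D.act (xp i) u) [] = emb \<zero>\<^bsub>V\<^esub> []"
    using mult_x by (simp add: \<Phi>_gen emb_linear fun_eq_iff del: atLeastAtMost_iff)
  moreover have "\<zero>\<^bsub>V\<^esub> \<in> carrier V" by simp
  ultimately show ?case by blast
qed

lemma deg_poly_lowest:
  assumes h: "\<And>v. v \<in> carrier V \<Longrightarrow> D.act (euler - constp h) (\<iota> v) = \<zero>\<^bsub>\<Delta>\<^esub>" and v: "v \<in> carrier V"
  shows "\<exists>x. x \<noteq> 0 \<and> D.act (deg_poly h m) (\<iota> v) = \<iota> (x \<odot>\<^bsub>V\<^esub> v)"
proof (induction m)
  case 0
  then show ?case using v by (intro exI[of _ 1]) (simp add: V_scale)
next
  case (Suc m)
  then obtain x where x: "x \<noteq> 0" "D.act (deg_poly h m) (\<iota> v) = \<iota> (x \<odot>\<^bsub>V\<^esub> v)" by blast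
  have xv: "x \<odot>\<^bsub>V\<^esub> v \<in> carrier V" using V_closed(2)[OF v v] .
  have "euler - constp (h + of_nat (Suc m)) = (euler - constp h) + constp (- of_nat (Suc m))"
    by (simp only: constp_add constp_uminus diff_conv_add_uminus minus_add_distrib add.assoc)
  then have "D.act (euler - constp (h + of_nat (Suc m))) (\<iota> (x \<odot>\<^bsub>V\<^esub> v)) = \<iota> ((- of_nat (Suc m)) \<odot>\<^bsub>V\<^esub> (x \<odot>\<^bsub>V\<^esub> v))"
    using h[OF xv] xv V_closed(2)[OF xv xv] by (simp only: D.act_add \<iota>_simps \<iota>_closed ncpolys_diff ncpolys_const euler_closed D.M.M.l_zero)
  then have "D.act (deg_poly h (Suc m)) (\<iota> v) = \<iota> ((- of_nat (Suc m) * x) \<odot>\<^bsub>V\<^esub> v)"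
    using x v by (simp add: D.act_mult V_scale del: of_nat_Suc)
  then show ?case using x by (intro exI[of _ "- of_nat (Suc m) * x"]) (simp del: of_nat_Suc)
qed

text \<open>
  A submodule that is not killed by \<open>\<Phi>\<close> contains an element whose component of degree \<open>0\<close> is not zero.
  The Euler element separates this component from the others, so the submodule contains a nonzero lowest weight vector. As
  \<open>V\<close> is irreducible, it then contains the whole lowest weight space, which generates the module.
\<close>

lemma submodule_proper:
  assumes N: "submodule N A \<Delta>" and u: "u \<in> N" "\<Phi> u \<noteq> (\<lambda>w p. 0)"
  shows "N = carrier \<Delta>"
proof -
  note N' = submoduleD[OF N]
  have u\<Delta>: "u \<in> carrier \<Delta>" using u N' by blast
  obtain w p where wp: "\<Phi> u w p \<noteq> 0" using u(2) by (auto simp: fun_eq_iff)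
  then have w: "w \<in> lists {1..n}" using \<Phi>_range[OF u\<Delta>] by blast
  define u' where "u' = act_word w u"
  have u': "u' \<in> carrier \<Delta>" "\<Phi> u' [] p \<noteq> 0" using act_word[OF w u\<Delta>] wp by (simp_all add: u'_def)
  have "act_word w u \<in> N" using w u(1)
    by (induction w arbitrary: u) (simp_all add: D.submodule_act[OF N] del: atLeastAtMost_iff)
  then have u'N: "u' \<in> N" by (simp add: u'_def)
  obtain h where h: "\<And>v. v \<in> carrier V \<Longrightarrow> D.act (euler - constp h) (\<iota> v) = \<zero>\<^bsub>\<Delta>\<^esub>" by (rule euler_lowest) blast
  obtain m v where v: "v \<in> carrier V" "\<Phi> u' [] = emb v []" "D.act (deg_poly h m) u' = D.act (deg_poly h m) (\<iota> v)"
    using lowest_part[OF h u'(1)] by blast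
  obtain x where x: "x \<noteq> 0" "D.act (deg_poly h m) (\<iota> v) = \<iota> (x \<odot>\<^bsub>V\<^esub> v)" using deg_poly_lowest[OF h v(1)] by blast
  have "D.act (constp (1 / x)) (\<iota> (x \<odot>\<^bsub>V\<^esub> v)) \<in> N"
    using D.submodule_act[OF N deg_poly_closed u'N, of h m] v(3) x(2) by (auto intro: D.submodule_act[OF N])
  then have \<iota>N: "\<iota> v \<in> N" using x(1) v(1) V_closed(2)[OF v(1) v(1)] by (simp add: \<iota>_simps V_scale)
  have nz: "v \<noteq> \<zero>\<^bsub>V\<^esub>" using u'(2) v(2) by (auto simp: emb_linear)
  let ?U = "{v \<in> carrier V. \<iota> v \<in> N}"
  have "subrep ?U"
  proof (rule subrepI)
    fix g v assume g: "g \<in> G" and v: "v \<in> ?U"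
    then have "D.act (wp g) (\<iota> v) \<in> N" by (auto intro: D.submodule_act[OF N])
    then show "act g v \<in> ?U" using g v V_closed(3)[of v v g] by (simp add: \<iota>_simps)
  next
    fix y v assume v: "v \<in> ?U"
    then have "D.act (constp y) (\<iota> v) \<in> N" by (auto intro: D.submodule_act[OF N])
    then show "y \<odot>\<^bsub>V\<^esub> v \<in> ?U" using v V_closed(2)[of v v y] by (simp add: \<iota>_simps)
  qed (use N'(2,3) \<iota>_simps(4)[OF v(1)] in \<open>auto simp: \<iota>_add V_closed\<close>)
  moreover have "?U \<noteq> {\<zero>\<^bsub>V\<^esub>}" using \<iota>N nz v(1) by blast
  ultimately have "?U = carrier V" by (rule irrep_irreducible)
  then show ?thesis by (intro submodule_\<Delta>_eq[OF N]) blast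
qed

definition J where "J = {u \<in> carrier \<Delta>. \<Phi> u = (\<lambda>w p. 0)}"

lemma J_submodule: "submodule J A \<Delta>"
proof (rule D.submodule_actI)
  fix g u assume "g \<in> CG" "u \<in> J"
  then have "\<Phi> (D.act (genp g) u) = coind.opact (genp g) (\<lambda>w p. 0)" "u \<in> carrier \<Delta>" "genp g \<in> ncpolys CG"
    by (simp_all add: J_def \<Phi>_act)
  moreover have "coind.opact (genp g) (\<lambda>w p. 0) = ((\<lambda>w p. 0) :: ((nat \<Rightarrow> nat) \<times> (nat \<Rightarrow> nat)) coind_vec)"
    using coind.opact_linear(2)[of "genp g" "\<lambda>w p. 0" "\<lambda>w p. 0" 0] \<open>g \<in> CG\<close> by (simp add: swap_invariant_def)
  ultimately show "D.act (genp g) u \<in> J" by (simp add: J_def)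
next
  show "\<zero>\<^bsub>\<Delta>\<^esub> \<in> J" using \<Phi>_gen(5)[of "\<zero>\<^bsub>\<Delta>\<^esub>"] by (simp add: J_def)
qed (auto simp: J_def \<Phi>_add \<Phi>_gen(4))

lemma nonzero_V: obtains v where "v \<in> carrier V" "v \<noteq> \<zero>\<^bsub>V\<^esub>"
  using tableaux_ex coset_vec_nonzero by blast

lemma std_radical_eq: "std_radical n c d \<Lambda> = J"
proof -
  have "J \<noteq> carrier \<Delta>"
  proof
    assume J: "J = carrier \<Delta>"
    obtain v where v: "v \<in> carrier V" "v \<noteq> \<zero>\<^bsub>V\<^esub>" by (rule nonzero_V)
    have "\<iota> v \<in> J" unfolding J using v by simp
    then have "emb v [] = emb \<zero>\<^bsub>V\<^esub> []" using v by (simp add: J_def \<Phi>_unit emb_linear)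
    then show False using emb_inj[OF v(1)] v(2) by simp
  qed
  then have "\<And>K. submodule K A \<Delta> \<and> irreducible_module A (quot_module \<Delta> K) \<longleftrightarrow> K = J"
  proof (rule D.irreducible_quotient_unique[OF J_submodule])
    fix N assume N: "submodule N A \<Delta>" "N \<noteq> carrier \<Delta>"
    then show "N \<subseteq> J" using submodule_proper[OF N(1)] submoduleD(1)[OF N(1)] by (auto simp: J_def)
  qed
  then show ?thesis by (simp add: std_radical_def cherednik_algebra_def)
qed

end

section \<open>Positive definite Hermitian forms\<close>

locale positive_definite_form = left_module complex_ring M
  for M :: "(complex, 'v, 'd) module_scheme" +
  fixes B :: "'v \<Rightarrow> 'v \<Rightarrow> complex"
  assumes B_add: "\<lbrakk>u \<in> carrier M; v \<in> carrier M; w \<in> carrier M\<rbrakk> \<Longrightarrow> B (u \<oplus>\<^bsub>M\<^esub> v) w = B u w + B v w"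
    and B_smult: "\<lbrakk>u \<in> carrier M; v \<in> carrier M\<rbrakk> \<Longrightarrow> B (a \<odot>\<^bsub>M\<^esub> u) v = a * B u v"
    and B_cnj: "\<lbrakk>u \<in> carrier M; v \<in> carrier M\<rbrakk> \<Longrightarrow> B v u = cnj (B u v)"
    and B_pos: "\<lbrakk>u \<in> carrier M; u \<noteq> \<zero>\<^bsub>M\<^esub>\<rbrakk> \<Longrightarrow> Im (B u u) = 0 \<and> Re (B u u) > 0"
begin

lemma B_smult_right: "u \<in> carrier M \<Longrightarrow> v \<in> carrier M \<Longrightarrow> B v (a \<odot>\<^bsub>M\<^esub> u) = cnj a * B v u"
  using B_cnj[of "a \<odot>\<^bsub>M\<^esub> u" v] B_cnj[of u v] by (simp add: B_smult)

lemma B_zero: "v \<in> carrier M \<Longrightarrow> B \<zero>\<^bsub>M\<^esub> v = 0"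
  using B_smult[of "\<zero>\<^bsub>M\<^esub>" v 0] by simp

lemma B_nonneg: "u \<in> carrier M \<Longrightarrow> B u u = of_real (Re (B u u)) \<and> Re (B u u) \<ge> 0"
  using B_pos[of u] B_zero[of u] by (cases "u = \<zero>\<^bsub>M\<^esub>") (auto simp: complex_eq_iff)

lemma B_definite: "u \<in> carrier M \<Longrightarrow> B u u = 0 \<Longrightarrow> u = \<zero>\<^bsub>M\<^esub>"
  using B_pos[of u] by auto

definition orthonormal :: "'v set \<Rightarrow> bool" where
  "orthonormal E \<longleftrightarrow> finite E \<and> E \<subseteq> carrier M \<and> (\<forall>e\<in>E. \<forall>f\<in>E. B e f = (if e = f then 1 else 0))"

text \<open>
  \<open>w = u - \<Sum> k\<^sub>e e\<close>, described through its pairings only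
\<close>

lemma subtract_combination:
  assumes "finite E" "E \<subseteq> carrier M" "u \<in> carrier M"
  shows "\<exists>w\<in>carrier M. \<forall>v\<in>carrier M. B w v = B u v - (\<Sum>e\<in>E. k e * B e v)"
  using assms(1,2)
proof (induction E)
  case (insert e E)
  then obtain w where w: "w \<in> carrier M" "\<forall>v\<in>carrier M. B w v = B u v - (\<Sum>e\<in>E. k e * B e v)" by blast
  show ?case
    using w insert by (intro bexI[of _ "w \<oplus>\<^bsub>M\<^esub> ((- k e) \<odot>\<^bsub>M\<^esub> e)"]) (auto simp: B_add B_smult)
qed (use assms in auto)

text \<open>
  Gram--Schmidt orthogonalization. That \<open>E\<close> spans the vectors of \<open>S\<close> is expressed by the expansion of the form, a
  condition that is linear in the first argument and so extends to the span of \<open>S\<close>.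
\<close>

lemma orthonormal_expansion:
  assumes "finite S" "S \<subseteq> carrier M"
  shows "\<exists>E. orthonormal E \<and> (\<forall>s\<in>S. \<forall>v\<in>carrier M. B s v = (\<Sum>e\<in>E. B s e * B e v))"
  using assms
proof (induction S)
  case empty
  show ?case by (intro exI[of _ "{}"]) (simp add: orthonormal_def)
next
  case (insert s S)
  then obtain E where on: "orthonormal E"
    and exp: "\<And>s v. s \<in> S \<Longrightarrow> v \<in> carrier M \<Longrightarrow> B s v = (\<Sum>e\<in>E. B s e * B e v)" by auto
  have s: "s \<in> carrier M" using insert by simp
  have E: "finite E" "E \<subseteq> carrier M" and orth: "\<And>e f. e \<in> E \<Longrightarrow> f \<in> E \<Longrightarrow> B e f = (if e = f then 1 else 0)"
    using on by (auto simp: orthonormal_def)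
  obtain w where w: "w \<in> carrier M" and Bw: "\<And>v. v \<in> carrier M \<Longrightarrow> B w v = B s v - (\<Sum>e\<in>E. B s e * B e v)"
    using subtract_combination[OF E s, of "B s"] by blast
  show ?case
  proof (cases "w = \<zero>\<^bsub>M\<^esub>")
    case True
    then have "B s v = (\<Sum>e\<in>E. B s e * B e v)" if "v \<in> carrier M" for v
      using Bw[OF that] B_zero[OF that] by simp
    then show ?thesis using on exp by blast
  next
    case False
    define r where "r = Re (B w w)"
    have r: "B w w = of_real r" "r > 0" using B_pos[OF w False] by (auto simp: r_def complex_eq_iff)
    \<comment> \<open>The next basis vector is the normalized remainder \<open>w\<close> of \<open>s\<close>.\<close>
    define f where "f = of_real (1 / sqrt r) \<odot>\<^bsub>M\<^esub> w"
    have f: "f \<in> carrier M" unfolding f_def using w by simp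
    have inv: "of_real (1 / sqrt r) * of_real (1 / sqrt r) * of_real r = (1 :: complex)"
      using r(2) unfolding of_real_mult[symmetric] by simp
    have Bf: "B f v = of_real (1 / sqrt r) * B w v" "B v f = of_real (1 / sqrt r) * B v w" if "v \<in> carrier M" for v
      unfolding f_def using w that by (simp_all add: B_smult B_smult_right)
    have "B w e = 0" if e: "e \<in> E" for e
    proof -
      have "(\<Sum>e'\<in>E. B s e' * B e' e) = (\<Sum>e'\<in>E. if e' = e then B s e else 0)"
        by (rule sum.cong) (use orth e in auto)
      then show ?thesis using Bw[of e] e E by (auto simp: subset_iff)
    qed
    then have ef: "B f e = 0" "B e f = 0" if "e \<in> E" for e
      using Bf(1)[of e] B_cnj[of f e] that E f by (auto simp: subset_iff)
    have ff: "B f f = 1" using Bf(1)[OF f] Bf(2)[OF w] inv r(1) by (simp add: mult_ac)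
    have nf: "f \<notin> E" using ef ff by force
    have "(\<Sum>e\<in>E. B s e * B e w) = 0"
    proof (rule sum.neutral, rule ballI)
      fix e assume e: "e \<in> E"
      then have "B e w = cnj (B w e)" using B_cnj[of w e] w E by blast
      then show "B s e * B e w = 0" using \<open>\<And>e. e \<in> E \<Longrightarrow> B w e = 0\<close>[OF e] by simp
    qed
    then have "B s w = of_real r" using Bw[OF w] r(1) by simp
    then have "B s v = B s f * B f v + (\<Sum>e\<in>E. B s e * B e v)" if v: "v \<in> carrier M" for v
    proof -
      have "B s f * B f v = (of_real (1 / sqrt r) * of_real (1 / sqrt r) * of_real r) * B w v"
        using Bf(1)[OF v] Bf(2)[OF s] \<open>B s w = of_real r\<close> by (simp only: mult_ac)
      then show ?thesis unfolding inv using Bw[OF v] by simp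
    qed
    moreover have "B t f = 0" if t: "t \<in> S" for t using exp[OF t f] ef by simp
    moreover have "orthonormal (insert f E)" using on ef ff f nf by (auto simp: orthonormal_def)
    ultimately show ?thesis using exp nf E by (intro exI[of _ "insert f E"]) auto
  qed
qed

lemma orthonormal_basis:
  assumes "finite S" "S \<subseteq> carrier M" "gen_submodule complex_ring M S = carrier M"
  obtains E where "orthonormal E"
    "\<And>u v. u \<in> carrier M \<Longrightarrow> v \<in> carrier M \<Longrightarrow> B u v = (\<Sum>e\<in>E. B u e * B e v)"
proof -
  obtain E where E: "orthonormal E" "\<forall>s\<in>S. \<forall>v\<in>carrier M. B s v = (\<Sum>e\<in>E. B s e * B e v)"
    using orthonormal_expansion[OF assms(1,2)] by blast
  let ?U = "{u \<in> carrier M. \<forall>v\<in>carrier M. B u v = (\<Sum>e\<in>E. B u e * B e v)}"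
  have e: "e \<in> carrier M" if "e \<in> E" for e using E(1) that by (auto simp: orthonormal_def)
  have "submodule ?U complex_ring M"
  proof (rule submoduleI)
    fix u u' assume "u \<in> ?U" "u' \<in> ?U"
    then have u: "u \<in> carrier M" "u' \<in> carrier M" and
      ex: "\<And>v. v \<in> carrier M \<Longrightarrow> B u v + B u' v = (\<Sum>e\<in>E. B u e * B e v) + (\<Sum>e\<in>E. B u' e * B e v)" by auto
    have "B (u \<oplus>\<^bsub>M\<^esub> u') v = (\<Sum>e\<in>E. B (u \<oplus>\<^bsub>M\<^esub> u') e * B e v)" if v: "v \<in> carrier M" for v
      using u v ex[OF v] by (simp add: B_add e distrib_right sum.distrib)
    then show "u \<oplus>\<^bsub>M\<^esub> u' \<in> ?U" using u by simp
  next
    fix a u assume "u \<in> ?U"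
    then have u: "u \<in> carrier M" and
      ex: "\<And>v. v \<in> carrier M \<Longrightarrow> a * B u v = a * (\<Sum>e\<in>E. B u e * B e v)" by auto
    have "B (a \<odot>\<^bsub>M\<^esub> u) v = (\<Sum>e\<in>E. B (a \<odot>\<^bsub>M\<^esub> u) e * B e v)" if v: "v \<in> carrier M" for v
      using u v ex[OF v] by (simp add: B_smult e sum_distrib_left mult.assoc)
    then show "a \<odot>\<^bsub>M\<^esub> u \<in> ?U" using u by simp
  qed (auto simp: B_zero e)
  then have "gen_submodule complex_ring M S \<subseteq> ?U" by (rule gen_submodule_least) (use assms E in auto)
  then show thesis using that[OF E(1)] assms(3) by blast
qed

text \<open>
  Both sides are the sum of the squared absolute values of the entries of the matrix of \<open>A\<close>. In other words,
  the commutator of \<open>A\<close> and \<open>A'\<close> has trace \<open>0\<close>.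
\<close>

lemma parseval_adjoint:
  assumes E: "orthonormal E" "\<And>u v. u \<in> carrier M \<Longrightarrow> v \<in> carrier M \<Longrightarrow> B u v = (\<Sum>e\<in>E. B u e * B e v)"
    and A: "\<And>u. u \<in> carrier M \<Longrightarrow> A u \<in> carrier M" "\<And>u. u \<in> carrier M \<Longrightarrow> A' u \<in> carrier M"
    and adj: "\<And>u v. u \<in> carrier M \<Longrightarrow> v \<in> carrier M \<Longrightarrow> B (A u) v = B u (A' v)"
  shows "(\<Sum>e\<in>E. B (A e) (A e)) = (\<Sum>e\<in>E. B (A' e) (A' e))"
proof -
  have e: "e \<in> carrier M" if "e \<in> E" for e using E(1) that by (auto simp: orthonormal_def)
  have "(\<Sum>e\<in>E. B (A e) (A e)) = (\<Sum>e\<in>E. \<Sum>f\<in>E. B (A e) f * B f (A e))"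
    by (intro sum.cong refl E(2) A e)
  also have "\<dots> = (\<Sum>e\<in>E. \<Sum>f\<in>E. B (A' f) e * B e (A' f))"
  proof (intro sum.cong refl)
    fix e f assume ef: "e \<in> E" "f \<in> E"
    then have "B (A e) f = B e (A' f)" using adj e by blast
    moreover have "B f (A e) = B (A' f) e"
      using B_cnj[of "A e" f] B_cnj[of e "A' f"] adj[of e f] ef e A by simp
    ultimately show "B (A e) f * B f (A e) = B (A' f) e * B e (A' f)" by simp
  qed
  also have "\<dots> = (\<Sum>f\<in>E. \<Sum>e\<in>E. B (A' f) e * B e (A' f))" by (rule sum.swap)
  also have "\<dots> = (\<Sum>f\<in>E. B (A' f) (A' f))" by (intro sum.cong refl E(2)[symmetric] A e)
  finally show ?thesis .
qed

end

section \<open>Unitary representations of finite dimension\<close>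

context cherednik_irrep
begin

abbreviation "L \<equiv> irred_module n c d \<Lambda>"
abbreviation "cl u \<equiv> J +>\<^bsub>\<Delta>\<^esub> u"

sublocale Q: quotient_by A \<Delta> J
  by (intro quotient_by.intro D.left_module_axioms quotient_by_axioms.intro J_submodule)

lemma L_eq: "L = quot_module \<Delta> J" by (simp add: irred_module_def std_radical_eq)

sublocale L: presented_module CG "cherednik_rels n c d" L
  unfolding L_eq by (intro presented_module.intro presentation_axioms Q.left_module_quot)

lemma L_simps [simp]: "u \<in> carrier \<Delta> \<Longrightarrow> cl u \<in> carrier L" "\<zero>\<^bsub>L\<^esub> = J"
  "u \<in> carrier \<Delta> \<Longrightarrow> u' \<in> carrier \<Delta> \<Longrightarrow> cl u \<oplus>\<^bsub>L\<^esub> cl u' = cl (u \<oplus>\<^bsub>\<Delta>\<^esub> u')"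
  unfolding L_eq by simp_all

lemma L_act: "p \<in> ncpolys CG \<Longrightarrow> u \<in> carrier \<Delta> \<Longrightarrow> L.act p (cl u) = cl (D.act p u)"
  unfolding L.act_def D.act_def unfolding L_eq by simp

lemma L_repE:
  assumes "C \<in> carrier L" obtains u where "u \<in> carrier \<Delta>" "C = cl u"
  using assms unfolding L_eq by (rule Q.coset_repE)

lemma cl_zero_iff: "u \<in> carrier \<Delta> \<Longrightarrow> cl u = J \<longleftrightarrow> \<Phi> u = (\<lambda>w p. 0)"
  by (simp add: Q.coset_eq_zero_iff) (simp add: J_def)

lemma class_eq: "cherednik_class n c d (gen g) = cls (genp g)" "cherednik_scalar n c d x = cls (constp x)"
  by (simp_all add: cherednik_class_def cherednik_scalar_def cls_def lookup_genp free_algebra_ops free_algebra_smult)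

text \<open>
  The definition, with the action written in terms of polynomials in the generators
\<close>

lemma contravariant_form_iff:
  "contravariant_form n c d L W B \<longleftrightarrow>
    (\<forall>u\<in>carrier L. \<forall>v\<in>carrier L. \<forall>w\<in>carrier L. B (u \<oplus>\<^bsub>L\<^esub> v) w = B u w + B v w) \<and>
    (\<forall>x. \<forall>u\<in>carrier L. \<forall>v\<in>carrier L. B (L.act (constp x) u) v = x * B u v) \<and>
    (\<forall>u\<in>carrier L. \<forall>v\<in>carrier L. B v u = cnj (B u v)) \<and>
    (\<forall>g\<in>G. \<forall>u\<in>carrier L. \<forall>v\<in>carrier L. B (L.act (wp g) u) (L.act (wp g) v) = B u v) \<and>
    (\<forall>i\<in>{1..n}. \<forall>u\<in>carrier L. \<forall>v\<in>carrier L. B (L.act (xp i) u) v = B u (L.act (yp i) v)) \<and>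
    (\<forall>u\<in>carrier L. (\<forall>v\<in>carrier L. B u v = 0) \<longrightarrow> u = \<zero>\<^bsub>L\<^esub>) \<and>
    (\<forall>u\<in>W. u \<noteq> \<zero>\<^bsub>L\<^esub> \<longrightarrow> Im (B u u) = 0 \<and> Re (B u u) > 0)"
  unfolding contravariant_form_def Let_def class_eq L.act_def ..

abbreviation "LC \<equiv> restrict_scalars (cherednik_scalar n c d) L"

lemma LC_simps [simp]: "carrier LC = carrier L" "\<zero>\<^bsub>LC\<^esub> = \<zero>\<^bsub>L\<^esub>" "u \<oplus>\<^bsub>LC\<^esub> v = u \<oplus>\<^bsub>L\<^esub> v"
  "x \<odot>\<^bsub>LC\<^esub> u = L.act (constp x) u"
  by (simp_all add: restrict_scalars_def L.act_def class_eq)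

lemma LC_left_module: "left_module complex_ring LC"
proof -
  interpret R: ring complex_ring by (rule ring_from_type_algebra)
  interpret M: abelian_group LC
  proof (rule abelian_groupI)
    fix x assume "x \<in> carrier LC"
    then show "\<exists>y\<in>carrier LC. y \<oplus>\<^bsub>LC\<^esub> x = \<zero>\<^bsub>LC\<^esub>"
      by (intro bexI[of _ "\<ominus>\<^bsub>L\<^esub> x"]) (simp_all add: L.M.M.l_neg del: L_simps(2))
  qed (simp_all add: L.M.M.a_ac del: L_simps(2))
  show ?thesis
    by unfold_locales (simp_all add: L.act_add L.act_mult L.act_vec_add constp_add constp_mult)
qed

text \<open>
  The form turns \<open>\<Sum> x\<^sub>i\<^sup>2\<close> and \<open>\<Sum> y\<^sub>i\<^sup>2\<close> into adjoint operators. On a space of finite dimension the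
  trace of their commutator is \<open>0\<close>, but this trace is also twice the sum of the squared norms
  of all \<open>x\<^sub>i e\<close> and \<open>y\<^sub>i e\<close>, where \<open>e\<close> runs through an orthonormal basis.
\<close>

lemma unitary_finite_dim_imp_x_zero:
  assumes "unitary_irred n c d \<Lambda>" "finite_dim_irred n c d \<Lambda>" and i: "i \<in> {1..n}" and u: "u \<in> carrier L"
  shows "L.act (xp i) u = \<zero>\<^bsub>L\<^esub>"
proof -
  obtain B where form: "contravariant_form n c d L (lowest_weight_space n c d \<Lambda>) B"
    and pos: "\<forall>u\<in>carrier L. u \<noteq> \<zero>\<^bsub>L\<^esub> \<longrightarrow> Im (B u u) = 0 \<and> Re (B u u) > 0"
    using assms(1) by (auto simp: unitary_irred_def Let_def)
  note form' = form[unfolded contravariant_form_iff]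
  have add: "B (u \<oplus>\<^bsub>L\<^esub> v) w = B u w + B v w" if "u \<in> carrier L" "v \<in> carrier L" "w \<in> carrier L" for u v w
    using form'[THEN conjunct1] that by blast
  have scal: "B (L.act (constp x) u) v = x * B u v" if "u \<in> carrier L" "v \<in> carrier L" for x u v
    using form'[THEN conjunct2, THEN conjunct1] that by blast
  have herm: "B v u = cnj (B u v)" if "u \<in> carrier L" "v \<in> carrier L" for u v
    using form'[THEN conjunct2, THEN conjunct2, THEN conjunct1] that by blast
  have adj: "B (L.act (xp i) u) v = B u (L.act (yp i) v)" if "i \<in> {1..n}" "u \<in> carrier L" "v \<in> carrier L" for i u v
    using form'[THEN conjunct2, THEN conjunct2, THEN conjunct2, THEN conjunct2, THEN conjunct1] that by blast
  interpret LC: left_module complex_ring LC by (rule LC_left_module)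
  interpret P: positive_definite_form LC B
  proof (intro positive_definite_form.intro LC_left_module positive_definite_form_axioms.intro)
    fix u v assume "u \<in> carrier LC" "v \<in> carrier LC"
    then show "B v u = cnj (B u v)" by (intro herm) simp_all
  qed (use add scal pos in \<open>simp_all del: L_simps(2)\<close>)
  have adj': "B (L.act (yp i) u) v = B u (L.act (xp i) v)" if "i \<in> {1..n}" "u \<in> carrier L" "v \<in> carrier L" for i u v
    using adj[OF that(1,3,2)] herm[of u "L.act (xp i) v"] herm[of "L.act (yp i) u" v] that
    by (simp del: atLeastAtMost_iff)
  have zero: "B (L.act 0 u) v = 0" if "u \<in> carrier L" "v \<in> carrier L" for u v
    using scal[OF that, of 0] that by (simp del: L_simps(2))
  have sum: "B (L.act (sum f S) u) v = (\<Sum>s\<in>S. B (L.act (f s) u) v)"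
    if "\<And>s. s \<in> S \<Longrightarrow> f s \<in> ncpolys CG" "u \<in> carrier L" "v \<in> carrier L" for f :: "nat \<Rightarrow> cgen ncpoly" and S u v
    using that(1)
  proof (induction S rule: infinite_finite_induct)
    case (insert s S)
    then have "sum f S \<in> ncpolys CG" by (auto intro: ncpolys_sum)
    then show ?case using insert that(2,3) by (simp add: L.act_add add)
  qed (use zero that in simp_all)
  have sum_right: "B u (L.act (sum f S) v) = (\<Sum>s\<in>S. B u (L.act (f s) v))"
    if "\<And>s. s \<in> S \<Longrightarrow> f s \<in> ncpolys CG" "u \<in> carrier L" "v \<in> carrier L" for f :: "nat \<Rightarrow> cgen ncpoly" and S u v
  proof -
    have "sum f S \<in> ncpolys CG" using that by (auto intro: ncpolys_sum)
    then have "B u (L.act (sum f S) v) = cnj (B (L.act (sum f S) v) u)"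
      using herm[of "L.act (sum f S) v" u] that by simp
    also have "\<dots> = (\<Sum>s\<in>S. cnj (B (L.act (f s) v) u))" using sum[OF that(1,3,2)] by simp
    also have "\<dots> = (\<Sum>s\<in>S. B u (L.act (f s) v))"
    proof (rule sum.cong[OF refl])
      fix s assume "s \<in> S"
      then show "cnj (B (L.act (f s) v) u) = B u (L.act (f s) v)"
        using herm[of "L.act (f s) v" u] that by simp
    qed
    finally show ?thesis .
  qed
  have sq: "B (L.act xsq u) v = B u (L.act ysq v)" if uv: "u \<in> carrier L" "v \<in> carrier L" for u v
  proof -
    have "B (L.act xsq u) v = (\<Sum>j\<in>{1..n}. B (L.act (xp j * xp j) u) v)"
      unfolding xsq_def by (rule sum) (use uv in auto)
    also have "\<dots> = (\<Sum>j\<in>{1..n}. B u (L.act (yp j * yp j) v))"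
      by (rule sum.cong) (use uv in \<open>simp_all add: L.act_mult adj del: atLeastAtMost_iff\<close>)
    also have "\<dots> = B u (L.act ysq v)" unfolding ysq_def by (rule sum_right[symmetric]) (use uv in auto)
    finally show ?thesis .
  qed
  have sq': "B (L.act ysq u) v = B u (L.act xsq v)" if "u \<in> carrier L" "v \<in> carrier L" for u v
    using sq[OF that(2,1)] herm[of u "L.act xsq v"] herm[of "L.act ysq u" v] that by simp
  obtain S where S: "finite S" "S \<subseteq> carrier LC" "gen_submodule complex_ring LC S = carrier LC"
    using assms(2) by (auto simp: finite_dim_irred_def Let_def)
  obtain E where E: "P.orthonormal E"
    and exp: "\<And>u v. u \<in> carrier LC \<Longrightarrow> v \<in> carrier LC \<Longrightarrow> B u v = (\<Sum>e\<in>E. B u e * B e v)"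
    by (rule P.orthonormal_basis[OF S]) blast
  have e: "e \<in> carrier L" if "e \<in> E" for e using E that by (auto simp: P.orthonormal_def)
  have fE: "finite E" using E by (simp add: P.orthonormal_def)
  let ?q = "\<lambda>j. (xp j * yp j + xp j * yp j) + (yp j * xp j + yp j * xp j)"
  let ?N = "\<lambda>e. \<Sum>j\<in>{1..n}. 2 * B (L.act (yp j) e) (L.act (yp j) e) + 2 * B (L.act (xp j) e) (L.act (xp j) e)"
  have comm: "B (L.act xsq e) (L.act xsq e) = B (L.act ysq e) (L.act ysq e) + ?N e" if "e \<in> E" for e
  proof -
    have eL: "e \<in> carrier L" using e that by simp
    have q: "sum ?q {1..n} \<in> ncpolys CG" by (rule ncpolys_sum) (auto simp: ncpolys_mult)
    have "B (L.act xsq e) (L.act xsq e) = B (L.act (ysq * xsq) e) e"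
      using eL sq'[of "L.act xsq e" e] by (simp add: L.act_mult)
    also have "L.act (ysq * xsq) e = L.act (xsq * ysq + sum ?q {1..n}) e"
      by (rule L.act_congr[OF ysq_xsq]) (use q in auto)
    also have "B \<dots> e = B (L.act (xsq * ysq) e) e + B (L.act (sum ?q {1..n}) e) e"
      using q eL by (simp add: L.act_add add)
    also have "B (L.act (xsq * ysq) e) e = B (L.act ysq e) (L.act ysq e)"
      using eL sq[of "L.act ysq e" e] by (simp add: L.act_mult)
    also have "B (L.act (sum ?q {1..n}) e) e = (\<Sum>j\<in>{1..n}. B (L.act (?q j) e) e)"
      by (rule sum) (use eL in auto)
    also have "\<dots> = ?N e"
      by (rule sum.cong[OF refl])
         (use eL in \<open>simp add: L.act_mult L.act_add add adj adj' del: atLeastAtMost_iff\<close>)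
    finally show ?thesis .
  qed
  have "(\<Sum>e\<in>E. B (L.act xsq e) (L.act xsq e)) = (\<Sum>e\<in>E. B (L.act ysq e) (L.act ysq e))"
    by (rule P.parseval_adjoint[OF E exp]) (use sq in auto)
  then have "(\<Sum>e\<in>E. ?N e) = 0" using comm by (simp add: sum.distrib)
  let ?R = "\<lambda>e j. 2 * Re (B (L.act (yp j) e) (L.act (yp j) e)) + 2 * Re (B (L.act (xp j) e) (L.act (xp j) e))"
  have R: "?R e j \<ge> 0" "Re (B (L.act (yp j) e) (L.act (yp j) e)) \<ge> 0" "Re (B (L.act (xp j) e) (L.act (xp j) e)) \<ge> 0"
    if "e \<in> E" "j \<in> {1..n}" for e j
    using P.B_nonneg[of "L.act (yp j) e"] P.B_nonneg[of "L.act (xp j) e"] e that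
    by (simp_all del: atLeastAtMost_iff)
  have "(\<Sum>e\<in>E. \<Sum>j\<in>{1..n}. ?R e j) = Re (\<Sum>e\<in>E. ?N e)" by simp
  then have "(\<Sum>e\<in>E. \<Sum>j\<in>{1..n}. ?R e j) = 0" unfolding \<open>(\<Sum>e\<in>E. ?N e) = 0\<close> by simp
  moreover have "(\<Sum>j\<in>{1..n}. ?R e j) \<ge> 0" if "e \<in> E" for e by (intro sum_nonneg R(1) that)
  ultimately have "(\<Sum>j\<in>{1..n}. ?R e j) = 0" if "e \<in> E" for e
    using sum_nonneg_eq_0_iff[OF fE, of "\<lambda>e. \<Sum>j\<in>{1..n}. ?R e j"] that by blast
  then have "?R e i = 0" if "e \<in> E" for e
    using sum_nonneg_eq_0_iff[OF finite_atLeastAtMost, of 1 n "?R e"] R(1) that i by blast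
  then have "Re (B (L.act (xp i) e) (L.act (xp i) e)) = 0" if "e \<in> E" for e
    using R(2,3)[OF that i] that by fastforce
  then have xe: "L.act (xp i) e = \<zero>\<^bsub>L\<^esub>" if "e \<in> E" for e
    using P.B_pos[of "L.act (xp i) e"] that e[OF that] i by (force simp del: L_simps(2))
  let ?z = "L.act (yp i) (L.act (xp i) u)"
  have z: "?z \<in> carrier L" using u i by simp
  have "B (L.act (xp i) u) (L.act (xp i) u) = B u ?z" using adj[of i u "L.act (xp i) u"] u i by simp
  also have "\<dots> = (\<Sum>e\<in>E. B u e * B e ?z)" using exp u z by simp
  also have "\<dots> = (\<Sum>e\<in>E. B u e * B (L.act (xp i) e) (L.act (xp i) u))"
    by (rule sum.cong) (use adj u i e in auto)
  also have "\<dots> = 0" using xe P.B_zero[of "L.act (xp i) u"] u i by (simp del: L_simps(2))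
  finally show ?thesis using P.B_definite[of "L.act (xp i) u"] u i by simp
qed

text \<open>
  The commutators \<open>[y\<^sub>i, x\<^sub>j]\<close> act on the lowest weight space by \<open>0\<close>: \<open>brop i j\<close> is their action, and the value of
  \<open>emb v\<close> at the empty word is \<open>v\<close>.
\<close>

definition bracket_free :: bool where
  "bracket_free \<longleftrightarrow> (\<forall>v\<in>carrier V. \<forall>i\<in>{1..n}. \<forall>j\<in>{1..n}. brop i j (emb v) [] = (\<lambda>p. 0))"

text \<open>
  On the image of \<open>v\<close> in \<open>L\<close>, both \<open>y\<^sub>i\<close> and \<open>x\<^sub>j\<close> act by \<open>0\<close>; the value of \<open>\<Phi>(x\<^sub>j v)\<close> at the word \<open>y\<^sub>i\<close>
  is the commutator applied to \<open>v\<close>.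
\<close>

lemma unitary_finite_dim_imp_bracket_free:
  assumes "unitary_irred n c d \<Lambda>" "finite_dim_irred n c d \<Lambda>" shows bracket_free
  unfolding bracket_free_def
proof (intro ballI ext)
  fix v i j p assume v: "v \<in> carrier V" and i: "i \<in> {1..n}" and j: "j \<in> {1..n}"
  have "cl (D.act (xp j) (\<iota> v)) = J"
    using unitary_finite_dim_imp_x_zero[OF assms j, of "cl (\<iota> v)"] v j by (simp add: L_act)
  then have "xop j (emb v) = (\<lambda>w p. 0)" using v j by (simp add: cl_zero_iff \<Phi>_gen \<Phi>_unit)
  then have "xop j (emb v) [i] p = 0" by simp
  then show "brop i j (emb v) [] p = 0" by (simp add: xop_Cons yop_emb xop_zero)
qed

subsection \<open>Representations on which the commutators vanish\<close>

lemma bracket_free_xop: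
  assumes free: bracket_free and v: "v \<in> carrier V" and j: "j \<in> {1..n}"
  shows "xop j (emb v) = (\<lambda>w p. 0)"
proof (intro ext)
  fix w p
  show "xop j (emb v) w p = 0"
  proof (cases w)
    case (Cons i w')
    have "brop i j (emb v) w' p = 0"
    proof (cases "w' = []")
      case True
      show ?thesis
      proof (cases "i \<in> {1..n}")
        case True
        then show ?thesis using free v j \<open>w' = []\<close> by (simp add: bracket_free_def del: atLeastAtMost_iff)
      next
        case False
        then have "i \<noteq> j" using j by blast
        then show ?thesis using False by (simp add: brop_def root_outside)
      qed
    next
      case False
      then have "emb u w' p = 0" for u by (cases p) (simp add: emb_def)
      then show ?thesis by (simp add: brop_def wact_emb)
    qed
    then show ?thesis by (simp add: Cons xop_Cons yop_emb xop_zero)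
  qed simp
qed

text \<open>
  So \<open>L\<close> is the image of the lowest weight space alone: the \<open>x\<^sub>i\<close> kill it.
\<close>

lemma bracket_free_\<Phi>:
  assumes free: bracket_free and u: "u \<in> carrier \<Delta>"
  shows "\<exists>v\<in>carrier V. \<Phi> u = emb v"
  using u
proof (induction u rule: \<Delta>_induct)
  case (unit v)
  then show ?case using \<Phi>_unit by blast
next
  case (add u u')
  then obtain v v' where v: "v \<in> carrier V" "v' \<in> carrier V" "\<Phi> u = emb v" "\<Phi> u' = emb v'" by blast
  then have "\<Phi> (u \<oplus>\<^bsub>\<Delta>\<^esub> u') = emb (v \<oplus>\<^bsub>V\<^esub> v')" using add by (simp add: \<Phi>_add emb_linear)
  then show ?case using v by blast
next
  case (mult_x u i)
  then have "\<Phi> (D.act (xp i) u) = emb \<zero>\<^bsub>V\<^esub>"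
    using bracket_free_xop[OF free] by (auto simp: \<Phi>_gen emb_linear simp del: atLeastAtMost_iff)
  moreover have "\<zero>\<^bsub>V\<^esub> \<in> carrier V" by simp
  ultimately show ?case by blast
qed

text \<open>
  \<open>\<Phi>\<close> on the quotient \<open>L\<close>; the choice of the representative does not matter by \<open>\<Phi>_cl\<close>.
\<close>

definition \<Psi> :: "std_vec set \<Rightarrow> ((nat \<Rightarrow> nat) \<times> (nat \<Rightarrow> nat)) coind_vec" where
  "\<Psi> C = \<Phi> (SOME u. u \<in> carrier \<Delta> \<and> C = cl u)"

lemma \<Phi>_cl: 
  assumes u: "u \<in> carrier \<Delta>" and u': "u' \<in> carrier \<Delta>" and eq: "cl u = cl u'" shows "\<Phi> u = \<Phi> u'"
proof -
  have "u = (u \<ominus>\<^bsub>\<Delta>\<^esub> u') \<oplus>\<^bsub>\<Delta>\<^esub> u'" using u u' by (simp add: a_minus_def D.M.M.a_assoc D.M.M.l_neg)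
  moreover have "u \<ominus>\<^bsub>\<Delta>\<^esub> u' \<in> J" using Q.coset_eq_iff[OF u u'] eq by simp
  ultimately show ?thesis using \<Phi>_add[of "u \<ominus>\<^bsub>\<Delta>\<^esub> u'" u'] u' unfolding J_def by auto
qed

lemma \<Psi>_cl:
  assumes u: "u \<in> carrier \<Delta>" shows "\<Psi> (cl u) = \<Phi> u"
proof -
  let ?P = "\<lambda>u'. u' \<in> carrier \<Delta> \<and> cl u = cl u'"
  have P: "?P (SOME u'. ?P u')" by (rule someI[of ?P u]) (simp add: u)
  show ?thesis unfolding \<Psi>_def by (rule \<Phi>_cl[OF u conjunct1[OF P] conjunct2[OF P], symmetric])
qed

lemma \<Psi>_simps:
  assumes "C \<in> carrier L"
  shows "C' \<in> carrier L \<Longrightarrow> \<Psi> (C \<oplus>\<^bsub>L\<^esub> C') = (\<lambda>w p. \<Psi> C w p + \<Psi> C' w p)"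
    and "\<Psi> (L.act (constp x) C) = (\<lambda>w p. x * \<Psi> C w p)"
    and "g \<in> G \<Longrightarrow> \<Psi> (L.act (wp g) C) = wact g (\<Psi> C)"
    and "i \<in> {1..n} \<Longrightarrow> \<Psi> (L.act (xp i) C) = xop i (\<Psi> C)"
    and "i \<in> {1..n} \<Longrightarrow> \<Psi> (L.act (yp i) C) = yop i (\<Psi> C)"
    and "\<Psi> C = (\<lambda>w p. 0) \<Longrightarrow> C = \<zero>\<^bsub>L\<^esub>"
proof -
  obtain u where u: "u \<in> carrier \<Delta>" "C = cl u" using assms by (rule L_repE)
  show "\<Psi> (C \<oplus>\<^bsub>L\<^esub> C') = (\<lambda>w p. \<Psi> C w p + \<Psi> C' w p)" if "C' \<in> carrier L"
  proof -
    obtain u' where "u' \<in> carrier \<Delta>" "C' = cl u'" using \<open>C' \<in> carrier L\<close> by (rule L_repE)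
    then show ?thesis using u by (simp add: \<Psi>_cl \<Phi>_add)
  qed
  show "\<Psi> (L.act (constp x) C) = (\<lambda>w p. x * \<Psi> C w p)"
    "g \<in> G \<Longrightarrow> \<Psi> (L.act (wp g) C) = wact g (\<Psi> C)"
    "i \<in> {1..n} \<Longrightarrow> \<Psi> (L.act (xp i) C) = xop i (\<Psi> C)"
    "i \<in> {1..n} \<Longrightarrow> \<Psi> (L.act (yp i) C) = yop i (\<Psi> C)"
    using u by (simp_all add: L_act \<Psi>_cl \<Phi>_gen)
  show "\<Psi> C = (\<lambda>w p. 0) \<Longrightarrow> C = \<zero>\<^bsub>L\<^esub>" using u by (simp add: \<Psi>_cl cl_zero_iff)
qed

text \<open>
  The standard inner product of the functions on \<open>G\<close> and the pairs of tabloids is invariant, and adjointness of \<open>x\<^sub>i\<close>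
  and \<open>y\<^sub>i\<close> is trivial since both act by \<open>0\<close>.
\<close>

lemma bracket_free_imp_unitary:
  assumes free: bracket_free shows "unitary_irred n c d \<Lambda>"
proof -
  let ?I = "G \<times> (TB1 \<times> TB2)"
  define B where "B C C' = (\<Sum>p\<in>?I. \<Psi> C [] p * cnj (\<Psi> C' [] p))" for C C'
  have \<Psi>_emb: "\<exists>v\<in>carrier V. \<Psi> C = emb v" if C: "C \<in> carrier L" for C
  proof -
    obtain u where "u \<in> carrier \<Delta>" "C = cl u" using C by (rule L_repE)
    then show ?thesis using bracket_free_\<Phi>[OF free] \<Psi>_cl by auto
  qed
  have fin_I: "finite ?I" by (simp add: HO_finite finite_tabloids)
  have pos: "Im (B C C) = 0 \<and> Re (B C C) > 0" if C: "C \<in> carrier L" "C \<noteq> \<zero>\<^bsub>L\<^esub>" for C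
  proof -
    obtain v where v: "v \<in> carrier V" "\<Psi> C = emb v" using \<Psi>_emb C by blast
    have eq: "B C C = of_real (\<Sum>p\<in>?I. (cmod (\<Psi> C [] p))\<^sup>2)"
      unfolding B_def of_real_sum by (intro sum.cong refl complex_norm_square[symmetric])
    have "(\<Sum>p\<in>?I. (cmod (\<Psi> C [] p))\<^sup>2) \<noteq> 0"
    proof
      assume "(\<Sum>p\<in>?I. (cmod (\<Psi> C [] p))\<^sup>2) = 0"
      from sum_nonneg_0[OF fin_I _ this] have 0: "\<Psi> C [] p = 0" if "p \<in> ?I" for p using that by auto
      have "\<Psi> C w (h, T, U) = 0" for w h T U
      proof (cases "w = [] \<and> h \<in> G")
        case True
        then have "v h \<in> Out" using v unfolding V_iff by blast
        then show ?thesis using True 0[of "(h, T, U)"] Out_support[of "v h" T U] v(2)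
          by (cases "T \<in> TB1 \<and> U \<in> TB2") (auto simp: emb_def)
      qed (auto simp: v(2) emb_def)
      then have "\<Psi> C = (\<lambda>w p. 0)" by (auto simp: fun_eq_iff)
      then show False using \<Psi>_simps(6)[OF C(1)] C(2) by blast
    qed
    moreover have "(\<Sum>p\<in>?I. (cmod (\<Psi> C [] p))\<^sup>2) \<ge> 0" by (rule sum_nonneg) simp
    ultimately show ?thesis unfolding eq by simp
  qed
  have "contravariant_form n c d L (lowest_weight_space n c d \<Lambda>) B"
    unfolding contravariant_form_iff
  proof (intro conjI ballI allI impI)
    fix u v w assume uvw: "u \<in> carrier L" "v \<in> carrier L" "w \<in> carrier L"
    show "B (u \<oplus>\<^bsub>L\<^esub> v) w = B u w + B v w"
      using uvw by (simp add: B_def \<Psi>_simps distrib_right sum.distrib)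
  next
    fix x u v assume uv: "u \<in> carrier L" "v \<in> carrier L"
    show "B (L.act (constp x) u) v = x * B u v"
      using uv by (simp add: B_def \<Psi>_simps sum_distrib_left mult.assoc)
  next
    fix u v
    show "B v u = cnj (B u v)" by (simp add: B_def mult.commute)
  next
    fix g u v assume g: "g \<in> G" and uv: "u \<in> carrier L" "v \<in> carrier L"
    have w: "wact g F [] (h, x) = F [] (bmul (binv g) h, x)"
      for F :: "((nat \<Rightarrow> nat) \<times> (nat \<Rightarrow> nat)) coind_vec" and h x
      by (simp add: wact.simps)
    have "B (L.act (wp g) u) (L.act (wp g) v) =
        (\<Sum>h\<in>G. \<Sum>x\<in>TB1 \<times> TB2. \<Psi> u [] (bmul (binv g) h, x) * cnj (\<Psi> v [] (bmul (binv g) h, x)))"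
      using uv g unfolding sum.cartesian_product
      by (auto simp: B_def \<Psi>_simps w intro!: sum.cong)
    also have "\<dots> = (\<Sum>h\<in>G. \<Sum>x\<in>TB1 \<times> TB2. \<Psi> u [] (h, x) * cnj (\<Psi> v [] (h, x)))"
      by (rule sum.reindex_bij_betw[OF HO_left_bij]) (use g in simp)
    also have "\<dots> = B u v" unfolding sum.cartesian_product B_def by (rule sum.cong) auto
    finally show "B (L.act (wp g) u) (L.act (wp g) v) = B u v" .
  next
    fix i u v assume i: "i \<in> {1..n}" and uv: "u \<in> carrier L" "v \<in> carrier L"
    obtain x y where xy: "x \<in> carrier V" "\<Psi> u = emb x" "y \<in> carrier V" "\<Psi> v = emb y" using \<Psi>_emb uv by meson
    show "B (L.act (xp i) u) v = B u (L.act (yp i) v)"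
      using uv i xy bracket_free_xop[OF free xy(1) i]
      by (simp add: B_def \<Psi>_simps yop_emb del: atLeastAtMost_iff)
  next
    fix u assume u: "u \<in> carrier L" "\<forall>v\<in>carrier L. B u v = 0"
    then have "B u u = 0" by blast
    then show "u = \<zero>\<^bsub>L\<^esub>" using pos[OF u(1)] by (cases "u = \<zero>\<^bsub>L\<^esub>") auto
  next
    fix u assume u: "u \<in> lowest_weight_space n c d \<Lambda>" "u \<noteq> \<zero>\<^bsub>L\<^esub>"
    have "lowest_weight_space n c d \<Lambda> = (\<lambda>v. cl (\<iota> v)) ` carrier V"
      by (simp add: lowest_weight_space_def std_radical_eq lowest_module_eq low.OM_simps \<iota>_def cherednik_algebra_def)
    then have "u \<in> carrier L" using u(1) by auto
    then show "Im (B u u) = 0" "Re (B u u) > 0" using pos u(2) by blast+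
  qed
  then show ?thesis unfolding unitary_irred_def Let_def using pos by blast
qed

text \<open>
  \<open>L\<close> is a quotient of \<open>V\<close>, which is spanned by the orbit of one vector under the finite group.
\<close>

lemma bracket_free_imp_finite_dim:
  assumes free: bracket_free shows "finite_dim_irred n c d \<Lambda>"
proof -
  interpret LC: left_module complex_ring LC by (rule LC_left_module)
  obtain t u where tu: "t \<in> tableaux (fst \<Lambda>) I1" "u \<in> tableaux (snd \<Lambda>) I2" using tableaux_ex by blast
  let ?e = "coset_vec (E t u)"
  have e: "?e \<in> carrier V" by (rule coset_vec_nonzero(2)[OF tu])
  define S where "S = (\<lambda>g. cl (\<iota> (act g ?e))) ` G"
  have S: "finite S" "S \<subseteq> carrier LC" unfolding S_def using V_closed(3)[OF e e] by (auto simp: HO_finite)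
  let ?N = "gen_submodule complex_ring LC S"
  have N: "submodule ?N complex_ring LC" by (rule LC.submodule_gen[OF S(2)])
  note N' = submoduleD[OF N]
  let ?U = "{v \<in> carrier V. \<forall>g\<in>G. cl (\<iota> (act g v)) \<in> ?N}"
  have "subrep ?U"
  proof (rule subrepI)
    have "cl \<zero>\<^bsub>\<Delta>\<^esub> = \<zero>\<^bsub>L\<^esub>" using Q.coset_eq_zero_iff[of "\<zero>\<^bsub>\<Delta>\<^esub>"] submoduleD(2)[OF J_submodule] by simp
    then show "\<zero>\<^bsub>V\<^esub> \<in> ?U" using N'(2) by (simp add: act_V_zero \<iota>_simps(4)[OF e])
  next
    fix v w assume vw: "v \<in> ?U" "w \<in> ?U"
    have "cl (\<iota> (act g (v \<oplus>\<^bsub>V\<^esub> w))) \<in> ?N" if g: "g \<in> G" for g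
    proof -
      have "cl (\<iota> (act g v)) \<oplus>\<^bsub>LC\<^esub> cl (\<iota> (act g w)) \<in> ?N" using N'(3) vw g by blast
      then show ?thesis using vw g V_closed(3)[of v v g] V_closed(3)[of w w g]
        by (simp add: act_linear \<iota>_add)
    qed
    then show "v \<oplus>\<^bsub>V\<^esub> w \<in> ?U" using vw by simp
  next
    fix x v assume v: "v \<in> ?U"
    have "cl (\<iota> (act g (x \<odot>\<^bsub>V\<^esub> v))) \<in> ?N" if g: "g \<in> G" for g
    proof -
      have "x \<odot>\<^bsub>LC\<^esub> cl (\<iota> (act g v)) \<in> ?N" using N'(5)[of x] v g by simp
      then show ?thesis using v g V_closed(3)[of v v g]
        by (simp add: act_linear L_act \<iota>_simps)
    qed
    then show "x \<odot>\<^bsub>V\<^esub> v \<in> ?U" using v V_closed(2)[of v v x] by simp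
  next
    fix h v assume h: "h \<in> G" and v: "v \<in> ?U"
    have "act g (act h v) = act (bmul g h) v" if "g \<in> G" for g using act_bmul[OF that h] by simp
    then show "act h v \<in> ?U" using h v V_closed(3)[of v v h] by simp
  qed auto
  moreover have "?e \<in> ?U" using e gen_submodule_incl[of S complex_ring LC] unfolding S_def by blast
  ultimately have "?U = carrier V" by (rule subrep_generate[OF _ tu])
  then have \<iota>N: "cl (\<iota> v) \<in> ?N" if v: "v \<in> carrier V" for v
  proof -
    have "v \<in> ?U" using v \<open>?U = carrier V\<close> by blast
    then have "cl (\<iota> (act bone v)) \<in> ?N" using K_G[OF bone_K] by blast
    then show ?thesis using act_bone[OF v] by simp
  qed
  have "C \<in> ?N" if C: "C \<in> carrier L" for C
  proof -
    obtain u where u: "u \<in> carrier \<Delta>" "C = cl u" using C by (rule L_repE)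
    obtain v where v: "v \<in> carrier V" "\<Phi> u = emb v" using bracket_free_\<Phi>[OF free u(1)] by blast
    have "u \<ominus>\<^bsub>\<Delta>\<^esub> \<iota> v \<in> J"
    proof -
      have u\<iota>: "u \<ominus>\<^bsub>\<Delta>\<^esub> \<iota> v \<in> carrier \<Delta>" using u v by simp
      have "u = (u \<ominus>\<^bsub>\<Delta>\<^esub> \<iota> v) \<oplus>\<^bsub>\<Delta>\<^esub> \<iota> v" using u v by (simp add: a_minus_def D.M.M.a_assoc D.M.M.l_neg)
      then have "\<Phi> u = (\<lambda>w p. \<Phi> (u \<ominus>\<^bsub>\<Delta>\<^esub> \<iota> v) w p + \<Phi> (\<iota> v) w p)" using \<Phi>_add[OF u\<iota>, of "\<iota> v"] v by simp
      then show ?thesis using u\<iota> v by (simp add: J_def \<Phi>_unit fun_eq_iff)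
    qed
    then have "C = cl (\<iota> v)" using Q.coset_eq_iff[of u "\<iota> v"] u v by simp
    then show ?thesis using \<iota>N v by simp
  qed
  then have "?N = carrier LC" using N'(1) by auto
  then show ?thesis unfolding finite_dim_irred_def Let_def using S by blast
qed

theorem unitary_finite_dim_iff_bracket_free:
  "unitary_irred n c d \<Lambda> \<and> finite_dim_irred n c d \<Lambda> \<longleftrightarrow> bracket_free"
  using unitary_finite_dim_imp_bracket_free bracket_free_imp_unitary bracket_free_imp_finite_dim by blast

end

section \<open>Vanishing of the commutators and rectangles\<close>

lemma tableau_row_card:
  assumes t: "t \<in> tableaux \<mu> I" and a: "1 \<le> a" "a \<le> length \<mu>"
  shows "card {j \<in> I. fst (t j) = a} = \<mu> ! (a - 1)"
proof -
  have t: "bij_betw t I (young_diagram \<mu>)" using t by (simp add: tableaux_def)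
  have "bij_betw t {j \<in> I. fst (t j) = a} ({a} \<times> {1..\<mu> ! (a - 1)})"
    unfolding bij_betw_def
  proof
    show "inj_on t {j \<in> I. fst (t j) = a}" using t by (auto simp: bij_betw_def inj_on_def)
    have "t ` {j \<in> I. fst (t j) = a} = {p \<in> t ` I. fst p = a}" by auto
    also have "\<dots> = {a} \<times> {1..\<mu> ! (a - 1)}" using t a by (auto simp: bij_betw_def young_diagram_def)
    finally show "t ` {j \<in> I. fst (t j) = a} = {a} \<times> {1..\<mu> ! (a - 1)}" .
  qed
  then show ?thesis by (simp add: bij_betw_same_card)
qed

lemma tableau_first_column_card:
  assumes part: "is_partition \<mu>" and t: "t \<in> tableaux \<mu> I"
  shows "card {j \<in> I. snd (t j) = 1} = length \<mu>"
proof -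
  have t: "bij_betw t I (young_diagram \<mu>)" using t by (simp add: tableaux_def)
  have "bij_betw t {j \<in> I. snd (t j) = 1} ({1..length \<mu>} \<times> {1})"
    unfolding bij_betw_def
  proof
    show "inj_on t {j \<in> I. snd (t j) = 1}" using t by (auto simp: bij_betw_def inj_on_def)
    have "t ` {j \<in> I. snd (t j) = 1} = {p \<in> t ` I. snd p = 1}" by auto
    also have "\<dots> = {1..length \<mu>} \<times> {1}"
    proof -
      have "1 \<le> \<mu> ! (a - 1)" if "1 \<le> a" "a \<le> length \<mu>" for a
        using part that nth_mem[of "a - 1" \<mu>] by (auto simp: is_partition_def Suc_le_eq One_nat_def)
      then show ?thesis using t by (auto simp: bij_betw_def young_diagram_def)
    qed
    finally show "t ` {j \<in> I. snd (t j) = 1} = {1..length \<mu>} \<times> {1}" .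
  qed
  then show ?thesis by (simp add: bij_betw_same_card)
qed

lemma rectangle_young_diagram:
  assumes "rectangle \<mu>" shows "young_diagram \<mu> = {1..num_rows \<mu>} \<times> {1..num_cols \<mu>}"
proof -
  have "\<mu> ! (a - 1) = num_cols \<mu>" if "1 \<le> a" "a \<le> length \<mu>" for a
  proof -
    have "\<mu> \<noteq> []" using that by auto
    then have "hd \<mu> \<in> set \<mu>" "\<mu> ! (a - 1) \<in> set \<mu>" using that by (auto simp: One_nat_def)
    then show ?thesis using assms \<open>\<mu> \<noteq> []\<close> by (auto simp: rectangle_def num_cols_def)
  qed
  then show ?thesis by (auto simp: young_diagram_def num_rows_def)
qed

text \<open>
  If the sum over \<open>j\<close> acts by \<open>z\<close>, then the coefficient formula at the first box of row \<open>a\<close> gives \<open>\<mu>\<^sub>a = z + length \<mu>\<close> for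
  every \<open>a\<close>.
\<close>

lemma jucys_murphy_scalar_iff:
  assumes part: "is_partition \<mu>" "\<mu> \<noteq> []" and fin: "finite I" and t0: "t0 \<in> tableaux \<mu> I"
  shows "(\<forall>t\<in>tableaux \<mu> I. \<forall>i\<in>I. \<forall>T.
      (\<Sum>j\<in>I - {i}. polytabloid I t (T \<circ> Transposition.transpose i j)) = z * polytabloid I t T) \<longleftrightarrow>
    rectangle \<mu> \<and> z = of_nat (num_cols \<mu>) - of_nat (num_rows \<mu>)" (is "?L \<longleftrightarrow> ?R")
proof
  assume ?R
  then show ?L using jucys_murphy_rectangle[OF fin _ _ rectangle_young_diagram[of \<mu>]] by auto
next
  assume L: ?L
  have row: "z = of_nat (\<mu> ! (a - 1)) - of_nat (length \<mu>)" if a: "1 \<le> a" "a \<le> length \<mu>" for a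
  proof -
    have "\<mu> ! (a - 1) \<in> set \<mu>" using a by (auto simp: One_nat_def)
    then have "(a, 1) \<in> young_diagram \<mu>"
      using part(1) a by (auto simp: young_diagram_def is_partition_def Suc_le_eq One_nat_def)
    then obtain i where i: "i \<in> I" "t0 i = (a, 1)"
      using t0 unfolding tableaux_def bij_betw_def by (metis (mono_tags, lifting) imageE mem_Collect_eq)
    show ?thesis
      using L[rule_format, OF t0 i(1), of "tabloid I t0"] jucys_murphy_coefficient[OF fin t0 i(1)]
      by (simp add: i(2) polytabloid_self[OF fin t0] tableau_row_card[OF t0 a] tableau_first_column_card[OF part(1) t0])
  qed
  have hd: "z = of_nat (hd \<mu>) - of_nat (length \<mu>)"
    using row[of 1] part(2) by (simp add: hd_conv_nth Suc_le_eq One_nat_def)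
  have "p = hd \<mu>" if p: "p \<in> set \<mu>" for p
  proof -
    obtain k where k: "k < length \<mu>" "p = \<mu> ! k" using p by (auto simp: in_set_conv_nth)
    then have "of_nat p = (of_nat (hd \<mu>) :: complex)" using row[of "Suc k"] hd by simp
    then show ?thesis by simp
  qed
  then show ?R using part hd by (auto simp: rectangle_def num_cols_def num_rows_def)
qed

lemma polytabloid_empty:
  assumes "bij \<sigma>" shows "polytabloid {} u (U \<circ> \<sigma>) = polytabloid {} u U"
proof -
  have "U \<circ> \<sigma> = (\<lambda>k. 0) \<longleftrightarrow> U = (\<lambda>k. 0)"
    using bij_is_surj[OF assms] by (auto simp: fun_eq_iff) (metis surjD)
  then show ?thesis by (simp add: polytabloid_def tabloid_def)
qed

context cherednik_irrep
begin

lemma brop_emb: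
  assumes h: "h \<in> G"
  shows "i \<in> {1..n} \<Longrightarrow> j \<in> {1..n} \<Longrightarrow> i \<noteq> j \<Longrightarrow> brop i j (emb v) [] (h, x) =
      c * (v (bmul (refln (i, j, 1)) h) x - v (bmul (refln (i, j, -1)) h) x)"
    and "i \<in> {1..n} \<Longrightarrow> brop i i (emb v) [] (h, x) = v h x -
      (\<Sum>k\<in>{1..n} - {i}. c * v (bmul (refln (i, k, 1)) h) x + c * v (bmul (refln (i, k, -1)) h) x) -
      2 * d * v (bmul (refln (i, i, -1)) h) x"
proof -
  have "(\<Sum>s\<in>roots n. weight c d s * rt s i * rt s j * wact (refln s) (emb v) [] (h, x)) =
      (\<Sum>s\<in>roots n. weight c d s * rt s i * rt s j * v (bmul (refln s) h) x)" for i j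
    by (rule sum.cong) (use h in \<open>auto simp: wact.simps emb_def refl_square(2)\<close>)
  then have eq: "brop i j (emb v) [] (h, x) = (if i = j then v h x else 0) -
      (\<Sum>s\<in>roots n. weight c d s * rt s i * rt s j * v (bmul (refln s) h) x)" for i j
    using h by (simp add: brop_def emb_def)
  show "i \<in> {1..n} \<Longrightarrow> j \<in> {1..n} \<Longrightarrow> i \<noteq> j \<Longrightarrow> brop i j (emb v) [] (h, x) =
      c * (v (bmul (refln (i, j, 1)) h) x - v (bmul (refln (i, j, -1)) h) x)"
    using sum_roots_diff[of "\<lambda>y g. y * v (bmul g h) x" i n j c d] unfolding eq
    by (simp add: distrib_right right_diff_distrib)
  show "i \<in> {1..n} \<Longrightarrow> brop i i (emb v) [] (h, x) = v h x -
      (\<Sum>k\<in>{1..n} - {i}. c * v (bmul (refln (i, k, 1)) h) x + c * v (bmul (refln (i, k, -1)) h) x) -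
      2 * d * v (bmul (refln (i, i, -1)) h) x"
    using sum_roots_same[of "\<lambda>y g. y * v (bmul g h) x" i n c d] unfolding eq
    by (simp add: distrib_right)
qed

text \<open>
  Translation by \<open>h\<^sup>-\<^sup>1\<close> permutes the commutators up to sign (\<open>brop_conj\<close>), so it suffices to look at the values at the
  identity.
\<close>

lemma bracket_free_bone:
  "bracket_free \<longleftrightarrow> (\<forall>v\<in>carrier V. \<forall>i\<in>{1..n}. \<forall>j\<in>{1..n}. \<forall>x. brop i j (emb v) [] (bone, x) = 0)"
proof
  assume *: "\<forall>v\<in>carrier V. \<forall>i\<in>{1..n}. \<forall>j\<in>{1..n}. \<forall>x. brop i j (emb v) [] (bone, x) = 0"
  have "brop i j (emb v) [] (h, x) = 0" if v: "v \<in> carrier V" and ij: "i \<in> {1..n}" "j \<in> {1..n}" for v i j h x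
  proof (cases "h \<in> G")
    case True
    let ?g = "binv h"
    have g: "?g \<in> G" using True by simp
    have "binv ?g = h" "bmul h bone = h" using True by simp_all
    then have "brop i j (emb v) [] (h, x) = wact ?g (brop i j (emb v)) [] (bone, x)" by (simp add: wact.simps)
    also have "\<dots> = of_int (fst ?g (snd ?g i)) * of_int (fst ?g (snd ?g j)) *
        brop (snd ?g i) (snd ?g j) (emb (act ?g v)) [] (bone, x)"
      unfolding brop_conj[OF g] wact_emb[OF g] ..
    also have "brop (snd ?g i) (snd ?g j) (emb (act ?g v)) [] (bone, x) = 0"
    proof -
      have "snd ?g i \<in> {1..n}" "snd ?g j \<in> {1..n}" using HO_in[OF g] ij by blast+
      then show ?thesis using * V_closed(3)[OF v v g] by blast
    qed
    finally show ?thesis by simp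
  next
    case False
    have "bmul (refln s) h \<notin> G" if s: "s \<in> roots n" for s
    proof
      assume "bmul (refln s) h \<in> G"
      then have "bmul (refln s) (bmul (refln s) h) \<in> G" using refl_closed[OF s] by simp
      then show False using False bmul_cancel(1)[OF refl_closed[OF s]] refl_square(2)[OF s] by metis
    qed
    then show ?thesis using False by (simp add: brop_def wact.simps emb_def refl_square(2))
  qed
  then show bracket_free unfolding bracket_free_def by (simp add: fun_eq_iff)
next
  assume bracket_free
  then show "\<forall>v\<in>carrier V. \<forall>i\<in>{1..n}. \<forall>j\<in>{1..n}. \<forall>x. brop i j (emb v) [] (bone, x) = 0"
    by (simp add: bracket_free_def del: split_paired_All)
qed

text \<open>
  With \<open>i\<close> in the first and \<open>j\<close> in the second block, the two reflections \<open>s\<^sub>i\<^sub>j\<close> and \<open>\<zeta>\<^sub>i s\<^sub>i\<^sub>j \<zeta>\<^sub>i\<close> of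
  \<open>[y\<^sub>i, x\<^sub>j]\<close> carry a vector of the identity coset to the same coset, where their values differ by the action of \<open>\<zeta>\<^sub>i \<zeta>\<^sub>j\<close>, which is
  \<open>-1\<close>. So they cannot cancel.
\<close>

lemma bracket_free_imp_one_block:
  assumes free: bracket_free and c: "c \<noteq> 0" shows "I1 = {} \<or> I2 = {}"
proof (rule ccontr)
  assume "\<not> ?thesis"
  then obtain i j where ij: "i \<in> I1" "j \<in> I2" by blast
  then have n: "i \<in> {1..n}" "j \<in> {1..n}" "i \<noteq> j" using I12 by blast+
  obtain t u where tu: "t \<in> tableaux (fst \<Lambda>) I1" "u \<in> tableaux (snd \<Lambda>) I2" using tableaux_ex by blast
  let ?e = "coset_vec (E t u)" and ?s = "refln (i, j, 1)" and ?x = "(tabloid I1 t, tabloid I2 u)"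
  have s: "?s \<in> G" "(i, j, 1) \<in> roots n" using n by (auto simp: roots_def)
  define z where "z = bmul (refln (i, j, -1)) ?s"
  have z: "z = (\<lambda>k. if k = i \<or> k = j then -1 else 1, id)"
    by (auto simp: z_def bmul_def fun_eq_iff Transposition.transpose_def refln.simps)
  have zK: "z \<in> K" using n by (auto simp: K_iff HO_carrier z permutes_id)
  have "binv z = z" by (auto simp: z binv_def)
  moreover have "sgn2 z = -1"
  proof -
    have "(\<Prod>k\<in>I2. fst z k) = (\<Prod>k\<in>I2. if k = j then -1 else 1)"
      by (rule prod.cong) (use ij I12 in \<open>auto simp: z\<close>)
    then show ?thesis using ij by (simp add: sgn2_def)
  qed
  ultimately have "?e z ?x = - 1"
    using zK E_self[OF tu] by (simp add: coset_vec_def \<rho>_eq) (simp add: z)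
  moreover have "?e bone ?x = 1" using E_self[OF tu] by (simp add: coset_vec_def binv_bone)
  moreover have "brop i j (emb ?e) [] (?s, ?x) = 0"
    using free coset_vec_nonzero(2)[OF tu] n by (simp add: bracket_free_def del: atLeastAtMost_iff)
  ultimately show False
    using brop_emb(1)[OF s(1) n, of ?e ?x] c refl_square(1)[OF s(2)] by (simp add: z_def)
qed

text \<open>The sign by which a single sign change acts if there is only one block.\<close>

definition block_sign :: complex where "block_sign = (if I2 = {} then 1 else -1)"

lemma sgn2_refln:
  assumes block: "I1 = {} \<or> I2 = {}" and ij: "i \<in> {1..n}" "j \<in> {1..n}"
  shows "i \<noteq> j \<Longrightarrow> \<tau> \<in> {1, -1} \<Longrightarrow> sgn2 (refln (i, j, \<tau>)) = 1" "sgn2 (refln (i, i, -1)) = block_sign"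
proof -
  consider "I2 = {}" | "I2 = {1..n}" "I2 \<noteq> {}" using block I12(2) by (metis Un_empty_left)
  then have "(i \<noteq> j \<longrightarrow> \<tau> \<in> {1, -1} \<longrightarrow> sgn2 (refln (i, j, \<tau>)) = 1) \<and> sgn2 (refln (i, i, -1)) = block_sign"
  proof cases
    case 2
    have "(\<Prod>k\<in>I2. fst (refln (i, j, \<tau>)) k) = (\<Prod>k\<in>{i, j}. \<tau>)"
      unfolding 2(1) by (rule prod.mono_neutral_cong_right) (use ij in \<open>auto simp: refln.simps\<close>)
    moreover have "(\<Prod>k\<in>I2. fst (refln (i, i, -1)) k) = (\<Prod>k\<in>{i}. -1)"
      unfolding 2(1) by (rule prod.mono_neutral_cong_right) (use ij in \<open>auto simp: refln.simps\<close>)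
    ultimately show ?thesis using 2(2) by (auto simp: sgn2_def block_sign_def)
  qed (simp add: sgn2_def block_sign_def)
  then show "i \<noteq> j \<Longrightarrow> \<tau> \<in> {1, -1} \<Longrightarrow> sgn2 (refln (i, j, \<tau>)) = 1" "sgn2 (refln (i, i, -1)) = block_sign"
    by blast+
qed

text \<open>
  The sum of the transpositions \<open>(i k)\<close>, acting on functions of a pair of tabloids
\<close>

definition swap_sum :: "nat \<Rightarrow> ((nat \<Rightarrow> nat) \<times> (nat \<Rightarrow> nat) \<Rightarrow> complex) \<Rightarrow>
    (nat \<Rightarrow> nat) \<Rightarrow> (nat \<Rightarrow> nat) \<Rightarrow> complex" where
  "swap_sum i F T U =
    (\<Sum>k\<in>{1..n} - {i}. F (T \<circ> Transposition.transpose i k, U \<circ> Transposition.transpose i k))"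

text \<open>
  If there is only one block, then \<open>\<zeta>\<^sub>i s\<^sub>i\<^sub>j \<zeta>\<^sub>i\<close> acts like \<open>s\<^sub>i\<^sub>j\<close>: the commutators with \<open>i \<noteq> j\<close> vanish, and the two kinds of reflections
  in the others contribute equally.
\<close>

lemma brop_one_block:
  assumes block: "I1 = {} \<or> I2 = {}" and v: "v \<in> carrier V" and i: "i \<in> {1..n}" and j: "j \<in> {1..n}"
  shows "i \<noteq> j \<Longrightarrow> brop i j (emb v) [] (bone, T, U) = 0"
    and "brop i i (emb v) [] (bone, T, U) =
      (1 - 2 * d * block_sign) * v bone (T, U) - 2 * c * swap_sum i (v bone) T U"
proof -
  have val: "v (bmul (refln s) bone) (T, U) = sgn2 (refln s) * v bone (T \<circ> snd (refln s), U \<circ> snd (refln s))"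
    if s: "s \<in> roots n" for s
  proof -
    have "snd (refln s) ` I1 = I1"
      using block I12 permutes_image[OF HO_permutes[OF refl_closed[OF s]]] by auto
    then have K: "refln s \<in> K" using refl_closed[OF s] by (simp add: K_iff)
    have "v (bmul bone (refln s)) = \<rho> (binv (refln s)) (v bone)"
      using v K K_G[OF bone_K] unfolding V_iff by blast
    moreover have "bmul (refln s) bone = bmul bone (refln s)" by (simp add: bmul_def bone_def)
    ultimately show ?thesis by (simp add: refl_square(2)[OF s] \<rho>_eq)
  qed
  have r: "i \<noteq> j \<Longrightarrow> j \<in> {1..n} \<Longrightarrow> \<tau> \<in> {1, -1} \<Longrightarrow> (i, j, \<tau>) \<in> roots n" "(i, i, -1) \<in> roots n" for j \<tau>
    using i by (auto simp: roots_def)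
  have swap: "v (bmul (refln (i, k, \<tau>)) bone) (T, U) =
      v bone (T \<circ> Transposition.transpose i k, U \<circ> Transposition.transpose i k)"
    if "i \<noteq> k" "k \<in> {1..n}" "\<tau> \<in> {1, -1}" for k \<tau>
    using val[OF r(1)[OF that]] sgn2_refln(1)[OF block i that(2,1,3)] by (simp add: refln.simps)
  show "i \<noteq> j \<Longrightarrow> brop i j (emb v) [] (bone, T, U) = 0"
    using brop_emb(1)[OF K_G[OF bone_K] i j, of v "(T, U)"] swap[of j 1] swap[of j "-1"] j by simp
  have "(\<Sum>k\<in>{1..n} - {i}. c * v (bmul (refln (i, k, 1)) bone) (T, U) + c * v (bmul (refln (i, k, -1)) bone) (T, U)) =
      2 * c * swap_sum i (v bone) T U"
    unfolding swap_sum_def sum_distrib_left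
  proof (rule sum.cong[OF refl])
    fix k assume k: "k \<in> {1..n} - {i}"
    have k1: "v (bmul (refln (i, k, 1)) bone) (T, U) =
        v bone (T \<circ> Transposition.transpose i k, U \<circ> Transposition.transpose i k)"
      by (rule swap) (use k in auto)
    have k2: "v (bmul (refln (i, k, -1)) bone) (T, U) =
        v bone (T \<circ> Transposition.transpose i k, U \<circ> Transposition.transpose i k)"
      by (rule swap) (use k in auto)
    show "c * v (bmul (refln (i, k, 1)) bone) (T, U) + c * v (bmul (refln (i, k, -1)) bone) (T, U) =
        2 * c * v bone (T \<circ> Transposition.transpose i k, U \<circ> Transposition.transpose i k)"
      unfolding k1 k2 by simp
  qed
  moreover have "v (bmul (refln (i, i, -1)) bone) (T, U) = block_sign * v bone (T, U)"
    using val[OF r(2)] sgn2_refln(2)[OF block i i] by (simp add: refln.simps)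
  ultimately show "brop i i (emb v) [] (bone, T, U) =
      (1 - 2 * d * block_sign) * v bone (T, U) - 2 * c * swap_sum i (v bone) T U"
    using brop_emb(2)[OF K_G[OF bone_K] i, of v "(T, U)"] by (simp add: left_diff_distrib)
qed

text \<open>
  Both sides are linear in the value at the identity, which runs through the span of the products of polytabloids.
\<close>

lemma bracket_free_one_block:
  assumes block: "I1 = {} \<or> I2 = {}"
  shows "bracket_free \<longleftrightarrow> (\<forall>t\<in>tableaux (fst \<Lambda>) I1. \<forall>u\<in>tableaux (snd \<Lambda>) I2. \<forall>i\<in>{1..n}. \<forall>T U.
    (1 - 2 * d * block_sign) * E t u (T, U) = 2 * c * swap_sum i (E t u) T U)" (is "_ \<longleftrightarrow> ?R")
proof
  assume free: bracket_free
  show ?R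
  proof (intro ballI allI)
    fix t u i T U assume tu: "t \<in> tableaux (fst \<Lambda>) I1" "u \<in> tableaux (snd \<Lambda>) I2" and i: "i \<in> {1..n}"
    have "coset_vec (E t u) bone = E t u" by (simp add: coset_vec_def binv_bone)
    then show "(1 - 2 * d * block_sign) * E t u (T, U) = 2 * c * swap_sum i (E t u) T U"
      using brop_one_block(2)[OF block coset_vec_nonzero(2)[OF tu] i i, of T U] free i coset_vec_nonzero(2)[OF tu]
      by (simp add: bracket_free_bone del: atLeastAtMost_iff)
  qed
next
  assume R: ?R
  let ?N = "{F. \<forall>i\<in>{1..n}. \<forall>T U. (1 - 2 * d * block_sign) * F (T, U) = 2 * c * swap_sum i F T U}"
  have lin: "swap_sum i (\<lambda>x. F x + F' x) T U = swap_sum i F T U + swap_sum i F' T U"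
    "swap_sum i (\<lambda>x. y * F x) T U = y * swap_sum i F T U" for i F F' T U y
    by (simp_all add: swap_sum_def sum.distrib sum_distrib_left)
  have "submodule ?N complex_ring function_space"
    by (rule FS.submoduleI) (auto simp: lin distrib_left mult.left_commute, simp add: swap_sum_def)
  then have "Out \<subseteq> ?N" by (rule Out_least) (use R in blast)
  moreover have "v bone \<in> Out" if "v \<in> carrier V" for v using that K_G[OF bone_K] unfolding V_iff by blast
  ultimately have N: "v bone \<in> ?N" if "v \<in> carrier V" for v using that by blast
  show bracket_free
    unfolding bracket_free_bone
  proof (intro ballI allI)
    fix v i j and x :: "(nat \<Rightarrow> nat) \<times> (nat \<Rightarrow> nat)"
    assume v: "v \<in> carrier V" and ij: "i \<in> {1..n}" "j \<in> {1..n}"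
    obtain T U where x: "x = (T, U)" by (cases x)
    show "brop i j (emb v) [] (bone, x) = 0"
      using brop_one_block[OF block v ij, of T U] N[OF v] ij unfolding x by (cases "i = j") auto
  qed
qed

lemma block_empty_iff: "I1 = {} \<longleftrightarrow> fst \<Lambda> = []" "I2 = {} \<longleftrightarrow> snd \<Lambda> = []"
proof -
  have "sum_list \<mu> = 0 \<longleftrightarrow> \<mu> = []" if "is_partition \<mu>" for \<mu>
    using that by (cases \<mu>) (auto simp: is_partition_def)
  then have "a = 0 \<longleftrightarrow> fst \<Lambda> = []" "b = 0 \<longleftrightarrow> snd \<Lambda> = []"
    using bipart by (auto simp: bipartition_def a_def b_def)
  then show "I1 = {} \<longleftrightarrow> fst \<Lambda> = []" "I2 = {} \<longleftrightarrow> snd \<Lambda> = []"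
    by (auto simp: I1_def I2_def)
qed

lemma swap_sum_E:
  "I2 = {} \<Longrightarrow> swap_sum i (E t u) T U =
    (\<Sum>k\<in>I1 - {i}. polytabloid I1 t (T \<circ> Transposition.transpose i k)) * polytabloid I2 u U"
  "I1 = {} \<Longrightarrow> swap_sum i (E t u) T U =
    (\<Sum>k\<in>I2 - {i}. polytabloid I2 u (U \<circ> Transposition.transpose i k)) * polytabloid I1 t T"
proof -
  have "I2 = {} \<Longrightarrow> I1 = {1..n}" "I1 = {} \<Longrightarrow> I2 = {1..n}" using I12 by auto
  then show "I2 = {} \<Longrightarrow> swap_sum i (E t u) T U =
      (\<Sum>k\<in>I1 - {i}. polytabloid I1 t (T \<circ> Transposition.transpose i k)) * polytabloid I2 u U"
    "I1 = {} \<Longrightarrow> swap_sum i (E t u) T U =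
      (\<Sum>k\<in>I2 - {i}. polytabloid I2 u (U \<circ> Transposition.transpose i k)) * polytabloid I1 t T"
    by (simp_all add: swap_sum_def E_def tensor_def polytabloid_empty sum_distrib_left mult.commute)
qed

lemma E_tensor: "E t u (T, U) = polytabloid I1 t T * polytabloid I2 u U"
  by (simp add: E_def tensor_def)

lemma bracket_free_first_block:
  assumes c: "c \<noteq> 0" and \<Lambda>: "snd \<Lambda> = []" "fst \<Lambda> \<noteq> []"
  shows "bracket_free \<longleftrightarrow> rectangle (fst \<Lambda>) \<and>
    (1 - 2 * d) / (2 * c) = of_nat (num_cols (fst \<Lambda>)) - of_nat (num_rows (fst \<Lambda>))"
proof -
  have sgn: "1 - 2 * d * block_sign = 1 - 2 * d" using \<Lambda> block_empty_iff by (simp add: block_sign_def)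
  have I: "I2 = {}" "I1 = {1..n}" using \<Lambda> block_empty_iff I12 by auto
  obtain t0 u0 where tu: "t0 \<in> tableaux (fst \<Lambda>) I1" "u0 \<in> tableaux (snd \<Lambda>) I2" using tableaux_ex by blast
  have one: "polytabloid I2 u0 (tabloid I2 u0) = 1" by (rule polytabloid_self[OF fin(2) tu(2)])
  have "bracket_free \<longleftrightarrow> (\<forall>t\<in>tableaux (fst \<Lambda>) I1. \<forall>u\<in>tableaux (snd \<Lambda>) I2. \<forall>i\<in>I1. \<forall>T U.
      (1 - 2 * d) * (polytabloid I1 t T * polytabloid I2 u U) = 2 * c *
      ((\<Sum>k\<in>I1 - {i}. polytabloid I1 t (T \<circ> Transposition.transpose i k)) * polytabloid I2 u U))"
    unfolding bracket_free_one_block[OF disjI2[OF I(1)]] swap_sum_E(1)[OF I(1)] E_tensor sgn I(2)[symmetric] ..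
  also have "\<dots> \<longleftrightarrow> (\<forall>t\<in>tableaux (fst \<Lambda>) I1. \<forall>i\<in>I1. \<forall>T.
      (\<Sum>k\<in>I1 - {i}. polytabloid I1 t (T \<circ> Transposition.transpose i k)) =
      (1 - 2 * d) / (2 * c) * polytabloid I1 t T)" (is "?A \<longleftrightarrow> ?B")
  proof
    assume A: ?A
    show ?B
    proof (intro ballI allI)
      fix t i T assume "t \<in> tableaux (fst \<Lambda>) I1" "i \<in> I1"
      then have "(1 - 2 * d) * (polytabloid I1 t T * polytabloid I2 u0 (tabloid I2 u0)) = 2 * c *
          ((\<Sum>k\<in>I1 - {i}. polytabloid I1 t (T \<circ> Transposition.transpose i k)) * polytabloid I2 u0 (tabloid I2 u0))"
        using A tu(2) by blast
      then show "(\<Sum>k\<in>I1 - {i}. polytabloid I1 t (T \<circ> Transposition.transpose i k)) =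
          (1 - 2 * d) / (2 * c) * polytabloid I1 t T"
        unfolding one using c by (simp add: field_simps)
    qed
  next
    assume B: ?B
    show ?A
    proof (intro ballI allI)
      fix t u i T U assume tu: "t \<in> tableaux (fst \<Lambda>) I1" "u \<in> tableaux (snd \<Lambda>) I2" and i: "i \<in> I1"
      show "(1 - 2 * d) * (polytabloid I1 t T * polytabloid I2 u U) = 2 * c *
          ((\<Sum>k\<in>I1 - {i}. polytabloid I1 t (T \<circ> Transposition.transpose i k)) * polytabloid I2 u U)"
        unfolding B[rule_format, OF tu(1) i] using c by simp
    qed
  qed
  also have "\<dots> \<longleftrightarrow> rectangle (fst \<Lambda>) \<and>
      (1 - 2 * d) / (2 * c) = of_nat (num_cols (fst \<Lambda>)) - of_nat (num_rows (fst \<Lambda>))"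
    by (rule jucys_murphy_scalar_iff[OF _ \<Lambda>(2) fin(1) tu(1)]) (use bipart in \<open>simp add: bipartition_def\<close>)
  finally show ?thesis .
qed

lemma bracket_free_second_block:
  assumes c: "c \<noteq> 0" and \<Lambda>: "fst \<Lambda> = []" "snd \<Lambda> \<noteq> []"
  shows "bracket_free \<longleftrightarrow> rectangle (snd \<Lambda>) \<and>
    (1 + 2 * d) / (2 * c) = of_nat (num_cols (snd \<Lambda>)) - of_nat (num_rows (snd \<Lambda>))"
proof -
  have sgn: "1 - 2 * d * block_sign = 1 + 2 * d" using \<Lambda> block_empty_iff by (simp add: block_sign_def)
  have I: "I1 = {}" "I2 = {1..n}" using \<Lambda> block_empty_iff I12 by auto
  obtain t0 u0 where tu: "t0 \<in> tableaux (fst \<Lambda>) I1" "u0 \<in> tableaux (snd \<Lambda>) I2" using tableaux_ex by blast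
  have one: "polytabloid I1 t0 (tabloid I1 t0) = 1" by (rule polytabloid_self[OF fin(1) tu(1)])
  have "bracket_free \<longleftrightarrow> (\<forall>t\<in>tableaux (fst \<Lambda>) I1. \<forall>u\<in>tableaux (snd \<Lambda>) I2. \<forall>i\<in>I2. \<forall>T U.
      (1 + 2 * d) * (polytabloid I1 t T * polytabloid I2 u U) = 2 * c *
      ((\<Sum>k\<in>I2 - {i}. polytabloid I2 u (U \<circ> Transposition.transpose i k)) * polytabloid I1 t T))"
    unfolding bracket_free_one_block[OF disjI1[OF I(1)]] swap_sum_E(2)[OF I(1)] E_tensor sgn I(2)[symmetric] ..
  also have "\<dots> \<longleftrightarrow> (\<forall>u\<in>tableaux (snd \<Lambda>) I2. \<forall>i\<in>I2. \<forall>U.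
      (\<Sum>k\<in>I2 - {i}. polytabloid I2 u (U \<circ> Transposition.transpose i k)) =
      (1 + 2 * d) / (2 * c) * polytabloid I2 u U)" (is "?A \<longleftrightarrow> ?B")
  proof
    assume A: ?A
    show ?B
    proof (intro ballI allI)
      fix u i U assume "u \<in> tableaux (snd \<Lambda>) I2" "i \<in> I2"
      then have "(1 + 2 * d) * (polytabloid I1 t0 (tabloid I1 t0) * polytabloid I2 u U) = 2 * c *
          ((\<Sum>k\<in>I2 - {i}. polytabloid I2 u (U \<circ> Transposition.transpose i k)) * polytabloid I1 t0 (tabloid I1 t0))"
        using A tu(1) by blast
      then show "(\<Sum>k\<in>I2 - {i}. polytabloid I2 u (U \<circ> Transposition.transpose i k)) =
          (1 + 2 * d) / (2 * c) * polytabloid I2 u U"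
        unfolding one using c by (simp add: field_simps)
    qed
  next
    assume B: ?B
    show ?A
    proof (intro ballI allI)
      fix t u i T U assume tu: "t \<in> tableaux (fst \<Lambda>) I1" "u \<in> tableaux (snd \<Lambda>) I2" and i: "i \<in> I2"
      show "(1 + 2 * d) * (polytabloid I1 t T * polytabloid I2 u U) = 2 * c *
          ((\<Sum>k\<in>I2 - {i}. polytabloid I2 u (U \<circ> Transposition.transpose i k)) * polytabloid I1 t T)"
        unfolding B[rule_format, OF tu(2) i] using c by simp
    qed
  qed
  also have "\<dots> \<longleftrightarrow> rectangle (snd \<Lambda>) \<and>
      (1 + 2 * d) / (2 * c) = of_nat (num_cols (snd \<Lambda>)) - of_nat (num_rows (snd \<Lambda>))"
    by (rule jucys_murphy_scalar_iff[OF _ \<Lambda>(2) fin(2) tu(2)]) (use bipart in \<open>simp add: bipartition_def\<close>)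
  finally show ?thesis .
qed

end

theorem theorem1p1:
  fixes \<Lambda> :: "nat list \<times> nat list" and n :: nat and e s\<^sub>1 s\<^sub>2 s :: int
  assumes "bipartition n \<Lambda>" and "n \<ge> 1"
    and "e \<ge> 2" and "s = s\<^sub>2 - s\<^sub>1"
  shows "unitary_irred n (fock_c e) (fock_d e (s\<^sub>1, s\<^sub>2)) \<Lambda> \<and>
         finite_dim_irred n (fock_c e) (fock_d e (s\<^sub>1, s\<^sub>2)) \<Lambda> \<longleftrightarrow>
         (\<exists>lam. rectangle lam \<and> (\<Lambda> = (lam, []) \<or> \<Lambda> = ([], lam)) \<and>
            (\<Lambda> = (lam, []) \<longrightarrow> int (num_rows lam) - int (num_cols lam) = s - e) \<and>
            (\<Lambda> = ([], lam) \<longrightarrow> int (num_rows lam) - int (num_cols lam) = - s))"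
proof -
  let ?c = "fock_c e" and ?d = "fock_d e (s\<^sub>1, s\<^sub>2)"
  interpret cherednik_irrep n ?c ?d \<Lambda>
    by (intro cherednik_irrep.intro bipartition_rep.intro assms(1))
  have e: "of_int e \<noteq> (0 :: complex)" using assms(3) by simp
  have c: "?c \<noteq> 0" using e by (simp add: fock_c_def)
  \<comment> \<open>The scalars that the commutators prescribe for the sum of transpositions.\<close>
  have d: "(1 - 2 * ?d) / (2 * ?c) = of_int (e - s)" "(1 + 2 * ?d) / (2 * ?c) = of_int s"
    using e unfolding assms(4) by (simp_all add: fock_c_def fock_d_def field_simps)
  have int: "of_int z = of_nat q - (of_nat r :: complex) \<longleftrightarrow> z = int q - int r" for z q r
  proof -
    have "of_nat q - (of_nat r :: complex) = of_int (int q - int r)" by simp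
    then show ?thesis by (simp only: of_int_eq_iff)
  qed
  have ne: "fst \<Lambda> \<noteq> [] \<or> snd \<Lambda> \<noteq> []" using assms(1,2) by (auto simp: bipartition_def)
  consider "fst \<Lambda> \<noteq> []" "snd \<Lambda> \<noteq> []" | "fst \<Lambda> \<noteq> []" "snd \<Lambda> = []" | "fst \<Lambda> = []" "snd \<Lambda> \<noteq> []"
    using ne by blast
  then have "bracket_free \<longleftrightarrow> (\<exists>lam. rectangle lam \<and> (\<Lambda> = (lam, []) \<or> \<Lambda> = ([], lam)) \<and>
        (\<Lambda> = (lam, []) \<longrightarrow> int (num_rows lam) - int (num_cols lam) = s - e) \<and>
        (\<Lambda> = ([], lam) \<longrightarrow> int (num_rows lam) - int (num_cols lam) = - s))"
  proof cases
    case 1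
    then have "\<not> bracket_free" using bracket_free_imp_one_block[OF _ c] block_empty_iff by blast
    then show ?thesis
      using 1 by auto
  next
    case 2
    then obtain \<mu> where \<mu>: "\<Lambda> = (\<mu>, [])" "\<mu> \<noteq> []" by (cases \<Lambda>) auto
    have "bracket_free \<longleftrightarrow> rectangle \<mu> \<and> e - s = int (num_cols \<mu>) - int (num_rows \<mu>)"
      using bracket_free_first_block[OF c] \<mu> unfolding d int by simp
    then show ?thesis
      using \<mu> by auto
  next
    case 3
    then obtain \<mu> where \<mu>: "\<Lambda> = ([], \<mu>)" "\<mu> \<noteq> []" by (cases \<Lambda>) auto
    have "bracket_free \<longleftrightarrow> rectangle \<mu> \<and> s = int (num_cols \<mu>) - int (num_rows \<mu>)"
      using bracket_free_second_block[OF c] \<mu> unfolding d int by simp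
    then show ?thesis
      using \<mu> by auto
  qed
  then show ?thesis unfolding unitary_finite_dim_iff_bracket_free .
qed

end
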